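(* Let $\phi$ be a smooth spatially periodic time-independent solution of the Lugiato–Lefever equation $$\partial_t \psi=-i\beta\,\partial_x^2\psi-(1+i\alpha)\psi+i|\psi|^2\psi+F ,\qquad \psi(x,t)\in\mathbb C,\ x\in\mathbb R, \tag{LLE}$$ with $\alpha,\beta,F\in\mathbb R$, $\beta\ne0$, $F>0$, and let $k\ge1$ be an integer and $K>0$. Then there exist constants $\theta>0$, $C>0$, $\varepsilon>0$ such that the following holds. Let $\psi$ be a solution of (LLE) on a time interval $[0,t]$, let $\gamma(x,s)$ be a real-valued phase function with $\|\gamma(\cdot,s)\|_{L^\infty(\mathbb R)}\le K$ for $0\le s\le t$, and let $$v(x,s):=\psi(x+\gamma(x,s),s)-\phi(x)$$ be the inverse-modulated perturbation variable. If $\|v(\cdot,s)\|_{H^k(\mathbb R)}\le\varepsilon$ and $\|\partial_{x,t}\gamma(\cdot,s)\|_{H^{k+2}(\mathbb R)}^2\le\varepsilon$ for all $0\le s\le t$, then $$\|v(\cdot,t)\|_{H^k}^2\le Ce^{-\theta t}\|v(\cdot,0)\|_{H^k}^2+C\int_0^te^{-\theta(t-s)}\Big(\|v(\cdot,s)\|_{L^2}^2+\|\partial_{x,t}\gamma(\cdot,s)\|_{H^{k+2}}^2\Big)ds+C\|\partial_x\gamma(\cdot,t)\|_{H^{k+1}}^2 .$$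
   Context: Here $\partial_{x,t}\gamma=(\partial_x\gamma,\partial_t\gamma)$, so $\|\partial_{x,t}\gamma\|_{H^r}^2=\|\partial_x\gamma\|_{H^r}^2+\|\partial_t\gamma\|_{H^r}^2$. All norms are over $x\in\mathbb R$. It is understood that $v$ is continuous in time with values in $H^k(\mathbb R)$ and that $\partial_x\gamma,\partial_t\gamma$ are continuous in time with values in $H^{k+2}(\mathbb R)$ on $[0,t]$. *)

theory Defs
  imports "HOL-Analysis.Analysis" "HOL-Probability.Essential_Supremum"
begin

section \<open>Sobolev spaces on the real line\<close>

definition nth_deriv :: "nat \<Rightarrow> (real \<Rightarrow> 'a::real_normed_vector) \<Rightarrow> real \<Rightarrow> 'a" where
  "nth_deriv n f = ((\<lambda>g x. vector_derivative g (at x)) ^^ n) f"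

definition smooth :: "(real \<Rightarrow> 'a::real_normed_vector) \<Rightarrow> bool" where
  "smooth f \<longleftrightarrow> (\<forall>n. nth_deriv n f differentiable_on UNIV)"

definition test_function :: "(real \<Rightarrow> real) \<Rightarrow> bool" where
  "test_function \<eta> \<longleftrightarrow> smooth \<eta> \<and> compact (closure {x. \<eta> x \<noteq> 0})"

definition in_L2 :: "(real \<Rightarrow> 'a::euclidean_space) \<Rightarrow> bool" where
  "in_L2 f \<longleftrightarrow> f \<in> borel_measurable lborel \<and> integrable lborel (\<lambda>x. (norm (f x))\<^sup>2)"

definition L2_nrm :: "(real \<Rightarrow> 'a::euclidean_space) \<Rightarrow> real" where
  "L2_nrm f = sqrt (\<integral>x. (norm (f x))\<^sup>2 \<partial>lborel)"

text \<open>The functions \<open>f\<close>, \<open>g\<close> are meant to be locally integrable here; below they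
  are always in \<open>L\<^sup>2\<close>.\<close>

definition has_weak_deriv ::
    "nat \<Rightarrow> (real \<Rightarrow> 'a::euclidean_space) \<Rightarrow> (real \<Rightarrow> 'a) \<Rightarrow> bool" where
  "has_weak_deriv n f g \<longleftrightarrow>
     (\<forall>\<eta>. test_function \<eta> \<longrightarrow>
        (\<integral>x. nth_deriv n \<eta> x *\<^sub>R f x \<partial>lborel) = (- 1) ^ n *\<^sub>R (\<integral>x. \<eta> x *\<^sub>R g x \<partial>lborel))"

definition in_H :: "nat \<Rightarrow> (real \<Rightarrow> 'a::euclidean_space) \<Rightarrow> bool" where
  "in_H k f \<longleftrightarrow> in_L2 f \<and> (\<forall>j\<le>k. \<exists>g. in_L2 g \<and> has_weak_deriv j f g)"

text \<open>Weak derivatives are unique only up to null sets; the norm does not depend on the choice.\<close>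

definition weak_deriv :: "nat \<Rightarrow> (real \<Rightarrow> 'a::euclidean_space) \<Rightarrow> real \<Rightarrow> 'a" where
  "weak_deriv j f = (SOME g. in_L2 g \<and> has_weak_deriv j f g)"

definition H_nrm :: "nat \<Rightarrow> (real \<Rightarrow> 'a::euclidean_space) \<Rightarrow> real" where
  "H_nrm k f = sqrt (\<Sum>j\<le>k. (L2_nrm (weak_deriv j f))\<^sup>2)"

definition H_continuous_on ::
    "nat \<Rightarrow> real set \<Rightarrow> (real \<Rightarrow> real \<Rightarrow> 'a::euclidean_space) \<Rightarrow> bool" where
  "H_continuous_on k I u \<longleftrightarrow>
     (\<forall>s\<in>I. in_H k (\<lambda>x. u x s)) \<and>
     (\<forall>s\<in>I. ((\<lambda>r. H_nrm k (\<lambda>x. u x r - u x s)) \<longlongrightarrow> 0) (at s within I))"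

section \<open>The Lugiato--Lefever equation\<close>

definition lle_reaction :: "real \<Rightarrow> real \<Rightarrow> complex \<Rightarrow> complex" where
  "lle_reaction \<alpha> F z =
     - (1 + \<i> * of_real \<alpha>) * z + \<i> * of_real ((cmod z)\<^sup>2) * z + of_real F"

definition lle_smooth_stationary ::
    "real \<Rightarrow> real \<Rightarrow> real \<Rightarrow> (real \<Rightarrow> complex) \<Rightarrow> bool" where
  "lle_smooth_stationary \<alpha> \<beta> F \<phi> \<longleftrightarrow>
     smooth \<phi> \<and>
     (\<forall>x. 0 = - \<i> * of_real \<beta> * nth_deriv 2 \<phi> x + lle_reaction \<alpha> F (\<phi> x))"

text \<open>Solutions with values in \<open>H\<^sup>k\<close>, \<open>k \<ge> 1\<close>, need not have a second derivative in
  \<open>x\<close> in the classical sense. The equation is therefore understood in the sense of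
  distributions in \<open>x\<close>, at every time (one-sided at the end points). Local cubic
  integrability makes every term of the equation a distribution.\<close>

definition lle_solution ::
    "real \<Rightarrow> real \<Rightarrow> real \<Rightarrow> real \<Rightarrow> (real \<Rightarrow> real \<Rightarrow> complex) \<Rightarrow> bool" where
  "lle_solution \<alpha> \<beta> F t \<psi> \<longleftrightarrow>
     (\<forall>s\<in>{0..t}. (\<lambda>x. \<psi> x s) \<in> borel_measurable lborel \<and>
        (\<forall>a b. set_integrable lborel {a..b} (\<lambda>x. (cmod (\<psi> x s)) ^ 3))) \<and>
     (\<forall>\<eta>. test_function \<eta> \<longrightarrow> (\<forall>s\<in>{0..t}.
        ((\<lambda>r. \<integral>x. \<eta> x *\<^sub>R \<psi> x r \<partial>lborel) has_vector_derivative
          (\<integral>x. nth_deriv 2 \<eta> x *\<^sub>R (- \<i> * of_real \<beta> * \<psi> x s)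
               + \<eta> x *\<^sub>R lle_reaction \<alpha> F (\<psi> x s) \<partial>lborel)) (at s within {0..t})))"

end

(* The perturbation v is not estimated directly. Let X be the inverse of x -> x + gamma(x,s).
   Then w(y,s) = v(X y,s) is the difference of psi and p = phi o X, so it solves an equation
   whose principal part has constant coefficients, with a forcing that is bounded
   in H^k by the H^(k+2) norms of gamma_x and gamma_t. The H^k norms of v and w are equivalent because gamma_x is small.

   For the j-th derivative w_j the linearisation around p contributes the damping term - w_j and
   the term i p^2 conj w_j, which has no sign. Adding to |w_j|^2 the quadratic form
   (1/beta) Re int p^2 (conj w_(j-1))^2 of lower order cancels it, since the dispersion turns the
   time derivative of this form into - 2 Re int i p^2 (conj w_j)^2 up to lower order terms. What remains
   is controlled by the H^(j-1) norm, by the forcing and, for small w, by the damping. A weighted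
   sum over the levels j leaves only the L^2 norm of w and the forcing on the right, and
   Gronwall's inequality finishes the proof.

   Since w is only a distributional solution with values in H^k, the energy identities are derived
   for mollifications in x, with time derivatives tested against a dense set, and passed to the
   limit in integrated form. *)

theory Submission
  imports Defs "HOL-Computational_Algebra.Polynomial"
begin

section \<open>The Hilbert space of square integrable functions\<close>

text \<open>Estimating v itself would lose derivatives: its equation contains gamma_t v_x and a
  variable coefficient in front of v_xx. After the change of variables the phase acts only on the
  smooth profile, so the forcing contains derivatives of phi and none of v. It is small because phi
  is stationary: the defect of p is a sum of terms with a factor gamma_x, gamma_xx or gamma_t.

  The correcting form sits one level lower, so one integration by parts in its dispersive term
  leaves only derivatives of w up to order j. At level 0 there is no lower form; there the term with
  conj w is left to the L^2 norm on the right.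

  Weak derivatives are handled through absolutely continuous representatives, which turns the
  product rule, the embedding and the composition estimates into inductions on the order.

  The constants must be chosen before the solution. The energy functional is therefore built by
  induction on the level, with constants given by explicit formulas in alpha, beta, k and a bound on
  the profile.\<close>

lemma in_L2_borel: "in_L2 f \<Longrightarrow> f \<in> borel_measurable borel"
  by (simp add: in_L2_def)

lemma in_L2_borel_lborel [measurable_dest]: "in_L2 f \<Longrightarrow> f \<in> borel_measurable lborel"
  by (simp add: in_L2_def)

lemma in_L2_norm_sq: "in_L2 f \<Longrightarrow> integrable lborel (\<lambda>x. (norm (f x))\<^sup>2)"
  by (simp add: in_L2_def)

lemma in_L2_bound:
  assumes "g \<in> borel_measurable lborel" "integrable lborel h" "\<And>x. (norm (g x))\<^sup>2 \<le> h x"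
  shows "in_L2 g"
proof -
  have "integrable lborel (\<lambda>x. (norm (g x))\<^sup>2)"
  proof (rule Bochner_Integration.integrable_bound[OF assms(2)])
    show "(\<lambda>x. (norm (g x))\<^sup>2) \<in> borel_measurable lborel"
      using assms(1) by measurable
    show "AE x in lborel. norm ((norm (g x))\<^sup>2) \<le> norm (h x)"
      using assms(3) by (auto intro!: AE_I2 order_trans[OF _ abs_ge_self])
  qed
  then show ?thesis using assms(1) by (simp add: in_L2_def)
qed

lemma in_L2_cmult_bound:
  assumes "in_L2 f" "g \<in> borel_measurable lborel" "\<And>x. norm (g x) \<le> c * norm (f x)"
  shows "in_L2 g"
proof (rule in_L2_bound[OF assms(2)])
  show "integrable lborel (\<lambda>x. c\<^sup>2 * (norm (f x))\<^sup>2)"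
    using in_L2_norm_sq[OF assms(1)] by simp
  show "(norm (g x))\<^sup>2 \<le> c\<^sup>2 * (norm (f x))\<^sup>2" for x
    using power_mono[OF assms(3)[of x] norm_ge_zero, of 2] by (simp add: power_mult_distrib)
qed

lemma L2_nrm_cmult_bound:
  assumes "in_L2 f" "g \<in> borel_measurable lborel" "AE x in lborel. norm (g x) \<le> c * norm (f x)" "0 \<le> c"
  shows "L2_nrm g \<le> c * L2_nrm f"
proof -
  have "(\<integral>x. (norm (g x))\<^sup>2 \<partial>lborel) \<le> (\<integral>x. c\<^sup>2 * (norm (f x))\<^sup>2 \<partial>lborel)"
  proof (cases "integrable lborel (\<lambda>x. (norm (g x))\<^sup>2)")
    case True
    show ?thesis
    proof (rule integral_mono_AE[OF True])
      show "integrable lborel (\<lambda>x. c\<^sup>2 * (norm (f x))\<^sup>2)"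
        using in_L2_norm_sq[OF assms(1)] by simp
      show "AE x in lborel. (norm (g x))\<^sup>2 \<le> c\<^sup>2 * (norm (f x))\<^sup>2"
        using assms(3)
        by eventually_elim (metis norm_ge_zero power_mono power_mult_distrib)
    qed
  next
    \<comment> \<open>The Bochner integral of a non-integrable function is 0, so the bound is
      trivial here.\<close>
    case False
    then show ?thesis by (simp add: not_integrable_integral_eq)
  qed
  then have "L2_nrm g \<le> sqrt (c\<^sup>2 * (\<integral>x. (norm (f x))\<^sup>2 \<partial>lborel))"
    by (simp add: L2_nrm_def)
  then show ?thesis
    using assms(4) by (simp add: L2_nrm_def real_sqrt_mult)
qed

lemma in_L2_zero [simp]: "in_L2 (\<lambda>x. 0)"
  by (simp add: in_L2_def)

lemma in_L2_scaleR: "in_L2 f \<Longrightarrow> in_L2 (\<lambda>x. c *\<^sub>R f x)"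
  by (rule in_L2_cmult_bound[of f _ "\<bar>c\<bar>"]) (auto dest: in_L2_borel)

lemma in_L2_uminus: "in_L2 f \<Longrightarrow> in_L2 (\<lambda>x. - f x)"
  using in_L2_scaleR[of f "-1"] by simp

lemma in_L2_add:
  assumes "in_L2 f" "in_L2 g"
  shows "in_L2 (\<lambda>x. f x + g x)"
proof (rule in_L2_bound)
  show "(\<lambda>x. f x + g x) \<in> borel_measurable lborel"
    using assms[THEN in_L2_borel] by measurable
  show "integrable lborel (\<lambda>x. 2 * (norm (f x))\<^sup>2 + 2 * (norm (g x))\<^sup>2)"
    using assms by (intro Bochner_Integration.integrable_add integrable_mult_right in_L2_norm_sq)
  fix x
  have "(norm (f x + g x))\<^sup>2 \<le> (norm (f x) + norm (g x))\<^sup>2"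
    by (intro power_mono norm_triangle_ineq) auto
  also have "\<dots> \<le> 2 * (norm (f x))\<^sup>2 + 2 * (norm (g x))\<^sup>2"
    using sum_squares_bound[of "norm (f x)" "norm (g x)"] by (simp add: power2_sum)
  finally show "(norm (f x + g x))\<^sup>2 \<le> 2 * (norm (f x))\<^sup>2 + 2 * (norm (g x))\<^sup>2" .
qed

lemma in_L2_diff: "in_L2 f \<Longrightarrow> in_L2 g \<Longrightarrow> in_L2 (\<lambda>x. f x - g x)"
  using in_L2_add[of f "\<lambda>x. - g x"] in_L2_uminus[of g] by simp

lemma integrable_inner_L2:
  assumes "in_L2 f" "in_L2 g"
  shows "integrable lborel (\<lambda>x. f x \<bullet> g x)"
proof (rule Bochner_Integration.integrable_bound)
  show "integrable lborel (\<lambda>x. (norm (f x))\<^sup>2 + (norm (g x))\<^sup>2)"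
    using assms by (intro Bochner_Integration.integrable_add in_L2_norm_sq)
  show "(\<lambda>x. f x \<bullet> g x) \<in> borel_measurable lborel"
    using assms[THEN in_L2_borel] by measurable
  show "AE x in lborel. norm (f x \<bullet> g x) \<le> norm ((norm (f x))\<^sup>2 + (norm (g x))\<^sup>2)"
  proof (rule AE_I2)
    fix x
    have "\<bar>f x \<bullet> g x\<bar> \<le> norm (f x) * norm (g x)" by (rule Cauchy_Schwarz_ineq2)
    also have "\<dots> \<le> (norm (f x))\<^sup>2 + (norm (g x))\<^sup>2"
      using sum_squares_bound[of "norm (f x)" "norm (g x)"]
        mult_nonneg_nonneg[OF norm_ge_zero[of "f x"] norm_ge_zero[of "g x"]] by linarith
    finally show "norm (f x \<bullet> g x) \<le> norm ((norm (f x))\<^sup>2 + (norm (g x))\<^sup>2)" by simp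
  qed
qed

\<comment> \<open>The relation is only a partial equivalence because \<open>in_L2\<close> is asked
  of both sides. The quotient is made an inner product space so that the abstract arguments on weak
  time derivatives and density apply to it.\<close>
quotient_type (overloaded) 'a l2 = "real \<Rightarrow> 'a::euclidean_space" /
  partial: "\<lambda>f g. in_L2 f \<and> in_L2 g \<and> (AE x in lborel. f x = g x)"
proof (rule part_equivpI)
  show "\<exists>f::real \<Rightarrow> 'a. in_L2 f \<and> in_L2 f \<and> (AE x in lborel. f x = f x)"
    by (rule exI[of _ "\<lambda>x. 0"]) simp
  show "symp (\<lambda>f g::real \<Rightarrow> 'a. in_L2 f \<and> in_L2 g \<and> (AE x in lborel. f x = g x))"
    by (auto simp: symp_def elim: eventually_mono)
  show "transp (\<lambda>f g::real \<Rightarrow> 'a. in_L2 f \<and> in_L2 g \<and> (AE x in lborel. f x = g x))"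
    by (auto simp: transp_def elim: eventually_elim2)
qed

lemma integral_inner_cong_AE:
  fixes f g f' g' :: "real \<Rightarrow> 'a::euclidean_space"
  assumes "in_L2 f" "in_L2 g" "in_L2 f'" "in_L2 g'"
    and "AE x in lborel. f x = f' x" "AE x in lborel. g x = g' x"
  shows "(\<integral>x. f x \<bullet> g x \<partial>lborel) = (\<integral>x. f' x \<bullet> g' x \<partial>lborel)"
  using assms
  by (intro integral_cong_AE) (auto dest!: in_L2_borel elim: eventually_elim2)

instantiation l2 :: (euclidean_space) real_inner
begin

lift_definition zero_l2 :: "'a l2" is "\<lambda>x. 0" by simp

lift_definition plus_l2 :: "'a l2 \<Rightarrow> 'a l2 \<Rightarrow> 'a l2" is "\<lambda>f g x. f x + g x"
  by (auto simp: in_L2_add elim: eventually_elim2)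

lift_definition minus_l2 :: "'a l2 \<Rightarrow> 'a l2 \<Rightarrow> 'a l2" is "\<lambda>f g x. f x - g x"
  by (auto simp: in_L2_diff elim: eventually_elim2)

lift_definition uminus_l2 :: "'a l2 \<Rightarrow> 'a l2" is "\<lambda>f x. - f x"
  by (auto simp: in_L2_uminus)

lift_definition scaleR_l2 :: "real \<Rightarrow> 'a l2 \<Rightarrow> 'a l2" is "\<lambda>c f x. c *\<^sub>R f x"
  by (auto simp: in_L2_scaleR elim: eventually_mono)

lift_definition inner_l2 :: "'a l2 \<Rightarrow> 'a l2 \<Rightarrow> real" is "\<lambda>f g. \<integral>x. f x \<bullet> g x \<partial>lborel"
  using integral_inner_cong_AE by blast

definition norm_l2 :: "'a l2 \<Rightarrow> real" where "norm_l2 f = sqrt (f \<bullet> f)"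

definition dist_l2 :: "'a l2 \<Rightarrow> 'a l2 \<Rightarrow> real" where "dist_l2 f g = norm (f - g)"

definition sgn_l2 :: "'a l2 \<Rightarrow> 'a l2" where "sgn_l2 f = inverse (norm f) *\<^sub>R f"

definition uniformity_l2 :: "('a l2 \<times> 'a l2) filter" where
  "uniformity_l2 = (INF e\<in>{0<..}. principal {(x, y). dist x y < e})"

definition open_l2 :: "'a l2 set \<Rightarrow> bool" where
  "open_l2 U = (\<forall>x\<in>U. \<forall>\<^sub>F (x', y) in uniformity. x' = x \<longrightarrow> y \<in> U)"

instance
proof
  fix f g h :: "'a l2" and a b :: real
  show "f + g + h = f + (g + h)" by transfer (simp add: in_L2_add add.assoc)
  show "f + g = g + f" by transfer (simp add: in_L2_add add.commute)
  show "0 + f = f" by transfer simp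
  show "- f + f = 0" by transfer simp
  show "f - g = f + - g" by transfer (simp add: in_L2_diff in_L2_add in_L2_uminus)
  show "a *\<^sub>R (f + g) = a *\<^sub>R f + a *\<^sub>R g"
    by transfer (simp add: in_L2_add in_L2_scaleR scaleR_add_right)
  show "(a + b) *\<^sub>R f = a *\<^sub>R f + b *\<^sub>R f"
    by transfer (simp add: in_L2_scaleR in_L2_add scaleR_add_left)
  show "a *\<^sub>R b *\<^sub>R f = (a * b) *\<^sub>R f"
    by transfer (simp add: in_L2_scaleR)
  show "1 *\<^sub>R f = f" by transfer simp
  show "dist f g = norm (f - g)" by (simp add: dist_l2_def)
  show "sgn f = inverse (norm f) *\<^sub>R f" by (simp add: sgn_l2_def)
  show "uniformity = (INF e\<in>{0<..}. principal {(x, y). dist (x::'a l2) y < e})"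
    by (simp add: uniformity_l2_def)
  show "open U = (\<forall>x\<in>U. \<forall>\<^sub>F (x', y) in uniformity. x' = x \<longrightarrow> y \<in> U)" for U :: "'a l2 set"
    by (simp add: open_l2_def)
  show "f \<bullet> g = g \<bullet> f" by transfer (simp add: inner_commute)
  show "(f + g) \<bullet> h = f \<bullet> h + g \<bullet> h"
    by transfer (simp add: inner_add_left integrable_inner_L2)
  show "a *\<^sub>R f \<bullet> g = a * (f \<bullet> g)" by transfer simp
  show "0 \<le> f \<bullet> f" by transfer simp
  show "f \<bullet> f = 0 \<longleftrightarrow> f = 0"
  proof (transfer, clarify)
    fix f :: "real \<Rightarrow> 'a"
    assume f: "in_L2 f"
    have "(\<integral>x. f x \<bullet> f x \<partial>lborel) = 0 \<longleftrightarrow> (AE x in lborel. f x \<bullet> f x = 0)"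
      by (rule integral_nonneg_eq_0_iff_AE) (auto intro!: integrable_inner_L2 f)
    then show "((\<integral>x. f x \<bullet> f x \<partial>lborel) = 0) = (in_L2 f \<and> in_L2 (\<lambda>x. 0::'a) \<and> (AE x in lborel. f x = 0))"
      using f by simp
  qed
  show "norm f = sqrt (f \<bullet> f)" by (simp add: norm_l2_def)
qed

end

definition to_l2 :: "(real \<Rightarrow> 'a::euclidean_space) \<Rightarrow> 'a l2" where "to_l2 f = abs_l2 f"

lemma to_l2_eq_iff:
  assumes "in_L2 f" "in_L2 g"
  shows "to_l2 f = to_l2 g \<longleftrightarrow> (AE x in lborel. f x = g x)"
  using Quotient_rel[OF Quotient_l2, of f g] assms by (simp add: to_l2_def)

lemma to_l2_zero: "to_l2 (\<lambda>x. 0) = 0"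
  by (simp add: to_l2_def zero_l2_def)

lemma to_l2_add: "in_L2 f \<Longrightarrow> in_L2 g \<Longrightarrow> to_l2 f + to_l2 g = to_l2 (\<lambda>x. f x + g x)"
  unfolding to_l2_def by (rule plus_l2.abs_eq) auto

lemma to_l2_diff: "in_L2 f \<Longrightarrow> in_L2 g \<Longrightarrow> to_l2 f - to_l2 g = to_l2 (\<lambda>x. f x - g x)"
  unfolding to_l2_def by (rule minus_l2.abs_eq) auto

lemma to_l2_scaleR: "in_L2 f \<Longrightarrow> c *\<^sub>R to_l2 f = to_l2 (\<lambda>x. c *\<^sub>R f x)"
  unfolding to_l2_def by (rule scaleR_l2.abs_eq) auto

lemma inner_to_l2: "in_L2 f \<Longrightarrow> in_L2 g \<Longrightarrow> to_l2 f \<bullet> to_l2 g = (\<integral>x. f x \<bullet> g x \<partial>lborel)"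
  unfolding to_l2_def by (rule inner_l2.abs_eq) auto

lemma norm_to_l2: "in_L2 f \<Longrightarrow> norm (to_l2 f) = L2_nrm f"
  by (subst norm_eq_sqrt_inner) (simp add: inner_to_l2 L2_nrm_def power2_norm_eq_inner)

lemma to_l2_cases:
  obtains f where "in_L2 f" "u = to_l2 f"
  using Quotient_abs_rep[OF Quotient_l2, of u] Quotient_rep_reflp[OF Quotient_l2, of u]
  unfolding to_l2_def by metis

lemma L2_nrm_nonneg [simp]: "0 \<le> L2_nrm f"
  by (simp add: L2_nrm_def)

lemma L2_nrm_sq: "(L2_nrm f)\<^sup>2 = (\<integral>x. (norm (f x))\<^sup>2 \<partial>lborel)"
  by (simp add: L2_nrm_def)

lemma L2_nrm_triangle:
  assumes "in_L2 f" "in_L2 g"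
  shows "L2_nrm (\<lambda>x. f x + g x) \<le> L2_nrm f + L2_nrm g"
  using norm_triangle_ineq[of "to_l2 f" "to_l2 g"] assms
  by (simp add: to_l2_add norm_to_l2 in_L2_add)

lemma integral_inner_L2_le:
  assumes "in_L2 f" "in_L2 g"
  shows "\<bar>\<integral>x. f x \<bullet> g x \<partial>lborel\<bar> \<le> L2_nrm f * L2_nrm g"
  using Cauchy_Schwarz_ineq2[of "to_l2 f" "to_l2 g"] assms
  by (simp add: inner_to_l2 norm_to_l2)

lemma in_L2_norm: "in_L2 f \<Longrightarrow> in_L2 (\<lambda>x. norm (f x))"
  by (rule in_L2_cmult_bound[of f _ 1]) (auto dest: in_L2_borel)

lemma L2_nrm_norm: "L2_nrm (\<lambda>x. norm (f x)) = L2_nrm f"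
  by (simp add: L2_nrm_def)

lemma L2_nrm_eq_0_iff: "in_L2 f \<Longrightarrow> L2_nrm f = 0 \<longleftrightarrow> (AE x in lborel. f x = 0)"
  using to_l2_eq_iff[of f "\<lambda>x. 0"] norm_to_l2[of f] by (auto simp: to_l2_zero)

lemma L2_nrm_cong_AE:
  assumes "in_L2 f" "in_L2 g" "AE x in lborel. f x = g x"
  shows "L2_nrm f = L2_nrm g"
  using assms by (metis norm_to_l2 to_l2_eq_iff)

lemma in_L2_cong_AE:
  assumes "in_L2 f" "g \<in> borel_measurable lborel" "AE x in lborel. g x = f x"
  shows "in_L2 g"
proof -
  have "integrable lborel (\<lambda>x. (norm (g x))\<^sup>2) \<longleftrightarrow> integrable lborel (\<lambda>x. (norm (f x))\<^sup>2)"
    using assms by (intro integrable_cong_AE) (auto dest: in_L2_borel elim: eventually_mono)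
  then show ?thesis using assms by (auto simp: in_L2_def)
qed

text \<open>Since |f| <= 1 + |f|^2, the indicator of \<open>S\<close> plus |f|^2 is an integrable
  majorant.\<close>

lemma integrable_mult_indicator_L2:
  assumes "in_L2 f" "S \<in> sets lborel" "emeasure lborel S < \<infinity>"
  shows "set_integrable lborel S f"
proof -
  have 1: "integrable lborel (\<lambda>x. indicat_real S x + (norm (f x))\<^sup>2)"
    using assms in_L2_norm_sq[OF assms(1)] by (intro Bochner_Integration.integrable_add integrable_real_indicator) auto
  show ?thesis
    unfolding set_integrable_def
  proof (rule Bochner_Integration.integrable_bound[OF 1])
    show "(\<lambda>x. indicat_real S x *\<^sub>R f x) \<in> borel_measurable lborel"
      using assms by (auto dest: in_L2_borel intro!: borel_measurable_scaleR borel_measurable_indicator)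
    have "norm (f x) \<le> 1 + (norm (f x))\<^sup>2" for x
      using sum_squares_bound[of "norm (f x)" 1] norm_ge_zero[of "f x"] unfolding power_one mult_1_right by linarith
    then show "AE x in lborel. norm (indicat_real S x *\<^sub>R f x) \<le> norm (indicat_real S x + (norm (f x))\<^sup>2)"
      by (intro AE_I2) (auto simp: indicator_def)
  qed
qed

lemma in_L2_set_integrable: "in_L2 f \<Longrightarrow> set_integrable lborel {a..b::real} f"
  by (rule integrable_mult_indicator_L2) (auto simp: emeasure_lborel_Icc_eq)

section \<open>Test functions\<close>

lemma nth_deriv_0 [simp]: "nth_deriv 0 f = f"
  by (simp add: nth_deriv_def)

lemma nth_deriv_Suc: "nth_deriv (Suc n) f x = vector_derivative (nth_deriv n f) (at x)"
  by (simp add: nth_deriv_def)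

lemma nth_deriv_add: "nth_deriv (m + n) f = nth_deriv m (nth_deriv n f)"
  by (simp add: nth_deriv_def funpow_add)

lemma smooth_deriv:
  assumes "smooth f"
  shows "(nth_deriv n f has_vector_derivative nth_deriv (Suc n) f x) (at x)"
  using assms unfolding smooth_def nth_deriv_Suc
  by (metis UNIV_I differentiable_on_eq_differentiable_at open_UNIV vector_derivative_works)

lemma nth_deriv_eqI:
  assumes "\<And>n x. (F n has_vector_derivative F (Suc n) x) (at x)"
  shows "nth_deriv n (F 0) = F n"
proof (induction n)
  case (Suc n)
  show ?case
  proof
    fix x
    show "nth_deriv (Suc n) (F 0) x = F (Suc n) x"
      unfolding nth_deriv_Suc Suc by (rule vector_derivative_at[OF assms])
  qed
qed simp

lemma smoothI:
  assumes "\<And>n x. (F n has_vector_derivative F (Suc n) x) (at x)"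
  shows "smooth (F 0)"
  unfolding smooth_def nth_deriv_eqI[of F, OF assms]
  using assms by (auto simp: differentiable_on_def intro!: differentiableI_vector)

text \<open>Choosing for each member a derivative inside \<open>S\<close> and iterating the choice
  produces all derivatives at once, without a formula for the n-th one.\<close>

lemma smooth_of_closed:
  assumes "\<And>f. f \<in> S \<Longrightarrow> \<exists>f'\<in>S. \<forall>x. (f has_vector_derivative f' x) (at x)" "f \<in> S"
  shows "smooth f"
proof -
  obtain D where D: "\<And>f. f \<in> S \<Longrightarrow> D f \<in> S" "\<And>f x. f \<in> S \<Longrightarrow> (f has_vector_derivative D f x) (at x)"
    using assms(1) by metis
  have "(D ^^ n) f \<in> S" for n
    by (induction n) (auto simp: assms(2) D)
  then show ?thesis
    using smoothI[of "\<lambda>n. (D ^^ n) f"] D by simp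
qed

lemma smooth_nth_deriv:
  assumes "smooth f" shows "smooth (nth_deriv n f)"
proof -
  have "smooth (nth_deriv (0 + n) f)"
    by (rule smoothI[where F = "\<lambda>m. nth_deriv (m + n) f"]) (unfold add_Suc, rule smooth_deriv[OF assms])
  then show ?thesis by simp
qed

lemma smooth_continuous: "smooth f \<Longrightarrow> continuous_on UNIV (nth_deriv n f)"
  by (rule continuous_at_imp_continuous_on) (blast intro: smooth_deriv has_vector_derivative_continuous)

lemma smooth_affine:
  fixes f :: "real \<Rightarrow> 'a::real_normed_vector"
  assumes "smooth f"
  shows "smooth (\<lambda>x. c *\<^sub>R f (a * x + b))"
    and "nth_deriv n (\<lambda>x. c *\<^sub>R f (a * x + b)) = (\<lambda>x. (c * a ^ n) *\<^sub>R nth_deriv n f (a * x + b))"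
proof -
  define F where "F n x = (c * a ^ n) *\<^sub>R nth_deriv n f (a * x + b)" for n x
  have "(F n has_vector_derivative F (Suc n) x) (at x)" for n x
  proof -
    have "((\<lambda>x. nth_deriv n f (a * x + b)) has_vector_derivative a *\<^sub>R nth_deriv (Suc n) f (a * x + b)) (at x)"
    proof -
      have "((\<lambda>x. a * x + b) has_vector_derivative a) (at x)"
        by (auto intro!: derivative_eq_intros)
      from vector_diff_chain_at[OF this smooth_deriv[OF assms]] show ?thesis
        by (simp add: o_def)
    qed
    then show ?thesis
      unfolding F_def by (auto intro!: derivative_eq_intros simp: mult_ac)
  qed
  from smoothI[of F, OF this] nth_deriv_eqI[of F, OF this]
  show "smooth (\<lambda>x. c *\<^sub>R f (a * x + b))"
    "nth_deriv n (\<lambda>x. c *\<^sub>R f (a * x + b)) = (\<lambda>x. (c * a ^ n) *\<^sub>R nth_deriv n f (a * x + b))"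
    by (simp_all add: F_def[abs_def])
qed

lemma nth_deriv_zero_outside:
  assumes "\<And>x. \<bar>x\<bar> > R \<Longrightarrow> f x = 0" "\<bar>x\<bar> > R"
  shows "nth_deriv n f x = 0"
  using assms(2)
proof (induction n arbitrary: x)
  case (Suc n)
  have "open {x::real. \<bar>x\<bar> > R}"
    by (intro open_Collect_less continuous_intros)
  then have "(nth_deriv n f has_vector_derivative 0) (at x)"
    using has_vector_derivative_transform_within_open[of "\<lambda>x. 0" 0 x "{x::real. \<bar>x\<bar> > R}" "nth_deriv n f"]
      Suc by auto
  then show ?case
    unfolding nth_deriv_Suc by (rule vector_derivative_at)
qed (use assms in auto)

lemma test_function_support:
  assumes "test_function \<eta>"
  obtains R where "R > 0" "\<And>n x. \<bar>x\<bar> > R \<Longrightarrow> nth_deriv n \<eta> x = 0"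
proof -
  have "bounded (closure {x. \<eta> x \<noteq> 0})"
    using assms by (auto simp: test_function_def compact_imp_bounded)
  then obtain R where R: "R > 0" "\<And>x. x \<in> closure {x. \<eta> x \<noteq> 0} \<Longrightarrow> norm x \<le> R"
    by (auto simp: bounded_pos)
  have "\<eta> x = 0" if "\<bar>x\<bar> > R" for x
    using R(2)[of x] closure_subset[of "{x. \<eta> x \<noteq> 0}"] that by (auto simp: subset_iff)
  then show ?thesis
    using R(1) nth_deriv_zero_outside[of R \<eta>] that by blast
qed

lemma test_functionI:
  assumes "smooth \<eta>" "\<And>x. \<bar>x\<bar> > R \<Longrightarrow> \<eta> x = 0"
  shows "test_function \<eta>"
proof -
  have "{x. \<eta> x \<noteq> 0} \<subseteq> cball 0 R"
    using assms(2) by (auto simp: not_less[symmetric])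
  then have "bounded {x. \<eta> x \<noteq> 0}"
    using bounded_cball bounded_subset by blast
  then show ?thesis
    using assms(1) by (simp add: test_function_def compact_closure)
qed

lemma test_function_nth_deriv:
  assumes "test_function \<eta>" shows "test_function (nth_deriv n \<eta>)"
  using test_function_support[OF assms] assms
  by (metis smooth_nth_deriv test_functionI test_function_def)

lemma test_function_affine:
  assumes "test_function \<eta>" "a \<noteq> 0" shows "test_function (\<lambda>x. c *\<^sub>R \<eta> (a * x + b))"
proof -
  obtain R where R: "R > 0" "\<And>n x. \<bar>x\<bar> > R \<Longrightarrow> nth_deriv n \<eta> x = 0"
    by (rule test_function_support[OF assms(1)]) (use that in blast)
  have "\<eta> (a * x + b) = 0" if "\<bar>x\<bar> > (R + \<bar>b\<bar>) / \<bar>a\<bar>" for x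
  proof -
    have "R + \<bar>b\<bar> < \<bar>a * x\<bar>"
      using that assms(2) by (simp add: field_simps abs_mult)
    then have "\<bar>a * x + b\<bar> > R" by linarith
    then show ?thesis using R(2)[of _ 0] by simp
  qed
  then show ?thesis
    using assms by (intro test_functionI[where R = "(R + \<bar>b\<bar>) / \<bar>a\<bar>"] smooth_affine) (auto simp: test_function_def)
qed

subsection \<open>A smooth bump\<close>

text \<open>The polynomials P_n for which the n-th derivative of exp (-1/x) on x > 0 is P_n(1/x) exp
  (-1/x). Differentiating once more gives P_(n+1)(y) = y^2 (P_n(y) - P_n'(y)).\<close>

primrec exp_poly :: "nat \<Rightarrow> real poly" where
  "exp_poly 0 = 1"
| "exp_poly (Suc n) = [:0, 0, 1:] * (exp_poly n - pderiv (exp_poly n))"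

definition flat :: "nat \<Rightarrow> real \<Rightarrow> real" where
  "flat n x = (if x > 0 then poly (exp_poly n) (1 / x) * exp (- (1 / x)) else 0)"

lemma poly_exp_tendsto_0: "((\<lambda>x. poly p x * exp (- x)) \<longlongrightarrow> (0::real)) at_top"
proof -
  have "((\<lambda>x. \<Sum>i\<le>degree p. coeff p i * (x ^ i / exp x)) \<longlongrightarrow> (\<Sum>i\<le>degree p. coeff p i * 0)) at_top"
    by (intro tendsto_sum tendsto_mult_left tendsto_power_div_exp_0)
  then show ?thesis
    by (simp add: poly_altdef sum_distrib_right exp_minus divide_inverse mult.assoc)
qed

lemma flat_deriv: "(flat n has_real_derivative flat (Suc n) x) (at x)"
proof (cases x "0::real" rule: linorder_cases)
  case less
  have "(flat n has_real_derivative 0) (at x)"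
    by (rule has_field_derivative_transform_within_open[of "\<lambda>x. 0" 0 x "{..<0}"])
       (use less in \<open>auto simp: flat_def\<close>)
  then show ?thesis using less by (simp add: flat_def)
next
  case greater
  have i: "((\<lambda>x. 1 / x) has_real_derivative - (1 / x\<^sup>2)) (at x)"
    using greater by (auto intro!: derivative_eq_intros simp: power2_eq_square)
  have "((\<lambda>x. poly (exp_poly n) (1 / x) * exp (- (1 / x))) has_real_derivative
      poly (pderiv (exp_poly n)) (1 / x) * - (1 / x\<^sup>2) * exp (- (1 / x))
      + exp (- (1 / x)) * - (- (1 / x\<^sup>2)) * poly (exp_poly n) (1 / x)) (at x)"
    by (intro DERIV_mult DERIV_chain2[OF poly_DERIV] DERIV_chain2[OF DERIV_exp] DERIV_minus i)
  also have "poly (pderiv (exp_poly n)) (1 / x) * - (1 / x\<^sup>2) * exp (- (1 / x))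
      + exp (- (1 / x)) * - (- (1 / x\<^sup>2)) * poly (exp_poly n) (1 / x) = flat (Suc n) x"
    using greater by (simp add: flat_def power2_eq_square algebra_simps)
  finally have "((\<lambda>x. poly (exp_poly n) (1 / x) * exp (- (1 / x))) has_real_derivative flat (Suc n) x) (at x)" .
  then show ?thesis
    using greater
    by (rule_tac has_field_derivative_transform_within_open[of _ _ x "{0<..}"]) (auto simp: flat_def)
next
  case equal
  have "((\<lambda>h. flat n h / h) \<longlongrightarrow> 0) (at_right 0)"
  proof -
    \<comment> \<open>Dividing by h multiplies the polynomial in 1/h by one more power, and the
      exponential still wins.\<close>
    have "((\<lambda>h. poly ([:0, 1:] * exp_poly n) (inverse h) * exp (- inverse h)) \<longlongrightarrow> 0) (at_right (0::real))"
      by (rule filterlim_compose[OF poly_exp_tendsto_0 filterlim_inverse_at_top_right])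
    then show ?thesis
      by (rule Lim_transform_eventually)
         (auto simp: flat_def eventually_at_right_less field_simps intro!: eventually_at_rightI[of 0 1])
  qed
  moreover have "((\<lambda>h. flat n h / h) \<longlongrightarrow> 0) (at_left (0::real))"
    by (rule tendsto_eventually) (auto simp: flat_def intro!: eventually_at_leftI[of "-1"])
  ultimately have "((\<lambda>h. flat n h / h) \<longlongrightarrow> 0) (at (0::real))"
    by (simp add: filterlim_split_at)
  then show ?thesis
    using equal by (simp add: DERIV_def flat_def)
qed

text \<open>The derivative of a base product is a difference of two base products, because 1 - x has
  derivative -1. So the set is closed under derivatives, as \<open>smooth_of_closed\<close>
  asks.\<close>

inductive_set bump_span :: "(real \<Rightarrow> real) set" where
  base: "(\<lambda>x. flat m (1 + x) * flat n (1 - x)) \<in> bump_span"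
| diff: "f \<in> bump_span \<Longrightarrow> g \<in> bump_span \<Longrightarrow> (\<lambda>x. f x - g x) \<in> bump_span"

lemma bump_span_deriv:
  "f \<in> bump_span \<Longrightarrow> \<exists>f'\<in>bump_span. \<forall>x. (f has_vector_derivative f' x) (at x)"
proof (induction rule: bump_span.induct)
  case (base m n)
  have "((\<lambda>x. flat m (1 + x) * flat n (1 - x)) has_real_derivative
      flat (Suc m) (1 + x) * flat n (1 - x) - flat m (1 + x) * flat (Suc n) (1 - x)) (at x)" for x
    by (rule derivative_eq_intros DERIV_chain2[OF flat_deriv] refl | simp)+
  then show ?case
    by (intro bexI[of _ "\<lambda>x. flat (Suc m) (1 + x) * flat n (1 - x) - flat m (1 + x) * flat (Suc n) (1 - x)"]
        allI bump_span.intros) (simp add: has_real_derivative_iff_has_vector_derivative)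
next
  case (diff f g)
  then obtain f' g' where "f' \<in> bump_span" "g' \<in> bump_span"
    "\<forall>x. (f has_vector_derivative f' x) (at x)" "\<forall>x. (g has_vector_derivative g' x) (at x)" by auto
  then show ?case
    by (intro bexI[of _ "\<lambda>x. f' x - g' x"] allI bump_span.intros has_vector_derivative_diff) auto
qed

text \<open>Evenness will make convolution with the normalised bump self-adjoint; positivity at 0
  gives it nonzero mass.\<close>

lemma exists_bump:
  obtains \<rho> :: "real \<Rightarrow> real" where "test_function \<rho>" "\<And>x. \<rho> x \<ge> 0" "\<And>x. \<rho> (- x) = \<rho> x"
    "\<And>x. \<bar>x\<bar> > 1 \<Longrightarrow> \<rho> x = 0" "\<rho> 0 > 0"
proof -
  define \<rho> where "\<rho> x = flat 0 (1 + x) * flat 0 (1 - x)" for x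
  have "\<rho> \<in> bump_span" unfolding \<rho>_def[abs_def] by (rule bump_span.base)
  then have "smooth \<rho>" using smooth_of_closed[of bump_span] bump_span_deriv by blast
  moreover have "\<And>x. \<bar>x\<bar> > 1 \<Longrightarrow> \<rho> x = 0" by (auto simp: \<rho>_def flat_def)
  ultimately show ?thesis
    by (intro that[of \<rho>] test_functionI[of \<rho> 1]) (auto simp: \<rho>_def flat_def mult.commute)
qed

section \<open>Convolution with continuous compactly supported kernels\<close>

definition compactly_supported_cont :: "(real \<Rightarrow> 'a::euclidean_space) \<Rightarrow> bool" where
  "compactly_supported_cont f \<longleftrightarrow> continuous_on UNIV f \<and> (\<exists>R. \<forall>x. \<bar>x\<bar> > R \<longrightarrow> f x = 0)"

abbreviation "csc \<equiv> compactly_supported_cont"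

lemma csc_cont: "csc f \<Longrightarrow> continuous_on UNIV f"
  by (simp add: compactly_supported_cont_def)

lemma csc_borel: "csc f \<Longrightarrow> f \<in> borel_measurable borel"
  using csc_cont borel_measurable_continuous_onI by blast

lemma csc_bounds:
  assumes "csc f"
  obtains R B where "R > 0" "B > 0" "\<And>x. norm (f x) \<le> B * indicator {-R..R} x"
proof -
  obtain R where R: "\<And>x. \<bar>x\<bar> > R \<Longrightarrow> f x = 0" and "continuous_on UNIV f"
    using assms by (auto simp: compactly_supported_cont_def)
  define R' where "R' = max R 1"
  have "compact (f ` {-R'..R'})"
    using \<open>continuous_on UNIV f\<close> by (intro compact_continuous_image) (auto intro: continuous_on_subset)
  then obtain B where B: "B > 0" "\<And>y. y \<in> f ` {-R'..R'} \<Longrightarrow> norm y \<le> B"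
    using compact_imp_bounded bounded_pos by metis
  show ?thesis
  proof (rule that[of R' B])
    show "norm (f x) \<le> B * indicator {-R'..R'} x" for x
      using B R[of x] by (cases "x \<in> {-R'..R'}") (auto simp: R'_def indicator_def)
  qed (auto simp: B R'_def)
qed

lemma csc_integrable: assumes "csc f" shows "integrable lborel f"
proof -
  obtain R B where "\<And>x. norm (f x) \<le> B * indicator {-R..R} x"
    using csc_bounds[OF assms] by metis
  then show ?thesis
    using csc_borel[OF assms]
    by (intro Bochner_Integration.integrable_bound[of lborel "\<lambda>x. B * indicator {-R..R} x" f])
       (auto intro!: integrable_mult_right integrable_real_indicator AE_I2 order_trans[OF _ abs_ge_self]
         simp: emeasure_lborel_Icc_eq)
qed

lemma csc_norm: "csc f \<Longrightarrow> csc (\<lambda>x. norm (f x))"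
  unfolding compactly_supported_cont_def by (auto intro!: continuous_intros)

lemma csc_in_L2: assumes "csc f" shows "in_L2 f"
proof -
  have "csc (\<lambda>x. (norm (f x))\<^sup>2)"
    using assms unfolding compactly_supported_cont_def by (auto intro!: continuous_intros)
  from csc_integrable[OF this] csc_borel[OF assms] show ?thesis
    by (simp add: in_L2_def)
qed

lemma test_function_csc: "test_function \<eta> \<Longrightarrow> csc (nth_deriv n \<eta>)"
  unfolding compactly_supported_cont_def
  by (metis smooth_continuous test_function_def test_function_support)

lemma test_function_csc0: "test_function \<eta> \<Longrightarrow> csc \<eta>"
  using test_function_csc[of \<eta> 0] by simp

definition conv :: "(real \<Rightarrow> real) \<Rightarrow> (real \<Rightarrow> 'a::euclidean_space) \<Rightarrow> real \<Rightarrow> 'a" where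
  "conv \<kappa> f x = (\<integral>y. \<kappa> (x - y) *\<^sub>R f y \<partial>lborel)"

lemma csc_reflect: "csc \<kappa> \<Longrightarrow> csc (\<lambda>y. \<kappa> (x - y))"
  unfolding compactly_supported_cont_def
proof (elim conjE exE, intro conjI)
  fix R assume "continuous_on UNIV \<kappa>" and R: "\<forall>x. R < \<bar>x\<bar> \<longrightarrow> \<kappa> x = 0"
  show "continuous_on UNIV (\<lambda>y. \<kappa> (x - y))"
    by (rule continuous_on_compose2[OF \<open>continuous_on UNIV \<kappa>\<close>]) (auto intro!: continuous_intros)
  show "\<exists>R. \<forall>y. R < \<bar>y\<bar> \<longrightarrow> \<kappa> (x - y) = 0"
    using R by (intro exI[of _ "R + \<bar>x\<bar>"]) auto
qed

lemma integrable_L2_scaleR: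
  fixes f :: "real \<Rightarrow> 'a::euclidean_space"
  assumes "in_L2 \<kappa>" "in_L2 f"
  shows "integrable lborel (\<lambda>y. \<kappa> y *\<^sub>R f y)"
proof (rule Bochner_Integration.integrable_bound)
  show "integrable lborel (\<lambda>x. \<bar>\<kappa> x\<bar> * norm (f x))"
    using integrable_inner_L2[OF in_L2_norm[OF assms(1)] in_L2_norm[OF assms(2)]] by simp
  show "(\<lambda>y. \<kappa> y *\<^sub>R f y) \<in> borel_measurable lborel"
    using assms[THEN in_L2_borel] by measurable
qed auto

lemma integrable_conv:
  fixes f :: "real \<Rightarrow> 'a::euclidean_space"
  assumes "csc \<kappa>" "in_L2 f" shows "integrable lborel (\<lambda>y. \<kappa> (x - y) *\<^sub>R f y)"
  by (intro integrable_L2_scaleR csc_in_L2 csc_reflect assms)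

lemma conv_diff: "csc \<kappa> \<Longrightarrow> in_L2 f \<Longrightarrow> in_L2 g \<Longrightarrow> conv \<kappa> (\<lambda>x. f x - g x) x = conv \<kappa> f x - conv \<kappa> g x"
  by (simp add: conv_def scaleR_diff_right integrable_conv)

lemma conv_bounded_linear:
  assumes "bounded_linear T" "csc \<kappa>" "in_L2 f"
  shows "conv \<kappa> (\<lambda>x. T (f x)) x = T (conv \<kappa> f x)"
  using integral_bounded_linear[OF assms(1) integrable_conv[OF assms(2,3), of x]]
  by (simp add: conv_def linear_simps[OF assms(1)])

lemma in_L2_reflect:
  fixes f :: "real \<Rightarrow> 'a::euclidean_space"
  assumes "in_L2 f"
  shows "in_L2 (\<lambda>z. f (x - z))" "L2_nrm (\<lambda>z. f (x - z)) = L2_nrm f"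
proof -
  have "integrable lborel (\<lambda>z. (norm (f (x + (-1) * z)))\<^sup>2)"
    using lborel_integrable_real_affine_iff[of "-1" "\<lambda>z. (norm (f z))\<^sup>2" x] in_L2_norm_sq[OF assms] by simp
  then show "in_L2 (\<lambda>z. f (x - z))"
    using in_L2_borel[OF assms] by (simp add: in_L2_def)
  show "L2_nrm (\<lambda>z. f (x - z)) = L2_nrm f"
    using lborel_integral_real_affine[of "-1" "\<lambda>z. (norm (f z))\<^sup>2" x]
    by (simp add: L2_nrm_def)
qed

lemma conv_alt:
  fixes f :: "real \<Rightarrow> 'a::euclidean_space"
  shows "conv \<kappa> f x = (\<integral>z. \<kappa> z *\<^sub>R f (x - z) \<partial>lborel)"
  using lborel_integral_real_affine[of "-1" "\<lambda>y. \<kappa> (x - y) *\<^sub>R f y" x]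
  by (simp add: conv_def)

lemma conv_measurable [measurable]:
  assumes "\<kappa> \<in> borel_measurable borel" "f \<in> borel_measurable borel"
  shows "conv \<kappa> f \<in> borel_measurable borel"
proof -
  have "(\<lambda>x. \<integral>y. \<kappa> (x - y) *\<^sub>R f y \<partial>lborel) \<in> borel_measurable borel"
    using assms by measurable
  then show ?thesis unfolding conv_def[abs_def] .
qed

section \<open>Derivatives as limits of difference quotients\<close>

lemma has_vector_derivative_within_quotient:
  fixes f :: "real \<Rightarrow> 'a::real_normed_vector"
  shows "(f has_vector_derivative D) (at x within S) \<longleftrightarrow>
    ((\<lambda>y. (f y - f x) /\<^sub>R (y - x)) \<longlongrightarrow> D) (at x within S)"
proof -
  have eq: "norm ((1 / norm (y - x)) *\<^sub>R (f y - (f x + (y - x) *\<^sub>R D))) = norm ((f y - f x) /\<^sub>R (y - x) - D)"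
    if "y \<noteq> x" for y
  proof -
    have "(f y - f x) /\<^sub>R (y - x) - D = inverse (y - x) *\<^sub>R (f y - (f x + (y - x) *\<^sub>R D))"
      using that by (simp add: scaleR_diff_right scaleR_add_right)
    then show ?thesis by (simp add: divide_inverse)
  qed
  have "(f has_vector_derivative D) (at x within S) \<longleftrightarrow>
    ((\<lambda>y. (1 / norm (y - x)) *\<^sub>R (f y - (f x + (y - x) *\<^sub>R D))) \<longlongrightarrow> 0) (at x within S)"
    by (simp add: has_vector_derivative_def has_derivative_within bounded_linear_scaleR_left)
  also have "\<dots> \<longleftrightarrow> ((\<lambda>y. norm ((1 / norm (y - x)) *\<^sub>R (f y - (f x + (y - x) *\<^sub>R D)))) \<longlongrightarrow> 0) (at x within S)"
    by (rule tendsto_norm_zero_iff[symmetric])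
  also have "\<dots> \<longleftrightarrow> ((\<lambda>y. norm ((f y - f x) /\<^sub>R (y - x) - D)) \<longlongrightarrow> 0) (at x within S)"
    by (rule filterlim_cong[OF refl refl]) (use eq in \<open>auto simp: eventually_at_filter\<close>)
  also have "\<dots> \<longleftrightarrow> ((\<lambda>y. (f y - f x) /\<^sub>R (y - x)) \<longlongrightarrow> D) (at x within S)"
    by (simp only: tendsto_norm_zero_iff LIM_zero_iff)
  finally show ?thesis .
qed

text \<open>Dominated convergence speaks of sequences, so derivatives of integrals with respect to a
  parameter are verified in this form.\<close>

lemma has_vector_derivative_within_seq:
  fixes f :: "real \<Rightarrow> 'a::real_normed_vector"
  shows "(f has_vector_derivative D) (at x within S) \<longleftrightarrow>
    (\<forall>X. (\<forall>n. X n \<in> S - {x}) \<longrightarrow> X \<longlonglongrightarrow> x \<longrightarrow> (\<lambda>n. (f (X n) - f x) /\<^sub>R (X n - x)) \<longlonglongrightarrow> D)"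
  unfolding has_vector_derivative_within_quotient tendsto_at_iff_sequentially by (simp add: o_def)

section \<open>Mollification in the space of square integrable functions\<close>

text \<open>The limit inherits the majorant \<open>w\<close>, so the squared distance is dominated
  by 4 w^2 and ordinary dominated convergence applies.\<close>

lemma L2_dominated:
  fixes u :: "nat \<Rightarrow> real \<Rightarrow> 'a::euclidean_space"
  assumes u [measurable]: "\<And>n. u n \<in> borel_measurable borel" and l [measurable]: "l \<in> borel_measurable borel"
    and lim: "AE x in lborel. (\<lambda>n. u n x) \<longlonglongrightarrow> l x"
    and w: "in_L2 w" "\<And>n. AE x in lborel. norm (u n x) \<le> w x"
  shows "(\<lambda>n. L2_nrm (\<lambda>x. u n x - l x)) \<longlonglongrightarrow> 0"
proof -
  have "AE x in lborel. \<forall>n. norm (u n x) \<le> w x"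
    using w(2) by (simp add: AE_all_countable)
  with lim have b: "AE x in lborel. \<forall>n. norm (u n x - l x) \<le> 2 * w x"
  proof eventually_elim
    case (elim x)
    have "norm (l x) \<le> w x"
      using elim by (intro Lim_norm_ubound[OF _ elim(1)]) auto
    then show ?case
      using elim(2) norm_triangle_ineq4 by (smt (verit))
  qed
  have "(\<lambda>n. \<integral>x. (norm (u n x - l x))\<^sup>2 \<partial>lborel) \<longlonglongrightarrow> (\<integral>x. 0 \<partial>(lborel::real measure))"
  proof (rule integral_dominated_convergence)
    show "integrable lborel (\<lambda>x. 4 * (w x)\<^sup>2)"
      using in_L2_norm_sq[OF w(1)] by simp
    show "AE x in lborel. (\<lambda>n. (norm (u n x - l x))\<^sup>2) \<longlonglongrightarrow> 0"
      using lim
    proof eventually_elim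
      case (elim x)
      then have "(\<lambda>n. (norm (u n x - l x))\<^sup>2) \<longlonglongrightarrow> (norm (l x - l x))\<^sup>2"
        by (intro tendsto_intros)
      then show ?case by simp
    qed
    show "AE x in lborel. norm ((norm (u n x - l x))\<^sup>2) \<le> 4 * (w x)\<^sup>2" for n
      using b
    proof eventually_elim
      case (elim x)
      then show ?case using power_mono[of "norm (u n x - l x)" "2 * w x" 2] by (simp add: power_mult_distrib)
    qed
  qed measurable
  then have "(\<lambda>n. sqrt (\<integral>x. (norm (u n x - l x))\<^sup>2 \<partial>lborel)) \<longlonglongrightarrow> sqrt 0"
    by (intro tendsto_real_sqrt) simp
  then show ?thesis by (simp add: L2_nrm_def)
qed

subsection \<open>Young's inequality\<close>

text \<open>Write |kappa| as the product of two square roots. Cauchy-Schwarz bounds |conv|^2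
  pointwise by the mass of |kappa| times the integral of |kappa| |f|^2, and Tonelli integrates this
  in x.\<close>

lemma
  fixes f :: "real \<Rightarrow> 'a::euclidean_space"
  assumes k: "csc \<kappa>" and f: "in_L2 f"
  shows in_L2_conv: "in_L2 (conv \<kappa> f)"
    and L2_nrm_conv_le: "L2_nrm (conv \<kappa> f) \<le> (\<integral>x. \<bar>\<kappa> x\<bar> \<partial>lborel) * L2_nrm f"
proof -
  define A where "A = (\<integral>x. \<bar>\<kappa> x\<bar> \<partial>lborel)"
  have A: "A \<ge> 0" by (simp add: A_def)
  note [measurable] = csc_borel[OF k] in_L2_borel[OF f]
  have ki: "integrable lborel (\<lambda>z. \<bar>\<kappa> z\<bar>)"
    using csc_integrable[OF csc_norm[OF k]] by simp
  obtain R B where B: "B > 0" "\<And>x. norm (\<kappa> x) \<le> B * indicator {-R..R} x"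
    using csc_bounds[OF k] by metis
  have B': "\<bar>\<kappa> x\<bar> \<le> B" for x
    using B(2)[of x] B(1) by (cases "x \<in> {-R..R}") auto
  have fx: "integrable lborel (\<lambda>z. (norm (f (x - z)))\<^sup>2)" for x
    using in_L2_reflect(1)[OF f] by (rule in_L2_norm_sq)
  have kf: "integrable lborel (\<lambda>z. \<bar>\<kappa> z\<bar> * (norm (f (x - z)))\<^sup>2)" for x
    by (rule Bochner_Integration.integrable_bound[OF integrable_mult_right[OF fx[of x], of B]])
       (auto simp: abs_mult intro!: AE_I2 mult_right_mono B' order_trans[OF B' abs_ge_self])
  have pw: "(norm (conv \<kappa> f x))\<^sup>2 \<le> A * (\<integral>z. \<bar>\<kappa> z\<bar> * (norm (f (x - z)))\<^sup>2 \<partial>lborel)" for x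
  proof -
    have a: "in_L2 (\<lambda>z. sqrt \<bar>\<kappa> z\<bar>)" "in_L2 (\<lambda>z. sqrt \<bar>\<kappa> z\<bar> * norm (f (x - z)))"
      using ki kf[of x] by (auto simp: in_L2_def power_mult_distrib)
    have "norm (conv \<kappa> f x) \<le> (\<integral>z. norm (\<kappa> z *\<^sub>R f (x - z)) \<partial>lborel)"
      unfolding conv_alt by (rule integral_norm_bound)
    also have "\<dots> = (\<integral>z. sqrt \<bar>\<kappa> z\<bar> \<bullet> (sqrt \<bar>\<kappa> z\<bar> * norm (f (x - z))) \<partial>lborel)"
      by (rule Bochner_Integration.integral_cong) auto
    also have "\<dots> \<le> L2_nrm (\<lambda>z. sqrt \<bar>\<kappa> z\<bar>) * L2_nrm (\<lambda>z. sqrt \<bar>\<kappa> z\<bar> * norm (f (x - z)))"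
      using integral_inner_L2_le[OF a] by linarith
    finally have "norm (conv \<kappa> f x) \<le> L2_nrm (\<lambda>z. sqrt \<bar>\<kappa> z\<bar>) * L2_nrm (\<lambda>z. sqrt \<bar>\<kappa> z\<bar> * norm (f (x - z)))" .
    then have "(norm (conv \<kappa> f x))\<^sup>2 \<le> (L2_nrm (\<lambda>z. sqrt \<bar>\<kappa> z\<bar>) * L2_nrm (\<lambda>z. sqrt \<bar>\<kappa> z\<bar> * norm (f (x - z))))\<^sup>2"
      by (rule power_mono) auto
    then show ?thesis
      by (simp add: power_mult_distrib L2_nrm_sq A_def)
  qed
  have "(\<integral>\<^sup>+x. ennreal ((norm (conv \<kappa> f x))\<^sup>2) \<partial>lborel)
      \<le> (\<integral>\<^sup>+x. ennreal A * (\<integral>\<^sup>+z. ennreal (\<bar>\<kappa> z\<bar> * (norm (f (x - z)))\<^sup>2) \<partial>lborel) \<partial>lborel)"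
  proof (rule nn_integral_mono)
    fix x
    have "ennreal ((norm (conv \<kappa> f x))\<^sup>2) \<le> ennreal (A * (\<integral>z. \<bar>\<kappa> z\<bar> * (norm (f (x - z)))\<^sup>2 \<partial>lborel))"
      using pw by (rule ennreal_leI)
    also have "\<dots> = ennreal A * ennreal (\<integral>z. \<bar>\<kappa> z\<bar> * (norm (f (x - z)))\<^sup>2 \<partial>lborel)"
      using A by (simp add: ennreal_mult')
    also have "ennreal (\<integral>z. \<bar>\<kappa> z\<bar> * (norm (f (x - z)))\<^sup>2 \<partial>lborel)
        = (\<integral>\<^sup>+z. ennreal (\<bar>\<kappa> z\<bar> * (norm (f (x - z)))\<^sup>2) \<partial>lborel)"
      by (rule nn_integral_eq_integral[OF kf, symmetric]) auto
    finally show "ennreal ((norm (conv \<kappa> f x))\<^sup>2) \<le> ennreal A * (\<integral>\<^sup>+z. ennreal (\<bar>\<kappa> z\<bar> * (norm (f (x - z)))\<^sup>2) \<partial>lborel)" .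
  qed
  also have "\<dots> = ennreal A * (\<integral>\<^sup>+x. (\<integral>\<^sup>+z. ennreal (\<bar>\<kappa> z\<bar> * (norm (f (x - z)))\<^sup>2) \<partial>lborel) \<partial>lborel)"
    by (rule nn_integral_cmult) measurable
  also have "(\<integral>\<^sup>+x. (\<integral>\<^sup>+z. ennreal (\<bar>\<kappa> z\<bar> * (norm (f (x - z)))\<^sup>2) \<partial>lborel) \<partial>lborel)
      = (\<integral>\<^sup>+z. (\<integral>\<^sup>+x. ennreal (\<bar>\<kappa> z\<bar> * (norm (f (x - z)))\<^sup>2) \<partial>lborel) \<partial>lborel)"
    by (rule lborel_pair.Fubini'[symmetric]) measurable
  also have "\<dots> = (\<integral>\<^sup>+z. ennreal \<bar>\<kappa> z\<bar> * ennreal ((L2_nrm f)\<^sup>2) \<partial>lborel)"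
  proof (rule nn_integral_cong)
    fix z
    have "(\<integral>\<^sup>+x. ennreal (\<bar>\<kappa> z\<bar> * (norm (f (x - z)))\<^sup>2) \<partial>lborel)
        = ennreal \<bar>\<kappa> z\<bar> * (\<integral>\<^sup>+x. ennreal ((norm (f (x - z)))\<^sup>2) \<partial>lborel)"
      by (subst nn_integral_cmult[symmetric]) (auto simp: ennreal_mult')
    also have "(\<integral>\<^sup>+x. ennreal ((norm (f (x - z)))\<^sup>2) \<partial>lborel) = (\<integral>\<^sup>+x. ennreal ((norm (f x))\<^sup>2) \<partial>lborel)"
      using nn_integral_real_affine[of "\<lambda>x. ennreal ((norm (f x))\<^sup>2)" 1 "-z"] by simp
    also have "\<dots> = ennreal ((L2_nrm f)\<^sup>2)"
      unfolding L2_nrm_sq by (rule nn_integral_eq_integral[OF in_L2_norm_sq[OF f]]) auto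
    finally show "(\<integral>\<^sup>+x. ennreal (\<bar>\<kappa> z\<bar> * (norm (f (x - z)))\<^sup>2) \<partial>lborel) = ennreal \<bar>\<kappa> z\<bar> * ennreal ((L2_nrm f)\<^sup>2)" .
  qed
  also have "\<dots> = ennreal A * ennreal ((L2_nrm f)\<^sup>2)"
    unfolding A_def using ki
    by (subst nn_integral_multc) (auto simp: nn_integral_eq_integral)
  also have "ennreal A * (ennreal A * ennreal ((L2_nrm f)\<^sup>2)) = ennreal ((A * L2_nrm f)\<^sup>2)"
    using A by (simp add: ennreal_mult'[symmetric] power_mult_distrib power2_eq_square mult_ac)
  finally have le: "(\<integral>\<^sup>+x. ennreal ((norm (conv \<kappa> f x))\<^sup>2) \<partial>lborel) \<le> ennreal ((A * L2_nrm f)\<^sup>2)" .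
  have "integrable lborel (\<lambda>x. (norm (conv \<kappa> f x))\<^sup>2)"
    using le by (intro integrableI_bounded) (auto simp: top.not_eq_extremum[symmetric] top_unique)
  then show L2: "in_L2 (conv \<kappa> f)"
    by (simp add: in_L2_def)
  have "ennreal ((L2_nrm (conv \<kappa> f))\<^sup>2) \<le> ennreal ((A * L2_nrm f)\<^sup>2)"
    using le nn_integral_eq_integral[OF in_L2_norm_sq[OF L2]] by (simp add: L2_nrm_sq)
  then have "(L2_nrm (conv \<kappa> f))\<^sup>2 \<le> (A * L2_nrm f)\<^sup>2"
    by (simp add: ennreal_le_iff)
  then show "L2_nrm (conv \<kappa> f) \<le> (\<integral>x. \<bar>\<kappa> x\<bar> \<partial>lborel) * L2_nrm f"
    using A unfolding A_def by (rule_tac power2_le_imp_le) auto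
qed

text \<open>Fubini exchanges the two integrals and evenness turns \<open>\<kappa> (x - y)\<close>
  into \<open>\<kappa> (y - x)\<close>. This is how a mollifier is moved from a solution to the test
  function in a weak equation.\<close>

lemma conv_adjoint:
  fixes f :: "real \<Rightarrow> 'a::euclidean_space"
  assumes k: "csc \<kappa>" "\<And>x. \<kappa> (- x) = \<kappa> x" and e: "csc \<eta>" and f: "in_L2 f"
  shows "(\<integral>x. conv \<kappa> \<eta> x *\<^sub>R f x \<partial>lborel) = (\<integral>x. \<eta> x *\<^sub>R conv \<kappa> f x \<partial>lborel)"
proof -
  note [measurable] = csc_borel[OF k(1)] in_L2_borel[OF f] csc_borel[OF e]
  define F where "F x y = (\<kappa> (x - y) * \<eta> y) *\<^sub>R f x" for x y
  have k': "csc (\<lambda>x. \<bar>\<kappa> x\<bar>)" "csc (\<lambda>x. \<bar>\<eta> x\<bar>)"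
    using csc_norm[OF k(1)] csc_norm[OF e] by auto
  have "integrable (lborel \<Otimes>\<^sub>M lborel) (\<lambda>(x, y). F x y)"
  proof (rule lborel_pair.Fubini_integrable)
    show "(\<lambda>(x, y). F x y) \<in> borel_measurable (lborel \<Otimes>\<^sub>M lborel)"
      unfolding F_def by measurable
    have "(\<integral>y. norm (case (x, y) of (x, y) \<Rightarrow> F x y) \<partial>lborel) = conv (\<lambda>x. \<bar>\<kappa> x\<bar>) (\<lambda>x. \<bar>\<eta> x\<bar>) x \<bullet> norm (f x)" for x
      by (simp add: F_def conv_def abs_mult)
    then show "integrable lborel (\<lambda>x. \<integral>y. norm (case (x, y) of (x, y) \<Rightarrow> F x y) \<partial>lborel)"
      using integrable_inner_L2[OF in_L2_conv[OF k'(1) csc_in_L2[OF k'(2)]] in_L2_norm[OF f]] by simp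
    show "AE x in lborel. integrable lborel (\<lambda>y. case (x, y) of (x, y) \<Rightarrow> F x y)"
      using integrable_conv[OF k(1) csc_in_L2[OF e]]
      by (auto simp: F_def intro!: integrable_scaleR_left)
  qed
  from lborel_pair.Fubini_integral[OF this]
  have "(\<integral>x. (\<integral>y. F x y \<partial>lborel) \<partial>lborel) = (\<integral>y. (\<integral>x. F x y \<partial>lborel) \<partial>lborel)"
    by simp
  moreover have "(\<integral>y. F x y \<partial>lborel) = conv \<kappa> \<eta> x *\<^sub>R f x" for x
    using integrable_conv[OF k(1) csc_in_L2[OF e], of x]
    by (simp add: F_def conv_def)
  moreover have "(\<integral>x. F x y \<partial>lborel) = \<eta> y *\<^sub>R conv \<kappa> f y" for y
  proof -
    have "F x y = \<eta> y *\<^sub>R (\<kappa> (y - x) *\<^sub>R f x)" for x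
      using k(2)[of "x - y"] by (simp add: F_def)
    then have "(\<integral>x. F x y \<partial>lborel) = (\<integral>x. \<eta> y *\<^sub>R (\<kappa> (y - x) *\<^sub>R f x) \<partial>lborel)" by presburger
    then show ?thesis by (simp add: conv_def del: scaleR_scaleR)
  qed
  ultimately show ?thesis by simp
qed

lemma conv_has_vector_derivative:
  fixes f :: "real \<Rightarrow> 'a::euclidean_space"
  assumes r: "test_function \<rho>" and f: "in_L2 f"
  shows "(conv \<rho> f has_vector_derivative conv (nth_deriv 1 \<rho>) f x) (at x)"
  unfolding has_vector_derivative_within_seq
proof (intro allI impI)
  fix X assume X: "\<forall>n. X n \<in> UNIV - {x}" "X \<longlonglongrightarrow> x"
  have sm: "smooth \<rho>" using r by (simp add: test_function_def)
  note D = smooth_deriv[OF sm, of 0, unfolded nth_deriv_0]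
  obtain R where R: "R > 0" "\<And>n x. \<bar>x\<bar> > R \<Longrightarrow> nth_deriv n \<rho> x = 0"
    by (rule test_function_support[OF r]) (use that in blast)
  obtain B R1 where B: "B > 0" "\<And>x. norm (nth_deriv 1 \<rho> x) \<le> B * indicator {-R1..R1} x"
    using csc_bounds[OF test_function_csc[OF r]] by metis
  have B': "norm (nth_deriv 1 \<rho> x) \<le> B" for x
    using B(2)[of x] B(1) by (cases "x \<in> {-R1..R1}") auto
  have lip: "\<bar>\<rho> a - \<rho> b\<bar> \<le> B * \<bar>a - b\<bar>" for a b
    using field_differentiable_bound[of UNIV \<rho> "nth_deriv 1 \<rho>" B a b] D B'
    by (simp add: has_real_derivative_iff_has_vector_derivative)
  note [measurable] = csc_borel[OF test_function_csc0[OF r]] in_L2_borel[OF f] csc_borel[OF test_function_csc[OF r]]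
  have "bounded (range X)" using X(2) by (rule convergent_imp_bounded)
  then obtain M where M: "\<And>n. \<bar>X n\<bar> \<le> M"
    by (auto simp: bounded_iff)
  \<comment> \<open>The sequence \<open>X\<close> is bounded by \<open>M\<close>, so all kernels
    \<open>\<rho> (X n - y)\<close> and \<open>\<rho> (x - y)\<close> vanish for y outside this one
    interval. The Lipschitz constant \<open>B\<close> on it dominates every difference
    quotient.\<close>
  define R' where "R' = R + M + \<bar>x\<bar>"
  have out: "\<rho> (X n - y) = 0" "\<rho> (x - y) = 0" if "y \<notin> {-R'..R'}" for n y
    using R(2)[of "X n - y" 0] R(2)[of "x - y" 0] M[of n] that by (auto simp: R'_def)
  have "(\<lambda>n. (conv \<rho> f (X n) - conv \<rho> f x) /\<^sub>R (X n - x)) =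
      (\<lambda>n. \<integral>y. ((\<rho> (X n - y) - \<rho> (x - y)) /\<^sub>R (X n - x)) *\<^sub>R f y \<partial>lborel)"
  proof
    fix n
    have "(\<integral>y. ((\<rho> (X n - y) - \<rho> (x - y)) /\<^sub>R (X n - x)) *\<^sub>R f y \<partial>lborel)
       = (\<integral>y. (1 / (X n - x)) *\<^sub>R (\<rho> (X n - y) *\<^sub>R f y - \<rho> (x - y) *\<^sub>R f y) \<partial>lborel)"
      by (rule Bochner_Integration.integral_cong) (auto simp: algebra_simps divide_inverse)
    also have "\<dots> = (1 / (X n - x)) *\<^sub>R (conv \<rho> f (X n) - conv \<rho> f x)"
      using integrable_conv[OF test_function_csc0[OF r] f] by (simp add: conv_def)
    finally show "(conv \<rho> f (X n) - conv \<rho> f x) /\<^sub>R (X n - x) =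
      (\<integral>y. ((\<rho> (X n - y) - \<rho> (x - y)) /\<^sub>R (X n - x)) *\<^sub>R f y \<partial>lborel)"
      by (simp add: divide_inverse)
  qed
  also have "\<dots> \<longlonglongrightarrow> (\<integral>y. nth_deriv 1 \<rho> (x - y) *\<^sub>R f y \<partial>lborel)"
  proof (rule integral_dominated_convergence)
    show "integrable lborel (\<lambda>y. norm ((B * indicator {-R'..R'} y) *\<^sub>R f y))"
    proof -
      have "integrable lborel (\<lambda>y. norm (B *\<^sub>R (indicat_real {-R'..R'} y *\<^sub>R f y)))"
        using in_L2_set_integrable[OF f, of "-R'" R'] unfolding set_integrable_def
        by (intro integrable_norm integrable_scaleR_right)
      then show ?thesis by (simp only: scaleR_scaleR)
    qed
    show "AE y in lborel. (\<lambda>n. ((\<rho> (X n - y) - \<rho> (x - y)) /\<^sub>R (X n - x)) *\<^sub>R f y) \<longlonglongrightarrow> nth_deriv 1 \<rho> (x - y) *\<^sub>R f y"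
    proof (intro AE_I2 tendsto_scaleR tendsto_const)
      fix y
      have "((\<lambda>z. (\<rho> z - \<rho> (x - y)) /\<^sub>R (z - (x - y))) \<longlongrightarrow> nth_deriv (Suc 0) \<rho> (x - y)) (at (x - y))"
        using D[of "x - y"] unfolding has_vector_derivative_within_quotient .
      moreover have "(\<lambda>n. X n - y) \<longlonglongrightarrow> x - y" by (intro tendsto_intros X)
      ultimately have "(\<lambda>n. (\<rho> (X n - y) - \<rho> (x - y)) /\<^sub>R ((X n - y) - (x - y))) \<longlonglongrightarrow> nth_deriv (Suc 0) \<rho> (x - y)"
        using X(1) unfolding tendsto_at_iff_sequentially by (auto simp: o_def dest!: spec[of _ "\<lambda>n. X n - y"])
      then show "(\<lambda>n. (\<rho> (X n - y) - \<rho> (x - y)) /\<^sub>R (X n - x)) \<longlonglongrightarrow> nth_deriv 1 \<rho> (x - y)" by simp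
    qed
    show "AE y in lborel. norm (((\<rho> (X n - y) - \<rho> (x - y)) /\<^sub>R (X n - x)) *\<^sub>R f y) \<le> norm ((B * indicator {-R'..R'} y) *\<^sub>R f y)" for n
    proof (rule AE_I2)
      fix y
      have "\<bar>(\<rho> (X n - y) - \<rho> (x - y)) /\<^sub>R (X n - x)\<bar> \<le> B * indicator {-R'..R'} y"
      proof (cases "y \<in> {-R'..R'}")
        case True
        have "X n \<noteq> x" using X(1) by auto
        then show ?thesis using lip[of "X n - y" "x - y"] True
          by (simp add: divide_simps abs_mult mult.commute flip: divide_inverse_commute)
      qed (simp add: out)
      then show "norm (((\<rho> (X n - y) - \<rho> (x - y)) /\<^sub>R (X n - x)) *\<^sub>R f y) \<le> norm ((B * indicator {-R'..R'} y) *\<^sub>R f y)"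
        using mult_right_mono[OF _ norm_ge_zero[of "f y"]] B(1) by (simp add: abs_mult)
    qed
  qed measurable
  finally show "(\<lambda>n. (conv \<rho> f (X n) - conv \<rho> f x) /\<^sub>R (X n - x)) \<longlonglongrightarrow> conv (nth_deriv 1 \<rho>) f x"
    by (simp add: conv_def)
qed

lemma
  fixes f :: "real \<Rightarrow> 'a::euclidean_space"
  assumes r: "test_function \<rho>" and f: "in_L2 f"
  shows smooth_conv: "smooth (conv \<rho> f)"
    and nth_deriv_conv: "nth_deriv n (conv \<rho> f) = conv (nth_deriv n \<rho>) f"
proof -
  have "(conv (nth_deriv n \<rho>) f has_vector_derivative conv (nth_deriv (Suc n) \<rho>) f x) (at x)" for n x
    using conv_has_vector_derivative[OF test_function_nth_deriv[OF r] f, of n x]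
    by (simp add: nth_deriv_add[symmetric])
  from smoothI[of "\<lambda>n. conv (nth_deriv n \<rho>) f", OF this] nth_deriv_eqI[of "\<lambda>n. conv (nth_deriv n \<rho>) f", OF this]
  show "smooth (conv \<rho> f)" "nth_deriv n (conv \<rho> f) = conv (nth_deriv n \<rho>) f" by simp_all
qed

lemma test_function_conv:
  assumes r: "test_function \<rho>" and e: "csc \<eta>"
  shows "test_function (conv \<rho> \<eta>)"
proof -
  obtain R where R: "R > 0" "\<And>n x. \<bar>x\<bar> > R \<Longrightarrow> nth_deriv n \<rho> x = 0"
    by (rule test_function_support[OF r]) (use that in blast)
  obtain S where S: "\<And>x. \<bar>x\<bar> > S \<Longrightarrow> \<eta> x = 0"
    using e by (auto simp: compactly_supported_cont_def)
  have "conv \<rho> \<eta> x = 0" if "\<bar>x\<bar> > R + S" for x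
  proof -
    have "\<rho> (x - y) *\<^sub>R \<eta> y = 0" for y
      using R(2)[of "x - y" 0] S[of y] that by (cases "\<bar>y\<bar> > S") auto
    then show ?thesis unfolding conv_def by (simp only: integral_zero)
  qed
  then show ?thesis
    by (rule test_functionI[OF smooth_conv[OF r csc_in_L2[OF e]]])
qed

subsection \<open>Density and approximate identities\<close>

lemma L2_nrm_uminus: "L2_nrm (\<lambda>x. - f x) = L2_nrm f"
  by (simp add: L2_nrm_def)

lemma L2_nrm_diff_commute: "L2_nrm (\<lambda>x. f x - g x) = L2_nrm (\<lambda>x. g x - f x)"
  by (simp add: L2_nrm_def norm_minus_commute)

lemma L2_nrm_diff_triangle:
  assumes "in_L2 f" "in_L2 g" "in_L2 h"
  shows "L2_nrm (\<lambda>x. f x - h x) \<le> L2_nrm (\<lambda>x. f x - g x) + L2_nrm (\<lambda>x. g x - h x)"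
  using L2_nrm_triangle[OF in_L2_diff[OF assms(1,2)] in_L2_diff[OF assms(2,3)]] by simp

definition cutoff :: "nat \<Rightarrow> real \<Rightarrow> real" where
  "cutoff N x = max 0 (min 1 (real N + 1 - \<bar>x\<bar>))"

text \<open>Radial retraction onto the ball of radius N + 1. Being continuous, it truncates the
  values of a continuous function without making it discontinuous.\<close>

definition clip :: "nat \<Rightarrow> 'a::real_normed_vector \<Rightarrow> 'a" where
  "clip N z = z /\<^sub>R max 1 (norm z / (real N + 1))"

lemma clip_le: "norm (clip N z) \<le> real N + 1" "norm (clip N z) \<le> norm z"
proof -
  have m: "max 1 (norm z / (real N + 1)) > 0" by (simp add: less_max_iff_disj)
  have eq: "norm (clip N z) = norm z / max 1 (norm z / (real N + 1))"
    using m by (simp add: clip_def divide_inverse mult.commute)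
  have "(real N + 1) * (norm z / (real N + 1)) \<le> (real N + 1) * max 1 (norm z / (real N + 1))"
    by (intro mult_left_mono) auto
  then have "norm z \<le> (real N + 1) * max 1 (norm z / (real N + 1))"
    by simp
  then show "norm (clip N z) \<le> real N + 1"
    unfolding eq using m by (simp add: pos_divide_le_eq)
  show "norm (clip N z) \<le> norm z"
    unfolding eq using m mult_left_mono[of 1 "max 1 (norm z / (real N + 1))" "norm z"]
    by (simp add: pos_divide_le_eq)
qed

lemma continuous_clip: "continuous_on UNIV (clip N)"
proof -
  have "max 1 (norm z / (real N + 1)) \<noteq> 0" for z :: 'a
    by (smt (verit))
  then show ?thesis
    unfolding clip_def[abs_def] by (intro continuous_intros) auto
qed

lemma clip_eq: "norm z \<le> real N + 1 \<Longrightarrow> clip N z = z"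
  by (simp add: clip_def max_def)

lemma cutoff_le: "0 \<le> cutoff N x" "cutoff N x \<le> 1"
  by (auto simp: cutoff_def)

lemma cutoff_eq_0: "\<bar>x\<bar> > real N + 1 \<Longrightarrow> cutoff N x = 0"
  by (auto simp: cutoff_def)

lemma cutoff_eq_1: "\<bar>x\<bar> \<le> real N \<Longrightarrow> cutoff N x = 1"
  by (auto simp: cutoff_def)

lemma continuous_cutoff: "continuous_on UNIV (cutoff N)"
  unfolding cutoff_def[abs_def] by (intro continuous_intros)

lemma in_L2_indicator: "in_L2 (\<lambda>x. c * indicat_real {a..b} x)"
proof -
  have "integrable lborel (\<lambda>x. c\<^sup>2 * indicat_real {a..b} x)"
    by (intro integrable_mult_right integrable_real_indicator) (auto simp: emeasure_lborel_Icc_eq)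
  moreover have "(norm (c * indicat_real {a..b} x))\<^sup>2 = c\<^sup>2 * indicat_real {a..b} x" for x
    by (auto simp: indicator_def power_mult_distrib)
  ultimately show ?thesis
    unfolding in_L2_def by (simp only:) measurable
qed

text \<open>A measurable function is an almost everywhere limit of continuous ones, but without a
  majorant. Truncating both the values and the support at level N supplies one: \<open>F N\<close>
  tends to f as N grows, and for fixed N the functions \<open>G N n\<close> tend to
  \<open>F N\<close> as n grows.\<close>

lemma csc_dense_L2:
  fixes f :: "real \<Rightarrow> 'a::euclidean_space"
  assumes f: "in_L2 f" and e: "e > 0"
  obtains h where "csc h" "L2_nrm (\<lambda>x. f x - h x) < e"
proof -
  note [measurable] = in_L2_borel[OF f] borel_measurable_continuous_onI[OF continuous_cutoff]
    borel_measurable_continuous_onI[OF continuous_clip]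
  have "f \<in> borel_measurable lebesgue"
    using in_L2_borel[OF f] by (simp add: measurable_completion)
  then have "f measurable_on UNIV"
    by (intro lebesgue_measurable_imp_measurable_on) auto
  then obtain S g where S: "negligible S" and g: "\<And>n. continuous_on UNIV (g n)"
    and lim: "\<And>x. x \<notin> S \<Longrightarrow> (\<lambda>n. g n x) \<longlonglongrightarrow> f x"
    unfolding measurable_on_def by auto
  have AEg: "AE x in lborel. (\<lambda>n. g n x) \<longlonglongrightarrow> f x"
  proof -
    have "AE x in lebesgue. x \<notin> S"
      using S by (simp add: negligible_iff_null_sets AE_not_in)
    then have "AE x in lborel. x \<notin> S"
      by (simp add: AE_completion_iff)
    then show ?thesis by eventually_elim (rule lim)
  qed
  define F where "F N x = cutoff N x *\<^sub>R clip N (f x)" for N x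
  define G where "G N n x = cutoff N x *\<^sub>R clip N (g n x)" for N n x
  have Fm [measurable]: "F N \<in> borel_measurable borel" for N
    unfolding F_def[abs_def] by measurable
  have cG: "csc (G N n)" for N n
  proof -
    have "continuous_on UNIV (\<lambda>x. clip N (g n x))"
      by (rule continuous_on_compose2[OF continuous_clip g]) auto
    then have "continuous_on UNIV (G N n)"
      unfolding G_def[abs_def] by (intro continuous_on_scaleR continuous_cutoff)
    then show ?thesis
      unfolding compactly_supported_cont_def using cutoff_eq_0[of N] by (auto simp: G_def)
  qed
  have "(\<lambda>N. L2_nrm (\<lambda>x. F N x - f x)) \<longlonglongrightarrow> 0"
  proof (rule L2_dominated)
    show "AE x in lborel. (\<lambda>N. F N x) \<longlonglongrightarrow> f x"
    proof (rule AE_I2)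
      fix x
      have "\<forall>\<^sub>F N in sequentially. F N x = f x"
        using eventually_ge_at_top[of "nat \<lceil>\<bar>x\<bar> + norm (f x)\<rceil>"]
      proof eventually_elim
        case (elim N)
        then have "\<bar>x\<bar> + norm (f x) \<le> real N" by linarith
        then show ?case
        proof -
          have "\<bar>x\<bar> \<le> real N" "norm (f x) \<le> real N + 1"
            using \<open>\<bar>x\<bar> + norm (f x) \<le> real N\<close> norm_ge_zero[of "f x"] by linarith+
          then show ?thesis using cutoff_eq_1[of x N] clip_eq[of "f x" N] by (simp add: F_def)
        qed
      qed
      then show "(\<lambda>N. F N x) \<longlonglongrightarrow> f x" by (rule tendsto_eventually)
    qed
    show "in_L2 (\<lambda>x. norm (f x))" by (rule in_L2_norm[OF f])
    show "AE x in lborel. norm (F N x) \<le> norm (f x)" for N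
    proof (rule AE_I2)
      fix x show "norm (F N x) \<le> norm (f x)"
        using mult_mono[OF cutoff_le(2)[of N x] clip_le(2)[of N "f x"]] cutoff_le(1)[of N x] by (simp add: F_def)
    qed
  qed measurable
  then have "\<forall>\<^sub>F N in sequentially. L2_nrm (\<lambda>x. F N x - f x) < e / 2"
    using e by (intro order_tendstoD) auto
  then obtain N where N: "L2_nrm (\<lambda>x. F N x - f x) < e / 2"
    by (auto simp: eventually_sequentially)
  have "(\<lambda>n. L2_nrm (\<lambda>x. G N n x - F N x)) \<longlonglongrightarrow> 0"
  proof (rule L2_dominated)
    show "AE x in lborel. (\<lambda>n. G N n x) \<longlonglongrightarrow> F N x"
      using AEg
    proof eventually_elim
      case (elim x)
      have "isCont (clip N) (f x)"
        using continuous_clip continuous_on_eq_continuous_at by blast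
      then show ?case
        unfolding G_def F_def by (intro tendsto_intros isCont_tendsto_compose[of "f x" "clip N"] elim)
    qed
    show "in_L2 (\<lambda>x. (real N + 1) * indicat_real {- (real N + 1)..real N + 1} x)"
      by (rule in_L2_indicator)
    show "AE x in lborel. norm (G N n x) \<le> (real N + 1) * indicat_real {- (real N + 1)..real N + 1} x" for n
    proof (rule AE_I2)
      fix x
      show "norm (G N n x) \<le> (real N + 1) * indicat_real {- (real N + 1)..real N + 1} x"
        using mult_mono[OF cutoff_le(2)[of N x] clip_le(1)[of N "g n x"]] cutoff_le(1)[of N x] cutoff_eq_0[of N x]
        by (cases "\<bar>x\<bar> > real N + 1") (auto simp: G_def indicator_def)
    qed
  qed (auto intro: csc_borel[OF cG])
  then have "\<forall>\<^sub>F n in sequentially. L2_nrm (\<lambda>x. G N n x - F N x) < e / 2"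
    using e by (intro order_tendstoD) auto
  then obtain n where n: "L2_nrm (\<lambda>x. G N n x - F N x) < e / 2"
    by (auto simp: eventually_sequentially)
  have FL: "in_L2 (F N)"
  proof (rule in_L2_cmult_bound[of f _ 1])
    fix x show "norm (F N x) \<le> 1 * norm (f x)"
      using mult_mono[OF cutoff_le(2)[of N x] clip_le(2)[of N "f x"]] cutoff_le(1)[of N x] by (simp add: F_def)
  qed (use f in auto)
  have "L2_nrm (\<lambda>x. f x - G N n x) \<le> L2_nrm (\<lambda>x. f x - F N x) + L2_nrm (\<lambda>x. F N x - G N n x)"
    by (rule L2_nrm_diff_triangle[OF f FL csc_in_L2[OF cG]])
  also have "\<dots> < e"
    using N n L2_nrm_diff_commute[of f "F N"] L2_nrm_diff_commute[of "F N" "G N n"] by linarith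
  finally show ?thesis using that cG by blast
qed

lemma exists_mollifier:
  "\<exists>m :: nat \<Rightarrow> real \<Rightarrow> real. \<forall>n. test_function (m n) \<and> (\<forall>x. m n x \<ge> 0) \<and> (\<forall>x. m n (- x) = m n x)
     \<and> (\<forall>x. \<bar>x\<bar> > 1 / (real n + 1) \<longrightarrow> m n x = 0) \<and> (\<integral>x. m n x \<partial>lborel) = 1"
proof -
  obtain \<rho> :: "real \<Rightarrow> real" where r: "test_function \<rho>" "\<And>x. \<rho> x \<ge> 0" "\<And>x. \<rho> (- x) = \<rho> x"
    "\<And>x. \<bar>x\<bar> > 1 \<Longrightarrow> \<rho> x = 0" "\<rho> 0 > 0"
    using exists_bump by metis
  have ri: "integrable lborel \<rho>" by (rule csc_integrable[OF test_function_csc0[OF r(1)]])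
  define I where "I = (\<integral>x. \<rho> x \<partial>lborel)"
  \<comment> \<open>With integral 0 the nonnegative bump would vanish almost everywhere, yet it is
    positive on a nonempty open set.\<close>
  have "I \<noteq> 0"
  proof
    assume "I = 0"
    then have ae: "AE x in lborel. \<rho> x = 0"
      using integral_nonneg_eq_0_iff_AE[OF ri] r(2) by (auto simp: I_def)
    have op: "open {x. \<rho> x > 0}"
      using csc_cont[OF test_function_csc0[OF r(1)]] by (intro open_Collect_less continuous_intros)
    moreover have "{x. \<rho> x > 0} \<noteq> {}" using r(5) by auto
    ultimately have "\<not> negligible {x. \<rho> x > 0}" by (rule open_not_negligible)
    moreover have "{x. \<rho> x > 0} \<in> null_sets lborel"
      using ae op by (subst AE_iff_null_sets) (auto elim: eventually_mono)
    then have "{x. \<rho> x > 0} \<in> null_sets lebesgue" by (rule null_sets_completionI)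
    ultimately show False by (simp add: negligible_iff_null_sets)
  qed
  moreover have "I \<ge> 0" unfolding I_def by (rule integral_nonneg_AE) (simp add: r)
  ultimately have I: "I > 0" by simp
  define m where "m n x = ((real n + 1) / I) *\<^sub>R \<rho> ((real n + 1) * x + 0)" for n x
  have "test_function (m n)" for n
    unfolding m_def[abs_def] by (rule test_function_affine[OF r(1)]) auto
  moreover have "m n x \<ge> 0" for n x using r(2) I by (simp add: m_def)
  moreover have "m n (- x) = m n x" for n x using r(3)[of "(real n + 1) * x"] by (simp add: m_def)
  moreover have "m n x = 0" if "\<bar>x\<bar> > 1 / (real n + 1)" for n x
  proof -
    have "\<bar>(real n + 1) * x + 0\<bar> > 1" using that by (simp add: field_simps abs_mult)
    then show ?thesis using r(4) by (simp add: m_def)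
  qed
  moreover have "(\<integral>x. m n x \<partial>lborel) = 1" for n
  proof -
    have "(\<integral>x. m n x \<partial>lborel) = (real n + 1) / I * (\<integral>x. \<rho> (0 + (real n + 1) * x) \<partial>lborel)"
      by (simp add: m_def)
    also have "\<dots> = 1"
    proof -
      have "I = (real n + 1) * (\<integral>x. \<rho> (0 + (real n + 1) * x) \<partial>lborel)"
        using lborel_integral_real_affine[of "real n + 1" \<rho> 0] by (simp add: I_def)
      then show ?thesis using I by (simp add: field_simps)
    qed
    finally show ?thesis .
  qed
  ultimately show ?thesis by blast
qed

definition moll :: "nat \<Rightarrow> real \<Rightarrow> real" where
  "moll = (SOME m. \<forall>n. test_function (m n) \<and> (\<forall>x. m n x \<ge> 0) \<and> (\<forall>x. m n (- x) = m n x)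
     \<and> (\<forall>x. \<bar>x\<bar> > 1 / (real n + 1) \<longrightarrow> m n x = 0) \<and> (\<integral>x. m n x \<partial>lborel) = 1)"

lemma test_function_moll: "test_function (moll n)"
  and moll_nonneg: "moll n x \<ge> 0"
  and moll_even: "moll n (- x) = moll n x"
  and moll_eq_0: "\<bar>x\<bar> > 1 / (real n + 1) \<Longrightarrow> moll n x = 0"
  and integral_moll: "(\<integral>x. moll n x \<partial>lborel) = 1"
  using someI_ex[OF exists_mollifier] unfolding moll_def[symmetric] by blast+

lemma csc_moll: "csc (moll n)"
  by (rule test_function_csc0[OF test_function_moll])

lemma integral_abs_moll: "(\<integral>x. \<bar>moll n x\<bar> \<partial>lborel) = 1"
  using integral_moll[of n] moll_nonneg[of n] by simp

lemma L2_nrm_conv_moll_le: "in_L2 f \<Longrightarrow> L2_nrm (conv (moll n) f) \<le> L2_nrm f"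
  using L2_nrm_conv_le[OF csc_moll[of n], of f] by (simp only: integral_abs_moll mult_1)

lemma conv_moll_csc_tendsto:
  fixes h :: "real \<Rightarrow> 'a::euclidean_space"
  assumes h: "csc h"
  shows "(\<lambda>n. L2_nrm (\<lambda>x. conv (moll n) h x - h x)) \<longlonglongrightarrow> 0"
proof -
  obtain R B where B: "R > 0" "B > 0" "\<And>x. norm (h x) \<le> B * indicator {-R..R} x"
    using csc_bounds[OF h] by metis
  have B': "norm (h x) \<le> B" for x
    using B(3)[of x] B(2) by (cases "x \<in> {-R..R}") auto
  have diff: "conv (moll n) h x - c = (\<integral>z. moll n z *\<^sub>R (h (x - z) - c) \<partial>lborel)" for n x c
  proof -
    have "integrable lborel (\<lambda>z. moll n z *\<^sub>R h (x - z))"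
      by (intro integrable_L2_scaleR csc_in_L2 csc_moll in_L2_reflect h)
    moreover have "integrable lborel (\<lambda>z. moll n z *\<^sub>R c)"
      by (rule integrable_scaleR_left) (rule csc_integrable[OF csc_moll])
    moreover have "(\<integral>z. moll n z *\<^sub>R c \<partial>lborel) = c"
      using csc_integrable[OF csc_moll] integral_moll[of n] by (simp)
    ultimately show ?thesis by (simp add: conv_alt scaleR_diff_right)
  qed
  \<comment> \<open>Used twice: with c = h x for the pointwise limit, and with c = 0 for the
    majorant, where the support grows by at most 1.\<close>
  have bd: "norm (conv (moll n) h x - c) \<le> d"
    if "\<And>z. \<bar>z\<bar> \<le> 1 / (real n + 1) \<Longrightarrow> norm (h (x - z) - c) \<le> d" for n x c d
  proof -
    have "norm (conv (moll n) h x - c) \<le> (\<integral>z. moll n z * d \<partial>lborel)"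
      unfolding diff
    proof (rule Bochner_Integration.integral_norm_bound_integral)
      have "integrable lborel (\<lambda>z. moll n z *\<^sub>R h (x - z))"
        by (intro integrable_L2_scaleR csc_in_L2 csc_moll in_L2_reflect h)
      moreover have "integrable lborel (\<lambda>z. moll n z *\<^sub>R c)"
        by (rule integrable_scaleR_left) (rule csc_integrable[OF csc_moll])
      ultimately show "integrable lborel (\<lambda>z. moll n z *\<^sub>R (h (x - z) - c))"
        by (simp add: scaleR_diff_right)
      show "integrable lborel (\<lambda>z. moll n z * d)"
        by (rule integrable_mult_left) (rule csc_integrable[OF csc_moll])
      show "norm (moll n z *\<^sub>R (h (x - z) - c)) \<le> moll n z * d" for z
      proof (cases "\<bar>z\<bar> \<le> 1 / (real n + 1)")
        case True
        then show ?thesis using that[OF True] moll_nonneg[of n z] by (simp add: mult_left_mono)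
      next
        case False
        then show ?thesis using moll_eq_0[where n=n and x = z] by simp
      qed
    qed
    then show ?thesis by (simp add: integral_moll)
  qed
  show ?thesis
  proof (rule L2_dominated[where w = "\<lambda>x. B * indicat_real {- (R + 1)..R + 1} x"])
    show "conv (moll n) h \<in> borel_measurable borel" for n
      by (rule conv_measurable[OF csc_borel[OF csc_moll] csc_borel[OF h]])
    show "h \<in> borel_measurable borel" by (rule csc_borel[OF h])
    show "AE x in lborel. (\<lambda>n. conv (moll n) h x) \<longlonglongrightarrow> h x"
    proof (rule AE_I2)
      fix x
      show "(\<lambda>n. conv (moll n) h x) \<longlonglongrightarrow> h x"
      proof (rule LIMSEQ_I)
        fix r :: real assume r: "r > 0"
        have "isCont h x" using csc_cont[OF h] continuous_on_eq_continuous_at by blast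
        then obtain d where d: "d > 0" "\<And>y. dist y x < d \<Longrightarrow> dist (h y) (h x) < r / 2"
          using r unfolding continuous_at_eps_delta by (metis half_gt_zero)
        obtain N :: nat where N: "1 / (real N + 1) < d"
          using reals_Archimedean[OF d(1)] by (auto simp: inverse_eq_divide add.commute)
        have "norm (conv (moll n) h x - h x) < r" if "n \<ge> N" for n
        proof -
          have "1 / (real n + 1) \<le> 1 / (real N + 1)" using that by (intro divide_left_mono) auto
          then have "norm (conv (moll n) h x - h x) \<le> r / 2"
          proof (intro bd)
            fix z assume "\<bar>z\<bar> \<le> 1 / (real n + 1)"
            then have "dist (x - z) x < d"
              using N \<open>1 / (real n + 1) \<le> 1 / (real N + 1)\<close> by (simp add: dist_norm)
            then show "norm (h (x - z) - h x) \<le> r / 2"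
              using d(2)[of "x - z"] by (simp add: dist_norm)
          qed
          then show ?thesis using r by simp
        qed
        then show "\<exists>no. \<forall>n\<ge>no. norm (conv (moll n) h x - h x) < r" by blast
      qed
    qed
    show "in_L2 (\<lambda>x. B * indicat_real {- (R + 1)..R + 1} x)"
      by (rule in_L2_indicator)
    show "AE x in lborel. norm (conv (moll n) h x) \<le> B * indicat_real {- (R + 1)..R + 1} x" for n
    proof (rule AE_I2)
      fix x
      have le1: "1 / (real n + 1) \<le> 1" by simp
      have "norm (conv (moll n) h x - 0) \<le> B * indicat_real {- (R + 1)..R + 1} x"
      proof (rule bd)
        fix z :: real assume "\<bar>z\<bar> \<le> 1 / (real n + 1)"
        then have z: "\<bar>z\<bar> \<le> 1" using le1 by linarith
        show "norm (h (x - z) - 0) \<le> B * indicat_real {- (R + 1)..R + 1} x"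
        proof (cases "x - z \<in> {-R..R}")
          case True
          then have "x \<in> {- (R + 1)..R + 1}" using z by auto
          then show ?thesis using B' by simp
        next
          case False
          then show ?thesis using B(2) B(3)[of "x - z"] by simp
        qed
      qed
      then show "norm (conv (moll n) h x) \<le> B * indicat_real {- (R + 1)..R + 1} x" by simp
    qed
  qed
qed

text \<open>Approximate f by a compactly supported continuous function; mollification is an L2
  contraction for every n, so the approximation error stays small uniformly in n.\<close>

lemma conv_moll_tendsto:
  fixes f :: "real \<Rightarrow> 'a::euclidean_space"
  assumes f: "in_L2 f"
  shows "(\<lambda>n. L2_nrm (\<lambda>x. conv (moll n) f x - f x)) \<longlonglongrightarrow> 0"
proof (rule LIMSEQ_I)
  fix r :: real assume r: "r > 0"
  obtain h where h: "csc h" "L2_nrm (\<lambda>x. f x - h x) < r / 3"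
    using csc_dense_L2[OF f, of "r / 3"] r by auto
  have "\<forall>\<^sub>F n in sequentially. L2_nrm (\<lambda>x. conv (moll n) h x - h x) < r / 3"
    using r by (intro order_tendstoD(2)[OF conv_moll_csc_tendsto[OF h(1)]]) auto
  then obtain N where N: "\<And>n. n \<ge> N \<Longrightarrow> L2_nrm (\<lambda>x. conv (moll n) h x - h x) < r / 3"
    by (auto simp: eventually_sequentially)
  have "norm (L2_nrm (\<lambda>x. conv (moll n) f x - f x) - 0) < r" if "n \<ge> N" for n
  proof -
    note L = f csc_in_L2[OF h(1)] in_L2_conv[OF csc_moll f] in_L2_conv[OF csc_moll csc_in_L2[OF h(1)]]
    have "L2_nrm (\<lambda>x. conv (moll n) f x - conv (moll n) h x) = L2_nrm (conv (moll n) (\<lambda>x. f x - h x))"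
      using conv_diff[OF csc_moll L(1,2)] by presburger
    also have "\<dots> < r / 3"
      using L2_nrm_conv_moll_le[OF in_L2_diff[OF L(1,2)], of n] h(2) by linarith
    finally have "L2_nrm (\<lambda>x. conv (moll n) f x - conv (moll n) h x) < r / 3" .
    moreover have "L2_nrm (\<lambda>x. h x - f x) < r / 3" using h(2) L2_nrm_diff_commute[of f h] by simp
    moreover note N[OF that] L2_nrm_diff_triangle[OF L(3,4,1), of n n] L2_nrm_diff_triangle[OF L(4,2,1), of n]
    ultimately have "L2_nrm (\<lambda>x. conv (moll n) f x - f x) < r" by linarith
    then show ?thesis by simp
  qed
  then show "\<exists>no. \<forall>n\<ge>no. norm (L2_nrm (\<lambda>x. conv (moll n) f x - f x) - 0) < r" by blast
qed

lemma to_l2_conv_moll_tendsto: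
  assumes f: "in_L2 f"
  shows "(\<lambda>n. to_l2 (conv (moll n) f)) \<longlonglongrightarrow> to_l2 f"
proof -
  have "norm (to_l2 (conv (moll n) f) - to_l2 f) = L2_nrm (\<lambda>x. conv (moll n) f x - f x)" for n
    using f by (simp add: to_l2_diff in_L2_conv csc_moll norm_to_l2 in_L2_diff)
  then have "(\<lambda>n. norm (to_l2 (conv (moll n) f) - to_l2 f)) \<longlonglongrightarrow> 0"
    using conv_moll_tendsto[OF f] by presburger
  then show ?thesis
    by (rule LIM_zero_cancel[OF tendsto_norm_zero_cancel])
qed

text \<open>Test functions are real valued, hence the complex approximant is assembled from the
  mollified real and imaginary parts of a continuous one.\<close>

lemma test_functions_dense:
  fixes u :: "complex l2"
  assumes "e > 0"
  obtains \<eta> \<zeta> where "test_function \<eta>" "test_function \<zeta>"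
    "norm (u - to_l2 (\<lambda>x. complex_of_real (\<eta> x) + \<i> * complex_of_real (\<zeta> x))) < e"
proof -
  obtain f where f: "in_L2 f" "u = to_l2 f" by (rule to_l2_cases)
  obtain h where h: "csc h" "L2_nrm (\<lambda>x. f x - h x) < e / 2"
    using csc_dense_L2[OF f(1), of "e / 2"] assms by auto
  have "\<forall>\<^sub>F n in sequentially. L2_nrm (\<lambda>x. conv (moll n) h x - h x) < e / 2"
    using assms by (intro order_tendstoD(2)[OF conv_moll_csc_tendsto[OF h(1)]]) auto
  then obtain n where n: "L2_nrm (\<lambda>x. conv (moll n) h x - h x) < e / 2"
    by (auto simp: eventually_sequentially)
  have c: "csc (\<lambda>x. Re (h x))" "csc (\<lambda>x. Im (h x))"
    using h(1) unfolding compactly_supported_cont_def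
    by (auto intro!: continuous_intros) (metis zero_complex.simps)+
  note hL = csc_in_L2[OF h(1)]
  have eq: "complex_of_real (conv (moll n) (\<lambda>x. Re (h x)) x) + \<i> * complex_of_real (conv (moll n) (\<lambda>x. Im (h x)) x)
      = conv (moll n) h x" for x
    using conv_bounded_linear[OF bounded_linear_Re csc_moll hL] conv_bounded_linear[OF bounded_linear_Im csc_moll hL]
    by (simp add: complex_eq_iff)
  have "L2_nrm (\<lambda>x. f x - conv (moll n) h x) < e"
    using L2_nrm_diff_triangle[OF f(1) hL in_L2_conv[OF csc_moll hL, of n]] h(2) n
    unfolding L2_nrm_diff_commute[of h "conv (moll n) h"] by linarith
  then have "norm (u - to_l2 (conv (moll n) h)) < e"
    unfolding f(2) to_l2_diff[OF f(1) in_L2_conv[OF csc_moll hL]]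
      norm_to_l2[OF in_L2_diff[OF f(1) in_L2_conv[OF csc_moll hL]]] .
  then show ?thesis
    using that[OF test_function_conv[OF test_function_moll c(1), of n] test_function_conv[OF test_function_moll c(2), of n]]
    by (simp add: eq)
qed

lemma test_function_reflect:
  assumes "test_function \<eta>"
  shows "test_function (\<lambda>y. \<eta> (x - y))"
    and "nth_deriv n (\<lambda>y. \<eta> (x - y)) = (\<lambda>y. (- 1) ^ n * nth_deriv n \<eta> (x - y))"
  using test_function_affine[OF assms, of "-1" 1 x] smooth_affine(2)[of \<eta> n 1 "-1" x] assms
  by (simp_all add: test_function_def)

text \<open>The reflected mollifier is a test function, so all mollifications of f vanish
  identically, and they converge to f in L2.\<close>

lemma test_integral_zero_imp_AE_zero:
  fixes f :: "real \<Rightarrow> 'a::euclidean_space"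
  assumes f: "in_L2 f" and z: "\<And>\<eta>. test_function \<eta> \<Longrightarrow> (\<integral>x. \<eta> x *\<^sub>R f x \<partial>lborel) = 0"
  shows "AE x in lborel. f x = 0"
proof -
  have "conv (moll n) f x = 0" for n x
    unfolding conv_def by (rule z[OF test_function_reflect(1)[OF test_function_moll]])
  then have "L2_nrm (\<lambda>x. - f x) = 0"
    using conv_moll_tendsto[OF f] by (simp add: LIMSEQ_const_iff)
  then show ?thesis
    using L2_nrm_eq_0_iff[OF f] by (simp add: L2_nrm_uminus)
qed

section \<open>Absolutely continuous functions and weak derivatives\<close>

text \<open>If the property failed at one point it would fail on a nonempty open set, which is not a
  null set.\<close>

lemma AE_lborel_closed:
  fixes P :: "real \<Rightarrow> bool"
  assumes "AE x in lborel. P x" "closed {x. P x}"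
  shows "P x"
proof (rule ccontr)
  assume "\<not> P x"
  have op: "open {x. \<not> P x}"
    using assms(2) by (simp add: closed_def Collect_neg_eq)
  have "\<not> negligible {x. \<not> P x}"
    using open_not_negligible[OF op] \<open>\<not> P x\<close> by blast
  moreover have "{x. \<not> P x} \<in> null_sets lborel"
    using assms(1) op by (subst AE_iff_null_sets) (auto elim: eventually_mono)
  then have "{x. \<not> P x} \<in> null_sets lebesgue" by (rule null_sets_completionI)
  ultimately show False by (simp add: negligible_iff_null_sets)
qed

lemma AE_lborel_ex:
  fixes P :: "real \<Rightarrow> bool"
  assumes "AE x in lborel. P x" shows "\<exists>x. P x"
  using AE_lborel_closed[of "\<lambda>_. False" 0] assms by (cases "\<exists>x. P x") auto

lemma AE_eq_continuous:
  fixes f g :: "real \<Rightarrow> 'a::t2_space"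
  assumes "AE x in lborel. f x = g x" "continuous_on UNIV f" "continuous_on UNIV g"
  shows "f = g"
  using AE_lborel_closed[OF assms(1)] closed_Collect_eq[OF assms(2,3)] by auto

lemma AE_norm_le_continuous:
  fixes f :: "real \<Rightarrow> 'a::real_normed_vector"
  assumes "AE x in lborel. norm (f x) \<le> c" "continuous_on UNIV f"
  shows "norm (f x) \<le> c"
  by (rule AE_lborel_closed[OF assms(1)]) (intro closed_Collect_le continuous_intros assms(2))

text \<open>Local absolute continuity in integral form. It fixes f at every point while g matters
  only almost everywhere, and no differentiability of f almost everywhere has to be
  discussed.\<close>

definition ac_deriv :: "(real \<Rightarrow> 'a::euclidean_space) \<Rightarrow> (real \<Rightarrow> 'a) \<Rightarrow> bool" where
  "ac_deriv f g \<longleftrightarrow> continuous_on UNIV f \<and> (\<forall>a b. set_integrable lborel {a..b} g) \<and>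
     (\<forall>a b. a \<le> b \<longrightarrow> f b - f a = (LINT x:{a..b}|lborel. g x))"

lemma set_integral_L2_le:
  fixes h :: "real \<Rightarrow> 'a::euclidean_space"
  assumes h: "in_L2 h" and ab: "a \<le> b"
  shows "norm (LINT x:{a..b}|lborel. h x) \<le> sqrt (b - a) * L2_nrm h"
proof -
  have i: "in_L2 (indicat_real {a..b})" using in_L2_indicator[of 1 a b] by simp
  have "norm (LINT x:{a..b}|lborel. h x) \<le> (\<integral>x. norm (indicat_real {a..b} x *\<^sub>R h x) \<partial>lborel)"
    unfolding set_lebesgue_integral_def by (rule integral_norm_bound)
  also have "\<dots> = (\<integral>x. indicat_real {a..b} x \<bullet> norm (h x) \<partial>lborel)"
    by simp
  also have "\<dots> \<le> L2_nrm (indicat_real {a..b}) * L2_nrm (\<lambda>x. norm (h x))"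
    using integral_inner_L2_le[OF i in_L2_norm[OF h]] by linarith
  also have "L2_nrm (indicat_real {a..b}) = sqrt (b - a)"
  proof -
    have "(\<lambda>x. (norm (indicat_real {a..b} x))\<^sup>2) = indicat_real {a..b}"
      by (auto simp: indicator_def)
    then show ?thesis using ab by (simp add: L2_nrm_def)
  qed
  finally show ?thesis by (simp add: L2_nrm_norm)
qed

text \<open>Continuity comes for free: by Cauchy-Schwarz the increments are bounded by the square
  root of the distance.\<close>

lemma ac_derivI_L2:
  fixes f g :: "real \<Rightarrow> 'a::euclidean_space"
  assumes g: "in_L2 g" and fg: "\<And>a b. a \<le> b \<Longrightarrow> f b - f a = (LINT x:{a..b}|lborel. g x)"
  shows "ac_deriv f g"
proof -
  have "isCont f x" for x
  proof -
    have b: "norm (f y - f x) \<le> sqrt \<bar>y - x\<bar> * L2_nrm g" for y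
      using set_integral_L2_le[OF g, of x y] set_integral_L2_le[OF g, of y x] fg[of x y] fg[of y x]
      by (cases "x \<le> y") (auto simp: norm_minus_commute)
    have "((\<lambda>y. sqrt \<bar>y - x\<bar> * L2_nrm g) \<longlongrightarrow> sqrt \<bar>x - x\<bar> * L2_nrm g) (at x)"
      by (intro tendsto_intros)
    then have "((\<lambda>y. sqrt \<bar>y - x\<bar> * L2_nrm g) \<longlongrightarrow> 0) (at x)" by simp
    then have "((\<lambda>y. f y - f x) \<longlongrightarrow> 0) (at x)"
      by (rule Lim_null_comparison[OF always_eventually, rotated]) (use b in auto)
    then show ?thesis
      unfolding isCont_def by (rule LIM_zero_cancel)
  qed
  then show ?thesis
    using fg in_L2_set_integrable[OF g] by (auto simp: ac_deriv_def intro: continuous_at_imp_continuous_on)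
qed

lemma ac_deriv_C1:
  fixes f g :: "real \<Rightarrow> 'a::euclidean_space"
  assumes "\<And>x. (f has_vector_derivative g x) (at x)" "continuous_on UNIV g"
  shows "ac_deriv f g"
  unfolding ac_deriv_def
proof (intro conjI allI impI)
  show "continuous_on UNIV f"
    by (intro continuous_at_imp_continuous_on ballI has_vector_derivative_continuous[OF assms(1)])
  show "set_integrable lborel {a..b} g" for a b
    by (rule borel_integrable_atLeastAtMost') (rule continuous_on_subset[OF assms(2)], simp)
  fix a b :: real assume "a \<le> b"
  then show "f b - f a = (LINT x:{a..b}|lborel. g x)"
    unfolding set_lebesgue_integral_def
    by (intro integral_FTC_Icc[symmetric])
       (auto intro: has_vector_derivative_at_within assms continuous_on_subset[OF assms(2)])
qed

lemma ac_deriv_differentiable: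
  fixes f g :: "real \<Rightarrow> 'a::euclidean_space"
  assumes fg: "ac_deriv f g" and g: "continuous_on UNIV g"
  shows "(f has_vector_derivative g x) (at x)"
proof -
  have c: "continuous_on {x - 1..x + 1} g" by (rule continuous_on_subset[OF g]) simp
  have "((\<lambda>u. integral {x - 1..u} g) has_vector_derivative g x) (at x within {x - 1..x + 1})"
    by (rule integral_has_vector_derivative[OF c]) simp
  then have "((\<lambda>u. f (x - 1) + integral {x - 1..u} g) has_vector_derivative g x) (at x within {x - 1..x + 1})"
    by (auto intro!: derivative_eq_intros)
  then have "(f has_vector_derivative g x) (at x within {x - 1..x + 1})"
  proof (rule has_vector_derivative_transform[rotated 2])
    fix u assume u: "u \<in> {x - 1..x + 1}"
    then have "f u - f (x - 1) = (LINT x:{x - 1..u}|lborel. g x)"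
      using fg by (simp add: ac_deriv_def)
    also have "\<dots> = integral {x - 1..u} g"
      using fg by (intro set_borel_integral_eq_integral) (simp add: ac_deriv_def)
    finally show "f u = f (x - 1) + integral {x - 1..u} g" by (simp add: algebra_simps)
  qed simp
  then show ?thesis
    by (simp add: at_within_Icc_at)
qed

lemma integrable_pair_bilinear:
  fixes F :: "real \<Rightarrow> 'a::euclidean_space" and G :: "real \<Rightarrow> 'b::euclidean_space"
    and prod :: "'a \<Rightarrow> 'b \<Rightarrow> 'c::euclidean_space"
  assumes p: "bounded_bilinear prod" and F: "integrable lborel F" and G: "integrable lborel G"
    and S: "S \<in> sets (lborel \<Otimes>\<^sub>M lborel)"
  shows "integrable (lborel \<Otimes>\<^sub>M lborel) (\<lambda>(x, y). indicat_real S (x, y) *\<^sub>R prod (F x) (G y))"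
proof -
  have [measurable]: "F \<in> borel_measurable borel" "G \<in> borel_measurable borel"
    using F G by auto
  note S [measurable]
  obtain K where K: "K > 0" "\<And>a b. norm (prod a b) \<le> norm a * norm b * K"
    using bounded_bilinear.pos_bounded[OF p] by auto
  have cont: "continuous_on UNIV (\<lambda>x. prod (fst x) (snd x))"
    by (intro bounded_bilinear.continuous_on[OF p] continuous_intros)
  have 1: "integrable (lborel \<Otimes>\<^sub>M lborel) (\<lambda>(x, y). norm (F x) * norm (G y) * K)"
  proof (rule lborel_pair.Fubini_integrable)
    show "(\<lambda>(x, y). norm (F x) * norm (G y) * K) \<in> borel_measurable (lborel \<Otimes>\<^sub>M lborel)" by measurable
    show "integrable lborel (\<lambda>x. \<integral>y. norm (case (x, y) of (x, y) \<Rightarrow> norm (F x) * norm (G y) * K) \<partial>lborel)"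
      using F K(1) by (simp add: abs_mult)
    show "AE x in lborel. integrable lborel (\<lambda>y. case (x, y) of (x, y) \<Rightarrow> norm (F x) * norm (G y) * K)"
      using G by simp
  qed
  show ?thesis
  proof (rule Bochner_Integration.integrable_bound[OF 1])
    have "(\<lambda>z. prod (F (fst z)) (G (snd z))) \<in> borel_measurable (lborel \<Otimes>\<^sub>M lborel)"
      by (rule borel_measurable_continuous_Pair[OF _ _ cont]) measurable
    then show "(\<lambda>(x, y). indicat_real S (x, y) *\<^sub>R prod (F x) (G y)) \<in> borel_measurable (lborel \<Otimes>\<^sub>M lborel)"
      by (simp add: case_prod_beta')
    show "AE z in lborel \<Otimes>\<^sub>M lborel. norm (case z of (x, y) \<Rightarrow> indicat_real S (x, y) *\<^sub>R prod (F x) (G y))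
        \<le> norm (case z of (x, y) \<Rightarrow> norm (F x) * norm (G y) * K)"
      using K by (intro AE_I2) (auto simp: indicator_def abs_mult)
  qed
qed

text \<open>Both sides of the product rule are iterated integrals over a triangle.\<close>

lemma ac_deriv_bilinear:
  fixes f f' :: "real \<Rightarrow> 'a::euclidean_space" and g g' :: "real \<Rightarrow> 'b::euclidean_space"
    and prod :: "'a \<Rightarrow> 'b \<Rightarrow> 'c::euclidean_space"
  assumes p: "bounded_bilinear prod" and f: "ac_deriv f f'" and g: "ac_deriv g g'"
  shows "ac_deriv (\<lambda>x. prod (f x) (g x)) (\<lambda>x. prod (f' x) (g x) + prod (f x) (g' x))"
proof -
  note bl = bounded_bilinear.bounded_linear_left[OF p] bounded_bilinear.bounded_linear_right[OF p]
  note simps = bounded_bilinear.diff_left[OF p] bounded_bilinear.diff_right[OF p]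
    bounded_bilinear.scaleR_left[OF p] bounded_bilinear.scaleR_right[OF p]
    bounded_bilinear.zero_left[OF p] bounded_bilinear.zero_right[OF p]
  have main: "set_integrable lborel {a..b} (\<lambda>x. prod (f' x) (g x) + prod (f x) (g' x)) \<and>
      prod (f b) (g b) - prod (f a) (g a) = (LINT x:{a..b}|lborel. prod (f' x) (g x) + prod (f x) (g' x))"
    if ab: "a \<le> b" for a b
  proof -
    define F where "F x = indicat_real {a..b} x *\<^sub>R f' x" for x
    define G where "G x = indicat_real {a..b} x *\<^sub>R g' x" for x
    have FG: "integrable lborel F" "integrable lborel G"
      using f g by (simp_all add: ac_deriv_def F_def[abs_def] G_def[abs_def] set_integrable_def)
    define S where "S = {z::real \<times> real. snd z \<le> fst z}"
    have S: "S \<in> sets (lborel \<Otimes>\<^sub>M lborel)"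
    proof -
      have "{z \<in> space (lborel \<Otimes>\<^sub>M lborel). snd z \<le> (fst z::real)} \<in> sets (lborel \<Otimes>\<^sub>M lborel)"
        by measurable
      then show ?thesis by (simp add: S_def space_pair_measure)
    qed
    define h where "h x y = indicat_real S (x, y) *\<^sub>R prod (F x) (G y)" for x y
    have hi: "integrable (lborel \<Otimes>\<^sub>M lborel) (\<lambda>(x, y). h x y)"
      using integrable_pair_bilinear[OF p FG S] by (simp add: h_def)
    have hy: "(\<integral>y. h x y \<partial>lborel) = prod (F x) (g x - g a)" for x
    proof (cases "x \<in> {a..b}")
      case True
      have "h x y = prod (F x) (indicat_real {a..x} y *\<^sub>R g' y)" for y
        using True by (auto simp: h_def S_def G_def indicator_def simps)
      then have "(\<integral>y. h x y \<partial>lborel) = (\<integral>y. prod (F x) (indicat_real {a..x} y *\<^sub>R g' y) \<partial>lborel)"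
        by presburger
      also have "\<dots> = prod (F x) (\<integral>y. indicat_real {a..x} y *\<^sub>R g' y \<partial>lborel)"
        using g by (intro integral_bounded_linear[OF bl(2)]) (simp add: ac_deriv_def set_integrable_def)
      also have "(\<integral>y. indicat_real {a..x} y *\<^sub>R g' y \<partial>lborel) = g x - g a"
        using g True by (simp add: ac_deriv_def set_lebesgue_integral_def)
      finally show ?thesis .
    qed (simp add: h_def F_def simps)
    have hx: "(\<integral>x. h x y \<partial>lborel) = prod (f b - f y) (G y)" for y
    proof (cases "y \<in> {a..b}")
      case True
      have "h x y = prod (indicat_real {y..b} x *\<^sub>R f' x) (G y)" for x
        using True by (auto simp: h_def S_def F_def indicator_def simps)
      then have "(\<integral>x. h x y \<partial>lborel) = (\<integral>x. prod (indicat_real {y..b} x *\<^sub>R f' x) (G y) \<partial>lborel)"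
        by presburger
      also have "\<dots> = prod (\<integral>x. indicat_real {y..b} x *\<^sub>R f' x \<partial>lborel) (G y)"
        using f by (intro integral_bounded_linear[OF bl(1)]) (simp add: ac_deriv_def set_integrable_def)
      also have "(\<integral>x. indicat_real {y..b} x *\<^sub>R f' x \<partial>lborel) = f b - f y"
        using f True by (simp add: ac_deriv_def set_lebesgue_integral_def)
      finally show ?thesis .
    qed (simp add: h_def G_def simps)
    have eq: "(\<integral>x. prod (F x) (g x - g a) \<partial>lborel) = (\<integral>y. prod (f b - f y) (G y) \<partial>lborel)"
      using lborel_pair.Fubini_integral[OF hi] by (simp add: hx hy)
    have i1: "integrable lborel (\<lambda>x. prod (F x) (g x - g a))"
      using lborel_pair.integrable_fst'[OF hi] by (simp add: hy)
    have i2: "integrable lborel (\<lambda>y. prod (f b - f y) (G y))"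
      using lborel_pair.integrable_snd[OF hi] by (simp add: hx)
    have i3: "integrable lborel (\<lambda>x. prod (F x) (g a))" "integrable lborel (\<lambda>x. prod (f b) (G x))"
      by (rule integrable_bounded_linear[OF bl(1) FG(1)], rule integrable_bounded_linear[OF bl(2) FG(2)])
    \<comment> \<open>The two summands of the product rule are split into the integrands compared by
      Fubini and pieces with one constant factor, each of which is integrable by itself.\<close>
    have dec: "indicat_real {a..b} x *\<^sub>R (prod (f' x) (g x) + prod (f x) (g' x))
        = (prod (F x) (g x - g a) + prod (F x) (g a)) + (prod (f b) (G x) - prod (f b - f x) (G x))" for x
      by (simp add: simps F_def G_def scaleR_add_right scaleR_diff_right)
    have int: "set_integrable lborel {a..b} (\<lambda>x. prod (f' x) (g x) + prod (f x) (g' x))"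
      unfolding set_integrable_def dec
      by (intro Bochner_Integration.integrable_add Bochner_Integration.integrable_diff i1 i2 i3)
    have "(LINT x:{a..b}|lborel. prod (f' x) (g x) + prod (f x) (g' x))
        = (\<integral>x. prod (F x) (g a) \<partial>lborel) + (\<integral>x. prod (f b) (G x) \<partial>lborel)"
      unfolding set_lebesgue_integral_def dec
      using i1 i2 i3 eq by simp
    also have "(\<integral>x. prod (F x) (g a) \<partial>lborel) = prod (f b - f a) (g a)"
      using f ab by (subst integral_bounded_linear[OF bl(1) FG(1)])
        (simp add: ac_deriv_def F_def[abs_def] set_lebesgue_integral_def)
    also have "(\<integral>x. prod (f b) (G x) \<partial>lborel) = prod (f b) (g b - g a)"
      using g ab by (subst integral_bounded_linear[OF bl(2) FG(2)])
        (simp add: ac_deriv_def G_def[abs_def] set_lebesgue_integral_def)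
    finally show ?thesis using int by (simp add: simps)
  qed
  have "set_integrable lborel {a..b} (\<lambda>x. prod (f' x) (g x) + prod (f x) (g' x))" for a b
    using main[of a b] by (cases "a \<le> b") (auto simp: set_integrable_def)
  moreover have "continuous_on UNIV (\<lambda>x. prod (f x) (g x))"
    using f g by (intro bounded_bilinear.continuous_on[OF p]) (auto simp: ac_deriv_def)
  ultimately show ?thesis
    using main by (auto simp: ac_deriv_def)
qed

text \<open>The product rule for eta f is integrated over an interval whose end points lie outside
  the support of eta, so the boundary terms vanish.\<close>

lemma ac_deriv_imp_weak:
  fixes f g :: "real \<Rightarrow> 'a::euclidean_space"
  assumes fg: "ac_deriv f g"
  shows "has_weak_deriv 1 f g"
  unfolding has_weak_deriv_def
proof (intro allI impI)
  fix \<eta> assume e: "test_function \<eta>"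
  obtain R where R: "R > 0" "\<And>n x. \<bar>x\<bar> > R \<Longrightarrow> nth_deriv n \<eta> x = 0"
    by (rule test_function_support[OF e]) (use that in blast)
  note R0 = R(2)[of _ 0, unfolded nth_deriv_0]
  have sm: "smooth \<eta>" using e by (simp add: test_function_def)
  have "ac_deriv \<eta> (nth_deriv 1 \<eta>)"
    using smooth_deriv[OF sm, of 0] smooth_continuous[OF sm] by (intro ac_deriv_C1) auto
  note ac = ac_deriv_bilinear[OF bounded_bilinear_scaleR this fg]
  define K where "K = {- (R + 1)..R + 1}"
  have K: "indicat_real K x *\<^sub>R c x = c x" if "\<And>x. \<bar>x\<bar> > R \<Longrightarrow> c x = 0" for x and c :: "real \<Rightarrow> 'a"
    using that[of x] by (auto simp: K_def indicator_def)
  have c: "set_integrable lborel K (\<lambda>x. nth_deriv 1 \<eta> x *\<^sub>R f x)"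
    unfolding K_def using fg smooth_continuous[OF sm]
    by (intro borel_integrable_atLeastAtMost' continuous_intros)
       (auto simp: ac_deriv_def intro: continuous_on_subset)
  have "set_integrable lborel K (\<lambda>x. nth_deriv 1 \<eta> x *\<^sub>R f x + \<eta> x *\<^sub>R g x)"
    using ac by (simp add: ac_deriv_def K_def)
  from set_integral_diff(1)[OF this c] have d: "set_integrable lborel K (\<lambda>x. \<eta> x *\<^sub>R g x)" by simp
  have "\<eta> (R + 1) *\<^sub>R f (R + 1) - \<eta> (- (R + 1)) *\<^sub>R f (- (R + 1))
      = (LINT x:K|lborel. nth_deriv 1 \<eta> x *\<^sub>R f x + \<eta> x *\<^sub>R g x)"
    using ac R(1) unfolding ac_deriv_def K_def by (elim conjE allE[of _ "- (R + 1)"] allE[of _ "R + 1"] impE) auto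
  then have "0 = (LINT x:K|lborel. nth_deriv 1 \<eta> x *\<^sub>R f x + \<eta> x *\<^sub>R g x)"
    using R(1) R0[of "R + 1"] R0[of "- (R + 1)"] by simp
  also have "\<dots> = (LINT x:K|lborel. nth_deriv 1 \<eta> x *\<^sub>R f x) + (LINT x:K|lborel. \<eta> x *\<^sub>R g x)"
    by (rule set_integral_add(2)[OF c d])
  also have "(LINT x:K|lborel. nth_deriv 1 \<eta> x *\<^sub>R f x) = (\<integral>x. nth_deriv 1 \<eta> x *\<^sub>R f x \<partial>lborel)"
    unfolding set_lebesgue_integral_def by (rule Bochner_Integration.integral_cong) (use K[of "\<lambda>x. nth_deriv 1 \<eta> x *\<^sub>R f x"] R(2) in auto)
  also have "(LINT x:K|lborel. \<eta> x *\<^sub>R g x) = (\<integral>x. \<eta> x *\<^sub>R g x \<partial>lborel)"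
    unfolding set_lebesgue_integral_def by (rule Bochner_Integration.integral_cong) (use K[of "\<lambda>x. \<eta> x *\<^sub>R g x"] R0 in auto)
  finally show "(\<integral>x. nth_deriv 1 \<eta> x *\<^sub>R f x \<partial>lborel) = (- 1) ^ 1 *\<^sub>R (\<integral>x. \<eta> x *\<^sub>R g x \<partial>lborel)"
    by (simp add: eq_neg_iff_add_eq_0)
qed

text \<open>For fixed x the map y -> rho (x - y) is a test function; its inner derivative -1 absorbs
  the sign of the weak derivative.\<close>

lemma conv_weak_deriv:
  fixes f g :: "real \<Rightarrow> 'a::euclidean_space"
  assumes "has_weak_deriv 1 f g" "test_function \<rho>"
  shows "conv (nth_deriv 1 \<rho>) f = conv \<rho> g"
proof
  fix x
  have "(\<integral>y. (- nth_deriv 1 \<rho> (x - y)) *\<^sub>R f y \<partial>lborel) = - (\<integral>y. \<rho> (x - y) *\<^sub>R g y \<partial>lborel)"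
    using assms(1) test_function_reflect[OF assms(2), where x = x] unfolding has_weak_deriv_def
    by (fastforce dest!: spec[of _ "\<lambda>y. \<rho> (x - y)"])
  then show "conv (nth_deriv 1 \<rho>) f x = conv \<rho> g x" by (simp add: conv_def)
qed

text \<open>Mollifications satisfy the increment formula, and their increments converge because the
  derivatives converge in L2. A subsequence converges almost everywhere, in particular at one point
  \<open>x0\<close>; the increments then carry convergence from \<open>x0\<close> to every point,
  and the limit is the representative.\<close>

lemma weak_imp_ac_deriv:
  fixes f g :: "real \<Rightarrow> 'a::euclidean_space"
  assumes f: "in_L2 f" and g: "in_L2 g" and fg: "has_weak_deriv 1 f g"
  obtains f' where "ac_deriv f' g" "AE x in lborel. f x = f' x"
proof -
  define fn where "fn n = conv (moll n) f" for n
  define gn where "gn n = conv (moll n) g" for n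
  have L: "in_L2 (fn n)" "in_L2 (gn n)" for n
    by (simp_all add: fn_def gn_def in_L2_conv csc_moll f g)
  have "ac_deriv (fn n) (gn n)" for n
  proof (rule ac_deriv_C1)
    show "(fn n has_vector_derivative gn n x) (at x)" for x
      using conv_has_vector_derivative[OF test_function_moll f] conv_weak_deriv[OF fg test_function_moll]
      by (simp add: fn_def gn_def)
    show "continuous_on UNIV (gn n)"
      using smooth_continuous[OF smooth_conv[OF test_function_moll g], of 0] by (simp add: gn_def)
  qed
  then have inc: "fn n b - fn n a = (LINT x:{a..b}|lborel. gn n x)" if "a \<le> b" for n a b
    using that by (simp add: ac_deriv_def)
  have lim: "(\<lambda>n. fn n b - fn n a) \<longlonglongrightarrow> (LINT x:{a..b}|lborel. g x)" if ab: "a \<le> b" for a b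
  proof -
    have "norm (fn n b - fn n a - (LINT x:{a..b}|lborel. g x)) \<le> sqrt (b - a) * L2_nrm (\<lambda>x. gn n x - g x)" for n
      using set_integral_L2_le[OF in_L2_diff[OF L(2)[of n] g] ab]
      unfolding set_integral_diff(2)[OF in_L2_set_integrable[OF L(2)] in_L2_set_integrable[OF g]] inc[OF ab] .
    then have "\<forall>\<^sub>F n in sequentially. norm (fn n b - fn n a - (LINT x:{a..b}|lborel. g x)) \<le> sqrt (b - a) * L2_nrm (\<lambda>x. gn n x - g x)"
      by simp
    moreover have "(\<lambda>n. sqrt (b - a) * L2_nrm (\<lambda>x. gn n x - g x)) \<longlonglongrightarrow> 0"
      unfolding gn_def by (rule tendsto_mult_right_zero[OF conv_moll_tendsto[OF g]])
    ultimately have "(\<lambda>n. fn n b - fn n a - (LINT x:{a..b}|lborel. g x)) \<longlonglongrightarrow> 0"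
      by (rule Lim_null_comparison)
    then show ?thesis by (rule LIM_zero_cancel)
  qed
  \<comment> \<open>L2 convergence is L1 convergence of the squared distances, which yields a
    subsequence converging almost everywhere.\<close>
  have "\<exists>r::nat\<Rightarrow>nat. strict_mono r \<and> (AE x in lborel. (\<lambda>n. (norm (fn (r n) x - f x))\<^sup>2) \<longlonglongrightarrow> 0)"
  proof (rule tendsto_L1_AE_subseq)
    show "integrable lborel (\<lambda>x. (norm (fn n x - f x))\<^sup>2)" for n
      by (rule in_L2_norm_sq[OF in_L2_diff[OF L(1) f]])
    have "(\<lambda>n. (L2_nrm (\<lambda>x. fn n x - f x))\<^sup>2) \<longlonglongrightarrow> 0\<^sup>2"
      unfolding fn_def by (intro tendsto_power conv_moll_tendsto[OF f])
    then show "(\<lambda>n. \<integral>x. norm ((norm (fn n x - f x))\<^sup>2) \<partial>lborel) \<longlonglongrightarrow> 0"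
      by (simp add: L2_nrm_sq)
  qed
  then obtain r :: "nat \<Rightarrow> nat" where r: "strict_mono r"
    and AE0: "AE x in lborel. (\<lambda>n. (norm (fn (r n) x - f x))\<^sup>2) \<longlonglongrightarrow> 0" by auto
  have AE: "AE x in lborel. (\<lambda>n. fn (r n) x) \<longlonglongrightarrow> f x"
    using AE0
  proof eventually_elim
    case (elim x)
    then have "(\<lambda>n. sqrt ((norm (fn (r n) x - f x))\<^sup>2)) \<longlonglongrightarrow> sqrt 0"
      by (rule tendsto_real_sqrt)
    then have "(\<lambda>n. norm (fn (r n) x - f x)) \<longlonglongrightarrow> 0" by simp
    then show ?case
      by (rule LIM_zero_cancel[OF tendsto_norm_zero_cancel])
  qed
  from AE_lborel_ex[OF this] obtain x0 where x0: "(\<lambda>n. fn (r n) x0) \<longlonglongrightarrow> f x0" by auto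
  have conv: "convergent (\<lambda>n. fn (r n) x)" for x
  proof (cases "x0 \<le> x")
    case True
    from tendsto_add[OF x0 LIMSEQ_subseq_LIMSEQ[OF lim[OF True] r]]
    show ?thesis by (auto simp: o_def convergent_def)
  next
    case False
    then have "x \<le> x0" by simp
    from tendsto_diff[OF x0 LIMSEQ_subseq_LIMSEQ[OF lim[OF this] r]]
    show ?thesis by (auto simp: o_def convergent_def)
  qed
  define f' where "f' x = lim (\<lambda>n. fn (r n) x)" for x
  have f': "(\<lambda>n. fn (r n) x) \<longlonglongrightarrow> f' x" for x
    using conv[of x] by (simp add: f'_def convergent_LIMSEQ_iff)
  have "ac_deriv f' g"
  proof (rule ac_derivI_L2[OF g])
    fix a b :: real assume ab: "a \<le> b"
    show "f' b - f' a = (LINT x:{a..b}|lborel. g x)"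
      using LIMSEQ_unique[OF tendsto_diff[OF f'[of b] f'[of a]]] LIMSEQ_subseq_LIMSEQ[OF lim[OF ab] r]
      by (simp add: o_def)
  qed
  moreover have "AE x in lborel. f x = f' x"
    using AE by eventually_elim (rule LIMSEQ_unique[OF _ f'])
  ultimately show ?thesis by (rule that)
qed

section \<open>Sobolev spaces\<close>

lemma integrable_test_L2:
  fixes f :: "real \<Rightarrow> 'a::euclidean_space"
  assumes "test_function \<eta>" "in_L2 f" shows "integrable lborel (\<lambda>x. nth_deriv n \<eta> x *\<^sub>R f x)"
  by (intro integrable_L2_scaleR csc_in_L2 test_function_csc assms)

lemma integrable_test_L2_0:
  fixes f :: "real \<Rightarrow> 'a::euclidean_space"
  assumes "test_function \<eta>" "in_L2 f" shows "integrable lborel (\<lambda>x. \<eta> x *\<^sub>R f x)"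
  using integrable_test_L2[OF assms, of 0] by simp

lemma has_weak_deriv_0 [simp]: "has_weak_deriv 0 f f"
  by (simp add: has_weak_deriv_def)

lemma has_weak_derivD:
  "has_weak_deriv n f g \<Longrightarrow> test_function \<eta> \<Longrightarrow>
    (\<integral>x. nth_deriv n \<eta> x *\<^sub>R f x \<partial>lborel) = (- 1) ^ n *\<^sub>R (\<integral>x. \<eta> x *\<^sub>R g x \<partial>lborel)"
  by (simp add: has_weak_deriv_def)

lemma integral_test_cong_AE:
  fixes f g :: "real \<Rightarrow> 'a::euclidean_space"
  assumes "AE x in lborel. f x = g x" "f \<in> borel_measurable borel" "g \<in> borel_measurable borel"
    "\<eta> \<in> borel_measurable borel"
  shows "(\<integral>x. \<eta> x *\<^sub>R f x \<partial>lborel) = (\<integral>x. \<eta> x *\<^sub>R g x \<partial>lborel)"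
  using assms by (intro integral_cong_AE) (auto elim: eventually_mono)

lemma has_weak_deriv_cong_AE:
  fixes f g f' g' :: "real \<Rightarrow> 'a::euclidean_space"
  assumes "AE x in lborel. f x = f' x" "AE x in lborel. g x = g' x"
    and [measurable]: "f \<in> borel_measurable borel" "f' \<in> borel_measurable borel"
    "g \<in> borel_measurable borel" "g' \<in> borel_measurable borel"
  shows "has_weak_deriv n f g \<longleftrightarrow> has_weak_deriv n f' g'"
  unfolding has_weak_deriv_def
  using integral_test_cong_AE[OF assms(1,3,4) csc_borel[OF test_function_csc]]
    integral_test_cong_AE[OF assms(2,5,6) csc_borel[OF test_function_csc0]]
  by (intro iff_allI imp_cong refl) simp

lemma has_weak_deriv_unique:
  fixes f g h :: "real \<Rightarrow> 'a::euclidean_space"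
  assumes "has_weak_deriv n f g" "has_weak_deriv n f h" "in_L2 g" "in_L2 h"
  shows "AE x in lborel. g x = h x"
proof -
  have "AE x in lborel. g x - h x = 0"
  proof (rule test_integral_zero_imp_AE_zero[OF in_L2_diff[OF assms(3,4)]])
    fix \<eta> assume e: "test_function \<eta>"
    have "(\<integral>x. \<eta> x *\<^sub>R g x \<partial>lborel) = (\<integral>x. \<eta> x *\<^sub>R h x \<partial>lborel)"
      using has_weak_derivD[OF assms(1) e] has_weak_derivD[OF assms(2) e] by simp
    then show "(\<integral>x. \<eta> x *\<^sub>R (g x - h x) \<partial>lborel) = 0"
      using integrable_test_L2_0[OF e assms(3)] integrable_test_L2_0[OF e assms(4)]
      by (simp add: scaleR_diff_right)
  qed
  then show ?thesis by simp
qed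

lemma has_weak_deriv_trans:
  assumes "has_weak_deriv m f g" "has_weak_deriv n g h"
  shows "has_weak_deriv (m + n) f h"
  unfolding has_weak_deriv_def
proof (intro allI impI)
  fix \<eta> assume e: "test_function \<eta>"
  show "(\<integral>x. nth_deriv (m + n) \<eta> x *\<^sub>R f x \<partial>lborel) = (- 1) ^ (m + n) *\<^sub>R (\<integral>x. \<eta> x *\<^sub>R h x \<partial>lborel)"
    using has_weak_derivD[OF assms(1) test_function_nth_deriv[OF e, of n]] has_weak_derivD[OF assms(2) e]
    by (simp add: nth_deriv_add power_add)
qed

text \<open>Testing the first hypothesis with the n-th derivative of eta gives the same integral as
  testing the second with eta. This lets a derivative of order m be differentiated further.\<close>

lemma has_weak_deriv_diff:
  assumes "has_weak_deriv m f g" "has_weak_deriv (m + n) f h"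
  shows "has_weak_deriv n g h"
  unfolding has_weak_deriv_def
proof (intro allI impI)
  fix \<eta> assume e: "test_function \<eta>"
  have "(- 1) ^ m *\<^sub>R (\<integral>x. nth_deriv n \<eta> x *\<^sub>R g x \<partial>lborel) = (- 1) ^ (m + n) *\<^sub>R (\<integral>x. \<eta> x *\<^sub>R h x \<partial>lborel)"
    using has_weak_derivD[OF assms(1) test_function_nth_deriv[OF e, of n]] has_weak_derivD[OF assms(2) e]
    by (simp add: nth_deriv_add)
  then have "(- 1) ^ m *\<^sub>R (- 1) ^ m *\<^sub>R (\<integral>x. nth_deriv n \<eta> x *\<^sub>R g x \<partial>lborel)
      = (- 1) ^ m *\<^sub>R (- 1) ^ (m + n) *\<^sub>R (\<integral>x. \<eta> x *\<^sub>R h x \<partial>lborel)" by simp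
  then show "(\<integral>x. nth_deriv n \<eta> x *\<^sub>R g x \<partial>lborel) = (- 1) ^ n *\<^sub>R (\<integral>x. \<eta> x *\<^sub>R h x \<partial>lborel)"
    by (simp add: power_add[symmetric] add.assoc[symmetric] power_mult_distrib mult_2[symmetric])
       (simp add: power_add)
qed

lemma has_weak_deriv_add:
  fixes f g f' g' :: "real \<Rightarrow> 'a::euclidean_space"
  assumes "has_weak_deriv n f g" "has_weak_deriv n f' g'" "in_L2 f" "in_L2 g" "in_L2 f'" "in_L2 g'"
  shows "has_weak_deriv n (\<lambda>x. f x + f' x) (\<lambda>x. g x + g' x)"
  unfolding has_weak_deriv_def
proof (intro allI impI)
  fix \<eta> assume e: "test_function \<eta>"
  note i = integrable_test_L2[OF e] integrable_test_L2_0[OF e]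
  show "(\<integral>x. nth_deriv n \<eta> x *\<^sub>R (f x + f' x) \<partial>lborel) = (- 1) ^ n *\<^sub>R (\<integral>x. \<eta> x *\<^sub>R (g x + g' x) \<partial>lborel)"
    using has_weak_derivD[OF assms(1) e] has_weak_derivD[OF assms(2) e] assms(3-6)
    by (simp add: scaleR_add_right i)
qed

lemma has_weak_deriv_bounded_linear:
  fixes f g :: "real \<Rightarrow> 'a::euclidean_space" and T :: "'a \<Rightarrow> 'b::euclidean_space"
  assumes T: "bounded_linear T" and w: "has_weak_deriv n f g" and f: "in_L2 f" and g: "in_L2 g"
  shows "has_weak_deriv n (\<lambda>x. T (f x)) (\<lambda>x. T (g x))"
  unfolding has_weak_deriv_def
proof (intro allI impI)
  fix \<eta> assume e: "test_function \<eta>"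
  have "(\<integral>x. nth_deriv n \<eta> x *\<^sub>R T (f x) \<partial>lborel) = T (\<integral>x. nth_deriv n \<eta> x *\<^sub>R f x \<partial>lborel)"
    using integral_bounded_linear[OF T integrable_test_L2[OF e f]] by (simp add: linear_simps[OF T])
  moreover have "(\<integral>x. \<eta> x *\<^sub>R T (g x) \<partial>lborel) = T (\<integral>x. \<eta> x *\<^sub>R g x \<partial>lborel)"
    using integral_bounded_linear[OF T integrable_test_L2_0[OF e g]] by (simp add: linear_simps[OF T])
  ultimately show "(\<integral>x. nth_deriv n \<eta> x *\<^sub>R T (f x) \<partial>lborel) = (- 1) ^ n *\<^sub>R (\<integral>x. \<eta> x *\<^sub>R T (g x) \<partial>lborel)"
    using has_weak_derivD[OF w e] by (simp add: linear_simps[OF T])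
qed

lemma in_L2_bounded_linear:
  fixes f :: "real \<Rightarrow> 'a::euclidean_space" and T :: "'a \<Rightarrow> 'b::euclidean_space"
  assumes T: "bounded_linear T" and f: "in_L2 f" shows "in_L2 (\<lambda>x. T (f x))"
proof -
  obtain K where "\<And>x. norm (T x) \<le> norm x * K" using bounded_linear.bounded[OF T] by auto
  moreover have "(\<lambda>x. T (f x)) \<in> borel_measurable lborel"
    using borel_measurable_continuous_on[OF bounded_linear.continuous_on[OF T continuous_on_id]] in_L2_borel[OF f] by simp
  ultimately show ?thesis
    by (intro in_L2_cmult_bound[OF f, of _ K]) (auto simp: mult.commute)
qed

lemma weak_deriv_someI:
  assumes "in_L2 g" "has_weak_deriv j f g"
  shows "in_L2 (weak_deriv j f)" "has_weak_deriv j f (weak_deriv j f)"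
  using someI[of "\<lambda>g. in_L2 g \<and> has_weak_deriv j f g" g] assms by (auto simp: weak_deriv_def)

lemma weak_deriv_AE:
  assumes "in_L2 g" "has_weak_deriv j f g"
  shows "AE x in lborel. weak_deriv j f x = g x"
  using has_weak_deriv_unique weak_deriv_someI[OF assms] assms by blast

lemma L2_nrm_weak_deriv:
  assumes "in_L2 g" "has_weak_deriv j f g"
  shows "L2_nrm (weak_deriv j f) = L2_nrm g"
  by (rule L2_nrm_cong_AE[OF weak_deriv_someI(1)[OF assms] assms(1) weak_deriv_AE[OF assms]])

lemma in_H_L2: "in_H k f \<Longrightarrow> in_L2 f"
  by (simp add: in_H_def)

lemma
  assumes "in_H k f" "j \<le> k"
  shows in_H_weak_deriv_L2: "in_L2 (weak_deriv j f)"
    and in_H_has_weak_deriv: "has_weak_deriv j f (weak_deriv j f)"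
  using assms weak_deriv_someI unfolding in_H_def by blast+

lemma in_H_mono: "in_H k f \<Longrightarrow> j \<le> k \<Longrightarrow> in_H j f"
  by (auto simp: in_H_def)

lemma in_H_0: "in_H 0 f \<longleftrightarrow> in_L2 f"
  by (auto simp: in_H_def)

lemma L2_nrm_weak_deriv_0: "in_L2 f \<Longrightarrow> L2_nrm (weak_deriv 0 f) = L2_nrm f"
  by (rule L2_nrm_weak_deriv) auto

lemma H_nrm_0: "in_L2 f \<Longrightarrow> H_nrm 0 f = L2_nrm f"
  by (simp add: H_nrm_def L2_nrm_weak_deriv_0)

lemma H_nrm_sq: "(H_nrm k f)\<^sup>2 = (\<Sum>j\<le>k. (L2_nrm (weak_deriv j f))\<^sup>2)"
  by (simp add: H_nrm_def sum_nonneg)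

lemma H_nrm_nonneg [simp]: "0 \<le> H_nrm k f"
  by (simp add: H_nrm_def sum_nonneg)

lemma H_nrm_L2_set: "H_nrm k f = L2_set (\<lambda>j. L2_nrm (weak_deriv j f)) {..k}"
  by (simp add: H_nrm_def L2_set_def)

lemma H_nrm_mono: "j \<le> k \<Longrightarrow> H_nrm j f \<le> H_nrm k f"
  unfolding H_nrm_def by (intro real_sqrt_le_mono sum_mono2) auto

lemma L2_nrm_weak_deriv_le: "j \<le> k \<Longrightarrow> L2_nrm (weak_deriv j f) \<le> H_nrm k f"
  unfolding H_nrm_L2_set by (rule member_le_L2_set) auto

lemma L2_nrm_le_H_nrm: "in_L2 f \<Longrightarrow> L2_nrm f \<le> H_nrm k f"
  using L2_nrm_weak_deriv_le[of 0 k f] by (simp add: L2_nrm_weak_deriv_0)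

lemma H_nrm_Suc_sq: "(H_nrm (Suc k) f)\<^sup>2 = (H_nrm k f)\<^sup>2 + (L2_nrm (weak_deriv (Suc k) f))\<^sup>2"
  by (simp add: H_nrm_sq)

lemma
  fixes f f' :: "real \<Rightarrow> 'a::euclidean_space"
  assumes f: "in_H k f" and f': "f' \<in> borel_measurable borel" and ae: "AE x in lborel. f x = f' x"
  shows in_H_cong_AE: "in_H k f'" and H_nrm_cong_AE: "H_nrm k f = H_nrm k f'"
proof -
  have fb: "f \<in> borel_measurable borel" by (rule in_L2_borel[OF in_H_L2[OF f]])
  have eq: "(\<lambda>g. in_L2 g \<and> has_weak_deriv n f g) = (\<lambda>g. in_L2 g \<and> has_weak_deriv n f' g)" for n
    using has_weak_deriv_cong_AE[OF ae AE_I2[OF refl] fb f'] by (auto dest: in_L2_borel)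
  \<comment> \<open>The predicates under the choice operator coincide, so the chosen derivatives are
    the same function and not merely equal almost everywhere.\<close>
  then have wd: "weak_deriv n f = weak_deriv n f'" for n
    by (simp add: weak_deriv_def)
  show "H_nrm k f = H_nrm k f'" by (simp add: H_nrm_def wd)
  have "in_L2 f'"
    using in_L2_cong_AE[OF in_H_L2[OF f], of f'] f' ae by (simp add: eq_commute[of "f' _"])
  then show "in_H k f'"
    using f eq unfolding in_H_def by meson
qed

text \<open>Membership and norm of order m + 1 are reduced to f and its first derivative. All later
  inductions on the Sobolev order use this recursion.\<close>

lemma
  fixes f g :: "real \<Rightarrow> 'a::euclidean_space"
  assumes f: "in_L2 f" and w: "has_weak_deriv 1 f g" and g: "in_H m g"
  shows in_H_SucI: "in_H (Suc m) f"
    and H_nrm_SucI: "(H_nrm (Suc m) f)\<^sup>2 = (L2_nrm f)\<^sup>2 + (H_nrm m g)\<^sup>2"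
    and weak_deriv_Suc: "j \<le> m \<Longrightarrow> AE x in lborel. weak_deriv (Suc j) f x = weak_deriv j g x"
proof -
  have wj: "has_weak_deriv (Suc j) f (weak_deriv j g)" if "j \<le> m" for j
    using has_weak_deriv_trans[OF w in_H_has_weak_deriv[OF g that]] by simp
  note gj = in_H_weak_deriv_L2[OF g]
  show "AE x in lborel. weak_deriv (Suc j) f x = weak_deriv j g x" if "j \<le> m"
    by (rule weak_deriv_AE[OF gj[OF that] wj[OF that]])
  have "\<exists>h. in_L2 h \<and> has_weak_deriv j f h" if "j \<le> Suc m" for j
    using that f gj wj by (cases j) (auto intro: exI[of _ f])
  then show "in_H (Suc m) f" using f by (simp add: in_H_def)
  have "L2_nrm (weak_deriv (Suc j) f) = L2_nrm (weak_deriv j g)" if "j \<le> m" for j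
    by (rule L2_nrm_weak_deriv[OF gj[OF that] wj[OF that]])
  then have "(\<Sum>j\<le>m. (L2_nrm (weak_deriv (Suc j) f))\<^sup>2) = (\<Sum>j\<le>m. (L2_nrm (weak_deriv j g))\<^sup>2)"
    by (intro sum.cong) auto
  then show "(H_nrm (Suc m) f)\<^sup>2 = (L2_nrm f)\<^sup>2 + (H_nrm m g)\<^sup>2"
    unfolding H_nrm_sq by (subst sum.atMost_Suc_shift) (simp add: L2_nrm_weak_deriv_0[OF f])
qed

lemma in_H_SucD:
  assumes "in_H (Suc m) f"
  shows "in_H m (weak_deriv 1 f)"
proof -
  have "\<exists>g. in_L2 g \<and> has_weak_deriv j (weak_deriv 1 f) g" if "j \<le> m" for j
    using has_weak_deriv_diff[of 1 f "weak_deriv 1 f" j "weak_deriv (Suc j) f"]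
      in_H_has_weak_deriv[OF assms] in_H_weak_deriv_L2[OF assms, of "Suc j"] that by auto
  then show ?thesis
    using in_H_weak_deriv_L2[OF assms, of 1] by (simp add: in_H_def)
qed

text \<open>The passage from weak derivatives to the classical product and chain rules: f is
  replaced by an absolutely continuous representative of the same norm, and results are transferred
  back at the end.\<close>

lemma in_H_Suc_rep:
  fixes f :: "real \<Rightarrow> 'a::euclidean_space"
  assumes f: "in_H (Suc m) f"
  obtains f' g where "ac_deriv f' g" "AE x in lborel. f x = f' x" "in_H m g" "has_weak_deriv 1 f g"
    "in_H (Suc m) f'" "H_nrm (Suc m) f = H_nrm (Suc m) f'" "weak_deriv 1 f = g"
proof -
  have g: "in_H m (weak_deriv 1 f)" by (rule in_H_SucD[OF f])
  have w: "has_weak_deriv 1 f (weak_deriv 1 f)" by (rule in_H_has_weak_deriv[OF f]) simp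
  obtain f' where f': "ac_deriv f' (weak_deriv 1 f)" "AE x in lborel. f x = f' x"
    by (rule weak_imp_ac_deriv[OF in_H_L2[OF f] in_H_L2[OF g] w])
  have "f' \<in> borel_measurable borel"
    using f'(1) borel_measurable_continuous_onI by (auto simp: ac_deriv_def)
  with that[OF f' g w] in_H_cong_AE[OF f _ f'(2)] H_nrm_cong_AE[OF f _ f'(2)] show ?thesis by simp
qed

lemma
  fixes f g :: "real \<Rightarrow> 'a::euclidean_space"
  assumes "in_L2 f" "ac_deriv f g" "in_H m g"
  shows in_H_ac: "in_H (Suc m) f"
    and H_nrm_ac: "(H_nrm (Suc m) f)\<^sup>2 = (L2_nrm f)\<^sup>2 + (H_nrm m g)\<^sup>2"
    and H_nrm_ac_le: "H_nrm (Suc m) f \<le> L2_nrm f + H_nrm m g"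
proof -
  note w = ac_deriv_imp_weak[OF assms(2)]
  show "in_H (Suc m) f" by (rule in_H_SucI[OF assms(1) w assms(3)])
  show eq: "(H_nrm (Suc m) f)\<^sup>2 = (L2_nrm f)\<^sup>2 + (H_nrm m g)\<^sup>2"
    by (rule H_nrm_SucI[OF assms(1) w assms(3)])
  have "(H_nrm (Suc m) f)\<^sup>2 \<le> (L2_nrm f + H_nrm m g)\<^sup>2"
    unfolding eq by (simp add: power2_sum)
  then show "H_nrm (Suc m) f \<le> L2_nrm f + H_nrm m g"
    by (rule power2_le_imp_le) simp
qed

lemma
  fixes f g :: "real \<Rightarrow> 'a::euclidean_space"
  assumes f: "in_H k f" and g: "in_H k g"
  shows in_H_add: "in_H k (\<lambda>x. f x + g x)"
    and H_nrm_triangle: "H_nrm k (\<lambda>x. f x + g x) \<le> H_nrm k f + H_nrm k g"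
    and weak_deriv_add: "j \<le> k \<Longrightarrow> AE x in lborel. weak_deriv j (\<lambda>x. f x + g x) x = weak_deriv j f x + weak_deriv j g x"
proof -
  note fg = in_H_L2[OF f] in_H_L2[OF g]
  note L = in_H_weak_deriv_L2[OF f] in_H_weak_deriv_L2[OF g]
  have w: "has_weak_deriv j (\<lambda>x. f x + g x) (\<lambda>x. weak_deriv j f x + weak_deriv j g x)" if "j \<le> k" for j
    using that in_H_has_weak_deriv[OF f] in_H_has_weak_deriv[OF g] L fg
    by (intro has_weak_deriv_add) auto
  have L': "in_L2 (\<lambda>x. weak_deriv j f x + weak_deriv j g x)" if "j \<le> k" for j
    by (intro in_L2_add L that)
  show "in_H k (\<lambda>x. f x + g x)"
    unfolding in_H_def using w L' in_L2_add[OF fg] by blast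
  show "AE x in lborel. weak_deriv j (\<lambda>x. f x + g x) x = weak_deriv j f x + weak_deriv j g x" if "j \<le> k"
    by (rule weak_deriv_AE[OF L'[OF that] w[OF that]])
  have "H_nrm k (\<lambda>x. f x + g x) \<le> L2_set (\<lambda>j. L2_nrm (weak_deriv j f) + L2_nrm (weak_deriv j g)) {..k}"
    unfolding H_nrm_L2_set
  proof (rule L2_set_mono)
    fix j assume "j \<in> {..k}"
    then show "L2_nrm (weak_deriv j (\<lambda>x. f x + g x)) \<le> L2_nrm (weak_deriv j f) + L2_nrm (weak_deriv j g)"
      using L2_nrm_weak_deriv[OF L' w] L2_nrm_triangle[OF L(1) L(2)] by simp
  qed simp
  also have "\<dots> \<le> H_nrm k f + H_nrm k g"
    unfolding H_nrm_L2_set by (rule L2_set_triangle_ineq)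
  finally show "H_nrm k (\<lambda>x. f x + g x) \<le> H_nrm k f + H_nrm k g" .
qed

lemma
  fixes f :: "real \<Rightarrow> 'a::euclidean_space" and T :: "'a \<Rightarrow> 'b::euclidean_space"
  assumes T: "bounded_linear T" and f: "in_H k f"
  shows in_H_bounded_linear: "in_H k (\<lambda>x. T (f x))"
    and H_nrm_bounded_linear: "(\<And>x. norm (T x) \<le> c * norm x) \<Longrightarrow> 0 \<le> c \<Longrightarrow> H_nrm k (\<lambda>x. T (f x)) \<le> c * H_nrm k f"
    and weak_deriv_bounded_linear: "j \<le> k \<Longrightarrow> AE x in lborel. weak_deriv j (\<lambda>x. T (f x)) x = T (weak_deriv j f x)"
proof -
  note L = in_H_weak_deriv_L2[OF f]
  have w: "has_weak_deriv j (\<lambda>x. T (f x)) (\<lambda>x. T (weak_deriv j f x))" if "j \<le> k" for j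
    using that in_H_has_weak_deriv[OF f] L in_H_L2[OF f] by (intro has_weak_deriv_bounded_linear[OF T]) auto
  have L': "in_L2 (\<lambda>x. T (weak_deriv j f x))" if "j \<le> k" for j
    by (intro in_L2_bounded_linear[OF T] L that)
  show "in_H k (\<lambda>x. T (f x))"
    unfolding in_H_def using w L' in_L2_bounded_linear[OF T in_H_L2[OF f]] by blast
  show "AE x in lborel. weak_deriv j (\<lambda>x. T (f x)) x = T (weak_deriv j f x)" if "j \<le> k"
    by (rule weak_deriv_AE[OF L'[OF that] w[OF that]])
  assume c: "\<And>x. norm (T x) \<le> c * norm x" "0 \<le> c"
  have "H_nrm k (\<lambda>x. T (f x)) \<le> L2_set (\<lambda>j. c * L2_nrm (weak_deriv j f)) {..k}"
    unfolding H_nrm_L2_set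
  proof (rule L2_set_mono)
    fix j assume j: "j \<in> {..k}"
    have "L2_nrm (weak_deriv j (\<lambda>x. T (f x))) = L2_nrm (\<lambda>x. T (weak_deriv j f x))"
      using L2_nrm_weak_deriv[OF L' w] j by simp
    also have "\<dots> \<le> c * L2_nrm (weak_deriv j f)"
      using j c L' by (intro L2_nrm_cmult_bound L) (auto dest: in_L2_borel)
    finally show "L2_nrm (weak_deriv j (\<lambda>x. T (f x))) \<le> c * L2_nrm (weak_deriv j f)" .
  qed simp
  also have "\<dots> = c * H_nrm k f"
    unfolding H_nrm_L2_set by (rule L2_set_right_distrib[symmetric]) (rule c)
  finally show "H_nrm k (\<lambda>x. T (f x)) \<le> c * H_nrm k f" .
qed

text \<open>Averaging \<open>f x = f y - \<integral> f'\<close> over a unit interval.\<close>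

lemma H1_sup_bound:
  fixes f g :: "real \<Rightarrow> 'a::euclidean_space"
  assumes fg: "ac_deriv f g" and f: "in_L2 f" and g: "in_L2 g"
  shows "norm (f x) \<le> L2_nrm f + L2_nrm g"
proof -
  have le: "norm (f x) \<le> norm (f y) + L2_nrm g" if "y \<in> {x..x + 1}" for y
  proof -
    have "norm (f y - f x) \<le> sqrt (y - x) * L2_nrm g"
      using set_integral_L2_le[OF g, of x y] fg that by (simp add: ac_deriv_def)
    also have "\<dots> \<le> 1 * L2_nrm g"
      using that by (intro mult_right_mono) auto
    finally show ?thesis using norm_triangle_ineq2[of "f x" "f y"] by (simp add: norm_minus_commute)
  qed
  have i: "set_integrable lborel {x..x + 1} (\<lambda>y. norm (f y))"
    by (rule in_L2_set_integrable[OF in_L2_norm[OF f]])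
  have c: "set_integrable lborel {x..x + 1} (\<lambda>y. c::real)" for c
    by (rule borel_integrable_atLeastAtMost') (intro continuous_intros)
  have C: "(LINT y:{x..x + 1}|lborel. c) = c" for c :: real
    by (simp add: set_lebesgue_integral_def)
  have "(LINT y:{x..x + 1}|lborel. norm (f x)) \<le> (LINT y:{x..x + 1}|lborel. norm (f y) + L2_nrm g)"
    by (rule set_integral_mono[OF c set_integral_add(1)[OF i c]]) (rule le)
  also have "\<dots> = (LINT y:{x..x + 1}|lborel. norm (f y)) + (LINT y:{x..x + 1}|lborel. L2_nrm g)"
    by (rule set_integral_add(2)[OF i c])
  also have "(LINT y:{x..x + 1}|lborel. norm (f y)) \<le> L2_nrm f"
    using set_integral_L2_le[OF in_L2_norm[OF f], of x "x + 1"] by (simp add: L2_nrm_norm)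
  finally show ?thesis by (simp add: C)
qed

section \<open>Multipliers and products\<close>

text \<open>C^m functions all of whose derivatives up to order m are bounded by the same A. The
  recursive form, with an unnamed derivative at each stage, fits induction with the Leibniz and
  chain rules.\<close>

primrec W_bdd :: "nat \<Rightarrow> (real \<Rightarrow> complex) \<Rightarrow> real \<Rightarrow> bool" where
  "W_bdd 0 a A \<longleftrightarrow> continuous_on UNIV a \<and> (\<forall>x. cmod (a x) \<le> A)"
| "W_bdd (Suc m) a A \<longleftrightarrow> (\<forall>x. cmod (a x) \<le> A) \<and>
     (\<exists>a'. (\<forall>x. (a has_vector_derivative a' x) (at x)) \<and> W_bdd m a' A)"

lemma W_bdd_bound: "W_bdd m a A \<Longrightarrow> cmod (a x) \<le> A"
  by (cases m) auto

lemma W_bdd_nonneg: "W_bdd m a A \<Longrightarrow> 0 \<le> A"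
  using W_bdd_bound[of m a A 0] norm_ge_zero[of "a 0"] by linarith

lemma W_bdd_continuous: "W_bdd m a A \<Longrightarrow> continuous_on UNIV a"
proof (cases m)
  case (Suc n)
  assume "W_bdd m a A"
  then obtain a' where a': "\<And>x. (a has_vector_derivative a' x) (at x)" using Suc by auto
  show ?thesis
    by (intro continuous_at_imp_continuous_on ballI has_vector_derivative_continuous[OF a'])
qed simp

lemma W_bdd_borel: "W_bdd m a A \<Longrightarrow> a \<in> borel_measurable borel"
  using W_bdd_continuous borel_measurable_continuous_onI by blast

lemma W_bdd_mono: "W_bdd m a A \<Longrightarrow> A \<le> B \<Longrightarrow> W_bdd m a B"
proof (induction m arbitrary: a)
  case (Suc m)
  have "cmod (a x) \<le> B" for x using W_bdd_bound[OF Suc.prems(1), of x] Suc.prems(2) by linarith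
  then show ?case using Suc by auto
qed (auto intro: order_trans)

lemma W_bdd_Suc: "W_bdd (Suc m) a A \<Longrightarrow> W_bdd m a A"
proof (induction m arbitrary: a)
  case 0
  then show ?case using W_bdd_continuous[OF 0] W_bdd_bound[OF 0] by simp
next
  case (Suc m)
  from Suc.prems obtain a' where "\<And>x. (a has_vector_derivative a' x) (at x)" "W_bdd (Suc m) a' A"
    by auto
  then show ?case using Suc.IH[of a'] W_bdd_bound[OF Suc.prems] by auto
qed

lemma W_bdd_le: "W_bdd m a A \<Longrightarrow> j \<le> m \<Longrightarrow> W_bdd j a A"
proof (induction m)
  case (Suc m)
  then show ?case using W_bdd_Suc[of m a A] by (cases "j = Suc m") auto
qed simp

lemma W_bdd_const: "cmod c \<le> A \<Longrightarrow> W_bdd m (\<lambda>_. c) A"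
proof (induction m arbitrary: c)
  case (Suc m)
  have "0 \<le> A" using Suc.prems norm_ge_zero[of c] by linarith
  then have "W_bdd m (\<lambda>_. 0) A" by (intro Suc.IH) simp
  then show ?case using Suc.prems by (auto intro!: exI[of _ "\<lambda>_. 0"] derivative_eq_intros)
qed simp

lemma W_bdd_add: "W_bdd m a A \<Longrightarrow> W_bdd m b B \<Longrightarrow> W_bdd m (\<lambda>x. a x + b x) (A + B)"
proof (induction m arbitrary: a b)
  case 0
  then show ?case by (auto intro!: continuous_intros norm_triangle_mono)
next
  case (Suc m)
  from Suc.prems obtain a' b' where "\<And>x. (a has_vector_derivative a' x) (at x)" "W_bdd m a' A"
    "\<And>x. (b has_vector_derivative b' x) (at x)" "W_bdd m b' B"
    by auto
  then show ?case
    using Suc.IH[of a' b'] W_bdd_bound[OF Suc.prems(1)] W_bdd_bound[OF Suc.prems(2)]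
    by (auto intro!: norm_triangle_mono exI[of _ "\<lambda>x. a' x + b' x"] has_vector_derivative_add)
qed

text \<open>Each derivative doubles the number of products in the Leibniz formula, whence
  2^m.\<close>

lemma W_bdd_mult: "W_bdd m a A \<Longrightarrow> W_bdd m b B \<Longrightarrow> W_bdd m (\<lambda>x. a x * b x) (2 ^ m * A * B)"
proof (induction m arbitrary: a b)
  case 0
  then show ?case by (auto intro!: continuous_intros simp: norm_mult mult_mono')
next
  case (Suc m)
  from Suc.prems obtain a' b' where a': "\<And>x. (a has_vector_derivative a' x) (at x)" "W_bdd m a' A"
    and b': "\<And>x. (b has_vector_derivative b' x) (at x)" "W_bdd m b' B"
    by auto
  have AB: "0 \<le> A" "0 \<le> B" using Suc.prems W_bdd_nonneg by blast+
  have "W_bdd m (\<lambda>x. a x * b' x + a' x * b x) (2 ^ m * A * B + 2 ^ m * A * B)"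
    by (intro W_bdd_add Suc.IH W_bdd_Suc[OF Suc.prems(1)] W_bdd_Suc[OF Suc.prems(2)] a' b')
  then have "W_bdd m (\<lambda>x. a x * b' x + a' x * b x) (2 ^ Suc m * A * B)" by (simp add: mult_ac)
  moreover have "((\<lambda>x. a x * b x) has_vector_derivative a x * b' x + a' x * b x) (at x)" for x
    by (rule has_vector_derivative_mult[OF a'(1) b'(1)])
  moreover have "cmod (a x * b x) \<le> 2 ^ Suc m * A * B" for x
  proof -
    have "cmod (a x * b x) \<le> 1 * (A * B)"
      using W_bdd_bound[OF Suc.prems(1), of x] W_bdd_bound[OF Suc.prems(2), of x]
      by (simp add: norm_mult mult_mono')
    also have "\<dots> \<le> 2 ^ Suc m * (A * B)"
      using AB one_le_power[of "2::real" "Suc m"] by (intro mult_right_mono) auto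
    finally show ?thesis by (simp add: mult.assoc)
  qed
  ultimately show ?case
    unfolding W_bdd.simps by (intro conjI allI exI[of _ "\<lambda>x. a x * b' x + a' x * b x"])
qed

lemma W_bdd_cnj: "W_bdd m a A \<Longrightarrow> W_bdd m (\<lambda>x. cnj (a x)) A"
proof (induction m arbitrary: a)
  case (Suc m)
  from Suc.prems obtain a' where "\<And>x. (a has_vector_derivative a' x) (at x)" "W_bdd m a' A" by auto
  then show ?case
    using Suc.IH[of a'] W_bdd_bound[OF Suc.prems]
    by (auto intro!: exI[of _ "\<lambda>x. cnj (a' x)"] bounded_linear.has_vector_derivative[OF bounded_linear_cnj])
qed (auto intro!: continuous_intros)

text \<open>Membership and bound are kept together so that estimates of composite expressions follow
  by introduction rules, the bound being computed along the way.\<close>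

definition H_bdd :: "nat \<Rightarrow> (real \<Rightarrow> complex) \<Rightarrow> real \<Rightarrow> bool" where
  "H_bdd m f B \<longleftrightarrow> in_H m f \<and> H_nrm m f \<le> B"

lemma H_bdd_nonneg: "H_bdd m f B \<Longrightarrow> 0 \<le> B"
  using H_nrm_nonneg[of m f] unfolding H_bdd_def by linarith

lemma H_bdd_mono: "H_bdd m f A \<Longrightarrow> A \<le> B \<Longrightarrow> H_bdd m f B"
  by (auto simp: H_bdd_def)

lemma H_bdd_le: "H_bdd m f A \<Longrightarrow> j \<le> m \<Longrightarrow> H_bdd j f A"
  using H_nrm_mono[of j m f] in_H_mono[of m f j] by (auto simp: H_bdd_def)

lemma H_bdd_add: "H_bdd m f A \<Longrightarrow> H_bdd m g B \<Longrightarrow> H_bdd m (\<lambda>x. f x + g x) (A + B)"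
  using H_nrm_triangle[of m f g] in_H_add[of m f g] by (auto simp: H_bdd_def)

lemma H_bdd_cnj: "H_bdd m f A \<Longrightarrow> H_bdd m (\<lambda>x. cnj (f x)) A"
  using H_nrm_bounded_linear[OF bounded_linear_cnj, of m f 1] in_H_bounded_linear[OF bounded_linear_cnj, of m f]
  by (auto simp: H_bdd_def)

lemma H_bdd_cong_AE:
  assumes "H_bdd m f A" "f' \<in> borel_measurable borel" "AE x in lborel. f x = f' x"
  shows "H_bdd m f' A"
  using H_nrm_cong_AE[OF _ assms(2,3), of m] in_H_cong_AE[OF _ assms(2,3), of m] assms(1) by (simp add: H_bdd_def)

lemma L2_nrm_mult_bound:
  fixes a f :: "real \<Rightarrow> complex"
  assumes "a \<in> borel_measurable borel" "\<And>x. cmod (a x) \<le> A" "in_L2 f"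
  shows "in_L2 (\<lambda>x. a x * f x)" "L2_nrm (\<lambda>x. a x * f x) \<le> A * L2_nrm f"
proof -
  note [measurable] = assms(1) in_L2_borel[OF assms(3)]
  have b: "cmod (a x * f x) \<le> A * cmod (f x)" for x
    using assms(2) by (simp add: norm_mult mult_right_mono)
  show "in_L2 (\<lambda>x. a x * f x)"
    by (rule in_L2_cmult_bound[OF assms(3) _ b]) measurable
  show "L2_nrm (\<lambda>x. a x * f x) \<le> A * L2_nrm f"
    by (rule L2_nrm_cmult_bound[OF assms(3)]) (use b order_trans[OF norm_ge_zero assms(2)] in auto)
qed

lemma ac_deriv_mult:
  fixes f g f' g' :: "real \<Rightarrow> complex"
  assumes "ac_deriv f f'" "ac_deriv g g'"
  shows "ac_deriv (\<lambda>x. f x * g x) (\<lambda>x. f' x * g x + f x * g' x)"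
  by (rule ac_deriv_bilinear[OF bounded_bilinear_mult assms])

text \<open>The L2 part costs A B and each of the two Leibniz terms costs 3^m A B, so a step from m
  to m + 1 multiplies the constant by at most 3.\<close>

lemma H_bdd_mult:
  "W_bdd m a A \<Longrightarrow> H_bdd m f B \<Longrightarrow> H_bdd m (\<lambda>x. a x * f x) (3 ^ m * A * B)"
proof (induction m arbitrary: a f B)
  case 0
  have A: "0 \<le> A" using 0 W_bdd_nonneg by blast
  have f: "in_L2 f" "L2_nrm f \<le> B" using 0(2) by (auto simp: H_bdd_def in_H_0 H_nrm_0)
  note L = L2_nrm_mult_bound[OF W_bdd_borel[OF 0(1)] W_bdd_bound[OF 0(1)] f(1)]
  show ?case
    using L mult_left_mono[OF f(2) A] by (simp add: H_bdd_def in_H_0 H_nrm_0)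
next
  case (Suc m)
  have A: "0 \<le> A" using Suc.prems W_bdd_nonneg by blast
  obtain f' g where fg: "ac_deriv f' g" "AE x in lborel. f x = f' x" "in_H m g"
    "in_H (Suc m) f'" "H_nrm (Suc m) f = H_nrm (Suc m) f'"
    using in_H_Suc_rep[of m f] Suc.prems(2) unfolding H_bdd_def by metis
  have B: "H_nrm (Suc m) f' \<le> B" "0 \<le> B"
    using Suc.prems(2) fg(5) H_bdd_nonneg[OF Suc.prems(2)] by (auto simp: H_bdd_def)
  have f': "in_L2 f'" by (rule in_H_L2[OF fg(4)])
  obtain a' where a': "\<And>x. (a has_vector_derivative a' x) (at x)" "W_bdd m a' A"
    using Suc.prems(1) by auto
  note am = W_bdd_Suc[OF Suc.prems(1)]
  have ac: "ac_deriv (\<lambda>x. a x * f' x) (\<lambda>x. a' x * f' x + a x * g x)"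
    by (rule ac_deriv_mult[OF ac_deriv_C1[OF a'(1) W_bdd_continuous[OF a'(2)]] fg(1)])
  have g: "H_bdd m g B"
  proof -
    have "(H_nrm m g)\<^sup>2 \<le> (H_nrm (Suc m) f')\<^sup>2"
      using H_nrm_ac[OF f' fg(1,3)] by simp
    then have "H_nrm m g \<le> H_nrm (Suc m) f'" by (rule power2_le_imp_le) simp
    then show ?thesis using fg(3) B by (simp add: H_bdd_def)
  qed
  have f'm: "H_bdd m f' B"
    using fg(4) B H_bdd_le[of "Suc m" f' B m] by (simp add: H_bdd_def)
  have H: "H_bdd m (\<lambda>x. a' x * f' x + a x * g x) (3 ^ m * A * B + 3 ^ m * A * B)"
    by (intro H_bdd_add Suc.IH a' am f'm g)
  then have H': "H_nrm m (\<lambda>x. a' x * f' x + a x * g x) \<le> 2 * 3 ^ m * (A * B)"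
    by (simp add: H_bdd_def mult_ac)
  have L: "in_L2 (\<lambda>x. a x * f' x)" "L2_nrm (\<lambda>x. a x * f' x) \<le> A * L2_nrm f'"
    by (rule L2_nrm_mult_bound[OF W_bdd_borel[OF am] W_bdd_bound[OF am] f'])+
  have "L2_nrm (\<lambda>x. a x * f' x) \<le> A * B"
    using L(2) mult_left_mono[OF order_trans[OF L2_nrm_le_H_nrm[OF f'] B(1)] A] by linarith
  then have "H_nrm (Suc m) (\<lambda>x. a x * f' x) \<le> 1 * (A * B) + 2 * 3 ^ m * (A * B)"
    using H_nrm_ac_le[OF L(1) ac, of m] H H' unfolding H_bdd_def by linarith
  also have "\<dots> \<le> 3 ^ m * (A * B) + 2 * 3 ^ m * (A * B)"
    using A B(2) by (intro add_right_mono mult_right_mono) auto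
  finally have "H_bdd (Suc m) (\<lambda>x. a x * f' x) (3 ^ Suc m * A * B)"
    using in_H_ac[OF L(1) ac, of m] H by (simp add: H_bdd_def mult_ac)
  then show ?case
  proof (rule H_bdd_cong_AE)
    show "AE x in lborel. a x * f' x = a x * f x"
      using fg(2) by eventually_elim simp
    show "(\<lambda>x. a x * f x) \<in> borel_measurable borel"
      using W_bdd_borel[OF am] in_L2_borel[of f] Suc.prems(2)
      by (auto simp: H_bdd_def in_H_def)
  qed
qed

section \<open>Sobolev embedding, the algebra property and commutators\<close>

lemma in_H_Suc_continuous:
  fixes f :: "real \<Rightarrow> 'a::euclidean_space"
  assumes f: "in_H (Suc m) f" "continuous_on UNIV f"
  obtains g where "ac_deriv f g" "in_H m g" "H_nrm m g \<le> H_nrm (Suc m) f" "weak_deriv 1 f = g"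
proof -
  obtain f' g where fg: "ac_deriv f' g" "AE x in lborel. f x = f' x" "in_H m g" "weak_deriv 1 f = g"
    "in_H (Suc m) f'" "H_nrm (Suc m) f = H_nrm (Suc m) f'"
    using in_H_Suc_rep[OF f(1)] by metis
  have "f = f'"
    using fg(1) by (intro AE_eq_continuous[OF fg(2) f(2)]) (simp add: ac_deriv_def)
  moreover have "(H_nrm m g)\<^sup>2 \<le> (H_nrm (Suc m) f')\<^sup>2"
    using H_nrm_ac[OF in_H_L2[OF fg(5)] fg(1,3)] by simp
  then have "H_nrm m g \<le> H_nrm (Suc m) f'" by (rule power2_le_imp_le) simp
  ultimately show ?thesis using that fg by blast
qed

lemma in_H_Suc_continuous_rep:
  fixes f :: "real \<Rightarrow> 'a::euclidean_space"
  assumes "in_H (Suc m) f"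
  obtains f' where "continuous_on UNIV f'" "AE x in lborel. f x = f' x"
    "in_H (Suc m) f'" "H_nrm (Suc m) f = H_nrm (Suc m) f'"
  using in_H_Suc_rep[OF assms] that unfolding ac_deriv_def by metis

lemma ac_deriv_cong_AE:
  fixes f g g' :: "real \<Rightarrow> 'a::euclidean_space"
  assumes fg: "ac_deriv f g" and ae: "AE x in lborel. g x = g' x"
    and m: "g \<in> borel_measurable borel" "g' \<in> borel_measurable borel"
  shows "ac_deriv f g'"
proof -
  note [measurable] = m
  have "set_integrable lborel {a..b} g \<longleftrightarrow> set_integrable lborel {a..b} g'" for a b
    unfolding set_integrable_def using ae by (intro integrable_cong_AE) (auto elim: eventually_mono)
  moreover have "(LINT x:{a..b}|lborel. g x) = (LINT x:{a..b}|lborel. g' x)" for a b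
    unfolding set_lebesgue_integral_def using ae by (intro integral_cong_AE) (auto elim: eventually_mono)
  ultimately show ?thesis using fg by (simp add: ac_deriv_def)
qed

text \<open>The embedding of H^1 into bounded functions; the factor 2 covers the L2 norms of f and
  of its derivative, each at most the full norm.\<close>

lemma H_sup_bound:
  fixes f :: "real \<Rightarrow> 'a::euclidean_space"
  assumes f: "in_H (Suc m) f" "continuous_on UNIV f"
  shows "norm (f x) \<le> 2 * H_nrm (Suc m) f"
proof -
  obtain g where g: "ac_deriv f g" "in_H m g" "H_nrm m g \<le> H_nrm (Suc m) f"
    by (rule in_H_Suc_continuous[OF f])
  have "norm (f x) \<le> L2_nrm f + L2_nrm g"
    by (rule H1_sup_bound[OF g(1) in_H_L2[OF f(1)] in_H_L2[OF g(2)]])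
  also have "\<dots> \<le> H_nrm (Suc m) f + H_nrm (Suc m) f"
    using L2_nrm_le_H_nrm[OF in_H_L2[OF f(1)]] L2_nrm_le_H_nrm[OF in_H_L2[OF g(2)]] g(3)
    by (intro add_mono) (blast intro: order_trans)+
  finally show ?thesis by simp
qed

text \<open>The embedding costs one derivative. At each stage the weak derivative is exchanged for
  its continuous representative, which then is the classical derivative at every point.\<close>

lemma H_bdd_imp_W_bdd:
  "H_bdd (Suc m) f B \<Longrightarrow> continuous_on UNIV f \<Longrightarrow> W_bdd m f (2 * B)"
proof (induction m arbitrary: f)
  case 0
  have "cmod (f x) \<le> 2 * B" for x
    using H_sup_bound[of 0 f x] 0 by (simp add: H_bdd_def)
  then show ?case using 0 by simp
next
  case (Suc m)
  have f: "in_H (Suc (Suc m)) f" "H_nrm (Suc (Suc m)) f \<le> B" using Suc.prems(1) by (auto simp: H_bdd_def)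
  obtain g where g: "ac_deriv f g" "in_H (Suc m) g" "H_nrm (Suc m) g \<le> H_nrm (Suc (Suc m)) f"
    by (rule in_H_Suc_continuous[OF f(1) Suc.prems(2)])
  obtain g' where g': "continuous_on UNIV g'" "AE x in lborel. g x = g' x"
    "in_H (Suc m) g'" "H_nrm (Suc m) g = H_nrm (Suc m) g'"
    by (rule in_H_Suc_continuous_rep[OF g(2)])
  have "ac_deriv f g'"
    by (rule ac_deriv_cong_AE[OF g(1) g'(2)])
       (use in_L2_borel[OF in_H_L2[OF g(2)]] borel_measurable_continuous_onI[OF g'(1)] in auto)
  from ac_deriv_differentiable[OF this g'(1)]
  have "\<And>x. (f has_vector_derivative g' x) (at x)" .
  moreover have "W_bdd m g' (2 * B)"
    using g' g(3) f(2) by (intro Suc.IH) (auto simp: H_bdd_def)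
  moreover have "cmod (f x) \<le> 2 * B" for x
    using H_sup_bound[OF f(1) Suc.prems(2), of x] f(2) by linarith
  ultimately show ?case by auto
qed

text \<open>In f' g + f g' the undifferentiated factor is placed in \<open>W_bdd m\<close> by the
  embedding and the other one is measured in H^m, so \<open>H_bdd_mult\<close> suffices. The
  constant is 2 for the L2 part and 4 * 3^m for the two Leibniz terms.\<close>

lemma H_bdd_algebra:
  assumes f: "H_bdd (Suc m) f A" and g: "H_bdd (Suc m) g B"
  shows "H_bdd (Suc m) (\<lambda>x. f x * g x) (6 * 3 ^ m * A * B)"
proof -
  have AB: "0 \<le> A" "0 \<le> B" using f g H_bdd_nonneg by blast+
  obtain f' where f': "continuous_on UNIV f'" "AE x in lborel. f x = f' x" "H_bdd (Suc m) f' A"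
    using in_H_Suc_continuous_rep[of m f] f unfolding H_bdd_def by metis
  obtain g' where g': "continuous_on UNIV g'" "AE x in lborel. g x = g' x" "H_bdd (Suc m) g' B"
    using in_H_Suc_continuous_rep[of m g] g unfolding H_bdd_def by metis
  obtain Df where Df: "ac_deriv f' Df" "H_bdd m Df A"
    using in_H_Suc_continuous[of m f'] f' unfolding H_bdd_def by (metis order_trans)
  obtain Dg where Dg: "ac_deriv g' Dg" "H_bdd m Dg B"
    using in_H_Suc_continuous[of m g'] g' unfolding H_bdd_def by (metis order_trans)
  note Wf = H_bdd_imp_W_bdd[OF f'(3,1)] and Wg = H_bdd_imp_W_bdd[OF g'(3,1)]
  have ac: "ac_deriv (\<lambda>x. f' x * g' x) (\<lambda>x. Df x * g' x + f' x * Dg x)"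
    by (rule ac_deriv_mult[OF Df(1) Dg(1)])
  have "H_bdd m (\<lambda>x. g' x * Df x + f' x * Dg x) (3 ^ m * (2 * B) * A + 3 ^ m * (2 * A) * B)"
    by (intro H_bdd_add H_bdd_mult Wf Wg Df Dg)
  then have H: "H_bdd m (\<lambda>x. Df x * g' x + f' x * Dg x) (4 * 3 ^ m * (A * B))"
    by (simp add: mult_ac)
  have L: "in_L2 (\<lambda>x. f' x * g' x)" "L2_nrm (\<lambda>x. f' x * g' x) \<le> 2 * A * L2_nrm g'"
    using g'(3) by (auto intro!: L2_nrm_mult_bound W_bdd_borel[OF Wf] W_bdd_bound[OF Wf] simp: H_bdd_def in_H_def)
  have "L2_nrm g' \<le> B"
    using g'(3) L2_nrm_le_H_nrm[of g' "Suc m"] by (auto simp: H_bdd_def in_H_def)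
  then have "L2_nrm (\<lambda>x. f' x * g' x) \<le> 2 * (A * B)"
    using L(2) mult_left_mono[of "L2_nrm g'" B "2 * A"] AB by linarith
  then have "H_nrm (Suc m) (\<lambda>x. f' x * g' x) \<le> 2 * (A * B) + 4 * 3 ^ m * (A * B)"
    using H_nrm_ac_le[OF L(1) ac, of m] H unfolding H_bdd_def by linarith
  also have "\<dots> \<le> (2 * 3 ^ m) * (A * B) + 4 * 3 ^ m * (A * B)"
    using AB by (intro add_right_mono mult_right_mono) auto
  finally have "H_bdd (Suc m) (\<lambda>x. f' x * g' x) (6 * 3 ^ m * A * B)"
    using in_H_ac[OF L(1) ac, of m] H by (simp add: H_bdd_def mult_ac)
  then show ?thesis
  proof (rule H_bdd_cong_AE)
    show "AE x in lborel. f' x * g' x = f x * g x"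
      using f'(2) g'(2) by eventually_elim simp
    have "f \<in> borel_measurable borel" "g \<in> borel_measurable borel"
      using f g by (auto simp: H_bdd_def in_H_def in_L2_def)
    then show "(\<lambda>x. f x * g x) \<in> borel_measurable borel" by measurable
  qed
qed

lemma has_weak_deriv_mult:
  assumes a: "\<And>x. (a has_vector_derivative a' x) (at x)" "W_bdd 0 a' A" and w: "in_H (Suc 0) w"
  shows "has_weak_deriv 1 (\<lambda>x. a x * w x) (\<lambda>x. a' x * w x + a x * weak_deriv 1 w x)"
proof -
  obtain w' g where w': "ac_deriv w' g" "AE x in lborel. w x = w' x" "in_H 0 g" "weak_deriv 1 w = g"
    by (rule in_H_Suc_rep[OF w]) (use that in blast)
  have ac: "ac_deriv a a'" by (rule ac_deriv_C1[OF a(1) W_bdd_continuous[OF a(2)]])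
  have "has_weak_deriv 1 (\<lambda>x. a x * w' x) (\<lambda>x. a' x * w' x + a x * g x)"
    by (rule ac_deriv_imp_weak[OF ac_deriv_mult[OF ac w'(1)]])
  moreover have [measurable]: "w \<in> borel_measurable borel" "w' \<in> borel_measurable borel"
    "g \<in> borel_measurable borel" "a \<in> borel_measurable borel" "a' \<in> borel_measurable borel"
    using in_L2_borel[OF in_H_L2[OF w]] in_L2_borel[OF in_H_L2[OF w'(3)]] w'(1) ac W_bdd_borel[OF a(2)]
    by (auto simp: ac_deriv_def intro: borel_measurable_continuous_onI)
  have "AE x in lborel. a x * w' x = a x * w x"
    "AE x in lborel. a' x * w' x + a x * g x = a' x * w x + a x * g x"
    using w'(2) by (auto elim: eventually_mono)
  from has_weak_deriv_cong_AE[OF this, of 1]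
  have "has_weak_deriv 1 (\<lambda>x. a x * w' x) (\<lambda>x. a' x * w' x + a x * g x)
      = has_weak_deriv 1 (\<lambda>x. a x * w x) (\<lambda>x. a' x * w x + a x * g x)" by simp
  ultimately show ?thesis unfolding w'(4) by blast
qed

text \<open>The top derivative of w cancels, so only the H^j norm remains. For the induction,
  differentiate once: the commutator with w' is of the same kind one order lower, and the rest is a
  derivative of a' w of order j + 1, bounded by the H^(j+1) norm of w.\<close>

lemma weak_deriv_commutator:
  "W_bdd (Suc j) a A \<Longrightarrow> in_H (Suc j) w \<Longrightarrow>
    L2_nrm (\<lambda>x. weak_deriv (Suc j) (\<lambda>x. a x * w x) x - a x * weak_deriv (Suc j) w x) \<le> 3 ^ Suc j * A * H_nrm j w"
proof (induction j arbitrary: w)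
  case (0 w)
  then obtain a' where a': "\<And>x. (a has_vector_derivative a' x) (at x)" "W_bdd 0 a' A" by auto
  have A: "0 \<le> A" using a'(2) W_bdd_nonneg by blast
  have w: "in_L2 w" "in_L2 (weak_deriv 1 w)" using 0(2) in_H_weak_deriv_L2[OF 0(2)] by (auto simp: in_H_def)
  note wd = has_weak_deriv_mult[OF a' 0(2)]
  note L1 = L2_nrm_mult_bound[OF W_bdd_borel[OF a'(2)] W_bdd_bound[OF a'(2)] w(1)]
  note L2 = L2_nrm_mult_bound[OF W_bdd_borel[OF 0(1)] W_bdd_bound[OF 0(1)] w(2)]
  note L = in_L2_add[OF L1(1) L2(1)]
  have "AE x in lborel. weak_deriv 1 (\<lambda>x. a x * w x) x - a x * weak_deriv 1 w x = a' x * w x"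
    using weak_deriv_AE[OF L wd] by eventually_elim simp
  then have "L2_nrm (\<lambda>x. weak_deriv 1 (\<lambda>x. a x * w x) x - a x * weak_deriv 1 w x) = L2_nrm (\<lambda>x. a' x * w x)"
    by (intro L2_nrm_cong_AE in_L2_diff L1 L2 weak_deriv_someI(1)[OF L wd])
  also have "\<dots> \<le> A * L2_nrm w" by (rule L1(2))
  also have "\<dots> \<le> 3 * (A * L2_nrm w)" using A by simp
  finally show ?case using w by (simp add: H_nrm_0 mult.assoc)
next
  case (Suc j w)
  from Suc.prems(1) obtain a' where a': "\<And>x. (a has_vector_derivative a' x) (at x)" "W_bdd (Suc j) a' A" by auto
  have A: "0 \<le> A" using a'(2) W_bdd_nonneg by blast
  note am = W_bdd_Suc[OF Suc.prems(1)]
  define g where "g = weak_deriv 1 w"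
  have w: "in_H (Suc j) w" "in_H (Suc 0) w" "in_L2 w"
    using Suc.prems(2) by (auto intro: in_H_mono in_H_L2)
  have g: "in_H (Suc j) g" "has_weak_deriv 1 w g"
    unfolding g_def by (rule in_H_SucD[OF Suc.prems(2)], rule in_H_has_weak_deriv[OF Suc.prems(2)]) simp
  have gj: "H_nrm j g \<le> H_nrm (Suc j) w"
  proof -
    have "(H_nrm j g)\<^sup>2 \<le> (H_nrm (Suc j) w)\<^sup>2"
      using H_nrm_SucI[OF w(3) g(2) in_H_mono[OF g(1), of j]] by simp
    then show ?thesis by (rule power2_le_imp_le) simp
  qed
  have wd: "has_weak_deriv 1 (\<lambda>x. a x * w x) (\<lambda>x. a' x * w x + a x * g x)"
    unfolding g_def by (rule has_weak_deriv_mult[OF a'(1) W_bdd_le[OF a'(2)] w(2)]) simp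
  have H1: "H_bdd (Suc j) (\<lambda>x. a' x * w x) (3 ^ Suc j * A * H_nrm (Suc j) w)"
    by (rule H_bdd_mult[OF a'(2)]) (simp add: H_bdd_def w)
  have H2: "in_H (Suc j) (\<lambda>x. a x * g x)"
    using H_bdd_mult[OF am, of g "H_nrm (Suc j) g"] g by (simp add: H_bdd_def)
  have H1': "in_H (Suc j) (\<lambda>x. a' x * w x)" using H1 by (simp add: H_bdd_def)
  have awL: "in_L2 (\<lambda>x. a x * w x)"
    by (rule L2_nrm_mult_bound(1)[OF W_bdd_borel[OF am] W_bdd_bound[OF am] w(3)])
  note r = in_H_add[OF H1' H2]
  define e where "e x = weak_deriv (Suc j) (\<lambda>x. a x * g x) x - a x * weak_deriv (Suc j) g x" for x
  note Lg = in_H_weak_deriv_L2[OF g(1) order_refl]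
  have Le: "in_L2 e"
    unfolding e_def[abs_def]
    by (intro in_L2_diff in_H_weak_deriv_L2[OF H2] L2_nrm_mult_bound(1)[OF W_bdd_borel[OF am] W_bdd_bound[OF am] Lg]) simp
  have L1: "in_L2 (weak_deriv (Suc j) (\<lambda>x. a' x * w x))" by (rule in_H_weak_deriv_L2[OF H1']) simp
  have "AE x in lborel. weak_deriv (Suc (Suc j)) (\<lambda>x. a x * w x) x - a x * weak_deriv (Suc (Suc j)) w x
      = weak_deriv (Suc j) (\<lambda>x. a' x * w x) x + e x"
    using weak_deriv_Suc[OF awL wd r order_refl] weak_deriv_add[OF H1' H2 order_refl]
      weak_deriv_Suc[OF w(3) g(2) g(1) order_refl]
    by eventually_elim (simp add: e_def)
  moreover have "in_L2 (\<lambda>x. weak_deriv (Suc (Suc j)) (\<lambda>x. a x * w x) x - a x * weak_deriv (Suc (Suc j)) w x)"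
    by (intro in_L2_diff in_H_weak_deriv_L2[OF in_H_SucI[OF awL wd r]]
        L2_nrm_mult_bound(1)[OF W_bdd_borel[OF am] W_bdd_bound[OF am]] in_H_weak_deriv_L2[OF Suc.prems(2)]) auto
  ultimately have "L2_nrm (\<lambda>x. weak_deriv (Suc (Suc j)) (\<lambda>x. a x * w x) x - a x * weak_deriv (Suc (Suc j)) w x)
      = L2_nrm (\<lambda>x. weak_deriv (Suc j) (\<lambda>x. a' x * w x) x + e x)"
    by (intro L2_nrm_cong_AE in_L2_add L1 Le)
  also have "\<dots> \<le> L2_nrm (weak_deriv (Suc j) (\<lambda>x. a' x * w x)) + L2_nrm e"
    by (rule L2_nrm_triangle[OF L1 Le])
  also have "L2_nrm (weak_deriv (Suc j) (\<lambda>x. a' x * w x)) \<le> 3 ^ Suc j * A * H_nrm (Suc j) w"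
    using L2_nrm_weak_deriv_le[of "Suc j" "Suc j" "\<lambda>x. a' x * w x"] H1 by (simp add: H_bdd_def)
  also have "L2_nrm e \<le> 3 ^ Suc j * A * H_nrm (Suc j) w"
  proof -
    have "L2_nrm e \<le> 3 ^ Suc j * A * H_nrm j g"
      unfolding e_def[abs_def] by (rule Suc.IH[OF am g(1)])
    also have "\<dots> \<le> 3 ^ Suc j * A * H_nrm (Suc j) w"
      using A gj by (intro mult_left_mono) auto
    finally show ?thesis .
  qed
  also have "3 ^ Suc j * A * H_nrm (Suc j) w + 3 ^ Suc j * A * H_nrm (Suc j) w \<le> 3 ^ Suc (Suc j) * A * H_nrm (Suc j) w"
    using A mult_nonneg_nonneg[OF A H_nrm_nonneg[of "Suc j" w]] by (simp add: mult.assoc)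
  finally show ?case by simp
qed

section \<open>Changes of variables\<close>

text \<open>The map x + gamma satisfies these bounds when |gamma_x| <= 1/2. As 1/2 and 2 are
  reciprocal, its inverse satisfies them as well.\<close>

definition bilip :: "(real \<Rightarrow> real) \<Rightarrow> (real \<Rightarrow> real) \<Rightarrow> bool" where
  "bilip \<xi> \<xi>' \<longleftrightarrow> (\<forall>x. (\<xi> has_real_derivative \<xi>' x) (at x)) \<and> continuous_on UNIV \<xi>' \<and>
     (\<forall>x. 1 / 2 \<le> \<xi>' x \<and> \<xi>' x \<le> 2)"

lemma bilip_deriv: "bilip \<xi> \<xi>' \<Longrightarrow> (\<xi> has_real_derivative \<xi>' x) (at x)"
  and bilip_cont: "bilip \<xi> \<xi>' \<Longrightarrow> continuous_on UNIV \<xi>'"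
  and bilip_ge: "bilip \<xi> \<xi>' \<Longrightarrow> 1 / 2 \<le> \<xi>' x"
  and bilip_le: "bilip \<xi> \<xi>' \<Longrightarrow> \<xi>' x \<le> 2"
  and bilip_nonneg: "bilip \<xi> \<xi>' \<Longrightarrow> 0 \<le> \<xi>' x"
  unfolding bilip_def by (auto intro: order_trans[of 0 "1/2"])

lemma bilip_continuous: "bilip \<xi> \<xi>' \<Longrightarrow> continuous_on UNIV \<xi>"
  by (intro continuous_at_imp_continuous_on ballI DERIV_isCont[OF bilip_deriv])

lemma bilip_borel: "bilip \<xi> \<xi>' \<Longrightarrow> \<xi> \<in> borel_measurable borel" "bilip \<xi> \<xi>' \<Longrightarrow> \<xi>' \<in> borel_measurable borel"
  using bilip_continuous bilip_cont borel_measurable_continuous_onI by blast+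

lemma bilip_expand: 
  assumes b: "bilip \<xi> \<xi>'" and xy: "x \<le> y" shows "(y - x) / 2 \<le> \<xi> y - \<xi> x"
proof (cases "x < y")
  case True
  obtain z where "\<xi> y - \<xi> x = (y - x) * \<xi>' z"
    using MVT2[OF True, of \<xi> \<xi>'] bilip_deriv[OF b] by auto
  then show ?thesis using mult_left_mono[OF bilip_ge[OF b, of z], of "y - x"] xy by simp
qed (use xy in auto)

lemma bilip_strict_mono: "bilip \<xi> \<xi>' \<Longrightarrow> strict_mono \<xi>"
proof (rule strict_monoI)
  fix x y :: real assume "bilip \<xi> \<xi>'" "x < y"
  then show "\<xi> x < \<xi> y" using bilip_expand[of \<xi> \<xi>' x y] by simp
qed

lemma bilip_surj: assumes b: "bilip \<xi> \<xi>'" shows "\<exists>x. \<xi> x = y"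
proof -
  define r where "r = 2 * \<bar>y - \<xi> 0\<bar>"
  have "\<xi> (- r) \<le> y" "y \<le> \<xi> r"
    using bilip_expand[OF b, of "-r" 0] bilip_expand[OF b, of 0 r] by (auto simp: r_def)
  then show ?thesis
    using IVT'[of \<xi> "- r" y r] continuous_on_subset[OF bilip_continuous[OF b]] by (auto simp: r_def)
qed

text \<open>Both measures need only be compared on intervals. The preimage of an interval is an
  interval, on which the density integrates to an increment of the map.\<close>

lemma bilip_lborel:
  assumes b: "bilip \<xi> \<xi>'"
  shows "lborel = distr (density lborel (\<lambda>x. ennreal (\<xi>' x))) lborel \<xi>"
proof (rule lborel_eqI)
  note [measurable] = bilip_borel[OF b]
  fix l u :: real assume "\<And>i. i \<in> Basis \<Longrightarrow> l \<bullet> i \<le> u \<bullet> i"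
  then have lu: "l \<le> u" by simp
  obtain a c where a: "\<xi> a = l" and c: "\<xi> c = u" using bilip_surj[OF b] by metis
  have ac: "a \<le> c" using lu strict_mono_less_eq[OF bilip_strict_mono[OF b], of a c] unfolding a c by simp
  have vi: "\<xi> -` box l u = {a<..<c}"
    using strict_mono_less[OF bilip_strict_mono[OF b]] by (auto simp: a[symmetric] c[symmetric])
  have "emeasure (distr (density lborel (\<lambda>x. ennreal (\<xi>' x))) lborel \<xi>) (box l u)
      = (\<integral>\<^sup>+x. ennreal (\<xi>' x) * indicator {a<..<c} x \<partial>lborel)"
    by (simp add: emeasure_distr vi[simplified] emeasure_density)
  also have "\<dots> = (\<integral>\<^sup>+x. ennreal (\<xi>' x) * indicator {a..c} x \<partial>lborel)"
    using AE_lborel_singleton[of a] AE_lborel_singleton[of c]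
    by (intro nn_integral_cong_AE) (auto simp: indicator_def elim!: eventually_elim2)
  also have "\<dots> = ennreal (\<xi> c - \<xi> a)"
    using bilip_deriv[OF b] bilip_nonneg[OF b] ac
    by (intro nn_integral_FTC_Icc) (auto intro: has_field_derivative_at_within)
  finally show "emeasure (distr (density lborel (\<lambda>x. ennreal (\<xi>' x))) lborel \<xi>) (box l u) = ennreal (\<Prod>i\<in>Basis. (u - l) \<bullet> i)"
    by (simp add: a c)
qed simp

lemma bilip_integral:
  fixes g :: "real \<Rightarrow> 'a::{banach, second_countable_topology}"
  assumes b: "bilip \<xi> \<xi>'" and g: "g \<in> borel_measurable borel"
  shows "(\<integral>y. g y \<partial>lborel) = (\<integral>x. \<xi>' x *\<^sub>R g (\<xi> x) \<partial>lborel)"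
    and "integrable lborel g \<longleftrightarrow> integrable lborel (\<lambda>x. \<xi>' x *\<^sub>R g (\<xi> x))"
proof -
  note [measurable] = bilip_borel[OF b] g
  have "(\<integral>y. g y \<partial>lborel) = (\<integral>y. g y \<partial>distr (density lborel (\<lambda>x. ennreal (\<xi>' x))) lborel \<xi>)"
    by (subst bilip_lborel[OF b]) simp
  also have "\<dots> = (\<integral>x. \<xi>' x *\<^sub>R g (\<xi> x) \<partial>lborel)"
    by (subst integral_distr, measurable, subst integral_density) (auto simp: bilip_nonneg[OF b])
  finally show "(\<integral>y. g y \<partial>lborel) = (\<integral>x. \<xi>' x *\<^sub>R g (\<xi> x) \<partial>lborel)" .
  have "integrable lborel g \<longleftrightarrow> integrable (distr (density lborel (\<lambda>x. ennreal (\<xi>' x))) lborel \<xi>) g"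
    by (subst bilip_lborel[OF b]) simp
  also have "\<dots> \<longleftrightarrow> integrable lborel (\<lambda>x. \<xi>' x *\<^sub>R g (\<xi> x))"
    by (subst integrable_distr_eq, measurable, subst integrable_density) (auto simp: bilip_nonneg[OF b])
  finally show "integrable lborel g \<longleftrightarrow> integrable lborel (\<lambda>x. \<xi>' x *\<^sub>R g (\<xi> x))" .
qed

text \<open>Preimages of null sets are null because the density \<open>\<xi>'\<close> is strictly
  positive.\<close>

lemma bilip_AE:
  assumes b: "bilip \<xi> \<xi>'" and ae: "AE y in lborel. P y"
  shows "AE x in lborel. P (\<xi> x)"
proof -
  note [measurable] = bilip_borel[OF b]
  have "AE y in distr (density lborel (\<lambda>x. ennreal (\<xi>' x))) lborel \<xi>. P y"
    using ae by (subst (asm) bilip_lborel[OF b])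
  then have "AE x in density lborel (\<lambda>x. ennreal (\<xi>' x)). P (\<xi> x)"
    by (rule AE_distrD[rotated]) measurable
  then have "AE x in lborel. 0 < ennreal (\<xi>' x) \<longrightarrow> P (\<xi> x)"
    by (subst (asm) AE_density) measurable
  then show ?thesis
    using bilip_ge[OF b] by (auto simp: less_le_trans[of 0 "1/2::real"])
qed

lemma bilip_L2:
  fixes f :: "real \<Rightarrow> 'a::euclidean_space"
  assumes b: "bilip \<xi> \<xi>'" and f: "in_L2 f"
  shows "in_L2 (\<lambda>x. f (\<xi> x))" "L2_nrm (\<lambda>x. f (\<xi> x)) \<le> 2 * L2_nrm f"
proof -
  note [measurable] = bilip_borel[OF b] in_L2_borel[OF f]
  have i: "integrable lborel (\<lambda>x. \<xi>' x *\<^sub>R (norm (f (\<xi> x)))\<^sup>2)"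
    using bilip_integral(2)[OF b, of "\<lambda>y. (norm (f y))\<^sup>2"] in_L2_norm_sq[OF f] by simp
  have le: "(norm (f (\<xi> x)))\<^sup>2 \<le> 2 * (\<xi>' x *\<^sub>R (norm (f (\<xi> x)))\<^sup>2)" for x
    using mult_right_mono[OF bilip_ge[OF b, of x], of "(norm (f (\<xi> x)))\<^sup>2"] by simp
  show L: "in_L2 (\<lambda>x. f (\<xi> x))"
    by (rule in_L2_bound[OF _ integrable_mult_right[OF i, of 2] le]) measurable
  have "(L2_nrm (\<lambda>x. f (\<xi> x)))\<^sup>2 \<le> (\<integral>x. 2 * (\<xi>' x *\<^sub>R (norm (f (\<xi> x)))\<^sup>2) \<partial>lborel)"
    unfolding L2_nrm_sq by (intro integral_mono in_L2_norm_sq L integrable_mult_right i le)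
  also have "\<dots> = 2 * (L2_nrm f)\<^sup>2"
    using bilip_integral(1)[OF b, of "\<lambda>y. (norm (f y))\<^sup>2"] by (simp add: L2_nrm_sq)
  also have "\<dots> \<le> (2 * L2_nrm f)\<^sup>2" by (simp add: power_mult_distrib)
  finally show "L2_nrm (\<lambda>x. f (\<xi> x)) \<le> 2 * L2_nrm f"
    by (rule power2_le_imp_le) simp
qed

lemma bilip_ac:
  fixes f g :: "real \<Rightarrow> 'a::euclidean_space"
  assumes b: "bilip \<xi> \<xi>'" and fg: "ac_deriv f g"
  shows "ac_deriv (\<lambda>x. f (\<xi> x)) (\<lambda>x. \<xi>' x *\<^sub>R g (\<xi> x))"
proof -
  have main: "set_integrable lborel {a..c} (\<lambda>x. \<xi>' x *\<^sub>R g (\<xi> x)) \<and>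
      f (\<xi> c) - f (\<xi> a) = (LINT x:{a..c}|lborel. \<xi>' x *\<^sub>R g (\<xi> x))" if ac: "a \<le> c" for a c
  proof -
    define h where "h y = indicat_real {\<xi> a..\<xi> c} y *\<^sub>R g y" for y
    have h: "integrable lborel h"
      using fg by (simp add: ac_deriv_def set_integrable_def h_def[abs_def])
    then have hb: "h \<in> borel_measurable borel" by auto
    have eq: "\<xi>' x *\<^sub>R h (\<xi> x) = indicat_real {a..c} x *\<^sub>R (\<xi>' x *\<^sub>R g (\<xi> x))" for x
      using strict_mono_less_eq[OF bilip_strict_mono[OF b]] by (simp add: h_def indicator_def)
    have le: "\<xi> a \<le> \<xi> c" using ac strict_mono_less_eq[OF bilip_strict_mono[OF b]] by simp
    have "f (\<xi> c) - f (\<xi> a) = (\<integral>y. h y \<partial>lborel)"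
      using fg le by (simp add: ac_deriv_def set_lebesgue_integral_def h_def)
    then show ?thesis
      using bilip_integral[OF b hb, unfolded eq] h
      by (simp add: set_integrable_def set_lebesgue_integral_def)
  qed
  have "set_integrable lborel {a..c} (\<lambda>x. \<xi>' x *\<^sub>R g (\<xi> x))" for a c
    using main[of a c] by (cases "a \<le> c") (auto simp: set_integrable_def)
  moreover have "continuous_on UNIV (\<lambda>x. f (\<xi> x))"
    using fg by (intro continuous_on_compose2[OF _ bilip_continuous[OF b]]) (auto simp: ac_deriv_def)
  ultimately show ?thesis using main by (auto simp: ac_deriv_def)
qed

text \<open>The summand 2 is the cost of a composition in L2, and \<open>3 ^ m * M\<close> the cost
  of multiplying by the inner derivative. The order of multiplication and composition does not
  change the product, so one constant serves both directions.\<close>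

primrec comp_const :: "real \<Rightarrow> nat \<Rightarrow> real" where
  "comp_const M 0 = 2"
| "comp_const M (Suc m) = 2 + 3 ^ m * M * comp_const M m"

lemma comp_const_nonneg: "0 \<le> M \<Longrightarrow> 0 \<le> comp_const M m"
  by (induction m) auto

text \<open>The chain rule produces the inner derivative times a composed function. The two
  applications differ in whether the multiplier is controlled before or after composition, so this
  estimate is left as a hypothesis.\<close>

lemma H_bdd_comp_step:
  fixes f :: "real \<Rightarrow> complex"
  assumes b: "bilip \<xi> \<xi>'" and f: "H_bdd (Suc m) f B"
    and g: "\<And>g. H_bdd m g B \<Longrightarrow> H_bdd m (\<lambda>x. of_real (\<xi>' x) * g (\<xi> x)) C"
  shows "H_bdd (Suc m) (\<lambda>x. f (\<xi> x)) (2 * B + C)"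
proof -
  obtain f' g where fg: "ac_deriv f' g" "AE x in lborel. f x = f' x" "in_H m g"
    "in_H (Suc m) f'" "H_nrm (Suc m) f = H_nrm (Suc m) f'"
    using in_H_Suc_rep[of m f] f unfolding H_bdd_def by metis
  have "(H_nrm m g)\<^sup>2 \<le> (H_nrm (Suc m) f')\<^sup>2"
    using H_nrm_ac[OF in_H_L2[OF fg(4)] fg(1,3)] by simp
  then have "H_nrm m g \<le> H_nrm (Suc m) f'" by (rule power2_le_imp_le) simp
  then have "H_bdd m g B" using f fg by (simp add: H_bdd_def)
  from g[OF this] have gC: "H_bdd m (\<lambda>x. \<xi>' x *\<^sub>R g (\<xi> x)) C" by (simp add: scaleR_conv_of_real)
  note L = bilip_L2[OF b in_H_L2[OF fg(4)]] and ac = bilip_ac[OF b fg(1)]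
  have "L2_nrm f' \<le> B" using f fg(5) L2_nrm_le_H_nrm[OF in_H_L2[OF fg(4)], of "Suc m"] by (simp add: H_bdd_def)
  then have "H_nrm (Suc m) (\<lambda>x. f' (\<xi> x)) \<le> 2 * B + C"
    using H_nrm_ac_le[OF L(1) ac, of m] L(2) gC unfolding H_bdd_def by linarith
  then have "H_bdd (Suc m) (\<lambda>x. f' (\<xi> x)) (2 * B + C)"
    using in_H_ac[OF L(1) ac, of m] gC by (simp add: H_bdd_def)
  then show ?thesis
  proof (rule H_bdd_cong_AE)
    have "f \<in> borel_measurable borel" using f by (auto simp: H_bdd_def in_H_def in_L2_def)
    then show "(\<lambda>x. f (\<xi> x)) \<in> borel_measurable borel" using bilip_borel[OF b] by measurable
    show "AE x in lborel. f' (\<xi> x) = f (\<xi> x)"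
      using bilip_AE[OF b fg(2)] by eventually_elim simp
  qed
qed

lemma H_bdd_comp_0:
  fixes f :: "real \<Rightarrow> complex"
  assumes b: "bilip \<xi> \<xi>'" and f: "H_bdd 0 f B"
  shows "H_bdd 0 (\<lambda>x. f (\<xi> x)) (2 * B)"
  using bilip_L2[OF b, of f] f by (auto simp: H_bdd_def in_H_0 H_nrm_0)

lemma H_bdd_comp:
  assumes b: "bilip \<xi> \<xi>'"
  shows "W_bdd m (\<lambda>x. of_real (\<xi>' x)) M \<Longrightarrow> H_bdd m f B \<Longrightarrow> H_bdd m (\<lambda>x. f (\<xi> x)) (comp_const M m * B)"
proof (induction m arbitrary: f)
  case 0
  then show ?case using H_bdd_comp_0[OF b] by simp
next
  case (Suc m)
  have "H_bdd (Suc m) (\<lambda>x. f (\<xi> x)) (2 * B + 3 ^ m * M * (comp_const M m * B))"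
    by (rule H_bdd_comp_step[OF b Suc.prems(2)])
      (intro H_bdd_mult W_bdd_Suc[OF Suc.prems(1)] Suc.IH)
  then show ?case by (simp add: algebra_simps)
qed

text \<open>For the inverse of a change of variables the derivative of the inverse is known as a function
  of the original variable only, so the multiplier enters before the composition.\<close>

lemma H_bdd_comp_inverse:
  assumes b: "bilip \<xi> \<xi>'" and s: "\<And>x. of_real (\<xi>' x) = \<sigma> (\<xi> x)"
  shows "W_bdd m \<sigma> M \<Longrightarrow> H_bdd m f B \<Longrightarrow> H_bdd m (\<lambda>x. f (\<xi> x)) (comp_const M m * B)"
proof (induction m arbitrary: f B)
  case 0
  then show ?case using H_bdd_comp_0[OF b] by simp
next
  case (Suc m)
  have "H_bdd (Suc m) (\<lambda>x. f (\<xi> x)) (2 * B + comp_const M m * (3 ^ m * M * B))"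
  proof (rule H_bdd_comp_step[OF b Suc.prems(2)])
    fix g assume "H_bdd m g B"
    from Suc.IH[OF W_bdd_Suc[OF Suc.prems(1)] H_bdd_mult[OF W_bdd_Suc[OF Suc.prems(1)] this]]
    show "H_bdd m (\<lambda>x. of_real (\<xi>' x) * g (\<xi> x)) (comp_const M m * (3 ^ m * M * B))"
      by (simp add: s)
  qed
  then show ?case by (simp add: algebra_simps)
qed

primrec W_comp_const :: "real \<Rightarrow> nat \<Rightarrow> real" where
  "W_comp_const M 0 = 1"
| "W_comp_const M (Suc m) = 1 + W_comp_const M m * 2 ^ m * M"

lemma W_comp_const_nonneg: "0 \<le> M \<Longrightarrow> 0 \<le> W_comp_const M m"
  by (induction m) auto

lemma W_bdd_comp_inverse:
  assumes b: "bilip \<xi> \<xi>'" and s: "\<And>x. of_real (\<xi>' x) = \<sigma> (\<xi> x)"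
  shows "W_bdd m \<sigma> M \<Longrightarrow> W_bdd m a A \<Longrightarrow> W_bdd m (\<lambda>x. a (\<xi> x)) (W_comp_const M m * A)"
proof (induction m arbitrary: a A)
  case 0
  then show ?case
    by (auto intro!: continuous_on_compose2[OF _ bilip_continuous[OF b]])
next
  case (Suc m)
  obtain a' where a': "\<And>x. (a has_vector_derivative a' x) (at x)" "W_bdd m a' A"
    using Suc.prems(2) by auto
  have A: "0 \<le> A" and M: "0 \<le> M" using Suc.prems W_bdd_nonneg by blast+
  note sm = W_bdd_Suc[OF Suc.prems(1)]
  have "W_bdd m (\<lambda>x. a' (\<xi> x) * \<sigma> (\<xi> x)) (W_comp_const M m * (2 ^ m * A * M))"
    by (rule Suc.IH[OF sm W_bdd_mult[OF a'(2) sm]])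
  then have W: "W_bdd m (\<lambda>x. a' (\<xi> x) * \<sigma> (\<xi> x)) (W_comp_const M (Suc m) * A)"
    by (rule W_bdd_mono) (use A in \<open>simp add: algebra_simps\<close>)
  have d: "((\<lambda>x. a (\<xi> x)) has_vector_derivative a' (\<xi> x) * \<sigma> (\<xi> x)) (at x)" for x
    using vector_diff_chain_at[of \<xi> "\<xi>' x" x a "a' (\<xi> x)"] bilip_deriv[OF b, of x] a'(1)[of "\<xi> x"]
    by (simp add: has_real_derivative_iff_has_vector_derivative o_def s[symmetric] scaleR_conv_of_real mult.commute)
  have "cmod (a (\<xi> x)) \<le> W_comp_const M (Suc m) * A" for x
  proof -
    have "cmod (a (\<xi> x)) \<le> 1 * A" using W_bdd_bound[OF Suc.prems(2)] by simp
    also have "\<dots> \<le> W_comp_const M (Suc m) * A"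
      using A M W_comp_const_nonneg[OF M, of m] by (intro mult_right_mono) auto
    finally show ?thesis .
  qed
  then show ?case
    unfolding W_bdd.simps by (intro conjI allI exI[of _ "\<lambda>x. a' (\<xi> x) * \<sigma> (\<xi> x)"] d W)
qed

section \<open>Weak time derivatives in inner product spaces\<close>

text \<open>The mean value inequality applies to each scalar function d . U. Letting d tend to U r -
  U s itself turns these bounds into a bound of the norm, although U is differentiated only against
  a dense set.\<close>

lemma weak_time_lipschitz:
  fixes U V :: "real \<Rightarrow> 'a::real_inner"
  assumes dense: "closure D = UNIV"
    and wd: "\<And>d s. d \<in> D \<Longrightarrow> s \<in> {0..t} \<Longrightarrow> ((\<lambda>r. d \<bullet> U r) has_real_derivative d \<bullet> V s) (at s within {0..t})"
    and M: "\<And>s. s \<in> {0..t} \<Longrightarrow> norm (V s) \<le> M"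
    and rs: "r \<in> {0..t}" "s \<in> {0..t}"
  shows "norm (U r - U s) \<le> M * \<bar>r - s\<bar>"
proof -
  define z where "z = U r - U s"
  have le: "\<bar>d \<bullet> z\<bar> \<le> norm d * (M * \<bar>r - s\<bar>)" if "d \<in> D" for d
  proof -
    have "norm (d \<bullet> V x) \<le> norm d * M" if "x \<in> {0..t}" for x
      using Cauchy_Schwarz_ineq2[of d "V x"] mult_left_mono[OF M[OF that] norm_ge_zero[of d]] by simp
    from field_differentiable_bound[OF convex_real_interval(5) wd[OF \<open>d \<in> D\<close>] this rs]
    show ?thesis by (simp add: z_def inner_diff_right mult.assoc)
  qed
  have "z \<in> closure D" using dense by simp
  then obtain d where d: "\<And>n. d n \<in> D" "d \<longlonglongrightarrow> z"
    unfolding closure_sequential by auto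
  have "(\<lambda>n. \<bar>d n \<bullet> z\<bar>) \<longlonglongrightarrow> \<bar>z \<bullet> z\<bar>" "(\<lambda>n. norm (d n) * (M * \<bar>r - s\<bar>)) \<longlonglongrightarrow> norm z * (M * \<bar>r - s\<bar>)"
    by (intro tendsto_intros d)+
  then have "\<bar>z \<bullet> z\<bar> \<le> norm z * (M * \<bar>r - s\<bar>)"
    by (rule LIMSEQ_le) (use le d in blast)
  then have "norm z * norm z \<le> norm z * (M * \<bar>r - s\<bar>)"
    by (simp add: dot_square_norm power2_eq_square)
  moreover have "0 \<le> M" using order_trans[OF norm_ge_zero M[OF rs(1)]] .
  ultimately show ?thesis
    by (cases "z = 0") (auto simp: z_def mult_le_cancel_left)
qed

text \<open>By the Lipschitz bound the difference quotients stay in a ball, and on bounded sets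
  convergence against a dense set implies convergence against every vector.\<close>

lemma weak_time_derivative:
  fixes U V :: "real \<Rightarrow> 'a::real_inner"
  assumes dense: "closure D = UNIV"
    and wd: "\<And>d s. d \<in> D \<Longrightarrow> s \<in> {0..t} \<Longrightarrow> ((\<lambda>r. d \<bullet> U r) has_real_derivative d \<bullet> V s) (at s within {0..t})"
    and M: "\<And>s. s \<in> {0..t} \<Longrightarrow> norm (V s) \<le> M"
    and s: "s \<in> {0..t}"
  shows "((\<lambda>r. z \<bullet> U r) has_real_derivative z \<bullet> V s) (at s within {0..t})"
proof -
  define q where "q r = (U r - U s) /\<^sub>R (r - s)" for r
  have eq: "(z \<bullet> U r - z \<bullet> U s) /\<^sub>R (r - s) = z \<bullet> q r" for r z
    by (simp add: q_def inner_diff_right)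
  have q: "norm (q r) \<le> M" if "r \<in> {0..t}" "r \<noteq> s" for r
    using weak_time_lipschitz[OF dense wd M that(1) s] that(2)
    by (simp add: q_def divide_simps flip: divide_inverse_commute)
  have M0: "0 \<le> M" using order_trans[OF norm_ge_zero M[OF s]] .
  have "((\<lambda>r. z \<bullet> q r) \<longlongrightarrow> z \<bullet> V s) (at s within {0..t})"
  proof (rule tendstoI)
    fix e :: real assume e: "e > 0"
    have "z \<in> closure D" using dense by simp
    \<comment> \<open>The error z - d is paired with a vector of norm at most 2 M, so this choice
      costs at most e / 2; adding 1 to M covers M = 0.\<close>
    moreover have "e / (4 * (M + 1)) > 0" using e M0 by simp
    ultimately obtain d where d: "d \<in> D" "dist d z < e / (4 * (M + 1))"
      unfolding closure_approachable by blast
    have "((\<lambda>r. d \<bullet> q r) \<longlongrightarrow> d \<bullet> V s) (at s within {0..t})"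
      using wd[OF d(1) s] unfolding has_real_derivative_iff_has_vector_derivative has_vector_derivative_within_quotient eq .
    then have "\<forall>\<^sub>F r in at s within {0..t}. dist (d \<bullet> q r) (d \<bullet> V s) < e / 2"
      using e by (intro tendstoD) auto
    moreover have "\<forall>\<^sub>F r in at s within {0..t}. r \<in> {0..t} \<and> r \<noteq> s"
      by (auto simp: eventually_at_filter)
    ultimately show "\<forall>\<^sub>F r in at s within {0..t}. dist (z \<bullet> q r) (z \<bullet> V s) < e"
    proof eventually_elim
      case (elim r)
      have "norm (q r - V s) \<le> 2 * M"
        using q[of r] elim(2) M[OF s] norm_triangle_ineq4[of "q r" "V s"] by simp
      then have "\<bar>(z - d) \<bullet> (q r - V s)\<bar> \<le> norm (z - d) * (2 * M)"
        using Cauchy_Schwarz_ineq2[of "z - d" "q r - V s"] mult_left_mono[of _ "2 * M" "norm (z - d)"] order_trans norm_ge_zero by blast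
      also have "\<dots> \<le> e / (4 * (M + 1)) * (2 * M)"
        using d(2) M0 by (intro mult_right_mono) (auto simp: dist_norm norm_minus_commute)
      also have "\<dots> \<le> e / 2" using e M0 by (simp add: field_simps)
      finally have "\<bar>(z \<bullet> q r - z \<bullet> V s) - (d \<bullet> q r - d \<bullet> V s)\<bar> \<le> e / 2"
        by (simp add: inner_diff_left inner_diff_right algebra_simps)
      then show ?case
        using elim(1) unfolding dist_real_def by linarith
    qed
  qed
  then show ?thesis
    unfolding has_real_derivative_iff_has_vector_derivative has_vector_derivative_within_quotient eq .
qed

lemma has_real_derivative_zero_of_quadratic:
  fixes R :: "real \<Rightarrow> real"
  assumes "\<And>r. r \<in> S \<Longrightarrow> \<bar>R r\<bar> \<le> C * (r - s)\<^sup>2" "s \<in> S"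
  shows "(R has_real_derivative 0) (at s within S)"
  unfolding has_real_derivative_iff_has_vector_derivative has_vector_derivative_within_quotient
proof (rule Lim_null_comparison)
  have R0: "R s = 0" using assms(1)[OF assms(2)] by simp
  show "\<forall>\<^sub>F r in at s within S. norm ((R r - R s) /\<^sub>R (r - s)) \<le> \<bar>C\<bar> * \<bar>r - s\<bar>"
    unfolding eventually_at_filter
  proof (rule always_eventually, intro allI impI)
    fix r assume r: "r \<noteq> s" "r \<in> S"
    have "\<bar>R r\<bar> \<le> \<bar>C\<bar> * \<bar>r - s\<bar> * \<bar>r - s\<bar>"
      using order_trans[OF assms(1)[OF r(2)] mult_right_mono[OF abs_ge_self[of C] zero_le_power2]]
      by (simp add: power2_eq_square mult.assoc)
    then show "norm ((R r - R s) /\<^sub>R (r - s)) \<le> \<bar>C\<bar> * \<bar>r - s\<bar>"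
      using r(1) by (simp add: R0 divide_simps flip: divide_inverse_commute)
  qed
  have "((\<lambda>r. \<bar>C\<bar> * \<bar>r - s\<bar>) \<longlongrightarrow> \<bar>C\<bar> * \<bar>s - s\<bar>) (at s within S)"
    by (intro tendsto_intros)
  then show "((\<lambda>r. \<bar>C\<bar> * \<bar>r - s\<bar>) \<longlongrightarrow> 0) (at s within S)" by simp
qed

text \<open>U has no strong derivative, so there is no product rule to quote. Expanding about s and
  using symmetry, the first order term pairs U with the fixed vector \<open>T s (U s)\<close> and
  has a weak derivative, while all other increments are bilinear in Lipschitz quantities, hence of
  order (r - s)^2.\<close>

lemma quadratic_form_derivative:
  fixes U V :: "real \<Rightarrow> 'a::real_inner" and T :: "real \<Rightarrow> 'a \<Rightarrow> 'a"
  assumes dense: "closure D = UNIV"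
    and wd: "\<And>d s. d \<in> D \<Longrightarrow> s \<in> {0..t} \<Longrightarrow> ((\<lambda>r. d \<bullet> U r) has_real_derivative d \<bullet> V s) (at s within {0..t})"
    and M: "\<And>s. s \<in> {0..t} \<Longrightarrow> norm (V s) \<le> M"
    and s: "s \<in> {0..t}"
    and add: "\<And>r u v. r \<in> {0..t} \<Longrightarrow> T r (u + v) = T r u + T r v"
    and sym: "\<And>r u v. r \<in> {0..t} \<Longrightarrow> T r u \<bullet> v = T r v \<bullet> u"
    and K: "\<And>r u. r \<in> {0..t} \<Longrightarrow> norm (T r u) \<le> K * norm u"
    and L: "\<And>r u. r \<in> {0..t} \<Longrightarrow> norm (T r u - T s u) \<le> L * \<bar>r - s\<bar> * norm u"
    and d: "((\<lambda>r. T r (U s) \<bullet> U s) has_real_derivative d) (at s within {0..t})"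
  shows "((\<lambda>r. T r (U r) \<bullet> U r) has_real_derivative d + 2 * (T s (U s) \<bullet> V s)) (at s within {0..t})"
proof -
  define R where "R r = 2 * ((T r (U s) - T s (U s)) \<bullet> (U r - U s)) + T r (U r - U s) \<bullet> (U r - U s)" for r
  have eq: "T r (U r) \<bullet> U r = T r (U s) \<bullet> U s + 2 * (T s (U s) \<bullet> U r - T s (U s) \<bullet> U s) + R r" if "r \<in> {0..t}" for r
  proof -
    define w where "w = U r - U s"
    have Ur: "U r = U s + w" by (simp add: w_def)
    show ?thesis
      using sym[OF that, of w "U s"]
      unfolding R_def w_def[symmetric] unfolding Ur
      by (simp add: add[OF that] inner_add_left inner_add_right inner_diff_left algebra_simps)
  qed
  have M0: "0 \<le> M" using order_trans[OF norm_ge_zero M[OF s]] .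
  have Rb: "\<bar>R r\<bar> \<le> (2 * \<bar>L\<bar> * norm (U s) * M + \<bar>K\<bar> * M\<^sup>2) * (r - s)\<^sup>2" if r: "r \<in> {0..t}" for r
  proof -
    have sq: "(r - s)\<^sup>2 = \<bar>r - s\<bar> * \<bar>r - s\<bar>" by (simp add: power2_eq_square)
    have w: "norm (U r - U s) \<le> M * \<bar>r - s\<bar>" by (rule weak_time_lipschitz[OF dense wd M r s])
    have "\<bar>(T r (U s) - T s (U s)) \<bullet> (U r - U s)\<bar> \<le> norm (T r (U s) - T s (U s)) * norm (U r - U s)"
      by (rule Cauchy_Schwarz_ineq2)
    also have "\<dots> \<le> (\<bar>L\<bar> * \<bar>r - s\<bar> * norm (U s)) * (M * \<bar>r - s\<bar>)"
      using order_trans[OF L[OF r, of "U s"] mult_right_mono[OF mult_right_mono[OF abs_ge_self[of L] abs_ge_zero[of "r - s"]] norm_ge_zero[of "U s"]]]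
      by (intro mult_mono w) auto
    finally have 1: "\<bar>(T r (U s) - T s (U s)) \<bullet> (U r - U s)\<bar> \<le> \<bar>L\<bar> * norm (U s) * M * (r - s)\<^sup>2"
      unfolding sq by (simp only: power2_eq_square mult_ac)
    have "\<bar>T r (U r - U s) \<bullet> (U r - U s)\<bar> \<le> norm (T r (U r - U s)) * norm (U r - U s)"
      by (rule Cauchy_Schwarz_ineq2)
    also have "\<dots> \<le> (\<bar>K\<bar> * norm (U r - U s)) * norm (U r - U s)"
      using order_trans[OF K[OF r, of "U r - U s"] mult_right_mono[OF abs_ge_self[of K] norm_ge_zero[of "U r - U s"]]]
      by (intro mult_right_mono) auto
    also have "\<dots> \<le> (\<bar>K\<bar> * (M * \<bar>r - s\<bar>)) * (M * \<bar>r - s\<bar>)"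
      using w M0 by (intro mult_mono) auto
    finally have 2: "\<bar>T r (U r - U s) \<bullet> (U r - U s)\<bar> \<le> \<bar>K\<bar> * M\<^sup>2 * (r - s)\<^sup>2"
      unfolding sq by (simp only: power2_eq_square mult_ac)
    show ?thesis
      using 1 2 unfolding R_def by (simp add: algebra_simps)
  qed
  have "((\<lambda>r. T r (U s) \<bullet> U s + 2 * (T s (U s) \<bullet> U r - T s (U s) \<bullet> U s) + R r)
      has_real_derivative d + 2 * (T s (U s) \<bullet> V s - 0) + 0) (at s within {0..t})"
    by (intro DERIV_add d DERIV_cmult DERIV_diff weak_time_derivative[OF dense wd M s] DERIV_const
        has_real_derivative_zero_of_quadratic[OF Rb s])
  then have "((\<lambda>r. T r (U r) \<bullet> U r) has_real_derivative d + 2 * (T s (U s) \<bullet> V s - 0) + 0) (at s within {0..t})"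
    by (rule has_field_derivative_transform_within[OF _ zero_less_one s]) (simp add: eq)
  then show ?thesis by simp
qed

text \<open>\<open>energy_rate t E D\<close> encodes that \<open>E\<close> is absolutely continuous on \<open>[0, t]\<close> with
  derivative \<open>D\<close>, in a form that is linear in \<open>(E, D)\<close>, stable under bounded pointwise limits and
  directly usable with the integrating factor \<open>exp (\<theta> s)\<close>.\<close>

definition energy_rate :: "real \<Rightarrow> (real \<Rightarrow> real) \<Rightarrow> (real \<Rightarrow> real) \<Rightarrow> bool" where
  "energy_rate t E D \<longleftrightarrow>
     (\<forall>\<theta>. ((\<lambda>s. exp (\<theta> * s) * (\<theta> * E s + D s)) has_integral exp (\<theta> * t) * E t - E 0) {0..t})"

lemma energy_rate_add:
  assumes "energy_rate t E D" "energy_rate t E' D'"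
  shows "energy_rate t (\<lambda>s. E s + E' s) (\<lambda>s. D s + D' s)"
  unfolding energy_rate_def
proof
  fix \<theta>
  have "((\<lambda>s. exp (\<theta> * s) * (\<theta> * E s + D s) + exp (\<theta> * s) * (\<theta> * E' s + D' s)) has_integral
      (exp (\<theta> * t) * E t - E 0) + (exp (\<theta> * t) * E' t - E' 0)) {0..t}"
    using assms by (intro has_integral_add) (auto simp: energy_rate_def)
  then show "((\<lambda>s. exp (\<theta> * s) * (\<theta> * (E s + E' s) + (D s + D' s))) has_integral
      exp (\<theta> * t) * (E t + E' t) - (E 0 + E' 0)) {0..t}"
    by (simp add: algebra_simps)
qed

lemma energy_rate_cmult:
  assumes "energy_rate t E D"
  shows "energy_rate t (\<lambda>s. c * E s) (\<lambda>s. c * D s)"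
  unfolding energy_rate_def
proof
  fix \<theta>
  have "((\<lambda>s. c * (exp (\<theta> * s) * (\<theta> * E s + D s))) has_integral c * (exp (\<theta> * t) * E t - E 0)) {0..t}"
    using assms by (intro has_integral_mult_right) (auto simp: energy_rate_def)
  then show "((\<lambda>s. exp (\<theta> * s) * (\<theta> * (c * E s) + c * D s)) has_integral
      exp (\<theta> * t) * (c * E t) - c * E 0) {0..t}"
    by (simp add: algebra_simps)
qed

text \<open>The fundamental theorem for the gauge integral asks for no continuity of
  \<open>Dn n\<close>, so each member satisfies the integrated identity; the bound \<open>K\<close>,
  uniform in n, allows passing to the limit under the integral.\<close>

lemma energy_rate_limit:
  assumes t: "0 \<le> t"
    and d: "\<And>n s. s \<in> {0..t} \<Longrightarrow> (En n has_real_derivative Dn n s) (at s within {0..t})"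
    and lim: "\<And>s. s \<in> {0..t} \<Longrightarrow> (\<lambda>n. En n s) \<longlonglongrightarrow> E s" "\<And>s. s \<in> {0..t} \<Longrightarrow> (\<lambda>n. Dn n s) \<longlonglongrightarrow> D s"
    and b: "\<And>n s. s \<in> {0..t} \<Longrightarrow> \<bar>En n s\<bar> \<le> K" "\<And>n s. s \<in> {0..t} \<Longrightarrow> \<bar>Dn n s\<bar> \<le> K"
  shows "energy_rate t E D"
  unfolding energy_rate_def
proof
  fix \<theta> :: real
  define f where "f n s = exp (\<theta> * s) * (\<theta> * En n s + Dn n s)" for n s
  have int: "(f n has_integral exp (\<theta> * t) * En n t - exp (\<theta> * 0) * En n 0) {0..t}" for n
  proof (rule fundamental_theorem_of_calculus[OF t])
    fix s assume s: "s \<in> {0..t}"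
    have "((\<lambda>s. exp (\<theta> * s) * En n s) has_real_derivative exp (\<theta> * s) * \<theta> * En n s + Dn n s * exp (\<theta> * s)) (at s within {0..t})"
      by (rule DERIV_mult[OF _ d[OF s]]) (auto intro!: derivative_eq_intros)
    then show "((\<lambda>s. exp (\<theta> * s) * En n s) has_vector_derivative f n s) (at s within {0..t})"
      by (simp add: has_real_derivative_iff_has_vector_derivative f_def algebra_simps)
  qed
  have h: "(\<lambda>s. exp (\<theta> * s) * ((\<bar>\<theta>\<bar> + 1) * K)) integrable_on {0..t}"
    by (intro integrable_continuous_interval continuous_intros)
  have le: "norm (f n s) \<le> exp (\<theta> * s) * ((\<bar>\<theta>\<bar> + 1) * K)" if "s \<in> {0..t}" for n s
  proof -
    have "\<bar>\<theta> * En n s + Dn n s\<bar> \<le> \<bar>\<theta>\<bar> * \<bar>En n s\<bar> + \<bar>Dn n s\<bar>"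
      using abs_triangle_ineq[of "\<theta> * En n s" "Dn n s"] by (simp add: abs_mult)
    also have "\<dots> \<le> \<bar>\<theta>\<bar> * K + K"
      using b[OF that, of n] by (intro add_mono mult_left_mono) auto
    finally have "\<bar>\<theta> * En n s + Dn n s\<bar> \<le> (\<bar>\<theta>\<bar> + 1) * K" by (simp add: algebra_simps)
    then show ?thesis
      unfolding f_def by (simp add: abs_mult mult_left_mono)
  qed
  have l: "(\<lambda>n. f n s) \<longlonglongrightarrow> exp (\<theta> * s) * (\<theta> * E s + D s)" if "s \<in> {0..t}" for s
    unfolding f_def by (intro tendsto_intros lim that)
  have fi: "f n integrable_on {0..t}" for n
    using int[of n] by (rule has_integral_integrable)
  note dc = dominated_convergence[OF fi h le l]
  have "(\<lambda>n. integral {0..t} (f n)) \<longlonglongrightarrow> exp (\<theta> * t) * E t - E 0"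
  proof -
    have "integral {0..t} (f n) = exp (\<theta> * t) * En n t - En n 0" for n
      using integral_unique[OF int[of n]] by simp
    then show ?thesis using t by (simp, intro tendsto_intros lim) auto
  qed
  from LIMSEQ_unique[OF dc(2) this] integrable_integral[OF dc(1)]
  show "((\<lambda>s. exp (\<theta> * s) * (\<theta> * E s + D s)) has_integral exp (\<theta> * t) * E t - E 0) {0..t}"
    by simp
qed

section \<open>Energy identities for a forced Schroedinger equation\<close>

text \<open>Test the weak derivative with the stretched bumps rho (x / (n + 1)). The side with h is
  of order 1/n, the other tends to rho(0) times the integral of k. Thus no pointwise decay at
  infinity has to be established.\<close>

lemma ac_deriv_integral_zero:
  fixes h k :: "real \<Rightarrow> 'a::euclidean_space"
  assumes hk: "ac_deriv h k" and h: "integrable lborel h" and k: "integrable lborel k"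
  shows "(\<integral>x. k x \<partial>lborel) = 0"
proof -
  obtain \<rho> :: "real \<Rightarrow> real" where r: "test_function \<rho>" "\<rho> 0 > 0" using exists_bump by metis
  define e where "e n x = 1 *\<^sub>R \<rho> ((1 / (real n + 1)) * x + 0)" for n x
  have te: "test_function (e n)" for n
    unfolding e_def[abs_def] by (rule test_function_affine[OF r(1)]) simp
  have de: "nth_deriv 1 (e n) x = (1 / (real n + 1)) * nth_deriv 1 \<rho> ((1 / (real n + 1)) * x + 0)" for n x
    unfolding e_def[abs_def] using smooth_affine(2)[of \<rho> 1 1 "1 / (real n + 1)" 0] r(1)
    by (simp add: test_function_def)
  obtain B R where B: "B > 0" "\<And>x. norm (\<rho> x) \<le> B * indicator {-R..R} x"
    using csc_bounds[OF test_function_csc0[OF r(1)]] by metis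
  have B': "\<bar>\<rho> x\<bar> \<le> B" for x using B(2)[of x] B(1) by (cases "x \<in> {-R..R}") auto
  obtain C S where C: "C > 0" "\<And>x. norm (nth_deriv 1 \<rho> x) \<le> C * indicator {-S..S} x"
    using csc_bounds[OF test_function_csc[OF r(1)]] by metis
  have C': "\<bar>nth_deriv 1 \<rho> x\<bar> \<le> C" for x using C(2)[of x] C(1) by (cases "x \<in> {-S..S}") auto
  have [measurable]: "h \<in> borel_measurable borel" "k \<in> borel_measurable borel" using h k by auto
  have [measurable]: "e n \<in> borel_measurable borel" "nth_deriv 1 (e n) \<in> borel_measurable borel" for n
    using csc_borel[OF test_function_csc0[OF te]] csc_borel[OF test_function_csc[OF te]] by auto
  have eq: "(\<integral>x. nth_deriv 1 (e n) x *\<^sub>R h x \<partial>lborel) = - (\<integral>x. e n x *\<^sub>R k x \<partial>lborel)" for n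
    using has_weak_derivD[OF ac_deriv_imp_weak[OF hk] te] by simp
  have l0: "(\<lambda>n. 1 / (real n + 1)) \<longlonglongrightarrow> 0"
    using LIMSEQ_inverse_real_of_nat by (simp add: inverse_eq_divide add.commute)
  have 1: "(\<lambda>n. \<integral>x. e n x *\<^sub>R k x \<partial>lborel) \<longlonglongrightarrow> (\<integral>x. \<rho> 0 *\<^sub>R k x \<partial>lborel)"
  proof (rule integral_dominated_convergence)
    show "integrable lborel (\<lambda>x. B * norm (k x))" using k by simp
    show "AE x in lborel. (\<lambda>n. e n x *\<^sub>R k x) \<longlonglongrightarrow> \<rho> 0 *\<^sub>R k x"
    proof (intro AE_I2 tendsto_scaleR tendsto_const)
      fix x
      have "(\<lambda>n. (1 / (real n + 1)) * x + 0) \<longlonglongrightarrow> 0 * x + 0" by (intro tendsto_intros l0)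
      moreover have "isCont \<rho> 0"
        using csc_cont[OF test_function_csc0[OF r(1)]] continuous_on_eq_continuous_at by blast
      ultimately show "(\<lambda>n. e n x) \<longlonglongrightarrow> \<rho> 0"
        unfolding e_def by (simp, intro isCont_tendsto_compose[of 0 \<rho>]) auto
    qed
    show "AE x in lborel. norm (e n x *\<^sub>R k x) \<le> B * norm (k x)" for n
      using B' by (intro AE_I2) (simp add: e_def mult_right_mono)
  qed measurable
  have 2: "(\<lambda>n. \<integral>x. nth_deriv 1 (e n) x *\<^sub>R h x \<partial>lborel) \<longlonglongrightarrow> 0"
  proof (rule Lim_null_comparison[OF always_eventually])
    show "\<forall>n. norm (\<integral>x. nth_deriv 1 (e n) x *\<^sub>R h x \<partial>lborel) \<le> (1 / (real n + 1)) * (\<integral>x. C * norm (h x) \<partial>lborel)"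
    proof
      fix n
      have b: "norm (nth_deriv 1 (e n) x *\<^sub>R h x) \<le> (1 / (real n + 1)) * (C * norm (h x))" for x
        using C'[of "(1 / (real n + 1)) * x + 0"] unfolding de
        by (simp add: abs_mult divide_right_mono mult_right_mono)
      have i: "integrable lborel (\<lambda>x. (1 / (real n + 1)) * (C * norm (h x)))" using h by simp
      have "integrable lborel (\<lambda>x. nth_deriv 1 (e n) x *\<^sub>R h x)"
      proof (rule Bochner_Integration.integrable_bound[OF i])
        show "AE x in lborel. norm (nth_deriv 1 (e n) x *\<^sub>R h x) \<le> norm ((1 / (real n + 1)) * (C * norm (h x)))"
          by (intro AE_I2 order_trans[OF b]) (simp only: real_norm_def abs_ge_self)
      qed measurable
      then have "norm (\<integral>x. nth_deriv 1 (e n) x *\<^sub>R h x \<partial>lborel) \<le> (\<integral>x. (1 / (real n + 1)) * (C * norm (h x)) \<partial>lborel)"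
        by (rule Bochner_Integration.integral_norm_bound_integral[OF _ i b])
      then show "norm (\<integral>x. nth_deriv 1 (e n) x *\<^sub>R h x \<partial>lborel) \<le> (1 / (real n + 1)) * (\<integral>x. C * norm (h x) \<partial>lborel)"
        by simp
    qed
    have "(\<lambda>n. (1 / (real n + 1)) * (\<integral>x. C * norm (h x) \<partial>lborel)) \<longlonglongrightarrow> 0 * (\<integral>x. C * norm (h x) \<partial>lborel)"
      by (intro tendsto_intros l0)
    then show "(\<lambda>n. (1 / (real n + 1)) * (\<integral>x. C * norm (h x) \<partial>lborel)) \<longlonglongrightarrow> 0" by simp
  qed
  have "(\<lambda>n. \<integral>x. nth_deriv 1 (e n) x *\<^sub>R h x \<partial>lborel) \<longlonglongrightarrow> - (\<integral>x. \<rho> 0 *\<^sub>R k x \<partial>lborel)"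
    unfolding eq by (intro tendsto_intros 1)
  from LIMSEQ_unique[OF 2 this] show ?thesis using r(2) k by simp
qed

lemma integral_inner_by_parts:
  fixes f f' g g' :: "real \<Rightarrow> 'a::euclidean_space"
  assumes "ac_deriv f f'" "ac_deriv g g'" "in_L2 f" "in_L2 f'" "in_L2 g" "in_L2 g'"
  shows "(\<integral>x. f x \<bullet> g' x \<partial>lborel) = - (\<integral>x. f' x \<bullet> g x \<partial>lborel)"
proof -
  note i = integrable_inner_L2
  have "(\<integral>x. f' x \<bullet> g x + f x \<bullet> g' x \<partial>lborel) = 0"
    by (rule ac_deriv_integral_zero[OF ac_deriv_bilinear[OF bounded_bilinear_inner assms(1,2)]])
       (intro Bochner_Integration.integrable_add i assms)+
  then show ?thesis using i[OF assms(4,5)] i[OF assms(3,6)] by simp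
qed

lemma ac_deriv_bounded_linear:
  fixes f g :: "real \<Rightarrow> 'a::euclidean_space" and T :: "'a \<Rightarrow> 'b::euclidean_space"
  assumes T: "bounded_linear T" and fg: "ac_deriv f g"
  shows "ac_deriv (\<lambda>x. T (f x)) (\<lambda>x. T (g x))"
proof -
  have i: "integrable lborel (\<lambda>x. indicat_real {a..b} x *\<^sub>R g x)" for a b
    using fg by (simp add: ac_deriv_def set_integrable_def)
  have "set_integrable lborel {a..b} (\<lambda>x. T (g x))" for a b
    using integrable_bounded_linear[OF T i[of a b]] by (simp add: set_integrable_def linear_simps[OF T])
  moreover have "T (f b) - T (f a) = (LINT x:{a..b}|lborel. T (g x))" if "a \<le> b" for a b
    using integral_bounded_linear[OF T i[of a b]] fg that
    by (simp add: set_lebesgue_integral_def linear_simps[OF T] ac_deriv_def flip: linear_simps(2)[OF T])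
  moreover have "continuous_on UNIV (\<lambda>x. T (f x))"
    using fg by (intro bounded_linear.continuous_on[OF T]) (simp add: ac_deriv_def)
  ultimately show ?thesis by (simp add: ac_deriv_def)
qed

section \<open>Conjugate-linear multiplication operators and complex test vectors\<close>

lemma rep_l2: "in_L2 (rep_l2 u)" "to_l2 (rep_l2 u) = u"
  using Quotient_rep_reflp[OF Quotient_l2, of u] Quotient_abs_rep[OF Quotient_l2, of u]
  by (auto simp: to_l2_def)

text \<open>Conjugation followed by multiplication by b. For the real inner product this operator is
  real linear and symmetric, so u -> conj_mult b u . u = Re int b (conj u)^2 is a quadratic form to
  which \<open>quadratic_form_derivative\<close> applies.\<close>

definition conj_mult :: "(real \<Rightarrow> complex) \<Rightarrow> complex l2 \<Rightarrow> complex l2" where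
  "conj_mult b u = to_l2 (\<lambda>x. b x * cnj (rep_l2 u x))"

lemma in_L2_cnj: "in_L2 f \<Longrightarrow> in_L2 (\<lambda>x. cnj (f x))"
  by (rule in_L2_bounded_linear[OF bounded_linear_cnj])

lemma L2_nrm_cnj: "L2_nrm (\<lambda>x. cnj (f x)) = L2_nrm f"
  by (simp add: L2_nrm_def)

lemma
  assumes "b \<in> borel_measurable borel" "\<And>x. cmod (b x) \<le> K" "in_L2 f"
  shows in_L2_conj_mult: "in_L2 (\<lambda>x. b x * cnj (f x))"
    and L2_nrm_conj_mult: "L2_nrm (\<lambda>x. b x * cnj (f x)) \<le> K * L2_nrm f"
  using L2_nrm_mult_bound[OF assms(1,2) in_L2_cnj[OF assms(3)]] by (auto simp: L2_nrm_cnj)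

lemma conj_mult_to_l2:
  assumes "b \<in> borel_measurable borel" "\<And>x. cmod (b x) \<le> K" "in_L2 f"
  shows "conj_mult b (to_l2 f) = to_l2 (\<lambda>x. b x * cnj (f x))"
proof -
  have "AE x in lborel. rep_l2 (to_l2 f) x = f x"
    using to_l2_eq_iff[OF rep_l2(1) assms(3), of "to_l2 f"] rep_l2(2)[of "to_l2 f"] by simp
  then have "AE x in lborel. b x * cnj (rep_l2 (to_l2 f) x) = b x * cnj (f x)"
    by eventually_elim simp
  then show ?thesis
    unfolding conj_mult_def
    by (subst to_l2_eq_iff) (auto intro: in_L2_conj_mult[OF assms(1,2)] rep_l2(1) assms(3))
qed

lemma conj_mult_add:
  assumes b: "b \<in> borel_measurable borel" "\<And>x. cmod (b x) \<le> K"
  shows "conj_mult b (u + v) = conj_mult b u + conj_mult b v"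
proof -
  obtain f where f: "in_L2 f" "u = to_l2 f" by (rule to_l2_cases)
  obtain g where g: "in_L2 g" "v = to_l2 g" by (rule to_l2_cases)
  show ?thesis
    using f g by (simp add: to_l2_add in_L2_add conj_mult_to_l2[OF b] in_L2_conj_mult[OF b] distrib_left)
qed

lemma conj_mult_diff:
  assumes b: "b \<in> borel_measurable borel" "\<And>x. cmod (b x) \<le> K"
  shows "conj_mult b (u - v) = conj_mult b u - conj_mult b v"
  using conj_mult_add[OF b, of "u - v" v] by (simp add: algebra_simps)

lemma norm_conj_mult:
  assumes b: "b \<in> borel_measurable borel" "\<And>x. cmod (b x) \<le> K"
  shows "norm (conj_mult b u) \<le> K * norm u"
proof -
  obtain f where f: "in_L2 f" "u = to_l2 f" by (rule to_l2_cases)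
  show ?thesis
    using f L2_nrm_conj_mult[OF b f(1)] by (simp add: conj_mult_to_l2[OF b] norm_to_l2 in_L2_conj_mult[OF b])
qed

lemma norm_conj_mult_diff:
  assumes b: "b \<in> borel_measurable borel" "\<And>x. cmod (b x) \<le> K"
    and b': "b' \<in> borel_measurable borel" "\<And>x. cmod (b' x) \<le> K'"
    and d: "\<And>x. cmod (b x - b' x) \<le> L"
  shows "norm (conj_mult b u - conj_mult b' u) \<le> L * norm u"
proof -
  obtain f where f: "in_L2 f" "u = to_l2 f" by (rule to_l2_cases)
  have m: "(\<lambda>x. b x - b' x) \<in> borel_measurable borel" using b(1) b'(1) by measurable
  have "conj_mult b u - conj_mult b' u = conj_mult (\<lambda>x. b x - b' x) u"
    using f(1) unfolding f(2)
    by (simp add: conj_mult_to_l2[OF b] conj_mult_to_l2[OF b'] conj_mult_to_l2[OF m d] to_l2_diff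
        in_L2_conj_mult[OF b] in_L2_conj_mult[OF b'] left_diff_distrib)
  then show ?thesis using norm_conj_mult[OF m d] by simp
qed

lemma conj_mult_sym:
  assumes b: "b \<in> borel_measurable borel" "\<And>x. cmod (b x) \<le> K"
  shows "conj_mult b u \<bullet> v = conj_mult b v \<bullet> u"
proof -
  obtain f where f: "in_L2 f" "u = to_l2 f" by (rule to_l2_cases)
  obtain g where g: "in_L2 g" "v = to_l2 g" by (rule to_l2_cases)
  have "(b x * cnj (f x)) \<bullet> g x = (b x * cnj (g x)) \<bullet> f x" for x
    by (simp add: inner_complex_def algebra_simps)
  then show ?thesis
    using f g by (simp add: conj_mult_to_l2[OF b] in_L2_conj_mult[OF b] inner_to_l2)
qed

lemma tendsto_conj_mult:
  assumes b: "b \<in> borel_measurable borel" "\<And>x. cmod (b x) \<le> K" and u: "(u \<longlongrightarrow> l) F"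
  shows "((\<lambda>n. conj_mult b (u n)) \<longlongrightarrow> conj_mult b l) F"
proof (rule LIM_zero_cancel, rule Lim_null_comparison[OF always_eventually])
  show "\<forall>n. norm (conj_mult b (u n) - conj_mult b l) \<le> K * norm (u n - l)"
    using norm_conj_mult[OF b] by (simp add: conj_mult_diff[OF b, symmetric])
  have "((\<lambda>n. K * norm (u n - l)) \<longlongrightarrow> K * norm (l - l)) F"
    by (intro tendsto_intros u)
  then show "((\<lambda>n. K * norm (u n - l)) \<longlongrightarrow> 0) F" by simp
qed

definition complex_tests :: "complex l2 set" where
  "complex_tests = {to_l2 (\<lambda>x. complex_of_real (\<eta> x) + \<i> * complex_of_real (\<zeta> x)) |\<eta> \<zeta>.
     test_function \<eta> \<and> test_function \<zeta>}"

lemma closure_complex_tests: "closure complex_tests = UNIV"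
proof (intro set_eqI iffI UNIV_I)
  fix u :: "complex l2"
  show "u \<in> closure complex_tests"
    unfolding closure_approachable
  proof (intro allI impI)
    fix e :: real assume "e > 0"
    then obtain \<eta> \<zeta> where "test_function \<eta>" "test_function \<zeta>"
      "norm (u - to_l2 (\<lambda>x. complex_of_real (\<eta> x) + \<i> * complex_of_real (\<zeta> x))) < e"
      by (rule test_functions_dense)
    then show "\<exists>y\<in>complex_tests. dist y u < e"
      by (intro bexI[of _ "to_l2 (\<lambda>x. complex_of_real (\<eta> x) + \<i> * complex_of_real (\<zeta> x))"])
         (auto simp: complex_tests_def dist_norm norm_minus_commute)
  qed
qed

text \<open>Conjugating eta + i zeta in the real inner product leaves a real part of the integral
  against eta and an imaginary part of the one against zeta. The equation tested with real functions
  thereby controls pairings with a dense set.\<close>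

lemma inner_complex_test:
  assumes e: "test_function \<eta>" "test_function \<zeta>" and f: "in_L2 f"
  shows "to_l2 (\<lambda>x. complex_of_real (\<eta> x) + \<i> * complex_of_real (\<zeta> x)) \<bullet> to_l2 f
    = Re (\<integral>x. \<eta> x *\<^sub>R f x \<partial>lborel) + Im (\<integral>x. \<zeta> x *\<^sub>R f x \<partial>lborel)"
proof -
  have L: "in_L2 (\<lambda>x. complex_of_real (\<eta> x))" "in_L2 (\<lambda>x. \<i> * complex_of_real (\<zeta> x))"
    using csc_in_L2[OF test_function_csc0[OF e(1)]] csc_in_L2[OF test_function_csc0[OF e(2)]]
    by (auto intro!: in_L2_bounded_linear[OF bounded_linear_of_real]
        in_L2_bounded_linear[OF bounded_linear_compose[OF bounded_linear_mult_right bounded_linear_of_real, of \<i>]])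
  note i = integrable_test_L2_0[OF e(1) f] integrable_test_L2_0[OF e(2) f]
  have "to_l2 (\<lambda>x. complex_of_real (\<eta> x) + \<i> * complex_of_real (\<zeta> x)) \<bullet> to_l2 f
      = (\<integral>x. Re (\<eta> x *\<^sub>R f x) + Im (\<zeta> x *\<^sub>R f x) \<partial>lborel)"
    by (subst inner_to_l2[OF in_L2_add[OF L] f]) (simp add: inner_complex_def)
  also have "\<dots> = (\<integral>x. Re (\<eta> x *\<^sub>R f x) \<partial>lborel) + (\<integral>x. Im (\<zeta> x *\<^sub>R f x) \<partial>lborel)"
    by (rule Bochner_Integration.integral_add) (intro integrable_Re integrable_Im i)+
  also have "\<dots> = Re (\<integral>x. \<eta> x *\<^sub>R f x \<partial>lborel) + Im (\<integral>x. \<zeta> x *\<^sub>R f x \<partial>lborel)"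
    using i by (simp only: integral_Re integral_Im)
  finally show ?thesis .
qed

text \<open>The second derivative of an even kernel is even, so \<open>conv_adjoint\<close> also
  applies to the dispersive term.\<close>

lemma nth_deriv_moll_even: "nth_deriv 2 (moll n) (- x) = nth_deriv 2 (moll n) x"
proof -
  have "(\<lambda>y. moll n (0 - y)) = moll n" using moll_even by auto
  then have "nth_deriv 2 (moll n) = (\<lambda>y. (- 1) ^ 2 * nth_deriv 2 (moll n) (0 - y))"
    using test_function_reflect(2)[OF test_function_moll[of n], of 2 0] by simp
  from fun_cong[OF this, of x] show ?thesis by simp
qed

text \<open>Weak form of u_t = -i beta u_xx + g with u and g merely bounded in L2. Later u is a
  derivative of the perturbation w and g the same derivative of all terms without
  dispersion.\<close>

locale forced_schroedinger =
  fixes t \<beta> :: real and u g :: "real \<Rightarrow> real \<Rightarrow> complex" and M :: real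
  assumes t: "0 \<le> t"
    and uL: "\<And>s. s \<in> {0..t} \<Longrightarrow> in_L2 (u s)" and uM: "\<And>s. s \<in> {0..t} \<Longrightarrow> L2_nrm (u s) \<le> M"
    and gL: "\<And>s. s \<in> {0..t} \<Longrightarrow> in_L2 (g s)" and gM: "\<And>s. s \<in> {0..t} \<Longrightarrow> L2_nrm (g s) \<le> M"
    and weak: "\<And>\<eta> s. test_function \<eta> \<Longrightarrow> s \<in> {0..t} \<Longrightarrow>
      ((\<lambda>r. \<integral>x. \<eta> x *\<^sub>R u r x \<partial>lborel) has_vector_derivative
        (\<integral>x. nth_deriv 2 \<eta> x *\<^sub>R (- (\<i> * of_real \<beta>) * u s x) \<partial>lborel) + (\<integral>x. \<eta> x *\<^sub>R g s x \<partial>lborel))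
      (at s within {0..t})"
begin

lemma M_nonneg: "0 \<le> M"
  using order_trans[OF L2_nrm_nonneg uM[of 0]] t by simp

definition um :: "nat \<Rightarrow> nat \<Rightarrow> real \<Rightarrow> real \<Rightarrow> complex" where
  "um j n s = conv (nth_deriv j (moll n)) (u s)"

definition gm :: "nat \<Rightarrow> real \<Rightarrow> real \<Rightarrow> complex" where
  "gm n s = conv (moll n) (g s)"

text \<open>The time derivative of the mollified solution. It lies in L2 for each n because both
  space derivatives fall on the kernel.\<close>

definition vm :: "nat \<Rightarrow> real \<Rightarrow> real \<Rightarrow> complex" where
  "vm n s x = - (\<i> * of_real \<beta>) * um 2 n s x + gm n s x"

lemma umL: "s \<in> {0..t} \<Longrightarrow> in_L2 (um j n s)"
  unfolding um_def by (intro in_L2_conv test_function_csc test_function_moll uL)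

lemma gmL: "s \<in> {0..t} \<Longrightarrow> in_L2 (gm n s)"
  unfolding gm_def by (intro in_L2_conv csc_moll gL)

lemma cmultL: "in_L2 f \<Longrightarrow> in_L2 (\<lambda>x. c * f x :: complex)"
  by (rule in_L2_bounded_linear[OF bounded_linear_mult_right])

lemma vmL: "s \<in> {0..t} \<Longrightarrow> in_L2 (vm n s)"
  unfolding vm_def[abs_def] by (intro in_L2_add cmultL umL gmL)

lemma um_ac: "s \<in> {0..t} \<Longrightarrow> ac_deriv (um j n s) (um (Suc j) n s)"
proof (rule ac_deriv_C1)
  assume s: "s \<in> {0..t}"
  have eq: "um (j + i) n s = nth_deriv i (um j n s)" for i j
    using nth_deriv_conv[OF test_function_nth_deriv[OF test_function_moll] uL[OF s], of i j n]
    by (simp add: um_def nth_deriv_add[symmetric] add.commute)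
  have sm: "smooth (um j n s)" for j
    unfolding um_def by (rule smooth_conv[OF test_function_nth_deriv[OF test_function_moll] uL[OF s]])
  show "(um j n s has_vector_derivative um (Suc j) n s x) (at x)" for x
    using smooth_deriv[OF sm[of j], of 0 x] eq[of j 1] by simp
  show "continuous_on UNIV (um (Suc j) n s)"
    using smooth_continuous[OF sm[of "Suc j"], of 0] by simp
qed

lemma um_0: "um 0 n s = conv (moll n) (u s)"
  by (simp add: um_def)

text \<open>Testing the mollified function is testing u with the mollified test function, and the
  second derivative passes back to the kernel in the same way.\<close>

lemma moll_weak:
  assumes e: "test_function \<eta>" and s: "s \<in> {0..t}"
  shows "((\<lambda>r. \<integral>x. \<eta> x *\<^sub>R um 0 n r x \<partial>lborel) has_vector_derivative (\<integral>x. \<eta> x *\<^sub>R vm n s x \<partial>lborel)) (at s within {0..t})"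
proof -
  note ce = test_function_csc0[OF e]
  let ?e = "conv (moll n) \<eta>"
  have eq: "(\<integral>x. \<eta> x *\<^sub>R um 0 n r x \<partial>lborel) = (\<integral>x. ?e x *\<^sub>R u r x \<partial>lborel)" if "r \<in> {0..t}" for r
    unfolding um_0 by (rule conv_adjoint[OF csc_moll moll_even ce uL[OF that], symmetric])
  have L: "in_L2 (\<lambda>x. - (\<i> * of_real \<beta>) * u s x)" by (intro cmultL uL s)
  have "(\<integral>x. nth_deriv 2 ?e x *\<^sub>R (- (\<i> * of_real \<beta>) * u s x) \<partial>lborel)
      = (\<integral>x. \<eta> x *\<^sub>R conv (nth_deriv 2 (moll n)) (\<lambda>x. - (\<i> * of_real \<beta>) * u s x) x \<partial>lborel)"
    unfolding nth_deriv_conv[OF test_function_moll csc_in_L2[OF ce]]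
    by (rule conv_adjoint[OF test_function_csc[OF test_function_moll] nth_deriv_moll_even ce L])
  also have "conv (nth_deriv 2 (moll n)) (\<lambda>x. - (\<i> * of_real \<beta>) * u s x) = (\<lambda>x. - (\<i> * of_real \<beta>) * um 2 n s x)"
    unfolding um_def
    by (rule ext, rule conv_bounded_linear[OF bounded_linear_mult_right test_function_csc[OF test_function_moll] uL[OF s]])
  finally have 1: "(\<integral>x. nth_deriv 2 ?e x *\<^sub>R (- (\<i> * of_real \<beta>) * u s x) \<partial>lborel)
      = (\<integral>x. \<eta> x *\<^sub>R (- (\<i> * of_real \<beta>) * um 2 n s x) \<partial>lborel)" .
  have 2: "(\<integral>x. ?e x *\<^sub>R g s x \<partial>lborel) = (\<integral>x. \<eta> x *\<^sub>R gm n s x \<partial>lborel)"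
    unfolding gm_def by (rule conv_adjoint[OF csc_moll moll_even ce gL[OF s]])
  have "(\<integral>x. \<eta> x *\<^sub>R vm n s x \<partial>lborel)
     = (\<integral>x. \<eta> x *\<^sub>R (- (\<i> * of_real \<beta>) * um 2 n s x) \<partial>lborel) + (\<integral>x. \<eta> x *\<^sub>R gm n s x \<partial>lborel)"
    unfolding vm_def scaleR_add_right
    by (intro Bochner_Integration.integral_add integrable_test_L2_0[OF e] cmultL umL gmL s)
  then have d: "((\<lambda>r. \<integral>x. ?e x *\<^sub>R u r x \<partial>lborel) has_vector_derivative (\<integral>x. \<eta> x *\<^sub>R vm n s x \<partial>lborel)) (at s within {0..t})"
    using weak[OF test_function_conv[OF test_function_moll ce, of n] s] unfolding 1 2 by simp
  show ?thesis
    by (rule has_vector_derivative_transform[OF s _ d]) (rule eq)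
qed

lemma moll_weak_l2:
  assumes d: "d \<in> complex_tests" and s: "s \<in> {0..t}"
  shows "((\<lambda>r. d \<bullet> to_l2 (um 0 n r)) has_real_derivative d \<bullet> to_l2 (vm n s)) (at s within {0..t})"
proof -
  obtain \<eta> \<zeta> where e: "test_function \<eta>" "test_function \<zeta>"
    and d: "d = to_l2 (\<lambda>x. complex_of_real (\<eta> x) + \<i> * complex_of_real (\<zeta> x))"
    using d by (auto simp: complex_tests_def)
  have "((\<lambda>r. Re (\<integral>x. \<eta> x *\<^sub>R um 0 n r x \<partial>lborel) + Im (\<integral>x. \<zeta> x *\<^sub>R um 0 n r x \<partial>lborel))
      has_vector_derivative Re (\<integral>x. \<eta> x *\<^sub>R vm n s x \<partial>lborel) + Im (\<integral>x. \<zeta> x *\<^sub>R vm n s x \<partial>lborel)) (at s within {0..t})"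
    by (intro has_vector_derivative_add bounded_linear.has_vector_derivative[OF bounded_linear_Re]
        bounded_linear.has_vector_derivative[OF bounded_linear_Im] moll_weak e s)
  then have "((\<lambda>r. d \<bullet> to_l2 (um 0 n r)) has_vector_derivative d \<bullet> to_l2 (vm n s)) (at s within {0..t})"
    unfolding d inner_complex_test[OF e vmL[OF s]]
    by (rule has_vector_derivative_transform[OF s inner_complex_test[OF e umL], rotated 1])
  then show ?thesis by (simp add: has_real_derivative_iff_has_vector_derivative)
qed

lemma norm_um_le: "s \<in> {0..t} \<Longrightarrow> norm (to_l2 (um 0 n s)) \<le> M"
  using L2_nrm_conv_moll_le[OF uL, of s n] uM[of s] by (simp add: norm_to_l2 umL um_0[symmetric])

lemma norm_gm_le: "s \<in> {0..t} \<Longrightarrow> norm (to_l2 (gm n s)) \<le> M"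
  using L2_nrm_conv_moll_le[OF gL, of s n] gM[of s] by (simp add: norm_to_l2 gmL gm_def[symmetric])

text \<open>The bound grows with n, since it contains the L1 norm of the second derivative of the
  kernel. It serves only differentiability at fixed n.\<close>

lemma norm_vm_le:
  obtains B where "\<And>s. s \<in> {0..t} \<Longrightarrow> norm (to_l2 (vm n s)) \<le> B"
proof
  fix s assume s: "s \<in> {0..t}"
  define A where "A = (\<integral>x. \<bar>nth_deriv 2 (moll n) x\<bar> \<partial>lborel)"
  have A: "0 \<le> A" by (simp add: A_def)
  have "L2_nrm (\<lambda>x. - (\<i> * of_real \<beta>) * um 2 n s x) \<le> \<bar>\<beta>\<bar> * L2_nrm (um 2 n s)"
    using cmultL[OF umL[OF s]] by (intro L2_nrm_cmult_bound umL s) (auto simp: norm_mult dest: in_L2_borel)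
  also have "\<dots> \<le> \<bar>\<beta>\<bar> * (A * M)"
    using L2_nrm_conv_le[OF test_function_csc[OF test_function_moll, of 2 n] uL[OF s]]
      mult_left_mono[OF uM[OF s] A]
    by (intro mult_left_mono) (auto simp: um_def A_def)
  finally have "L2_nrm (\<lambda>x. - (\<i> * of_real \<beta>) * um 2 n s x) \<le> \<bar>\<beta>\<bar> * (A * M)" .
  moreover have "L2_nrm (gm n s) \<le> M" using norm_gm_le[OF s, of n] unfolding norm_to_l2[OF gmL[OF s]] .
  moreover have "L2_nrm (vm n s) \<le> L2_nrm (\<lambda>x. - (\<i> * of_real \<beta>) * um 2 n s x) + L2_nrm (gm n s)"
    unfolding vm_def[abs_def] by (intro L2_nrm_triangle cmultL umL gmL s)
  ultimately show "norm (to_l2 (vm n s)) \<le> \<bar>\<beta>\<bar> * ((\<integral>x. \<bar>nth_deriv 2 (moll n) x\<bar> \<partial>lborel) * M) + M"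
    unfolding norm_to_l2[OF vmL[OF s]] A_def[symmetric] by linarith
qed

lemma um_tendsto: "s \<in> {0..t} \<Longrightarrow> (\<lambda>n. to_l2 (um 0 n s)) \<longlonglongrightarrow> to_l2 (u s)"
  unfolding um_0 by (rule to_l2_conv_moll_tendsto[OF uL])

lemma gm_tendsto: "s \<in> {0..t} \<Longrightarrow> (\<lambda>n. to_l2 (gm n s)) \<longlonglongrightarrow> to_l2 (g s)"
  unfolding gm_def by (rule to_l2_conv_moll_tendsto[OF gL])

text \<open>Integration by parts leaves the pairing of u_x with i beta u_x, which is 0 because
  multiplication by i is skew for the real inner product.\<close>

lemma inner_um_vm:
  assumes s: "s \<in> {0..t}"
  shows "to_l2 (um 0 n s) \<bullet> to_l2 (vm n s) = to_l2 (um 0 n s) \<bullet> to_l2 (gm n s)"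
proof -
  let ?c = "- (\<i> * of_real \<beta>)"
  have "ac_deriv (\<lambda>x. ?c * um 1 n s x) (\<lambda>x. ?c * um 2 n s x)"
    using ac_deriv_mult[OF ac_deriv_C1[of "\<lambda>_. ?c" "\<lambda>_. 0"] um_ac[OF s, of 1 n]]
    by (simp add: numeral_2_eq_2)
  from integral_inner_by_parts[OF um_ac[OF s, of 0 n] this[simplified]]
  have "(\<integral>x. um 0 n s x \<bullet> (?c * um 2 n s x) \<partial>lborel) = - (\<integral>x. um 1 n s x \<bullet> (?c * um 1 n s x) \<partial>lborel)"
    using s by (simp add: umL cmultL in_L2_uminus)
  also have "\<dots> = 0" by (simp add: inner_complex_def)
  finally have "to_l2 (um 0 n s) \<bullet> to_l2 (\<lambda>x. ?c * um 2 n s x) = 0"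
    by (subst inner_to_l2[OF umL[OF s] cmultL[OF umL[OF s]]])
  moreover have "to_l2 (vm n s) = to_l2 (\<lambda>x. ?c * um 2 n s x) + to_l2 (gm n s)"
    unfolding vm_def[abs_def] by (intro to_l2_add[symmetric] cmultL umL gmL s)
  ultimately show ?thesis by (simp add: inner_add_right)
qed

text \<open>Once the dispersive term is gone, the energies and their rates are bounded by M^2 up to
  a factor, independently of n, so the mollification can be removed in integrated form.\<close>

theorem energy_L2:
  "energy_rate t (\<lambda>s. (L2_nrm (u s))\<^sup>2) (\<lambda>s. 2 * (\<integral>x. u s x \<bullet> g s x \<partial>lborel))"
proof (rule energy_rate_limit[OF t])
  fix n s assume s: "s \<in> {0..t}"
  obtain B where B: "\<And>s. s \<in> {0..t} \<Longrightarrow> norm (to_l2 (vm n s)) \<le> B" using norm_vm_le[of n] by metis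
  have "((\<lambda>r. to_l2 (um 0 n r) \<bullet> to_l2 (um 0 n r)) has_real_derivative 0 + 2 * (to_l2 (um 0 n s) \<bullet> to_l2 (vm n s))) (at s within {0..t})"
    by (rule quadratic_form_derivative[OF closure_complex_tests moll_weak_l2 B s, where T = "\<lambda>_ u. u" and K = 1 and L = 0])
       (auto simp: inner_commute)
  then show "((\<lambda>r. to_l2 (um 0 n r) \<bullet> to_l2 (um 0 n r)) has_real_derivative 2 * (to_l2 (um 0 n s) \<bullet> to_l2 (gm n s))) (at s within {0..t})"
    by (simp add: inner_um_vm[OF s])
  have "norm (to_l2 (um 0 n s)) * norm (to_l2 (um 0 n s)) \<le> M * M"
    "norm (to_l2 (um 0 n s)) * norm (to_l2 (gm n s)) \<le> M * M"
    using norm_um_le[OF s, of n] norm_gm_le[OF s, of n] M_nonneg by (auto intro!: mult_mono)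
  then show "\<bar>to_l2 (um 0 n s) \<bullet> to_l2 (um 0 n s)\<bar> \<le> 2 * (M * M)"
    "\<bar>2 * (to_l2 (um 0 n s) \<bullet> to_l2 (gm n s))\<bar> \<le> 2 * (M * M)"
    using Cauchy_Schwarz_ineq2[of "to_l2 (um 0 n s)" "to_l2 (um 0 n s)"]
      Cauchy_Schwarz_ineq2[of "to_l2 (um 0 n s)" "to_l2 (gm n s)"] M_nonneg by auto
next
  fix s assume s: "s \<in> {0..t}"
  have "(\<lambda>n. to_l2 (um 0 n s) \<bullet> to_l2 (um 0 n s)) \<longlonglongrightarrow> to_l2 (u s) \<bullet> to_l2 (u s)"
    by (intro tendsto_intros um_tendsto s)
  then show "(\<lambda>n. to_l2 (um 0 n s) \<bullet> to_l2 (um 0 n s)) \<longlonglongrightarrow> (L2_nrm (u s))\<^sup>2"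
    by (simp only: power2_norm_eq_inner[symmetric] norm_to_l2[OF uL[OF s]])
  have "(\<lambda>n. 2 * (to_l2 (um 0 n s) \<bullet> to_l2 (gm n s))) \<longlonglongrightarrow> 2 * (to_l2 (u s) \<bullet> to_l2 (g s))"
    by (intro tendsto_intros um_tendsto gm_tendsto s)
  then show "(\<lambda>n. 2 * (to_l2 (um 0 n s) \<bullet> to_l2 (gm n s))) \<longlonglongrightarrow> 2 * (\<integral>x. u s x \<bullet> g s x \<partial>lborel)"
    by (simp only: inner_to_l2[OF uL[OF s] gL[OF s]])
qed

text \<open>Unlike the L2 norm, the form Re int b (conj u)^2 sees the dispersion. One integration by
  parts distributes the second derivative over both factors, so a first derivative \<open>ux\<close>
  in L2 is enough for the limit.\<close>

theorem energy_cross: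
  fixes b bs bx ux :: "real \<Rightarrow> real \<Rightarrow> complex"
  assumes uxL: "\<And>s. s \<in> {0..t} \<Longrightarrow> in_L2 (ux s)" and uxM: "\<And>s. s \<in> {0..t} \<Longrightarrow> L2_nrm (ux s) \<le> M"
    and ux: "\<And>s. s \<in> {0..t} \<Longrightarrow> has_weak_deriv 1 (u s) (ux s)"
    and bK: "\<And>s x. s \<in> {0..t} \<Longrightarrow> cmod (b s x) \<le> K" and bxK: "\<And>s x. s \<in> {0..t} \<Longrightarrow> cmod (bx s x) \<le> K"
    and bsK: "\<And>s x. s \<in> {0..t} \<Longrightarrow> cmod (bs s x) \<le> K"
    and bx: "\<And>s x. s \<in> {0..t} \<Longrightarrow> (b s has_vector_derivative bx s x) (at x)"
    and bxc: "\<And>s. s \<in> {0..t} \<Longrightarrow> continuous_on UNIV (bx s)"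
    and bs: "\<And>s x. s \<in> {0..t} \<Longrightarrow> ((\<lambda>r. b r x) has_vector_derivative bs s x) (at s within {0..t})"
    and bsm: "\<And>s. s \<in> {0..t} \<Longrightarrow> bs s \<in> borel_measurable borel"
    and blip: "\<And>r s x. r \<in> {0..t} \<Longrightarrow> s \<in> {0..t} \<Longrightarrow> cmod (b r x - b s x) \<le> K * \<bar>r - s\<bar>"
  shows "energy_rate t (\<lambda>s. \<integral>x. (b s x * cnj (u s x)) \<bullet> u s x \<partial>lborel)
    (\<lambda>s. (\<integral>x. (bs s x * cnj (u s x)) \<bullet> u s x \<partial>lborel)
      + 2 * (\<integral>x. (bx s x * cnj (u s x) + b s x * cnj (ux s x)) \<bullet> (\<i> * of_real \<beta> * ux s x) \<partial>lborel)
      + 2 * (\<integral>x. (b s x * cnj (u s x)) \<bullet> g s x \<partial>lborel))"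
proof -
  define ib where "ib = \<i> * complex_of_real \<beta>"
  have bac: "ac_deriv (b s) (bx s)" if "s \<in> {0..t}" for s
    by (rule ac_deriv_C1[OF bx bxc]) (use that in auto)
  have bm: "b s \<in> borel_measurable borel" "bx s \<in> borel_measurable borel" if "s \<in> {0..t}" for s
    using bac[OF that] bxc[OF that] by (auto simp: ac_deriv_def intro: borel_measurable_continuous_onI)
  note cm = conj_mult_to_l2[OF bm(1) bK] conj_mult_to_l2[OF bm(2) bxK] conj_mult_to_l2[OF bsm bsK]
  note cL = in_L2_conj_mult[OF bm(1) bK] in_L2_conj_mult[OF bm(2) bxK] in_L2_conj_mult[OF bsm bsK]
  have K: "0 \<le> K" using order_trans[OF norm_ge_zero bK[of 0 0]] t by simp
  define w where "w n s = to_l2 (um 0 n s)" for n s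
  define w1 where "w1 n s = to_l2 (um 1 n s)" for n s
  define iw1 where "iw1 n s = to_l2 (\<lambda>x. ib * um 1 n s x)" for n s
  \<comment> \<open>The contribution of the moving coefficient with the argument frozen: the
    Lipschitz bound on b gives K |f|^2 as a majorant of the difference quotients.\<close>
  have deriv_b: "((\<lambda>r. conj_mult (b r) (to_l2 f) \<bullet> to_l2 f) has_real_derivative conj_mult (bs s) (to_l2 f) \<bullet> to_l2 f) (at s within {0..t})"
    if s: "s \<in> {0..t}" and f: "in_L2 f" for s f
    unfolding has_real_derivative_iff_has_vector_derivative has_vector_derivative_within_seq
  proof (intro allI impI)
    fix X assume X: "\<forall>n. X n \<in> {0..t} - {s}" "X \<longlonglongrightarrow> s"
    then have XI: "X n \<in> {0..t}" "X n \<noteq> s" for n by auto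
    note [measurable] = in_L2_borel[OF f] in_L2_borel[OF in_L2_cnj[OF f]] bm(1)[OF XI(1)] bm(1)[OF s] bsm[OF s]
    have eq: "(conj_mult (b (X n)) (to_l2 f) \<bullet> to_l2 f - conj_mult (b s) (to_l2 f) \<bullet> to_l2 f) /\<^sub>R (X n - s)
        = (\<integral>x. (((b (X n) x - b s x) /\<^sub>R (X n - s)) * cnj (f x)) \<bullet> f x \<partial>lborel)" for n
    proof -
      have "conj_mult (b (X n)) (to_l2 f) \<bullet> to_l2 f - conj_mult (b s) (to_l2 f) \<bullet> to_l2 f
          = (\<integral>x. (b (X n) x * cnj (f x)) \<bullet> f x - (b s x * cnj (f x)) \<bullet> f x \<partial>lborel)"
        using integrable_inner_L2[OF cL(1)[OF XI(1)[of n] XI(1) f] f] integrable_inner_L2[OF cL(1)[OF s s f] f]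
        by (simp add: cm(1)[OF XI(1) XI(1) f] cm(1)[OF s s f] inner_to_l2[OF cL(1)[OF XI(1) XI(1) f] f] inner_to_l2[OF cL(1)[OF s s f] f])
      then have "(conj_mult (b (X n)) (to_l2 f) \<bullet> to_l2 f - conj_mult (b s) (to_l2 f) \<bullet> to_l2 f) /\<^sub>R (X n - s)
          = (\<integral>x. ((b (X n) x * cnj (f x)) \<bullet> f x - (b s x * cnj (f x)) \<bullet> f x) /\<^sub>R (X n - s) \<partial>lborel)"
        by simp
      also have "\<dots> = (\<integral>x. (((b (X n) x - b s x) /\<^sub>R (X n - s)) * cnj (f x)) \<bullet> f x \<partial>lborel)"
        by (rule Bochner_Integration.integral_cong) (auto simp: inner_diff_left algebra_simps)
      finally show ?thesis .
    qed
    have "(\<lambda>n. \<integral>x. (((b (X n) x - b s x) /\<^sub>R (X n - s)) * cnj (f x)) \<bullet> f x \<partial>lborel)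
        \<longlonglongrightarrow> (\<integral>x. (bs s x * cnj (f x)) \<bullet> f x \<partial>lborel)"
    proof (rule integral_dominated_convergence)
      show "integrable lborel (\<lambda>x. K * (norm (f x))\<^sup>2)" using in_L2_norm_sq[OF f] by simp
      show "AE x in lborel. (\<lambda>n. (((b (X n) x - b s x) /\<^sub>R (X n - s)) * cnj (f x)) \<bullet> f x) \<longlonglongrightarrow> (bs s x * cnj (f x)) \<bullet> f x"
        using bs[OF s] X unfolding has_vector_derivative_within_seq by (intro AE_I2 tendsto_intros) blast
      show "AE x in lborel. norm ((((b (X n) x - b s x) /\<^sub>R (X n - s)) * cnj (f x)) \<bullet> f x) \<le> K * (norm (f x))\<^sup>2" for n
      proof (rule AE_I2)
        fix x
        have "norm ((b (X n) x - b s x) /\<^sub>R (X n - s)) = cmod (b (X n) x - b s x) / \<bar>X n - s\<bar>"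
          by (simp add: divide_inverse mult.commute)
        also have "\<dots> \<le> K"
          using blip[OF XI(1)[of n] s, of x] XI(2)[of n] by (simp add: pos_divide_le_eq)
        finally have q: "norm ((b (X n) x - b s x) /\<^sub>R (X n - s)) \<le> K" .
        have "norm ((((b (X n) x - b s x) /\<^sub>R (X n - s)) * cnj (f x)) \<bullet> f x)
            \<le> norm (((b (X n) x - b s x) /\<^sub>R (X n - s)) * cnj (f x)) * norm (f x)"
          unfolding real_norm_def by (rule Cauchy_Schwarz_ineq2)
        also have "\<dots> = norm ((b (X n) x - b s x) /\<^sub>R (X n - s)) * (norm (f x))\<^sup>2"
          by (simp add: norm_mult power2_eq_square)
        also have "\<dots> \<le> K * (norm (f x))\<^sup>2" by (rule mult_right_mono[OF q]) simp
        finally show "norm ((((b (X n) x - b s x) /\<^sub>R (X n - s)) * cnj (f x)) \<bullet> f x) \<le> K * (norm (f x))\<^sup>2" .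
      qed
    qed measurable
    then show "(\<lambda>n. (conj_mult (b (X n)) (to_l2 f) \<bullet> to_l2 f - conj_mult (b s) (to_l2 f) \<bullet> to_l2 f) /\<^sub>R (X n - s))
        \<longlonglongrightarrow> conj_mult (bs s) (to_l2 f) \<bullet> to_l2 f"
      unfolding eq cm(3)[OF s s f] inner_to_l2[OF cL(3)[OF s s f] f] .
  qed
  \<comment> \<open>The second derivative in \<open>vm\<close> is removed by parts; the minus sign
    of the dispersion and that of the integration by parts cancel.\<close>
  have parts: "conj_mult (b s) (w n s) \<bullet> to_l2 (vm n s)
      = (conj_mult (bx s) (w n s) + conj_mult (b s) (w1 n s)) \<bullet> iw1 n s + conj_mult (b s) (w n s) \<bullet> to_l2 (gm n s)"
    if s: "s \<in> {0..t}" for n s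
  proof -
    note L = umL[OF s, of _ n]
    note ibL = cmultL[OF L, of ib]
    have a1: "ac_deriv (\<lambda>x. b s x * cnj (um 0 n s x)) (\<lambda>x. bx s x * cnj (um 0 n s x) + b s x * cnj (um 1 n s x))"
    proof -
      have "ac_deriv (\<lambda>x. cnj (um 0 n s x)) (\<lambda>x. cnj (um 1 n s x))"
        using ac_deriv_bounded_linear[OF bounded_linear_cnj um_ac[OF s, of 0 n]] by simp
      from ac_deriv_mult[OF bac[OF s] this] show ?thesis .
    qed
    have a2: "ac_deriv (\<lambda>x. ib * um 1 n s x) (\<lambda>x. ib * um 2 n s x)"
      using ac_deriv_mult[OF ac_deriv_C1[of "\<lambda>_. ib" "\<lambda>_. 0"] um_ac[OF s, of 1 n]]
      by (simp add: numeral_2_eq_2)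
    have "(\<integral>x. (b s x * cnj (um 0 n s x)) \<bullet> (ib * um 2 n s x) \<partial>lborel)
        = - (\<integral>x. (bx s x * cnj (um 0 n s x) + b s x * cnj (um 1 n s x)) \<bullet> (ib * um 1 n s x) \<partial>lborel)"
      by (intro integral_inner_by_parts a1 a2 in_L2_add cL(1,2) s L ibL)
    then have "conj_mult (b s) (w n s) \<bullet> to_l2 (\<lambda>x. ib * um 2 n s x) = - ((conj_mult (bx s) (w n s) + conj_mult (b s) (w1 n s)) \<bullet> iw1 n s)"
      unfolding w_def w1_def iw1_def cm(1)[OF s s L] cm(2)[OF s s L] to_l2_add[OF cL(2)[OF s s L] cL(1)[OF s s L]]
        inner_to_l2[OF cL(1)[OF s s L] ibL] inner_to_l2[OF in_L2_add[OF cL(2)[OF s s L] cL(1)[OF s s L]] ibL] .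
    moreover have "to_l2 (vm n s) = - to_l2 (\<lambda>x. ib * um 2 n s x) + to_l2 (gm n s)"
    proof -
      have "- to_l2 (\<lambda>x. ib * um 2 n s x) = to_l2 (\<lambda>x. - (ib * um 2 n s x))"
        using to_l2_scaleR[OF ibL[of 2], of "-1"] by simp
      then show ?thesis
        using to_l2_add[OF in_L2_uminus[OF ibL[of 2]] gmL[OF s, of n]]
        by (simp add: vm_def[abs_def] ib_def)
    qed
    ultimately show ?thesis by (simp add: inner_diff_right)
  qed
  \<comment> \<open>Putting the derivative on u instead of the kernel gives a bound that does not
    depend on n, and identifies the limit.\<close>
  have w1: "w1 n s = to_l2 (conv (moll n) (ux s))" if "s \<in> {0..t}" for n s
    unfolding w1_def um_def conv_weak_deriv[OF ux[OF that] test_function_moll] ..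
  have iw1: "iw1 n s = to_l2 (conv (moll n) (\<lambda>x. ib * ux s x))" if s: "s \<in> {0..t}" for n s
    unfolding iw1_def um_def conv_weak_deriv[OF ux[OF that] test_function_moll]
    by (rule arg_cong[where f = to_l2], rule ext)
       (simp only: conv_bounded_linear[OF bounded_linear_mult_right[of ib] csc_moll[of n] uxL[OF s]])
  have iuxL: "in_L2 (\<lambda>x. ib * ux s x)" if "s \<in> {0..t}" for s by (rule cmultL[OF uxL[OF that]])
  define En where "En n s = conj_mult (b s) (w n s) \<bullet> w n s" for n s
  define Dn where "Dn n s = conj_mult (bs s) (w n s) \<bullet> w n s
      + 2 * ((conj_mult (bx s) (w n s) + conj_mult (b s) (w1 n s)) \<bullet> iw1 n s)
      + 2 * (conj_mult (b s) (w n s) \<bullet> to_l2 (gm n s))" for n s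
  define B where "B = K * M * M + 2 * ((K * M + K * M) * (\<bar>\<beta>\<bar> * M)) + 2 * (K * M * M)"
  show ?thesis
  proof (rule energy_rate_limit[OF t, where En = En and Dn = Dn and K = B])
    fix n s assume s: "s \<in> {0..t}"
    obtain C where C: "\<And>s. s \<in> {0..t} \<Longrightarrow> norm (to_l2 (vm n s)) \<le> C" using norm_vm_le[of n] by metis
    have "((\<lambda>r. conj_mult (b r) (w n r) \<bullet> w n r) has_real_derivative
        conj_mult (bs s) (w n s) \<bullet> w n s + 2 * (conj_mult (b s) (w n s) \<bullet> to_l2 (vm n s))) (at s within {0..t})"
    proof (rule quadratic_form_derivative[OF closure_complex_tests _ C s, where K = K and L = K])
      show "((\<lambda>r. d \<bullet> w n r) has_real_derivative d \<bullet> to_l2 (vm n s)) (at s within {0..t})"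
        if "d \<in> complex_tests" "s \<in> {0..t}" for d s
        unfolding w_def by (rule moll_weak_l2[OF that])
      show "((\<lambda>r. conj_mult (b r) (w n s) \<bullet> w n s) has_real_derivative conj_mult (bs s) (w n s) \<bullet> w n s) (at s within {0..t})"
        unfolding w_def by (rule deriv_b[OF s umL[OF s]])
      show "norm (conj_mult (b r) v - conj_mult (b s) v) \<le> K * \<bar>r - s\<bar> * norm v" if "r \<in> {0..t}" for r v
        by (rule norm_conj_mult_diff[OF bm(1)[OF that] bK[OF that] bm(1)[OF s] bK[OF s] blip[OF that s]])
    qed (auto intro: conj_mult_add[OF bm(1) bK] conj_mult_sym[OF bm(1) bK] norm_conj_mult[OF bm(1) bK])
    then show "(En n has_real_derivative Dn n s) (at s within {0..t})"
      by (simp add: En_def[abs_def] Dn_def parts[OF s] algebra_simps)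
    have wM: "norm (w n s) \<le> M" unfolding w_def by (rule norm_um_le[OF s])
    have w1M: "norm (w1 n s) \<le> M"
      using L2_nrm_conv_moll_le[OF uxL[OF s], of n] uxM[OF s]
      unfolding w1[OF s] norm_to_l2[OF in_L2_conv[OF csc_moll uxL[OF s]]] by linarith
    have "L2_nrm (\<lambda>x. ib * ux s x) \<le> \<bar>\<beta>\<bar> * L2_nrm (ux s)"
      using iuxL[OF s] by (intro L2_nrm_cmult_bound uxL s) (auto simp: norm_mult ib_def dest: in_L2_borel)
    then have iw1M: "norm (iw1 n s) \<le> \<bar>\<beta>\<bar> * M"
      using L2_nrm_conv_moll_le[OF iuxL[OF s], of n] mult_left_mono[OF uxM[OF s], of "\<bar>\<beta>\<bar>"]
      unfolding iw1[OF s] norm_to_l2[OF in_L2_conv[OF csc_moll iuxL[OF s]]] by linarith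
    have cb: "norm (conj_mult (b s) v) \<le> K * M" "norm (conj_mult (bx s) v) \<le> K * M" "norm (conj_mult (bs s) v) \<le> K * M"
      if "norm v \<le> M" for v
      using norm_conj_mult[OF bm(1)[OF s] bK[OF s], of v] norm_conj_mult[OF bm(2)[OF s] bxK[OF s], of v]
        norm_conj_mult[OF bsm[OF s] bsK[OF s], of v] mult_left_mono[OF that K] by linarith+
    have KM: "0 \<le> K * M" using K M_nonneg by simp
    have i1: "\<bar>conj_mult (b s) (w n s) \<bullet> w n s\<bar> \<le> K * M * M"
      by (rule order_trans[OF Cauchy_Schwarz_ineq2 mult_mono[OF cb(1)[OF wM] wM KM norm_ge_zero]])
    have i2: "\<bar>conj_mult (bs s) (w n s) \<bullet> w n s\<bar> \<le> K * M * M"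
      by (rule order_trans[OF Cauchy_Schwarz_ineq2 mult_mono[OF cb(3)[OF wM] wM KM norm_ge_zero]])
    have i3: "\<bar>conj_mult (b s) (w n s) \<bullet> to_l2 (gm n s)\<bar> \<le> K * M * M"
      by (rule order_trans[OF Cauchy_Schwarz_ineq2 mult_mono[OF cb(1)[OF wM] norm_gm_le[OF s] KM norm_ge_zero]])
    have i4: "\<bar>(conj_mult (bx s) (w n s) + conj_mult (b s) (w1 n s)) \<bullet> iw1 n s\<bar> \<le> (K * M + K * M) * (\<bar>\<beta>\<bar> * M)"
      by (rule order_trans[OF Cauchy_Schwarz_ineq2 mult_mono[OF norm_triangle_mono[OF cb(2)[OF wM] cb(1)[OF w1M]] iw1M _ norm_ge_zero]])
         (use KM in simp)
    have nn: "0 \<le> K * M * M" "0 \<le> (K * M + K * M) * (\<bar>\<beta>\<bar> * M)"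
      using KM M_nonneg by (auto intro!: mult_nonneg_nonneg)
    show "\<bar>En n s\<bar> \<le> B" using i1 nn unfolding En_def B_def by linarith
    show "\<bar>Dn n s\<bar> \<le> B" using i2 i3 i4 unfolding Dn_def B_def by linarith
  next
    fix s assume s: "s \<in> {0..t}"
    note L = uL[OF s] uxL[OF s]
    have lw: "(\<lambda>n. w n s) \<longlonglongrightarrow> to_l2 (u s)" unfolding w_def by (rule um_tendsto[OF s])
    have lw1: "(\<lambda>n. w1 n s) \<longlonglongrightarrow> to_l2 (ux s)" unfolding w1[OF s] by (rule to_l2_conv_moll_tendsto[OF uxL[OF s]])
    have liw1: "(\<lambda>n. iw1 n s) \<longlonglongrightarrow> to_l2 (\<lambda>x. ib * ux s x)" unfolding iw1[OF s] by (rule to_l2_conv_moll_tendsto[OF iuxL[OF s]])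
    note tc = tendsto_conj_mult[OF bm(1)[OF s] bK[OF s]] tendsto_conj_mult[OF bm(2)[OF s] bxK[OF s]] tendsto_conj_mult[OF bsm[OF s] bsK[OF s]]
    have "(\<lambda>n. En n s) \<longlonglongrightarrow> conj_mult (b s) (to_l2 (u s)) \<bullet> to_l2 (u s)"
      unfolding En_def by (intro tendsto_inner tc lw)
    then show "(\<lambda>n. En n s) \<longlonglongrightarrow> (\<integral>x. (b s x * cnj (u s x)) \<bullet> u s x \<partial>lborel)"
      unfolding cm(1)[OF s s L(1)] inner_to_l2[OF cL(1)[OF s s L(1)] L(1)] .
    have "(\<lambda>n. Dn n s) \<longlonglongrightarrow> conj_mult (bs s) (to_l2 (u s)) \<bullet> to_l2 (u s)
      + 2 * ((conj_mult (bx s) (to_l2 (u s)) + conj_mult (b s) (to_l2 (ux s))) \<bullet> to_l2 (\<lambda>x. ib * ux s x))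
      + 2 * (conj_mult (b s) (to_l2 (u s)) \<bullet> to_l2 (g s))"
      unfolding Dn_def by (intro tendsto_add tendsto_mult_left tendsto_inner tc lw lw1 liw1 gm_tendsto[OF s])
    then show "(\<lambda>n. Dn n s) \<longlonglongrightarrow> (\<integral>x. (bs s x * cnj (u s x)) \<bullet> u s x \<partial>lborel)
      + 2 * (\<integral>x. (bx s x * cnj (u s x) + b s x * cnj (ux s x)) \<bullet> (\<i> * of_real \<beta> * ux s x) \<partial>lborel)
      + 2 * (\<integral>x. (b s x * cnj (u s x)) \<bullet> g s x \<partial>lborel)"
      unfolding cm(1)[OF s s L(1)] cm(3)[OF s s L(1)] cm(2)[OF s s L(1)] cm(1)[OF s s L(2)]
        to_l2_add[OF cL(2)[OF s s L(1)] cL(1)[OF s s L(2)]]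
        inner_to_l2[OF cL(3)[OF s s L(1)] L(1)] inner_to_l2[OF cL(1)[OF s s L(1)] gL[OF s]]
        inner_to_l2[OF in_L2_add[OF cL(2)[OF s s L(1)] cL(1)[OF s s L(2)]] iuxL[OF s, unfolded ib_def]] ib_def .
  qed
qed

end

section \<open>The damping estimate\<close>

lemma H_bdd_cmult: "H_bdd m f B \<Longrightarrow> H_bdd m (\<lambda>x. c * f x) (cmod c * B)"
  using H_nrm_bounded_linear[OF bounded_linear_mult_right, of m f c "cmod c"]
    in_H_bounded_linear[OF bounded_linear_mult_right, of m f c] mult_left_mono[of "H_nrm m f" B "cmod c"]
  by (auto simp: H_bdd_def norm_mult intro: order_trans)

lemma W_bdd_cmult: "W_bdd m a A \<Longrightarrow> W_bdd m (\<lambda>x. c * a x) (2 ^ m * cmod c * A)"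
  by (rule W_bdd_mult[OF W_bdd_const]) auto

lemma inner_mult_I_self: "(z::complex) \<bullet> (a * z) = Re a * (norm z)\<^sup>2"
  unfolding cmod_power2 by (simp add: inner_complex_def algebra_simps power2_eq_square)

text \<open>Here x is the norm of the top derivative, Y the norm one order lower, z the full norm, n
  the forcing and h a bound on the remainder. The condition e a <= 1/8 makes the part of h that
  contains x small enough to be absorbed; Young's inequality does the rest, and one of the two
  copies of x^2 survives.\<close>

lemma level_arith:
  fixes x y z Y n e a b :: real
  assumes nn: "0 \<le> x" "0 \<le> Y" "0 \<le> n" "0 \<le> a" "0 \<le> b" "0 \<le> e" "e \<le> 1" and ea: "e * a \<le> 1 / 8" and z: "z \<le> Y + x"
    and h: "h \<le> a * (Y + e * z + n)"
  shows "- 2 * x\<^sup>2 + 2 * (x * h) + b * (Y\<^sup>2 + Y * x + Y * h) \<le> - x\<^sup>2 + (32 * a\<^sup>2 + 8 * b\<^sup>2 + b + 8 * a * b + 8) * (Y\<^sup>2 + n\<^sup>2)"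
proof -
  have "e * z \<le> e * Y + e * x" using mult_left_mono[OF z nn(6)] by (simp add: algebra_simps)
  also have "e * Y \<le> Y" using mult_right_mono[OF nn(7,2)] by simp
  finally have "h \<le> a * (2 * Y + e * x + n)"
    using order_trans[OF h mult_left_mono[of "Y + e * z + n" "2 * Y + e * x + n" a]] nn(4) by simp
  also have "\<dots> = 2 * a * Y + (e * a) * x + a * n" by (simp add: algebra_simps)
  also have "\<dots> \<le> 2 * a * Y + x / 8 + a * n" using mult_right_mono[OF ea nn(1)] by simp
  finally have h': "h \<le> 2 * a * Y + x / 8 + a * n" .
  have "x * h \<le> x * (2 * a * Y + x / 8 + a * n)" by (rule mult_left_mono[OF h' nn(1)])
  then have 1: "2 * (x * h) \<le> 4 * (a * (x * Y)) + x\<^sup>2 / 4 + 2 * (a * (x * n))"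
    by (simp add: algebra_simps power2_eq_square)
  have "b * (Y * h) \<le> b * (Y * (2 * a * Y + x / 8 + a * n))"
    by (intro mult_left_mono h' nn)
  then have 2: "b * (Y * h) \<le> 2 * (a * b * Y\<^sup>2) + b * (Y * x) / 8 + a * b * (Y * n)"
    by (simp add: algebra_simps power2_eq_square)
  \<comment> \<open>With the share 1/4 of x^2 already in fact 1, the shares 1/8, 1/8 and 1/4 of the
    next three inequalities add up to 3/4, less than the one copy of x^2 that may be spent.\<close>
  have s1: "4 * (a * (x * Y)) \<le> x\<^sup>2 / 8 + 32 * (a\<^sup>2 * Y\<^sup>2)"
    using sum_squares_ge_zero[of "x - 16 * a * Y" 0] by (simp add: power2_eq_square algebra_simps)
  have s2: "2 * (a * (x * n)) \<le> x\<^sup>2 / 8 + 8 * (a\<^sup>2 * n\<^sup>2)"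
    using sum_squares_ge_zero[of "x - 8 * a * n" 0] by (simp add: power2_eq_square algebra_simps)
  have s3: "(9 / 8) * (b * (Y * x)) \<le> x\<^sup>2 / 4 + (81 / 64) * (b\<^sup>2 * Y\<^sup>2)"
    using sum_squares_ge_zero[of "x - (9 / 4) * b * Y" 0] by (simp add: power2_eq_square algebra_simps)
  have s4: "a * b * (Y * n) \<le> a * b * Y\<^sup>2 + a * b * n\<^sup>2"
  proof -
    have "Y * n \<le> Y\<^sup>2 + n\<^sup>2"
      using sum_squares_bound[of Y n] mult_nonneg_nonneg[OF nn(2,3)] by simp
    then have "a * b * (Y * n) \<le> a * b * (Y\<^sup>2 + n\<^sup>2)" using nn by (intro mult_left_mono) auto
    then show ?thesis by (simp add: distrib_left)
  qed
  have nn2: "0 \<le> a\<^sup>2 * n\<^sup>2" "0 \<le> b\<^sup>2 * Y\<^sup>2" "0 \<le> b\<^sup>2 * n\<^sup>2" "0 \<le> b * n\<^sup>2" "0 \<le> a * b * n\<^sup>2" "0 \<le> a * b * Y\<^sup>2" "0 \<le> Y\<^sup>2" "0 \<le> n\<^sup>2" "0 \<le> x\<^sup>2"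
    using nn by auto
  have "- 2 * x\<^sup>2 + 2 * (x * h) + b * (Y\<^sup>2 + Y * x + Y * h)
      = - 2 * x\<^sup>2 + 2 * (x * h) + b * Y\<^sup>2 + b * (Y * x) + b * (Y * h)" by (simp add: algebra_simps)
  also have "\<dots> \<le> - x\<^sup>2 + (32 * (a\<^sup>2 * Y\<^sup>2) + 8 * (a\<^sup>2 * n\<^sup>2) + (81 / 64) * (b\<^sup>2 * Y\<^sup>2) + b * Y\<^sup>2 + 3 * (a * b * Y\<^sup>2) + a * b * n\<^sup>2)"
    using 1 2 s1 s2 s3 s4 nn2 by linarith
  also have "\<dots> \<le> - x\<^sup>2 + (32 * (a\<^sup>2 * Y\<^sup>2) + 32 * (a\<^sup>2 * n\<^sup>2) + 8 * (b\<^sup>2 * Y\<^sup>2) + 8 * (b\<^sup>2 * n\<^sup>2) + b * Y\<^sup>2 + b * n\<^sup>2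
      + 8 * (a * b * Y\<^sup>2) + 8 * (a * b * n\<^sup>2) + 8 * Y\<^sup>2 + 8 * n\<^sup>2)"
    using nn2 by linarith
  also have "\<dots> = - x\<^sup>2 + (32 * a\<^sup>2 + 8 * b\<^sup>2 + b + 8 * a * b + 8) * (Y\<^sup>2 + n\<^sup>2)"
    by (simp add: algebra_simps)
  finally show ?thesis .
qed

text \<open>Weak form of w_t = -i beta w_yy + R(p + w) - R(p) + f, with R the reaction; the constant
  F cancels in the difference, hence the argument 0. \<open>A\<close> controls the profile,
  \<open>e\<close> the size of w, and \<open>n s\<close> the forcing. \<open>N\<close> bounds the
  forcing over the whole time interval, as the mollification limit requires, while the estimates
  themselves see only \<open>n s\<close>.\<close>

locale modulated_lle =
  fixes \<alpha> \<beta> A :: real and k :: nat and t e N :: real and w p ps f :: "real \<Rightarrow> real \<Rightarrow> complex" and n :: "real \<Rightarrow> real"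
  assumes t: "0 \<le> t" and \<beta>: "\<beta> \<noteq> 0" and k: "1 \<le> k" and e1: "e \<le> 1"
    and pW: "\<And>s. s \<in> {0..t} \<Longrightarrow> W_bdd k (p s) A"
    and psA: "\<And>s x. s \<in> {0..t} \<Longrightarrow> cmod (ps s x) \<le> A"
    and psm: "\<And>s. s \<in> {0..t} \<Longrightarrow> ps s \<in> borel_measurable borel"
    and ps: "\<And>s x. s \<in> {0..t} \<Longrightarrow> ((\<lambda>r. p r x) has_vector_derivative ps s x) (at s within {0..t})"
    and plip: "\<And>r s x. r \<in> {0..t} \<Longrightarrow> s \<in> {0..t} \<Longrightarrow> cmod (p r x - p s x) \<le> A * \<bar>r - s\<bar>"
    and wH: "\<And>s. s \<in> {0..t} \<Longrightarrow> H_bdd k (w s) e"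
    and fH: "\<And>s. s \<in> {0..t} \<Longrightarrow> H_bdd k (f s) (n s)"
    and nN: "\<And>s. s \<in> {0..t} \<Longrightarrow> n s \<le> N"
    and weak_eq: "\<And>\<eta> s. test_function \<eta> \<Longrightarrow> s \<in> {0..t} \<Longrightarrow>
      ((\<lambda>r. \<integral>x. \<eta> x *\<^sub>R w r x \<partial>lborel) has_vector_derivative
        (\<integral>x. nth_deriv 2 \<eta> x *\<^sub>R (- (\<i> * of_real \<beta>) * w s x) \<partial>lborel)
        + (\<integral>x. \<eta> x *\<^sub>R (lle_reaction \<alpha> 0 (p s x + w s x) - lle_reaction \<alpha> 0 (p s x) + f s x) \<partial>lborel))
      (at s within {0..t})"
begin

text \<open>\<open>aa\<close> and \<open>bb\<close> are the coefficients of w and conj w in the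
  linearisation of the reaction at p, and \<open>Q\<close> is the quadratic and cubic rest. Since 2
  i |p|^2 is imaginary, \<open>aa\<close> has real part -1, which is the damping.\<close>

definition aa :: "real \<Rightarrow> real \<Rightarrow> complex" where
  "aa s x = - (1 + \<i> * of_real \<alpha>) + 2 * \<i> * (p s x * cnj (p s x))"

definition bb :: "real \<Rightarrow> real \<Rightarrow> complex" where
  "bb s x = \<i> * (p s x * p s x)"

definition Q :: "real \<Rightarrow> real \<Rightarrow> complex" where
  "Q s x = \<i> * (2 * (p s x * (w s x * cnj (w s x))) + (cnj (p s x) * (w s x * w s x) + (w s x * w s x) * cnj (w s x)))"

definition G :: "real \<Rightarrow> real \<Rightarrow> complex" where
  "G s x = (aa s x * w s x + bb s x * cnj (w s x)) + (Q s x + f s x)"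

text \<open>This and the following constants are explicit in alpha, A, k and j, so that they can be
  fixed before the time interval and the solution.\<close>

definition PP :: real where "PP = 2 ^ k * A * A"
definition AB :: real where "AB = (1 + \<bar>\<alpha>\<bar>) + 2 ^ k * 2 * PP + 2 ^ k * 1 * PP"
definition KQ :: "nat \<Rightarrow> real" where
  "KQ j = 3 * (3 ^ Suc j * A * (6 * 3 ^ j)) + (6 * 3 ^ j) * (6 * 3 ^ j)"
definition KK :: "nat \<Rightarrow> real" where "KK j = 3 ^ Suc j * AB + KQ j + 1"

lemma A_nonneg: "0 \<le> A"
  using order_trans[OF norm_ge_zero psA[of 0 0]] t by simp

lemma e_nonneg: "0 \<le> e"
  using H_bdd_nonneg[OF wH[of 0]] t by auto

lemma PP_nonneg: "0 \<le> PP" using A_nonneg by (simp add: PP_def)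
lemma AB_nonneg: "0 \<le> AB" using PP_nonneg by (simp add: AB_def)
lemma KQ_nonneg: "0 \<le> KQ j" using A_nonneg by (simp add: KQ_def)
lemma KK_nonneg: "0 \<le> KK j" using AB_nonneg KQ_nonneg by (simp add: KK_def)

lemma n_nonneg: "s \<in> {0..t} \<Longrightarrow> 0 \<le> n s"
  using H_bdd_nonneg[OF fH] .

lemma ppW: "s \<in> {0..t} \<Longrightarrow> W_bdd k (\<lambda>x. p s x * p s x) PP"
  unfolding PP_def by (intro W_bdd_mult pW)

lemma aW: "s \<in> {0..t} \<Longrightarrow> W_bdd k (aa s) ((1 + \<bar>\<alpha>\<bar>) + 2 ^ k * 2 * PP)"
proof -
  assume s: "s \<in> {0..t}"
  have "cmod (- (1 + \<i> * of_real \<alpha>)) \<le> 1 + \<bar>\<alpha>\<bar>"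
    using norm_triangle_ineq[of 1 "\<i> * of_real \<alpha>"] by (simp add: norm_mult del: minus_add_distrib)
  moreover have "W_bdd k (\<lambda>x. 2 * \<i> * (p s x * cnj (p s x))) (2 ^ k * cmod (2 * \<i>) * PP)"
    unfolding PP_def by (intro W_bdd_cmult W_bdd_mult W_bdd_cnj pW s)
  ultimately show ?thesis
    unfolding aa_def[abs_def] by (intro W_bdd_add W_bdd_const) (auto simp: norm_mult)
qed

lemma bW: "s \<in> {0..t} \<Longrightarrow> W_bdd k (bb s) (2 ^ k * 1 * PP)"
  using W_bdd_cmult[OF ppW, of s \<i>] by (simp add: bb_def[abs_def])

lemma G_eq: "lle_reaction \<alpha> 0 (p s x + w s x) - lle_reaction \<alpha> 0 (p s x) + f s x = G s x"
proof -
  have sq: "complex_of_real ((cmod z)\<^sup>2) = z * cnj z" for z by (simp add: complex_norm_square[symmetric])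
  show ?thesis
    unfolding lle_reaction_def G_def Q_def aa_def bb_def sq by (simp add: algebra_simps)
qed

lemma wH': "s \<in> {0..t} \<Longrightarrow> j \<le> k \<Longrightarrow> H_bdd j (w s) (H_nrm j (w s))"
  using wH[of s] in_H_mono[of k "w s" j] by (auto simp: H_bdd_def)

lemma w_le: "s \<in> {0..t} \<Longrightarrow> j \<le> k \<Longrightarrow> H_nrm j (w s) \<le> e"
  using H_bdd_le[OF wH] by (auto simp: H_bdd_def)

text \<open>In every product one factor w is estimated by e and one is kept in norm; a third factor
  is at most e <= 1. The factor e is what allows the nonlinearity to be absorbed at top
  order.\<close>

lemma QH:
  assumes s: "s \<in> {0..t}" and j: "Suc j \<le> k"
  shows "H_bdd (Suc j) (Q s) (KQ j * (e * H_nrm (Suc j) (w s)))"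
proof -
  define z where "z = H_nrm (Suc j) (w s)"
  define c where "c = 6 * (3::real) ^ j"
  note w = wH'[OF s j, folded z_def]
  note P = W_bdd_le[OF pW[OF s] j]
  have z: "0 \<le> z" "z \<le> e" unfolding z_def using w_le[OF s j] by auto
  have c: "0 \<le> c" by (simp add: c_def)
  have H1: "H_bdd (Suc j) (\<lambda>x. w s x * cnj (w s x)) (c * z * z)"
    unfolding c_def by (rule H_bdd_algebra[OF w H_bdd_cnj[OF w]])
  have H2: "H_bdd (Suc j) (\<lambda>x. w s x * w s x) (c * z * z)"
    unfolding c_def by (rule H_bdd_algebra[OF w w])
  have H3: "H_bdd (Suc j) (\<lambda>x. (w s x * w s x) * cnj (w s x)) (c * (c * z * z) * z)"
    unfolding c_def by (rule H_bdd_algebra[OF H2[unfolded c_def] H_bdd_cnj[OF w]])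
  have "H_bdd (Suc j) (Q s) (cmod \<i> * (cmod 2 * (3 ^ Suc j * A * (c * z * z)) + (3 ^ Suc j * A * (c * z * z) + c * (c * z * z) * z)))"
    unfolding Q_def[abs_def] by (intro H_bdd_cmult H_bdd_add H_bdd_mult P W_bdd_cnj H1 H2 H3)
  then show ?thesis
  proof (rule H_bdd_mono)
    have zz: "z * z \<le> e * z" using z by (intro mult_right_mono) auto
    have zzz: "z * z * z \<le> e * z"
    proof -
      have "z * z * z \<le> (e * z) * 1" using z zz e1 by (intro mult_mono) auto
      then show ?thesis by simp
    qed
    have "cmod \<i> * (cmod 2 * (3 ^ Suc j * A * (c * z * z)) + (3 ^ Suc j * A * (c * z * z) + c * (c * z * z) * z))
        = 3 * (3 ^ Suc j * A * c) * (z * z) + c * c * (z * z * z)" by (simp add: algebra_simps)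
    also have "\<dots> \<le> 3 * (3 ^ Suc j * A * c) * (e * z) + c * c * (e * z)"
      using zz zzz c A_nonneg by (intro add_mono mult_left_mono) auto
    also have "\<dots> = KQ j * (e * z)" by (simp add: KQ_def c_def algebra_simps)
    finally show "cmod \<i> * (cmod 2 * (3 ^ Suc j * A * (c * z * z)) + (3 ^ Suc j * A * (c * z * z) + c * (c * z * z) * z))
        \<le> KQ j * (e * H_nrm (Suc j) (w s))" by (simp add: z_def)
  qed
qed

text \<open>The linear part is measured in H^m, but Q always in H^(j+1), because the algebra
  property needs one derivative. The cases m = j and m = j + 1 are both used.\<close>

lemma GH:
  assumes s: "s \<in> {0..t}" and j: "Suc j \<le> k" and m: "m \<le> Suc j"
  shows "H_bdd m (G s) (3 ^ m * AB * H_nrm m (w s) + KQ j * (e * H_nrm (Suc j) (w s)) + n s)"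
proof -
  have mk: "m \<le> k" using j m by simp
  have "H_bdd m (G s) ((3 ^ m * ((1 + \<bar>\<alpha>\<bar>) + 2 ^ k * 2 * PP) * H_nrm m (w s) + 3 ^ m * (2 ^ k * 1 * PP) * H_nrm m (w s))
      + (KQ j * (e * H_nrm (Suc j) (w s)) + n s))"
    unfolding G_def[abs_def]
    by (intro H_bdd_add H_bdd_mult W_bdd_le[OF aW[OF s] mk] W_bdd_le[OF bW[OF s] mk] H_bdd_cnj wH'[OF s mk]
        H_bdd_le[OF QH[OF s j] m] H_bdd_le[OF fH[OF s] mk])
  then show ?thesis by (rule H_bdd_mono) (simp add: AB_def algebra_simps)
qed

lemma G_bounded: obtains B where "\<And>s. s \<in> {0..t} \<Longrightarrow> H_bdd k (G s) B"
proof -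
  obtain j where j: "k = Suc j" using k by (cases k) auto
  have "H_bdd k (G s) (3 ^ k * AB * e + KQ j * (e * e) + N)" if s: "s \<in> {0..t}" for s
  proof (rule H_bdd_mono[OF GH[OF s, of j k]])
    have "H_nrm k (w s) \<le> e" by (rule w_le[OF s order_refl])
    then show "3 ^ k * AB * H_nrm k (w s) + KQ j * (e * H_nrm (Suc j) (w s)) + n s \<le> 3 ^ k * AB * e + KQ j * (e * e) + N"
      unfolding j[symmetric] using AB_nonneg KQ_nonneg e_nonneg nN[OF s]
      by (intro add_mono mult_left_mono) auto
  qed (use j in auto)
  then show ?thesis by (rule that)
qed

section \<open>The differentiated equations\<close>

definition W :: "nat \<Rightarrow> real \<Rightarrow> real \<Rightarrow> complex" where "W j s = weak_deriv j (w s)"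
definition GG :: "nat \<Rightarrow> real \<Rightarrow> real \<Rightarrow> complex" where "GG j s = weak_deriv j (G s)"

lemma w_in_H: "s \<in> {0..t} \<Longrightarrow> in_H k (w s)" using wH by (auto simp: H_bdd_def)
lemma G_in_H: "s \<in> {0..t} \<Longrightarrow> in_H k (G s)" using G_bounded by (metis H_bdd_def)

lemma W_L2: "s \<in> {0..t} \<Longrightarrow> j \<le> k \<Longrightarrow> in_L2 (W j s)"
  unfolding W_def by (rule in_H_weak_deriv_L2[OF w_in_H])

lemma GG_L2: "s \<in> {0..t} \<Longrightarrow> j \<le> k \<Longrightarrow> in_L2 (GG j s)"
  unfolding GG_def by (rule in_H_weak_deriv_L2[OF G_in_H])

lemma W_weak: "s \<in> {0..t} \<Longrightarrow> j \<le> k \<Longrightarrow> has_weak_deriv j (w s) (W j s)"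
  unfolding W_def by (rule in_H_has_weak_deriv[OF w_in_H])

lemma GG_weak: "s \<in> {0..t} \<Longrightarrow> j \<le> k \<Longrightarrow> has_weak_deriv j (G s) (GG j s)"
  unfolding GG_def by (rule in_H_has_weak_deriv[OF G_in_H])

lemma W_weak1: "s \<in> {0..t} \<Longrightarrow> Suc j \<le> k \<Longrightarrow> has_weak_deriv 1 (W j s) (W (Suc j) s)"
  using has_weak_deriv_diff[of j "w s" "W j s" 1 "W (Suc j) s"] W_weak[of s j] W_weak[of s "Suc j"] by simp

lemma W_le: "s \<in> {0..t} \<Longrightarrow> j \<le> k \<Longrightarrow> L2_nrm (W j s) \<le> e"
  unfolding W_def using L2_nrm_weak_deriv_le[of j k] w_le[of s k] by (meson order_refl order_trans)

text \<open>Testing the equation with the j-th derivative of eta and multiplying by (-1)^j moves all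
  derivatives onto w and G. One bound serves all levels, since the cross identity at level j also
  needs the norm of level j + 1.\<close>

lemma forced:
  obtains B where "\<And>j. j \<le> k \<Longrightarrow> forced_schroedinger t \<beta> (W j) (GG j) B" "e \<le> B"
proof -
  obtain C where C: "\<And>s. s \<in> {0..t} \<Longrightarrow> H_bdd k (G s) C" using G_bounded by blast
  have "forced_schroedinger t \<beta> (W j) (GG j) (max e C)" if j: "j \<le> k" for j
  proof
    show "0 \<le> t" by (rule t)
    fix s assume s: "s \<in> {0..t}"
    show "in_L2 (W j s)" "in_L2 (GG j s)" by (rule W_L2[OF s j], rule GG_L2[OF s j])
    show "L2_nrm (W j s) \<le> max e C" using W_le[OF s j] by simp
    show "L2_nrm (GG j s) \<le> max e C"
      using order_trans[OF L2_nrm_weak_deriv_le[OF j, of "G s"], of C] C[OF s] by (simp add: GG_def H_bdd_def le_max_iff_disj)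
    fix \<eta> assume te: "test_function \<eta>"
    let ?c = "- (\<i> * complex_of_real \<beta>)"
    note tj = test_function_nth_deriv[OF te, of j]
    have eqW: "(\<integral>x. \<eta> x *\<^sub>R W j r x \<partial>lborel) = (- 1) ^ j *\<^sub>R (\<integral>x. nth_deriv j \<eta> x *\<^sub>R w r x \<partial>lborel)" if "r \<in> {0..t}" for r
      using has_weak_derivD[OF W_weak[OF that j] te] by (simp add: power_mult_distrib[symmetric])
    have eqG: "(\<integral>x. \<eta> x *\<^sub>R GG j s x \<partial>lborel) = (- 1) ^ j *\<^sub>R (\<integral>x. nth_deriv j \<eta> x *\<^sub>R G s x \<partial>lborel)"
      using has_weak_derivD[OF GG_weak[OF s j] te] by (simp add: power_mult_distrib[symmetric])
    have "has_weak_deriv j (\<lambda>x. ?c * w s x) (\<lambda>x. ?c * W j s x)"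
      by (rule has_weak_deriv_bounded_linear[OF bounded_linear_mult_right W_weak[OF s j] in_H_L2[OF w_in_H[OF s]] W_L2[OF s j]])
    from has_weak_derivD[OF this test_function_nth_deriv[OF te, of 2]]
    have eqI: "(\<integral>x. nth_deriv 2 \<eta> x *\<^sub>R (?c * W j s x) \<partial>lborel) = (- 1) ^ j *\<^sub>R (\<integral>x. nth_deriv 2 (nth_deriv j \<eta>) x *\<^sub>R (?c * w s x) \<partial>lborel)"
      by (simp add: nth_deriv_add[symmetric] add.commute power_mult_distrib[symmetric])
    have "((\<lambda>r. (- 1) ^ j *\<^sub>R (\<integral>x. nth_deriv j \<eta> x *\<^sub>R w r x \<partial>lborel)) has_vector_derivative
        (- 1) ^ j *\<^sub>R ((\<integral>x. nth_deriv 2 (nth_deriv j \<eta>) x *\<^sub>R (?c * w s x) \<partial>lborel) + (\<integral>x. nth_deriv j \<eta> x *\<^sub>R G s x \<partial>lborel))) (at s within {0..t})"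
      using weak_eq[OF tj s] unfolding G_eq
      by (rule bounded_linear.has_vector_derivative[OF bounded_linear_scaleR_right])
    then have "((\<lambda>r. (- 1) ^ j *\<^sub>R (\<integral>x. nth_deriv j \<eta> x *\<^sub>R w r x \<partial>lborel)) has_vector_derivative
        (\<integral>x. nth_deriv 2 \<eta> x *\<^sub>R (?c * W j s x) \<partial>lborel) + (\<integral>x. \<eta> x *\<^sub>R GG j s x \<partial>lborel)) (at s within {0..t})"
      unfolding eqI eqG by (simp only: scaleR_add_right)
    then show "((\<lambda>r. \<integral>x. \<eta> x *\<^sub>R W j r x \<partial>lborel) has_vector_derivative
        (\<integral>x. nth_deriv 2 \<eta> x *\<^sub>R (?c * W j s x) \<partial>lborel) + (\<integral>x. \<eta> x *\<^sub>R GG j s x \<partial>lborel)) (at s within {0..t})"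
      by (rule has_vector_derivative_transform[OF s eqW, rotated 1])
  qed
  then show ?thesis by (rule that) (assumption, rule max.cobounded1)
qed

end

section \<open>The quadratic correction and the estimate at one derivative level\<close>

context modulated_lle
begin

text \<open>A common bound for p^2, its derivatives in space and time and its Lipschitz constant in
  time; the factor 2 comes from the product rule.\<close>

definition A2 :: real where "A2 = 2 * A * A"

definition px :: "real \<Rightarrow> real \<Rightarrow> complex" where
  "px s = (SOME a'. (\<forall>x. (p s has_vector_derivative a' x) (at x)) \<and> W_bdd (k - 1) a' A)"

lemma px:
  assumes "s \<in> {0..t}"
  shows "(p s has_vector_derivative px s x) (at x)" "W_bdd (k - 1) (px s) A"
proof -
  have "\<exists>a'. (\<forall>x. (p s has_vector_derivative a' x) (at x)) \<and> W_bdd (k - 1) a' A"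
    using pW[OF assms] k by (cases k) auto
  from someI_ex[OF this] show "(p s has_vector_derivative px s x) (at x)" "W_bdd (k - 1) (px s) A"
    unfolding px_def by blast+
qed

lemma p_le: "s \<in> {0..t} \<Longrightarrow> cmod (p s x) \<le> A"
  by (rule W_bdd_bound[OF pW])

definition ppx :: "real \<Rightarrow> real \<Rightarrow> complex" where "ppx s x = p s x * px s x + px s x * p s x"
definition pps :: "real \<Rightarrow> real \<Rightarrow> complex" where "pps s x = p s x * ps s x + ps s x * p s x"

lemma p_borel: "s \<in> {0..t} \<Longrightarrow> p s \<in> borel_measurable borel"
  by (rule W_bdd_borel[OF pW])

lemma pp_le: "s \<in> {0..t} \<Longrightarrow> cmod (p s x * p s x) \<le> A2"
  using mult_mono[OF p_le[of s x] p_le[of s x] A_nonneg norm_ge_zero] mult_nonneg_nonneg[OF A_nonneg A_nonneg]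
  unfolding A2_def norm_mult by linarith

lemma sum_le_A2:
  assumes "cmod a \<le> A" "cmod b \<le> A" shows "cmod (a * b + b * a) \<le> A2"
proof -
  have "cmod (a * b) \<le> A * A" using mult_mono[OF assms A_nonneg norm_ge_zero] by (simp add: norm_mult)
  then show ?thesis using norm_triangle_ineq[of "a * b" "b * a"] by (simp add: A2_def mult.commute)
qed

lemma ppx_le: "s \<in> {0..t} \<Longrightarrow> cmod (ppx s x) \<le> A2"
  unfolding ppx_def by (intro sum_le_A2 p_le W_bdd_bound[OF px(2)])

lemma pps_le: "s \<in> {0..t} \<Longrightarrow> cmod (pps s x) \<le> A2"
  unfolding pps_def by (intro sum_le_A2 p_le psA)

lemma pp_lip: "r \<in> {0..t} \<Longrightarrow> s \<in> {0..t} \<Longrightarrow> cmod (p r x * p r x - p s x * p s x) \<le> A2 * \<bar>r - s\<bar>"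
proof -
  assume r: "r \<in> {0..t}" and s: "s \<in> {0..t}"
  have "cmod (p r x + p s x) \<le> 2 * A"
    using norm_triangle_ineq[of "p r x" "p s x"] p_le[OF r, of x] p_le[OF s, of x] by linarith
  then have "cmod (p r x + p s x) * cmod (p r x - p s x) \<le> (2 * A) * (A * \<bar>r - s\<bar>)"
    using A_nonneg by (intro mult_mono plip r s) auto
  moreover have "p r x * p r x - p s x * p s x = (p r x + p s x) * (p r x - p s x)"
    by (simp add: algebra_simps)
  ultimately show ?thesis by (simp add: norm_mult A2_def mult.assoc)
qed

text \<open>Up to lower order terms, the derivative of \<open>cr j / \<beta>\<close> cancels the term with \<open>bb\<close> in \<open>W_GG_inner\<close>
  at level \<open>j + 1\<close>.\<close>

definition cr :: "nat \<Rightarrow> real \<Rightarrow> real" where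
  "cr j s = (\<integral>x. ((p s x * p s x) * cnj (W j s x)) \<bullet> W j s x \<partial>lborel)"

definition cr_rate :: "nat \<Rightarrow> real \<Rightarrow> real" where
  "cr_rate j s = (\<integral>x. (pps s x * cnj (W j s x)) \<bullet> W j s x \<partial>lborel)
      + 2 * (\<integral>x. (ppx s x * cnj (W j s x) + (p s x * p s x) * cnj (W (Suc j) s x)) \<bullet> (\<i> * of_real \<beta> * W (Suc j) s x) \<partial>lborel)
      + 2 * (\<integral>x. ((p s x * p s x) * cnj (W j s x)) \<bullet> GG j s x \<partial>lborel)"

lemma energy_W: "j \<le> k \<Longrightarrow> energy_rate t (\<lambda>s. (L2_nrm (W j s))\<^sup>2) (\<lambda>s. 2 * (\<integral>x. W j s x \<bullet> GG j s x \<partial>lborel))"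
  by (rule forced) (rule forced_schroedinger.energy_L2)

lemma energy_cr:
  assumes j: "Suc j \<le> k"
  shows "energy_rate t (cr j) (cr_rate j)"
proof -
  obtain B where B: "\<And>j. j \<le> k \<Longrightarrow> forced_schroedinger t \<beta> (W j) (GG j) B" "e \<le> B" using forced by blast
  have jk: "j \<le> k" using j by simp
  interpret F: forced_schroedinger t \<beta> "W j" "GG j" B by (rule B(1)[OF jk])
  show ?thesis
    unfolding cr_def[abs_def] cr_rate_def[abs_def]
  proof (rule F.energy_cross[where K = A2])
    fix s assume s: "s \<in> {0..t}"
    show "in_L2 (W (Suc j) s)" by (rule W_L2[OF s j])
    show "L2_nrm (W (Suc j) s) \<le> B" using W_le[OF s j] B(2) by simp
    show "has_weak_deriv 1 (W j s) (W (Suc j) s)" by (rule W_weak1[OF s j])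
    show "cmod (p s x * p s x) \<le> A2" "cmod (ppx s x) \<le> A2" "cmod (pps s x) \<le> A2" for x
      by (rule pp_le[OF s], rule ppx_le[OF s], rule pps_le[OF s])
    show "((\<lambda>x. p s x * p s x) has_vector_derivative ppx s x) (at x)" for x
      unfolding ppx_def by (rule has_vector_derivative_mult[OF px(1)[OF s] px(1)[OF s]])
    show "continuous_on UNIV (ppx s)"
      unfolding ppx_def[abs_def] by (intro continuous_intros W_bdd_continuous[OF px(2)[OF s]] W_bdd_continuous[OF pW[OF s]])
    show "((\<lambda>r. p r x * p r x) has_vector_derivative pps s x) (at s within {0..t})" for x
      unfolding pps_def by (rule has_vector_derivative_mult[OF ps[OF s] ps[OF s]])
    show "pps s \<in> borel_measurable borel"
      unfolding pps_def[abs_def] using p_borel[OF s] psm[OF s] by measurable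
    show "cmod (p r x * p r x - p s x * p s x) \<le> A2 * \<bar>r - s\<bar>" if "r \<in> {0..t}" for r x
      by (rule pp_lip[OF that s])
  qed
qed

lemma cr_bound:
  assumes s: "s \<in> {0..t}" and j: "j \<le> k"
  shows "\<bar>cr j s\<bar> \<le> A2 * (L2_nrm (W j s))\<^sup>2"
proof -
  note m = borel_measurable_times[OF p_borel[OF s] p_borel[OF s]]
  have "\<bar>cr j s\<bar> \<le> L2_nrm (\<lambda>x. (p s x * p s x) * cnj (W j s x)) * L2_nrm (W j s)"
    unfolding cr_def by (rule integral_inner_L2_le[OF in_L2_conj_mult[OF m pp_le[OF s] W_L2[OF s j]] W_L2[OF s j]])
  also have "\<dots> \<le> A2 * L2_nrm (W j s) * L2_nrm (W j s)"
    by (intro mult_right_mono L2_nrm_conj_mult[OF m pp_le[OF s] W_L2[OF s j]]) simp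
  finally show ?thesis by (simp add: power2_eq_square mult.assoc)
qed

text \<open>What remains of the j-th derivative of G when the linear terms with all derivatives on w
  are removed: commutators, nonlinearity and forcing.\<close>

definition HH :: "nat \<Rightarrow> real \<Rightarrow> real \<Rightarrow> complex" where
  "HH j s x = GG j s x - (aa s x * W j s x + bb s x * cnj (W j s x))"

lemma aa_m: "s \<in> {0..t} \<Longrightarrow> aa s \<in> borel_measurable borel" by (rule W_bdd_borel[OF aW])
lemma bb_m: "s \<in> {0..t} \<Longrightarrow> bb s \<in> borel_measurable borel" by (rule W_bdd_borel[OF bW])

lemma aaW_L2: "s \<in> {0..t} \<Longrightarrow> j \<le> k \<Longrightarrow> in_L2 (\<lambda>x. aa s x * W j s x)"
  by (rule L2_nrm_mult_bound(1)[OF aa_m W_bdd_bound[OF aW] W_L2])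
lemma bbW_L2: "s \<in> {0..t} \<Longrightarrow> j \<le> k \<Longrightarrow> in_L2 (\<lambda>x. bb s x * cnj (W j s x))"
  by (rule in_L2_conj_mult[OF bb_m W_bdd_bound[OF bW] W_L2])
lemma HH_L2: "s \<in> {0..t} \<Longrightarrow> j \<le> k \<Longrightarrow> in_L2 (HH j s)"
  unfolding HH_def[abs_def] by (intro in_L2_diff in_L2_add GG_L2 aaW_L2 bbW_L2)

text \<open>The commutators with \<open>aa\<close> and \<open>bb\<close> cost only the H^j norm of
  w, so the norm of order j + 1 enters through Q alone and carries the factor e.\<close>

lemma HH_bound:
  assumes s: "s \<in> {0..t}" and j: "Suc j \<le> k"
  shows "L2_nrm (HH (Suc j) s) \<le> KK j * (H_nrm j (w s) + e * H_nrm (Suc j) (w s) + n s)"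
proof -
  note w = in_H_mono[OF w_in_H[OF s] j]
  note aw = W_bdd_le[OF aW[OF s] j] and bw = W_bdd_le[OF bW[OF s] j]
  have cw: "in_H (Suc j) (\<lambda>x. cnj (w s x))" by (rule in_H_bounded_linear[OF bounded_linear_cnj w])
  have cwn: "H_nrm j (\<lambda>x. cnj (w s x)) \<le> H_nrm j (w s)"
    using H_nrm_bounded_linear[OF bounded_linear_cnj in_H_mono[OF w, of j], of 1] by simp
  have Ha: "in_H (Suc j) (\<lambda>x. aa s x * w s x)"
    using H_bdd_mult[OF aw, of "w s" "H_nrm (Suc j) (w s)"] w by (simp add: H_bdd_def)
  have Hb: "in_H (Suc j) (\<lambda>x. bb s x * cnj (w s x))"
    using H_bdd_mult[OF bw, of "\<lambda>x. cnj (w s x)" "H_nrm (Suc j) (\<lambda>x. cnj (w s x))"] cw by (simp add: H_bdd_def)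
  have HQ: "in_H (Suc j) (Q s)" "H_nrm (Suc j) (Q s) \<le> KQ j * (e * H_nrm (Suc j) (w s))"
    using QH[OF s j] by (auto simp: H_bdd_def)
  have Hf: "in_H (Suc j) (f s)" "H_nrm (Suc j) (f s) \<le> n s"
    using H_bdd_le[OF fH[OF s] j] by (auto simp: H_bdd_def)
  define c1 where "c1 x = weak_deriv (Suc j) (\<lambda>x. aa s x * w s x) x - aa s x * W (Suc j) s x" for x
  define c2 where "c2 x = weak_deriv (Suc j) (\<lambda>x. bb s x * cnj (w s x)) x - bb s x * weak_deriv (Suc j) (\<lambda>x. cnj (w s x)) x" for x
  define c3 where "c3 x = weak_deriv (Suc j) (Q s) x + weak_deriv (Suc j) (f s) x" for x
  note LQ = in_H_weak_deriv_L2[OF HQ(1) order_refl] and Lf = in_H_weak_deriv_L2[OF Hf(1) order_refl]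
  have L1: "in_L2 c1" unfolding c1_def[abs_def]
    by (intro in_L2_diff in_H_weak_deriv_L2[OF Ha] aaW_L2 s j) simp
  have L2: "in_L2 c2" unfolding c2_def[abs_def]
    by (intro in_L2_diff in_H_weak_deriv_L2[OF Hb] L2_nrm_mult_bound(1)[OF bb_m[OF s] W_bdd_bound[OF bW[OF s]]] in_H_weak_deriv_L2[OF cw]) simp_all
  have L3: "in_L2 c3" unfolding c3_def[abs_def] by (intro in_L2_add LQ Lf)
  have "AE x in lborel. HH (Suc j) s x = (c1 x + c2 x) + c3 x"
    using weak_deriv_add[OF in_H_add[OF Ha Hb] in_H_add[OF HQ(1) Hf(1)] order_refl]
      weak_deriv_add[OF Ha Hb order_refl] weak_deriv_add[OF HQ(1) Hf(1) order_refl]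
      weak_deriv_bounded_linear[OF bounded_linear_cnj w order_refl]
  proof eventually_elim
    case (elim x)
    have "GG (Suc j) s x = weak_deriv (Suc j) (\<lambda>x. aa s x * w s x + bb s x * cnj (w s x) + (Q s x + f s x)) x"
      by (simp add: GG_def G_def[abs_def])
    with elim show ?case by (simp add: HH_def c1_def c2_def c3_def W_def)
  qed
  then have "L2_nrm (HH (Suc j) s) = L2_nrm (\<lambda>x. (c1 x + c2 x) + c3 x)"
    by (intro L2_nrm_cong_AE HH_L2 s j in_L2_add L1 L2 L3)
  also have "\<dots> \<le> L2_nrm c1 + L2_nrm c2 + L2_nrm c3"
    using L2_nrm_triangle[OF in_L2_add[OF L1 L2] L3] L2_nrm_triangle[OF L1 L2] by linarith
  also have "L2_nrm c1 \<le> 3 ^ Suc j * ((1 + \<bar>\<alpha>\<bar>) + 2 ^ k * 2 * PP) * H_nrm j (w s)"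
    unfolding c1_def[abs_def] W_def by (rule weak_deriv_commutator[OF aw w])
  also have "L2_nrm c2 \<le> 3 ^ Suc j * (2 ^ k * 1 * PP) * H_nrm j (w s)"
  proof -
    have "L2_nrm c2 \<le> 3 ^ Suc j * (2 ^ k * 1 * PP) * H_nrm j (\<lambda>x. cnj (w s x))"
      unfolding c2_def[abs_def] by (rule weak_deriv_commutator[OF bw cw])
    also have "\<dots> \<le> 3 ^ Suc j * (2 ^ k * 1 * PP) * H_nrm j (w s)"
      using cwn PP_nonneg by (intro mult_left_mono) auto
    finally show ?thesis .
  qed
  also have "L2_nrm c3 \<le> KQ j * (e * H_nrm (Suc j) (w s)) + n s"
  proof -
    have "L2_nrm c3 \<le> L2_nrm (weak_deriv (Suc j) (Q s)) + L2_nrm (weak_deriv (Suc j) (f s))"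
      unfolding c3_def[abs_def] by (rule L2_nrm_triangle[OF LQ Lf])
    then show ?thesis
      using L2_nrm_weak_deriv_le[OF order_refl, of "Suc j" "Q s"] L2_nrm_weak_deriv_le[OF order_refl, of "Suc j" "f s"] HQ(2) Hf(2)
      by linarith
  qed
  finally have "L2_nrm (HH (Suc j) s) \<le> 3 ^ Suc j * AB * H_nrm j (w s) + KQ j * (e * H_nrm (Suc j) (w s)) + n s"
    by (simp add: AB_def algebra_simps)
  also have "\<dots> \<le> KK j * H_nrm j (w s) + KK j * (e * H_nrm (Suc j) (w s)) + KK j * n s"
  proof (intro add_mono mult_right_mono)
    have "0 \<le> 3 ^ Suc j * AB" "0 \<le> AB * 3 ^ j" using AB_nonneg by simp_all
    then show "3 ^ Suc j * AB \<le> KK j" "KQ j \<le> KK j" and "n s \<le> KK j * n s"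
      using KQ_nonneg[of j] mult_right_mono[of 1 "KK j" "n s"] n_nonneg[OF s] by (auto simp: KK_def)
  qed (use e_nonneg in auto)
  finally show ?thesis by (simp add: algebra_simps)
qed

lemma GG_bound:
  assumes s: "s \<in> {0..t}" and j: "Suc j \<le> k"
  shows "L2_nrm (GG j s) \<le> KK j * (H_nrm j (w s) + e * H_nrm (Suc j) (w s) + n s)"
proof -
  have "L2_nrm (GG j s) \<le> H_nrm j (G s)" unfolding GG_def by (rule L2_nrm_weak_deriv_le) simp
  also have "\<dots> \<le> 3 ^ j * AB * H_nrm j (w s) + KQ j * (e * H_nrm (Suc j) (w s)) + n s"
    using GH[OF s j, of j] by (simp add: H_bdd_def)
  also have "\<dots> \<le> KK j * H_nrm j (w s) + KK j * (e * H_nrm (Suc j) (w s)) + KK j * n s"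
  proof (intro add_mono mult_right_mono)
    have "0 \<le> 3 ^ j * AB" "0 \<le> AB * 3 ^ j" using AB_nonneg by simp_all
    then show "3 ^ j * AB \<le> KK j" "KQ j \<le> KK j" and "n s \<le> KK j * n s"
      using KQ_nonneg[of j] mult_right_mono[of 1 "KK j" "n s"] n_nonneg[OF s] by (auto simp: KK_def)
  qed (use e_nonneg in auto)
  finally show ?thesis by (simp add: algebra_simps)
qed

lemma W_GG_inner:
  assumes s: "s \<in> {0..t}" and j: "j \<le> k"
  shows "(\<integral>x. W j s x \<bullet> GG j s x \<partial>lborel) = - (L2_nrm (W j s))\<^sup>2
    + (\<integral>x. W j s x \<bullet> (bb s x * cnj (W j s x)) \<partial>lborel) + (\<integral>x. W j s x \<bullet> HH j s x \<partial>lborel)"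
proof -
  note L = W_L2[OF s j]
  have Re_aa: "Re (aa s x) = - 1" for x by (simp add: aa_def complex_mult_cnj)
  have "W j s x \<bullet> GG j s x = (- (norm (W j s x))\<^sup>2 + W j s x \<bullet> (bb s x * cnj (W j s x))) + W j s x \<bullet> HH j s x" for x
    using inner_mult_I_self[of "W j s x" "aa s x"] by (simp add: HH_def inner_diff_right inner_add_right Re_aa)
  then have "(\<integral>x. W j s x \<bullet> GG j s x \<partial>lborel)
      = (\<integral>x. (- (norm (W j s x))\<^sup>2 + W j s x \<bullet> (bb s x * cnj (W j s x))) + W j s x \<bullet> HH j s x \<partial>lborel)"
    by presburger
  also have "\<dots> = (\<integral>x. - (norm (W j s x))\<^sup>2 \<partial>lborel) + (\<integral>x. W j s x \<bullet> (bb s x * cnj (W j s x)) \<partial>lborel)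
      + (\<integral>x. W j s x \<bullet> HH j s x \<partial>lborel)"
    using in_L2_norm_sq[OF L] integrable_inner_L2[OF L bbW_L2[OF s j]] integrable_inner_L2[OF L HH_L2[OF s j]] by simp
  finally show ?thesis by (simp add: L2_nrm_sq)
qed

lemma cancellation:
  assumes s: "s \<in> {0..t}" and j: "Suc j \<le> k"
  shows "2 * (\<integral>x. W (Suc j) s x \<bullet> GG (Suc j) s x \<partial>lborel) + (1 / \<beta>) * cr_rate j s
    = - 2 * (L2_nrm (W (Suc j) s))\<^sup>2 + 2 * (\<integral>x. W (Suc j) s x \<bullet> HH (Suc j) s x \<partial>lborel)
      + (1 / \<beta>) * (\<integral>x. (pps s x * cnj (W j s x)) \<bullet> W j s x \<partial>lborel)
      + 2 * (\<integral>x. (ppx s x * cnj (W j s x)) \<bullet> (\<i> * W (Suc j) s x) \<partial>lborel)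
      + (2 / \<beta>) * (\<integral>x. ((p s x * p s x) * cnj (W j s x)) \<bullet> GG j s x \<partial>lborel)"
proof -
  have jk: "j \<le> k" using j by simp
  note m = borel_measurable_times[OF p_borel[OF s] p_borel[OF s]]
  have mx: "ppx s \<in> borel_measurable borel"
    unfolding ppx_def[abs_def] using p_borel[OF s] W_bdd_borel[OF px(2)[OF s]] by measurable
  note L1 = in_L2_conj_mult[OF mx ppx_le[OF s] W_L2[OF s jk]] and L2 = in_L2_conj_mult[OF m pp_le[OF s] W_L2[OF s j]]
  have L3: "in_L2 (\<lambda>x. \<i> * W (Suc j) s x)"
    by (rule in_L2_bounded_linear[OF bounded_linear_mult_right W_L2[OF s j]])
  have "(\<integral>x. (ppx s x * cnj (W j s x) + (p s x * p s x) * cnj (W (Suc j) s x)) \<bullet> (\<i> * of_real \<beta> * W (Suc j) s x) \<partial>lborel)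
      = (\<integral>x. \<beta> * ((ppx s x * cnj (W j s x)) \<bullet> (\<i> * W (Suc j) s x) + ((p s x * p s x) * cnj (W (Suc j) s x)) \<bullet> (\<i> * W (Suc j) s x)) \<partial>lborel)"
    by (rule Bochner_Integration.integral_cong) (auto simp: inner_complex_def algebra_simps)
  also have "\<dots> = \<beta> * ((\<integral>x. (ppx s x * cnj (W j s x)) \<bullet> (\<i> * W (Suc j) s x) \<partial>lborel)
      + (\<integral>x. ((p s x * p s x) * cnj (W (Suc j) s x)) \<bullet> (\<i> * W (Suc j) s x) \<partial>lborel))"
    using integrable_inner_L2[OF L1 L3] integrable_inner_L2[OF L2 L3] by simp
  \<comment> \<open>Moving i across the real inner product changes the sign, which turns this into
    minus the indefinite term of \<open>W_GG_inner\<close>. The factor beta in front cancels against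
    1 / beta.\<close>
  also have "(\<integral>x. ((p s x * p s x) * cnj (W (Suc j) s x)) \<bullet> (\<i> * W (Suc j) s x) \<partial>lborel)
      = (\<integral>x. - (W (Suc j) s x \<bullet> (bb s x * cnj (W (Suc j) s x))) \<partial>lborel)"
    by (rule Bochner_Integration.integral_cong) (auto simp: bb_def inner_complex_def algebra_simps)
  finally have eq: "(\<integral>x. (ppx s x * cnj (W j s x) + (p s x * p s x) * cnj (W (Suc j) s x)) \<bullet> (\<i> * of_real \<beta> * W (Suc j) s x) \<partial>lborel)
      = \<beta> * ((\<integral>x. (ppx s x * cnj (W j s x)) \<bullet> (\<i> * W (Suc j) s x) \<partial>lborel)
      - (\<integral>x. W (Suc j) s x \<bullet> (bb s x * cnj (W (Suc j) s x)) \<partial>lborel))" by simp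
  show ?thesis
    unfolding cr_rate_def eq W_GG_inner[OF s j] using \<beta> by (simp add: field_simps)
qed

text \<open>It dominates the coefficients 1 / |beta|, 2 and 2 / |beta|, each times
  \<open>A2\<close>, of the lower order terms in \<open>cancellation\<close>. \<open>LC\<close> is
  the constant of \<open>level_arith\<close> with a = \<open>KK j\<close> and b =
  \<open>LB\<close>.\<close>

definition LB :: real where "LB = A2 * (2 + 3 / \<bar>\<beta>\<bar>)"
definition LC :: "nat \<Rightarrow> real" where "LC j = 32 * (KK j)\<^sup>2 + 8 * LB\<^sup>2 + LB + 8 * KK j * LB + 8"

lemma A2_nonneg: "0 \<le> A2" using A_nonneg by (simp add: A2_def)
lemma LB_nonneg: "0 \<le> LB" using A2_nonneg by (simp add: LB_def)

text \<open>After the cancellation each remaining term contains either \<open>HH\<close> or the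
  lower derivative \<open>W j\<close>. Cauchy-Schwarz bounds them by products of the numbers in
  \<open>level_arith\<close>.\<close>

theorem level_estimate:
  assumes s: "s \<in> {0..t}" and j: "Suc j \<le> k" and small: "e * KK j \<le> 1 / 8"
  shows "2 * (\<integral>x. W (Suc j) s x \<bullet> GG (Suc j) s x \<partial>lborel) + (1 / \<beta>) * cr_rate j s
    \<le> - (L2_nrm (W (Suc j) s))\<^sup>2 + LC j * ((H_nrm j (w s))\<^sup>2 + (n s)\<^sup>2)"
proof -
  have jk: "j \<le> k" using j by simp
  define x where "x = L2_nrm (W (Suc j) s)"
  define Y where "Y = H_nrm j (w s)"
  define z where "z = H_nrm (Suc j) (w s)"
  define h where "h = KK j * (Y + e * z + n s)"
  have y: "L2_nrm (W j s) \<le> Y" unfolding W_def Y_def by (rule L2_nrm_weak_deriv_le) simp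
  have z: "z \<le> Y + x"
  proof -
    have "z\<^sup>2 \<le> (Y + x)\<^sup>2"
      unfolding z_def Y_def x_def W_def H_nrm_Suc_sq by (simp add: power2_sum)
    then show ?thesis by (rule power2_le_imp_le) (simp add: Y_def x_def)
  qed
  have nn: "0 \<le> x" "0 \<le> Y" "0 \<le> z" "0 \<le> n s" by (auto simp: x_def Y_def z_def n_nonneg[OF s])
  have h0: "0 \<le> h" using nn KK_nonneg e_nonneg by (simp add: h_def)
  note Wj = W_L2[OF s jk] and WS = W_L2[OF s j]
  note m = borel_measurable_times[OF p_borel[OF s] p_borel[OF s]]
  have mx: "ppx s \<in> borel_measurable borel"
    unfolding ppx_def[abs_def] using p_borel[OF s] W_bdd_borel[OF px(2)[OF s]] by measurable
  have ms: "pps s \<in> borel_measurable borel"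
    unfolding pps_def[abs_def] using p_borel[OF s] psm[OF s] by measurable
  have cm: "L2_nrm (\<lambda>x. b x * cnj (W j s x)) \<le> A2 * Y" "in_L2 (\<lambda>x. b x * cnj (W j s x))"
    if "b \<in> borel_measurable borel" "\<And>x. cmod (b x) \<le> A2" for b
    using order_trans[OF L2_nrm_conj_mult[OF that Wj] mult_left_mono[OF y A2_nonneg]] in_L2_conj_mult[OF that Wj] .
  have AY: "0 \<le> A2 * Y" using A2_nonneg nn by simp
  have i1: "(\<integral>u. W (Suc j) s u \<bullet> HH (Suc j) s u \<partial>lborel) \<le> x * h"
  proof -
    have "L2_nrm (HH (Suc j) s) \<le> h" unfolding h_def Y_def z_def by (rule HH_bound[OF s j])
    then have "L2_nrm (W (Suc j) s) * L2_nrm (HH (Suc j) s) \<le> x * h"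
      unfolding x_def by (intro mult_left_mono) auto
    then show ?thesis using integral_inner_L2_le[OF WS HH_L2[OF s j]] by linarith
  qed
  have i2: "\<bar>\<integral>u. (pps s u * cnj (W j s u)) \<bullet> W j s u \<partial>lborel\<bar> \<le> A2 * Y * Y"
    by (rule order_trans[OF integral_inner_L2_le[OF cm(2)[OF ms pps_le[OF s]] Wj] mult_mono[OF cm(1)[OF ms pps_le[OF s]] y AY L2_nrm_nonneg]])
  have i3: "\<bar>\<integral>u. (ppx s u * cnj (W j s u)) \<bullet> (\<i> * W (Suc j) s u) \<partial>lborel\<bar> \<le> A2 * Y * x"
  proof -
    have L3: "in_L2 (\<lambda>u. \<i> * W (Suc j) s u)" "L2_nrm (\<lambda>u. \<i> * W (Suc j) s u) = x"
      using in_L2_bounded_linear[OF bounded_linear_mult_right WS] by (auto simp: x_def L2_nrm_def norm_mult)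
    show ?thesis
      by (rule order_trans[OF integral_inner_L2_le[OF cm(2)[OF mx ppx_le[OF s]] L3(1)]])
         (unfold L3(2), rule mult_right_mono[OF cm(1)[OF mx ppx_le[OF s]] nn(1)])
  qed
  have i4: "\<bar>\<integral>u. ((p s u * p s u) * cnj (W j s u)) \<bullet> GG j s u \<partial>lborel\<bar> \<le> A2 * Y * h"
    unfolding h_def Y_def z_def
    by (rule order_trans[OF integral_inner_L2_le[OF cm(2)[OF m pp_le[OF s]] GG_L2[OF s jk]]
          mult_mono[OF cm(1)[OF m pp_le[OF s], unfolded Y_def] GG_bound[OF s j] AY[unfolded Y_def] L2_nrm_nonneg]])
  have absb: "(c / \<beta>) * I \<le> (c / \<bar>\<beta>\<bar>) * J" if "\<bar>I\<bar> \<le> J" "0 \<le> c" for c I J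
  proof -
    have "(c / \<beta>) * I \<le> \<bar>(c / \<beta>) * I\<bar>" by (rule abs_ge_self)
    also have "\<dots> = (c / \<bar>\<beta>\<bar>) * \<bar>I\<bar>" using that(2) by (simp add: abs_mult)
    also have "\<dots> \<le> (c / \<bar>\<beta>\<bar>) * J" using that by (intro mult_left_mono) auto
    finally show ?thesis .
  qed
  have "2 * (\<integral>x. W (Suc j) s x \<bullet> GG (Suc j) s x \<partial>lborel) + (1 / \<beta>) * cr_rate j s
      \<le> - 2 * x\<^sup>2 + 2 * (x * h) + ((1 / \<bar>\<beta>\<bar>) * (A2 * Y * Y) + 2 * (A2 * Y * x) + (2 / \<bar>\<beta>\<bar>) * (A2 * Y * h))"
    unfolding cancellation[OF s j] x_def[symmetric]
    using i1 absb[OF i2, of 1] abs_le_D1[OF i3] absb[OF i4, of 2] by linarith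
  also have "\<dots> \<le> - 2 * x\<^sup>2 + 2 * (x * h) + LB * (Y\<^sup>2 + Y * x + Y * h)"
  proof -
    have q: "0 \<le> A2 * (Y * Y)" "0 \<le> A2 * (Y * x)" "0 \<le> A2 * (Y * h)" using A2_nonneg nn h0 by auto
    have q': "0 \<le> A2 * (Y * Y) / \<bar>\<beta>\<bar>" "0 \<le> A2 * (Y * x) / \<bar>\<beta>\<bar>" "0 \<le> A2 * (Y * h) / \<bar>\<beta>\<bar>" using q by auto
    have eq: "LB * (Y\<^sup>2 + Y * x + Y * h) = 2 * (A2 * (Y * Y)) + 2 * (A2 * (Y * x)) + 2 * (A2 * (Y * h))
       + 3 * (A2 * (Y * Y) / \<bar>\<beta>\<bar>) + 3 * (A2 * (Y * x) / \<bar>\<beta>\<bar>) + 3 * (A2 * (Y * h) / \<bar>\<beta>\<bar>)"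
      by (simp add: LB_def power2_eq_square distrib_left distrib_right mult.assoc mult.commute[of _ A2] mult.left_commute[of _ A2])
    have eq2: "(1 / \<bar>\<beta>\<bar>) * (A2 * Y * Y) + 2 * (A2 * Y * x) + (2 / \<bar>\<beta>\<bar>) * (A2 * Y * h)
      = A2 * (Y * Y) / \<bar>\<beta>\<bar> + 2 * (A2 * (Y * x)) + 2 * (A2 * (Y * h) / \<bar>\<beta>\<bar>)" by (simp add: mult.assoc)
    have gen: "X + (d1 + 2 * a2 + 2 * d3) \<le> X + (2 * a1 + 2 * a2 + 2 * a3 + 3 * d1 + 3 * d2 + 3 * d3)"
      if "0 \<le> a1" "0 \<le> a2" "0 \<le> a3" "0 \<le> d1" "0 \<le> d2" "0 \<le> d3" for X a1 a2 a3 d1 d2 d3 :: real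
      using that by linarith
    show ?thesis unfolding eq eq2 by (rule gen[OF q q'])
  qed
  also have "\<dots> \<le> - x\<^sup>2 + (32 * (KK j)\<^sup>2 + 8 * LB\<^sup>2 + LB + 8 * KK j * LB + 8) * (Y\<^sup>2 + (n s)\<^sup>2)"
    using level_arith[OF nn(1,2,4) KK_nonneg LB_nonneg e_nonneg e1 small z, of h] by (simp add: h_def)
  finally show ?thesis by (simp add: x_def Y_def LC_def)
qed

text \<open>At level 0 the L2 norm is allowed on the right, so a crude bound suffices. The embedding
  of H^1 gives |w| <= 2 almost everywhere, because the norm is at most e <= 1, and this makes the
  nonlinearity linear in |w|.\<close>

lemma ground_estimate:
  assumes s: "s \<in> {0..t}"
  shows "2 * (\<integral>x. W 0 s x \<bullet> GG 0 s x \<partial>lborel) \<le> (2 * (AB + 8 * A + 9)) * ((L2_nrm (w s))\<^sup>2 + (n s)\<^sup>2)"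
proof -
  define X where "X = L2_nrm (w s)"
  have wL: "in_L2 (w s)" by (rule in_H_L2[OF w_in_H[OF s]])
  have GL: "in_L2 (G s)" by (rule in_H_L2[OF G_in_H[OF s]])
  have fL: "in_L2 (f s)" and fn: "L2_nrm (f s) \<le> n s"
    using fH[OF s] L2_nrm_le_H_nrm[of "f s" k] by (auto simp: H_bdd_def in_H_def)
  have "in_H (Suc 0) (w s)" using in_H_mono[OF w_in_H[OF s], of "Suc 0"] k by simp
  then obtain w' where w': "continuous_on UNIV w'" "AE x in lborel. w s x = w' x" "in_H (Suc 0) w'"
      "H_nrm (Suc 0) (w s) = H_nrm (Suc 0) w'"
    by (rule in_H_Suc_continuous_rep)
  have "cmod (w' x) \<le> 2" for x
    using H_sup_bound[OF w'(3,1), of x] w_le[OF s, of "Suc 0"] k w'(4) e1 by simp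
  then have "AE x in lborel. cmod (w s x) \<le> 2"
    using w'(2) by (auto elim!: eventually_mono)
  then have bd: "AE x in lborel. norm (aa s x * w s x + bb s x * cnj (w s x) + Q s x) \<le> (AB + 8 * A + 8) * norm (w s x)"
  proof eventually_elim
    case (elim x)
    have a: "cmod (aa s x) \<le> (1 + \<bar>\<alpha>\<bar>) + 2 ^ k * 2 * PP" "cmod (bb s x) \<le> 2 ^ k * 1 * PP" "cmod (p s x) \<le> A"
      by (rule W_bdd_bound[OF aW[OF s]], rule W_bdd_bound[OF bW[OF s]], rule p_le[OF s])
    let ?w = "cmod (w s x)"
    have ww: "?w * ?w \<le> 2 * ?w" using elim by (rule mult_right_mono) simp
    have www: "?w * ?w * ?w \<le> 4 * ?w"
      using mult_mono[OF ww elim] by simp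
    have "cmod (Q s x) \<le> 2 * (A * (?w * ?w)) + (A * (?w * ?w) + ?w * ?w * ?w)"
    proof -
      have "cmod (Q s x) \<le> cmod (2 * (p s x * (w s x * cnj (w s x)))) + (cmod (cnj (p s x) * (w s x * w s x)) + cmod ((w s x * w s x) * cnj (w s x)))"
      proof -
        have t: "cmod (\<i> * (a + (b + c))) \<le> cmod a + (cmod b + cmod c)" for a b c
          using norm_triangle_ineq[of a "b + c"] norm_triangle_ineq[of b c] by (simp add: norm_mult)
        show ?thesis unfolding Q_def by (rule t)
      qed
      also have "\<dots> = 2 * (cmod (p s x) * (?w * ?w)) + (cmod (p s x) * (?w * ?w) + ?w * ?w * ?w)"
        by (simp add: norm_mult)
      also have "\<dots> \<le> 2 * (A * (?w * ?w)) + (A * (?w * ?w) + ?w * ?w * ?w)"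
        using a(3) by (intro add_mono mult_left_mono mult_right_mono) auto
      finally show ?thesis .
    qed
    also have "\<dots> \<le> 2 * (A * (2 * ?w)) + (A * (2 * ?w) + 4 * ?w)"
      using A_nonneg ww www by (intro add_mono mult_left_mono) auto
    finally have q: "cmod (Q s x) \<le> 6 * (A * ?w) + 4 * ?w" by simp
    have "norm (aa s x * w s x + bb s x * cnj (w s x) + Q s x) \<le> cmod (aa s x) * ?w + cmod (bb s x) * ?w + cmod (Q s x)"
      using norm_triangle_ineq[of "aa s x * w s x + bb s x * cnj (w s x)" "Q s x"]
        norm_triangle_ineq[of "aa s x * w s x" "bb s x * cnj (w s x)"] by (simp add: norm_mult)
    also have "\<dots> \<le> ((1 + \<bar>\<alpha>\<bar>) + 2 ^ k * 2 * PP) * ?w + (2 ^ k * 1 * PP) * ?w + (6 * (A * ?w) + 4 * ?w)"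
      using a q by (intro add_mono mult_right_mono) auto
    also have "\<dots> = AB * ?w + 6 * (A * ?w) + 4 * ?w" by (simp add: AB_def algebra_simps)
    also have "\<dots> \<le> AB * ?w + 8 * (A * ?w) + 8 * ?w" using A_nonneg by simp
    finally show ?case by (simp add: algebra_simps)
  qed
  have fm: "f s \<in> borel_measurable borel" "G s \<in> borel_measurable borel" using in_L2_borel[OF fL] in_L2_borel[OF GL] .
  have eqG: "G s x = (aa s x * w s x + bb s x * cnj (w s x) + Q s x) + f s x" for x by (simp add: G_def)
  have m: "(\<lambda>x. aa s x * w s x + bb s x * cnj (w s x) + Q s x) \<in> borel_measurable lborel"
  proof -
    have "(\<lambda>x. G s x - f s x) \<in> borel_measurable borel" using fm by measurable
    then show ?thesis by (simp add: G_def add.assoc)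
  qed
  have RL: "in_L2 (\<lambda>x. aa s x * w s x + bb s x * cnj (w s x) + Q s x)"
    using in_L2_diff[OF GL fL] by (simp add: G_def add.assoc)
  have C0: "0 \<le> AB + 8 * A + 8" using AB_nonneg A_nonneg by simp
  have "L2_nrm (G s) \<le> L2_nrm (\<lambda>x. aa s x * w s x + bb s x * cnj (w s x) + Q s x) + L2_nrm (f s)"
    using L2_nrm_triangle[OF RL fL] by (simp add: eqG[abs_def])
  also have "\<dots> \<le> (AB + 8 * A + 8) * X + n s"
    unfolding X_def using L2_nrm_cmult_bound[OF wL m bd C0] fn by linarith
  finally have G: "L2_nrm (G s) \<le> (AB + 8 * A + 8) * X + n s" .
  have W0: "L2_nrm (W 0 s) = X" "L2_nrm (GG 0 s) = L2_nrm (G s)"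
    by (simp_all add: W_def GG_def X_def L2_nrm_weak_deriv_0 wL GL)
  have X0: "0 \<le> X" by (simp add: X_def)
  have "(\<integral>x. W 0 s x \<bullet> GG 0 s x \<partial>lborel) \<le> X * L2_nrm (G s)"
    using integral_inner_L2_le[OF W_L2[OF s] GG_L2[OF s], of 0 0] unfolding W0 by simp
  also have "\<dots> \<le> X * ((AB + 8 * A + 8) * X + n s)" by (rule mult_left_mono[OF G X0])
  also have "\<dots> = (AB + 8 * A + 8) * X\<^sup>2 + X * n s" by (simp add: power2_eq_square algebra_simps)
  also have "\<dots> \<le> (AB + 8 * A + 8) * (X\<^sup>2 + (n s)\<^sup>2) + 1 * (X\<^sup>2 + (n s)\<^sup>2)"
  proof (rule add_mono)
    show "(AB + 8 * A + 8) * X\<^sup>2 \<le> (AB + 8 * A + 8) * (X\<^sup>2 + (n s)\<^sup>2)" using C0 by (intro mult_left_mono) auto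
    show "X * n s \<le> 1 * (X\<^sup>2 + (n s)\<^sup>2)"
      using sum_squares_bound[of X "n s"] mult_nonneg_nonneg[OF X0 n_nonneg[OF s]] by simp
  qed
  finally show ?thesis by (simp add: X_def algebra_simps)
qed

end

section \<open>The weighted sum over the derivative levels\<close>

lemma (in modulated_lle) L2_w: "s \<in> {0..t} \<Longrightarrow> L2_nrm (W 0 s) = L2_nrm (w s)"
  unfolding W_def by (rule L2_nrm_weak_deriv_0[OF in_H_L2[OF w_in_H]])

text \<open>The new functional is mu E plus the squared top norm plus cr / beta. The first summand
  of mu lets mu c outweigh the possible negativity of cr / beta, the second lets mu theta outweigh
  the lower order loss in \<open>level_estimate\<close>. Both leave a surplus of 1, which is why the
  new lower constant and decay rate are 1.\<close>

lemma (in modulated_lle) step_functional: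
  assumes j: "Suc j \<le> k" and small: "e * KK j \<le> 1 / 8"
    and E: "energy_rate t E D"
    and lo: "\<And>s. s \<in> {0..t} \<Longrightarrow> c * (H_nrm j (w s))\<^sup>2 \<le> E s"
    and hi: "\<And>s. s \<in> {0..t} \<Longrightarrow> E s \<le> C * (H_nrm j (w s))\<^sup>2"
    and rate: "\<And>s. s \<in> {0..t} \<Longrightarrow> D s \<le> - \<theta> * (H_nrm j (w s))\<^sup>2 + C * ((L2_nrm (w s))\<^sup>2 + (n s)\<^sup>2)"
    and cC: "0 < c" "0 < \<theta>" "0 < C"
    and \<mu>: "\<mu> = (A2 / \<bar>\<beta>\<bar> + 1) / c + (LC j + 1) / \<theta>"
    and C': "C' = \<mu> * C + A2 / \<bar>\<beta>\<bar> + 1 + LC j"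
  shows "\<exists>E D. energy_rate t E D \<and> (\<forall>s\<in>{0..t}. (H_nrm (Suc j) (w s))\<^sup>2 \<le> E s
      \<and> E s \<le> C' * (H_nrm (Suc j) (w s))\<^sup>2
      \<and> D s \<le> - 1 * (H_nrm (Suc j) (w s))\<^sup>2 + C' * ((L2_nrm (w s))\<^sup>2 + (n s)\<^sup>2))"
proof -
  have jk: "j \<le> k" using j by simp
  define q where "q = A2 / \<bar>\<beta>\<bar>"
  have q: "0 \<le> q" using A2_nonneg by (simp add: q_def)
  have LC: "0 \<le> LC j" using KK_nonneg LB_nonneg by (simp add: LC_def)
  have \<mu>0: "0 \<le> \<mu>" unfolding \<mu> q_def[symmetric] using q LC cC by simp
  have \<mu>c: "q + 1 \<le> \<mu> * c"
  proof -
    have "q + 1 = (q + 1) / c * c" using cC by simp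
    also have "\<dots> \<le> \<mu> * c" unfolding \<mu> q_def[symmetric] using LC cC by (intro mult_right_mono) auto
    finally show ?thesis .
  qed
  have \<mu>\<theta>: "LC j + 1 \<le> \<mu> * \<theta>"
  proof -
    have "LC j + 1 = (LC j + 1) / \<theta> * \<theta>" using cC by simp
    also have "\<dots> \<le> \<mu> * \<theta>" unfolding \<mu> q_def[symmetric] using q cC by (intro mult_right_mono) auto
    finally show ?thesis .
  qed
  let ?E = "\<lambda>s. \<mu> * E s + ((L2_nrm (W (Suc j) s))\<^sup>2 + (1 / \<beta>) * cr j s)"
  let ?D = "\<lambda>s. \<mu> * D s + (2 * (\<integral>x. W (Suc j) s x \<bullet> GG (Suc j) s x \<partial>lborel) + (1 / \<beta>) * cr_rate j s)"
  have "energy_rate t ?E ?D"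
    by (intro energy_rate_add energy_rate_cmult E energy_W energy_cr j)
  moreover have "(H_nrm (Suc j) (w s))\<^sup>2 \<le> ?E s \<and> ?E s \<le> C' * (H_nrm (Suc j) (w s))\<^sup>2
      \<and> ?D s \<le> - 1 * (H_nrm (Suc j) (w s))\<^sup>2 + C' * ((L2_nrm (w s))\<^sup>2 + (n s)\<^sup>2)" if s: "s \<in> {0..t}" for s
  proof -
    define Y where "Y = (H_nrm j (w s))\<^sup>2"
    define X where "X = (L2_nrm (W (Suc j) s))\<^sup>2"
    define N where "N = (L2_nrm (w s))\<^sup>2 + (n s)\<^sup>2"
    have z: "(H_nrm (Suc j) (w s))\<^sup>2 = Y + X" by (simp add: H_nrm_Suc_sq Y_def X_def W_def)
    have nn: "0 \<le> Y" "0 \<le> X" "0 \<le> N" "(n s)\<^sup>2 \<le> N" by (auto simp: Y_def X_def N_def)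
    have "\<bar>(1 / \<beta>) * cr j s\<bar> \<le> q * Y"
    proof -
      have "L2_nrm (W j s) \<le> H_nrm j (w s)" unfolding W_def by (rule L2_nrm_weak_deriv_le) simp
      then have "(L2_nrm (W j s))\<^sup>2 \<le> Y" unfolding Y_def by (rule power_mono) simp
      then have "\<bar>cr j s\<bar> \<le> A2 * Y" using cr_bound[OF s jk] mult_left_mono[OF _ A2_nonneg] by (meson order_trans)
      then have "\<bar>cr j s\<bar> / \<bar>\<beta>\<bar> \<le> A2 * Y / \<bar>\<beta>\<bar>" by (rule divide_right_mono) simp
      then show ?thesis by (simp add: q_def abs_mult)
    qed
    then have cr: "- (q * Y) \<le> (1 / \<beta>) * cr j s" "(1 / \<beta>) * cr j s \<le> q * Y" by linarith+
    have "Y + X \<le> ?E s"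
    proof -
      have "(q + 1) * Y \<le> \<mu> * c * Y" by (rule mult_right_mono[OF \<mu>c nn(1)])
      also have "\<dots> \<le> \<mu> * E s" using mult_left_mono[OF lo[OF s] \<mu>0] by (simp add: Y_def mult.assoc)
      finally show ?thesis using cr by (simp add: X_def[symmetric] algebra_simps)
    qed
    moreover have "?E s \<le> C' * (Y + X)"
    proof -
      have "\<mu> * E s \<le> \<mu> * C * Y" using mult_left_mono[OF hi[OF s] \<mu>0] by (simp add: Y_def mult.assoc)
      then have "?E s \<le> \<mu> * C * Y + X + q * Y" using cr by (simp add: X_def[symmetric])
      also have "\<dots> \<le> C' * (Y + X)"
      proof -
        have "0 \<le> \<mu> * C * X" "0 \<le> q * X" "0 \<le> LC j * Y" "0 \<le> LC j * X" using \<mu>0 cC q LC nn by auto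
        then show ?thesis using nn unfolding C' q_def[symmetric] by (simp add: algebra_simps)
      qed
      finally show ?thesis .
    qed
    moreover have "?D s \<le> - 1 * (Y + X) + C' * N"
    proof -
      have "\<mu> * D s \<le> \<mu> * (- \<theta> * Y + C * N)" using mult_left_mono[OF rate[OF s] \<mu>0] by (simp add: Y_def N_def)
      also have "\<dots> = - (\<mu> * \<theta> * Y) + \<mu> * C * N" by (simp add: algebra_simps)
      finally have 1: "\<mu> * D s \<le> - (\<mu> * \<theta> * Y) + \<mu> * C * N" .
      have 2: "(LC j + 1) * Y \<le> \<mu> * \<theta> * Y" by (rule mult_right_mono[OF \<mu>\<theta> nn(1)])
      have 3: "2 * (\<integral>x. W (Suc j) s x \<bullet> GG (Suc j) s x \<partial>lborel) + (1 / \<beta>) * cr_rate j s \<le> - X + LC j * (Y + (n s)\<^sup>2)"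
        unfolding X_def Y_def by (rule level_estimate[OF s j small])
      have 4: "LC j * (n s)\<^sup>2 \<le> LC j * N" by (rule mult_left_mono[OF nn(4) LC])
      have 5: "0 \<le> q * N" using q nn by simp
      have "?D s \<le> - Y - X + (\<mu> * C * N + LC j * N)"
        using 1 2 3 4 by (simp add: algebra_simps)
      also have "\<dots> \<le> - 1 * (Y + X) + C' * N"
        using 5 nn unfolding C' q_def[symmetric] by (simp add: algebra_simps)
      finally show ?thesis .
    qed
    ultimately show ?thesis unfolding z N_def by blast
  qed
  ultimately show ?thesis by blast
qed

text \<open>The constants precede the quantifiers over time interval, profile, forcing and solution,
  so each induction step has to name them outside the locale.\<close>

lemma energy_functional:
  assumes "m \<le> k" "0 \<le> A"
  shows "\<exists>c>0. \<exists>C>0. \<exists>\<theta>>0. \<exists>\<epsilon>>0. \<forall>t e N w p ps f n. modulated_lle \<alpha> \<beta> A k t e N w p ps f n \<longrightarrow> e \<le> \<epsilon> \<longrightarrow>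
    (\<exists>E D. energy_rate t E D \<and> (\<forall>s\<in>{0..t}. c * (H_nrm m (w s))\<^sup>2 \<le> E s \<and> E s \<le> C * (H_nrm m (w s))\<^sup>2
      \<and> D s \<le> - \<theta> * (H_nrm m (w s))\<^sup>2 + C * ((L2_nrm (w s))\<^sup>2 + (n s)\<^sup>2)))"
  using assms(1)
proof (induction m)
  case 0
  \<comment> \<open>The constant of \<open>ground_estimate\<close> with its abbreviations expanded.
    The extra 1 pays for the decay rate 1, since at level 0 the decaying norm is the L2 norm that
    stands on the right.\<close>
  define C where "C = 2 * (((1 + \<bar>\<alpha>\<bar>) + 2 ^ k * 2 * (2 ^ k * A * A) + 2 ^ k * 1 * (2 ^ k * A * A)) + 8 * A + 9) + 1"
  have C: "C > 0" using assms(2) by (simp add: C_def add_pos_nonneg)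
  have "\<exists>E D. energy_rate t E D \<and> (\<forall>s\<in>{0..t}. 1 * (H_nrm 0 (w s))\<^sup>2 \<le> E s \<and> E s \<le> C * (H_nrm 0 (w s))\<^sup>2
      \<and> D s \<le> - 1 * (H_nrm 0 (w s))\<^sup>2 + C * ((L2_nrm (w s))\<^sup>2 + (n s)\<^sup>2))"
    if "modulated_lle \<alpha> \<beta> A k t e N w p ps f n" for t e N w p ps f n
  proof -
    interpret modulated_lle \<alpha> \<beta> A k t e N w p ps f n by (rule that)
    have C_eq: "C = 2 * (AB + 8 * A + 9) + 1" by (simp add: C_def AB_def PP_def)
    let ?E = "\<lambda>s. (L2_nrm (W 0 s))\<^sup>2" and ?D = "\<lambda>s. 2 * (\<integral>x. W 0 s x \<bullet> GG 0 s x \<partial>lborel)"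
    have "1 * (H_nrm 0 (w s))\<^sup>2 \<le> ?E s \<and> ?E s \<le> C * (H_nrm 0 (w s))\<^sup>2
      \<and> ?D s \<le> - 1 * (H_nrm 0 (w s))\<^sup>2 + C * ((L2_nrm (w s))\<^sup>2 + (n s)\<^sup>2)" if s: "s \<in> {0..t}" for s
    proof -
      have H0: "H_nrm 0 (w s) = L2_nrm (w s)" by (rule H_nrm_0[OF in_H_L2[OF w_in_H[OF s]]])
      have C1: "1 \<le> C" using AB_nonneg A_nonneg by (simp add: C_eq)
      then have "1 * (L2_nrm (w s))\<^sup>2 \<le> C * (L2_nrm (w s))\<^sup>2" by (rule mult_right_mono) simp
      moreover have gen: "d \<le> - 1 * x + (K + 1) * (x + y)" if "d \<le> K * (x + y)" "0 \<le> y" for d K x y :: real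
        using that by (simp add: distrib_right)
      have "?D s \<le> - 1 * (L2_nrm (w s))\<^sup>2 + C * ((L2_nrm (w s))\<^sup>2 + (n s)\<^sup>2)"
        unfolding C_eq by (rule gen[OF ground_estimate[OF s]]) simp
      ultimately show ?thesis unfolding H0 L2_w[OF s] by simp
    qed
    moreover have "energy_rate t ?E ?D" by (rule energy_W) simp
    ultimately show ?thesis by blast
  qed
  then show ?case using C by (intro exI[of _ 1] conjI exI[of _ C]) auto
next
  case (Suc m)
  then obtain c C \<theta> \<epsilon> where pos: "c > 0" "C > 0" "\<theta> > 0" "\<epsilon> > 0"
    and IH: "\<And>t e N w p ps f n. modulated_lle \<alpha> \<beta> A k t e N w p ps f n \<Longrightarrow> e \<le> \<epsilon> \<Longrightarrow>
    (\<exists>E D. energy_rate t E D \<and> (\<forall>s\<in>{0..t}. c * (H_nrm m (w s))\<^sup>2 \<le> E s \<and> E s \<le> C * (H_nrm m (w s))\<^sup>2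
      \<and> D s \<le> - \<theta> * (H_nrm m (w s))\<^sup>2 + C * ((L2_nrm (w s))\<^sup>2 + (n s)\<^sup>2)))"
    by (metis Suc_leD)
  \<comment> \<open>Copies of the locale constants at level m, available before any solution is
    given; \<open>eqs\<close> identifies them with the originals.\<close>
  define PP where "PP = 2 ^ k * A * A"
  define AB where "AB = (1 + \<bar>\<alpha>\<bar>) + 2 ^ k * 2 * PP + 2 ^ k * 1 * PP"
  define KQ where "KQ = 3 * (3 ^ Suc m * A * (6 * 3 ^ m)) + (6 * 3 ^ m) * (6 * (3::real) ^ m)"
  define KK where "KK = 3 ^ Suc m * AB + KQ + 1"
  define A2 where "A2 = 2 * A * A"
  define LB where "LB = A2 * (2 + 3 / \<bar>\<beta>\<bar>)"
  define LC where "LC = 32 * KK\<^sup>2 + 8 * LB\<^sup>2 + LB + 8 * KK * LB + 8"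
  define \<mu> where "\<mu> = (A2 / \<bar>\<beta>\<bar> + 1) / c + (LC + 1) / \<theta>"
  define C' where "C' = \<mu> * C + A2 / \<bar>\<beta>\<bar> + 1 + LC"
  have nn: "0 \<le> PP" "0 \<le> A2" using assms(2) by (auto simp: PP_def A2_def)
  then have "0 \<le> AB" "0 \<le> LB" "0 \<le> KQ" using assms(2) by (auto simp: AB_def LB_def KQ_def)
  then have KK: "1 \<le> KK" by (simp add: KK_def)
  then have "0 \<le> LC" using \<open>0 \<le> LB\<close> by (simp add: LC_def)
  then have \<mu>: "0 \<le> \<mu>" using nn pos by (auto simp: \<mu>_def)
  then have "0 \<le> \<mu> * C" "0 \<le> A2 / \<bar>\<beta>\<bar>" using nn pos by auto
  then have C': "C' > 0" using \<open>0 \<le> LC\<close> unfolding C'_def by linarith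
  have step: "\<exists>E D. energy_rate t E D \<and> (\<forall>s\<in>{0..t}. 1 * (H_nrm (Suc m) (w s))\<^sup>2 \<le> E s \<and> E s \<le> C' * (H_nrm (Suc m) (w s))\<^sup>2
      \<and> D s \<le> - 1 * (H_nrm (Suc m) (w s))\<^sup>2 + C' * ((L2_nrm (w s))\<^sup>2 + (n s)\<^sup>2))"
    if M: "modulated_lle \<alpha> \<beta> A k t e N w p ps f n" and e: "e \<le> min \<epsilon> (1 / (8 * KK))" for t e N w p ps f n
  proof -
    interpret M: modulated_lle \<alpha> \<beta> A k t e N w p ps f n by (rule M)
    have eqs: "M.KK m = KK" "M.A2 = A2" "M.LC m = LC"
      unfolding M.KK_def M.A2_def M.LC_def M.KQ_def M.AB_def M.PP_def M.LB_def
        KK_def A2_def LC_def KQ_def AB_def PP_def LB_def by simp_all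
    have "e * KK \<le> 1 / (8 * KK) * KK" using e KK by (intro mult_right_mono) auto
    then have small: "e * M.KK m \<le> 1 / 8" unfolding eqs using KK by simp
    from IH[OF M] e obtain E D where E: "energy_rate t E D"
      and ED: "\<And>s. s \<in> {0..t} \<Longrightarrow> c * (H_nrm m (w s))\<^sup>2 \<le> E s \<and> E s \<le> C * (H_nrm m (w s))\<^sup>2
      \<and> D s \<le> - \<theta> * (H_nrm m (w s))\<^sup>2 + C * ((L2_nrm (w s))\<^sup>2 + (n s)\<^sup>2)" by auto
    have "\<mu> = (M.A2 / \<bar>\<beta>\<bar> + 1) / c + (M.LC m + 1) / \<theta>" "C' = \<mu> * C + M.A2 / \<bar>\<beta>\<bar> + 1 + M.LC m"
      unfolding eqs by (simp_all add: \<mu>_def C'_def)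
    from M.step_functional[OF Suc.prems small E _ _ _ pos(1,3,2) this] ED
    show ?thesis by simp
  qed
  have "min \<epsilon> (1 / (8 * KK)) > 0" using pos KK by simp
  then show ?case using C' step
    by (intro exI[of _ "1::real"] conjI exI[of _ C'] exI[of _ "min \<epsilon> (1 / (8 * KK))"]) auto
qed

text \<open>Gronwall's inequality is built into \<open>energy_rate\<close> through its integrating
  factor. The continuous majorant \<open>R\<close> makes the right-hand integrand integrable without
  any regularity in time of the forcing bound \<open>n\<close>.\<close>

theorem damping_estimate:
  assumes A: "0 \<le> A"
  shows "\<exists>C>0. \<exists>\<theta>>0. \<exists>\<epsilon>>0. \<forall>t e N w p ps f n R. modulated_lle \<alpha> \<beta> A k t e N w p ps f n \<longrightarrow> e \<le> \<epsilon> \<longrightarrow>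
    continuous_on {0..t} R \<longrightarrow> (\<forall>s\<in>{0..t}. (L2_nrm (w s))\<^sup>2 + (n s)\<^sup>2 \<le> R s) \<longrightarrow>
    (H_nrm k (w t))\<^sup>2 \<le> C * exp (- \<theta> * t) * (H_nrm k (w 0))\<^sup>2
      + C * integral {0..t} (\<lambda>s. exp (- \<theta> * (t - s)) * R s)"
proof -
  obtain c C \<theta> \<epsilon> where pos: "c > 0" "C > 0" "\<theta> > 0" "\<epsilon> > 0"
    and main: "\<And>t e N w p ps f n. modulated_lle \<alpha> \<beta> A k t e N w p ps f n \<Longrightarrow> e \<le> \<epsilon> \<Longrightarrow>
    (\<exists>E D. energy_rate t E D \<and> (\<forall>s\<in>{0..t}. c * (H_nrm k (w s))\<^sup>2 \<le> E s \<and> E s \<le> C * (H_nrm k (w s))\<^sup>2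
      \<and> D s \<le> - \<theta> * (H_nrm k (w s))\<^sup>2 + C * ((L2_nrm (w s))\<^sup>2 + (n s)\<^sup>2)))"
    using energy_functional[where m = k and k = k and A = A and \<alpha> = \<alpha> and \<beta> = \<beta>, OF order_refl A] by metis
  \<comment> \<open>Since E is at most C times the squared norm, \<open>\<theta>'\<close> E is at
    most theta times it, which the dissipation covers.\<close>
  define \<theta>' where "\<theta>' = \<theta> / C"
  have \<theta>': "\<theta>' > 0" using pos by (simp add: \<theta>'_def)
  have bound: "(H_nrm k (w t))\<^sup>2 \<le> (C / c) * exp (- \<theta>' * t) * (H_nrm k (w 0))\<^sup>2
      + (C / c) * integral {0..t} (\<lambda>s. exp (- \<theta>' * (t - s)) * R s)"
    if M: "modulated_lle \<alpha> \<beta> A k t e N w p ps f n" and e: "e \<le> \<epsilon>" and Rc: "continuous_on {0..t} R"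
      and R: "\<And>s. s \<in> {0..t} \<Longrightarrow> (L2_nrm (w s))\<^sup>2 + (n s)\<^sup>2 \<le> R s" for t e N w p ps f n R
  proof -
    interpret M: modulated_lle \<alpha> \<beta> A k t e N w p ps f n by (rule M)
    note t = M.t
    obtain E D where E: "energy_rate t E D" and lo: "\<And>s. s \<in> {0..t} \<Longrightarrow> c * (H_nrm k (w s))\<^sup>2 \<le> E s"
      and hi: "\<And>s. s \<in> {0..t} \<Longrightarrow> E s \<le> C * (H_nrm k (w s))\<^sup>2"
      and rate: "\<And>s. s \<in> {0..t} \<Longrightarrow> D s \<le> - \<theta> * (H_nrm k (w s))\<^sup>2 + C * ((L2_nrm (w s))\<^sup>2 + (n s)\<^sup>2)"
      using main[OF M e] by blast
    have i1: "((\<lambda>s. exp (\<theta>' * s) * (\<theta>' * E s + D s)) has_integral exp (\<theta>' * t) * E t - E 0) {0..t}"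
      using E by (simp add: energy_rate_def)
    have int: "(\<lambda>s. exp (\<theta>' * s) * (C * R s)) integrable_on {0..t}"
      by (intro integrable_continuous_interval continuous_intros Rc)
    have le: "exp (\<theta>' * s) * (\<theta>' * E s + D s) \<le> exp (\<theta>' * s) * (C * R s)" if s: "s \<in> {0..t}" for s
    proof (rule mult_left_mono)
      have "\<theta>' * E s \<le> \<theta>' * (C * (H_nrm k (w s))\<^sup>2)" using hi[OF s] \<theta>' by (intro mult_left_mono) auto
      also have "\<dots> = \<theta> * (H_nrm k (w s))\<^sup>2" using pos by (simp add: \<theta>'_def)
      finally have "\<theta>' * E s + D s \<le> C * ((L2_nrm (w s))\<^sup>2 + (n s)\<^sup>2)" using rate[OF s] by simp
      also have "\<dots> \<le> C * R s" using R[OF s] pos by (intro mult_left_mono) auto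
      finally show "\<theta>' * E s + D s \<le> C * R s" .
    qed simp
    have "exp (\<theta>' * t) * E t - E 0 \<le> integral {0..t} (\<lambda>s. exp (\<theta>' * s) * (C * R s))"
      by (rule has_integral_le[OF i1 integrable_integral[OF int] le])
    then have "exp (- \<theta>' * t) * (exp (\<theta>' * t) * E t) \<le> exp (- \<theta>' * t) * (E 0 + integral {0..t} (\<lambda>s. exp (\<theta>' * s) * (C * R s)))"
      by (intro mult_left_mono) auto
    moreover have "exp (- \<theta>' * t) * (exp (\<theta>' * t) * E t) = E t"
      by (simp add: mult.assoc[symmetric] exp_add[symmetric])
    moreover have "exp (- \<theta>' * t) * integral {0..t} (\<lambda>s. exp (\<theta>' * s) * (C * R s))
        = C * integral {0..t} (\<lambda>s. exp (- \<theta>' * (t - s)) * R s)"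
    proof -
      have "exp (- \<theta>' * t) * integral {0..t} (\<lambda>s. exp (\<theta>' * s) * (C * R s))
          = integral {0..t} (\<lambda>s. exp (- \<theta>' * t) * (exp (\<theta>' * s) * (C * R s)))" by simp
      also have "\<dots> = integral {0..t} (\<lambda>s. C * (exp (- \<theta>' * (t - s)) * R s))"
        by (rule integral_cong) (simp add: exp_diff exp_minus algebra_simps divide_inverse)
      finally show ?thesis by simp
    qed
    ultimately have "E t \<le> exp (- \<theta>' * t) * E 0 + C * integral {0..t} (\<lambda>s. exp (- \<theta>' * (t - s)) * R s)"
      unfolding distrib_left by linarith
    also have "exp (- \<theta>' * t) * E 0 \<le> exp (- \<theta>' * t) * (C * (H_nrm k (w 0))\<^sup>2)"
      using hi[of 0] t by (intro mult_left_mono) auto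
    finally have "c * (H_nrm k (w t))\<^sup>2 \<le> exp (- \<theta>' * t) * (C * (H_nrm k (w 0))\<^sup>2) + C * integral {0..t} (\<lambda>s. exp (- \<theta>' * (t - s)) * R s)"
      using lo[of t] t by simp
    then have fin: "(c * (H_nrm k (w t))\<^sup>2) / c \<le> (exp (- \<theta>' * t) * (C * (H_nrm k (w 0))\<^sup>2) + C * integral {0..t} (\<lambda>s. exp (- \<theta>' * (t - s)) * R s)) / c"
      using pos by (intro divide_right_mono) auto
    have gen: "h \<le> (C / c) * x * y + (C / c) * I" if "(c * h) / c \<le> (x * (C * y) + C * I) / c" for h x y I :: real
      using that pos by (simp add: field_simps)
    show ?thesis by (rule gen[OF fin])
  qed
  have "C / c > 0" using pos by simp
  then show ?thesis
    using \<theta>' pos(4) bound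
    by (intro exI[of _ "C / c"] conjI exI[of _ \<theta>'] exI[of _ \<epsilon>] allI impI) simp_all
qed

section \<open>Phase functions\<close>

text \<open>The gauge integral recovers f from its derivative q, and changing q on a null set does
  not affect the integral. So f is also a primitive of the continuous representative
  \<open>q'\<close>, hence has derivative \<open>q'\<close> at every point.\<close>

lemma derivative_in_H_continuous:
  fixes f q :: "real \<Rightarrow> 'a::euclidean_space"
  assumes d: "\<And>x. (f has_vector_derivative q x) (at x)" and q: "in_H (Suc m) q"
  shows "continuous_on UNIV q"
proof -
  obtain q' where q': "continuous_on UNIV q'" "AE x in lborel. q x = q' x"
    by (rule in_H_Suc_continuous_rep[OF q]) (use that in blast)
  have qb: "q \<in> borel_measurable borel" by (rule in_L2_borel[OF in_H_L2[OF q]])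
  have "negligible {x. q x \<noteq> q' x}"
  proof -
    have "{x. q x \<noteq> q' x} \<in> sets lborel"
      using qb borel_measurable_continuous_onI[OF q'(1)] by (simp add: borel_measurable_neq)
    then have "{x. q x \<noteq> q' x} \<in> null_sets lborel"
      using q'(2) by (subst AE_iff_null_sets) (auto elim: eventually_mono)
    then show ?thesis by (simp add: negligible_iff_null_sets null_sets_completionI)
  qed
  have "ac_deriv f q'"
    unfolding ac_deriv_def
  proof (intro conjI allI impI)
    show "continuous_on UNIV f"
      by (intro continuous_at_imp_continuous_on ballI has_vector_derivative_continuous[OF d])
    show si: "set_integrable lborel {a..b} q'" for a b
      by (rule borel_integrable_atLeastAtMost') (rule continuous_on_subset[OF q'(1)], simp)
    fix a b :: real assume "a \<le> b"
    then have "(q has_integral f b - f a) {a..b}"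
      by (rule fundamental_theorem_of_calculus) (rule has_vector_derivative_at_within[OF d])
    then have q'i: "(q' has_integral f b - f a) {a..b}"
      by (rule has_integral_spike[OF \<open>negligible {x. q x \<noteq> q' x}\<close>, rotated]) auto
    then show "f b - f a = (LINT x:{a..b}|lborel. q' x)"
      using set_borel_integral_eq_integral(2)[OF si[of a b]] integral_unique[OF q'i] by simp
  qed
  from ac_deriv_differentiable[OF this q'(1)] have "q = q'"
    by (intro ext vector_derivative_unique_at[OF d])
  then show ?thesis using q'(1) by simp
qed

lemma AE_sup_bound_in_H:
  fixes q :: "real \<Rightarrow> 'a::euclidean_space"
  assumes "in_H (Suc m) q"
  shows "AE x in lborel. norm (q x) \<le> 2 * H_nrm (Suc m) q"
proof -
  obtain q' where q': "continuous_on UNIV q'" "AE x in lborel. q x = q' x" "in_H (Suc m) q'"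
    "H_nrm (Suc m) q = H_nrm (Suc m) q'"
    by (rule in_H_Suc_continuous_rep[OF assms])
  show ?thesis using q'(2) by eventually_elim (simp add: H_sup_bound[OF q'(3,1)] q'(4))
qed

text \<open>By Fubini, for almost every \<open>x\<close> the bound holds at almost every time; continuity in \<open>x\<close>
  removes the exceptional \<open>x\<close>.\<close>

lemma time_lipschitz_of_AE_bound:
  fixes g gt :: "real \<Rightarrow> real \<Rightarrow> real"
  assumes t: "0 \<le> t"
    and cont: "continuous_on (UNIV \<times> {0..t}) (\<lambda>(x, s). g x s)"
    and dt: "\<And>x s. s \<in> {0..t} \<Longrightarrow> ((\<lambda>r. g x r) has_real_derivative gt x s) (at s within {0..t})"
    and bd: "\<And>s. s \<in> {0..t} \<Longrightarrow> AE x in lborel. \<bar>gt x s\<bar> \<le> B"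
    and rs: "r \<in> {0..t}" "s \<in> {0..t}"
  shows "\<bar>g x r - g x s\<bar> \<le> B * \<bar>r - s\<bar>"
proof -
  \<comment> \<open>Clamping the time to [0, t] extends g continuously to the whole plane.\<close>
  define cl where "cl s = max 0 (min t s)" for s :: real
  have cl: "cl s \<in> {0..t}" "s \<in> {0..t} \<Longrightarrow> cl s = s" for s using t by (auto simp: cl_def)
  have clc: "continuous_on UNIV cl" unfolding cl_def[abs_def] by (intro continuous_intros)
  have gc: "continuous_on UNIV (\<lambda>z. g (fst z) (cl (snd z + c)))" for c
  proof -
    have 1: "continuous_on UNIV (\<lambda>z::real \<times> real. (fst z, cl (snd z + c)))"
      by (intro continuous_intros continuous_on_compose2[OF clc]) auto
    have "continuous_on UNIV (\<lambda>z. (\<lambda>(x, s). g x s) (fst z, cl (snd z + c)))"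
      by (rule continuous_on_compose2[OF cont 1]) (use cl in auto)
    then show ?thesis by simp
  qed
  \<comment> \<open>Fubini needs joint measurability of the time derivative, which is obtained from
    difference quotients of the continuous g. At the final time there is no forward quotient, hence
    the strict inequality.\<close>
  define d where "d n z = (if 0 \<le> snd z \<and> snd z < t then (g (fst z) (cl (snd z + 1 / (real n + 1))) - g (fst z) (cl (snd z + 0))) /\<^sub>R (1 / (real n + 1)) else 0)" for n :: nat and z :: "real \<times> real"
  define D where "D z = (if 0 \<le> snd z \<and> snd z < t then gt (fst z) (snd z) else 0)" for z :: "real \<times> real"
  have lim: "(\<lambda>n. d n z) \<longlonglongrightarrow> D z" for z
  proof (cases "0 \<le> snd z \<and> snd z < t")
    case True
    define h where "h n = 1 / (real n + 1)" for n
    define N where "N = nat \<lceil>1 / (t - snd z)\<rceil>"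
    have hN: "snd z + h (n + N) \<in> {0..t} - {snd z}" for n
    proof -
      have "1 / (t - snd z) \<le> real N" unfolding N_def by linarith
      then have "1 / (t - snd z) \<le> real (n + N) + 1" by simp
      then have "h (n + N) \<le> t - snd z" using True by (simp add: h_def field_simps)
      moreover have "h (n + N) > 0" by (simp add: h_def)
      ultimately show ?thesis using True by simp
    qed
    have h0: "h \<longlonglongrightarrow> 0"
      unfolding h_def using LIMSEQ_inverse_real_of_nat by (simp add: inverse_eq_divide add.commute)
    have "(\<lambda>n. snd z + h (n + N)) \<longlonglongrightarrow> snd z + 0"
      by (intro tendsto_intros LIMSEQ_ignore_initial_segment h0)
    then have "(\<lambda>n. (g (fst z) (snd z + h (n + N)) - g (fst z) (snd z)) /\<^sub>R (snd z + h (n + N) - snd z)) \<longlonglongrightarrow> gt (fst z) (snd z)"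
      using dt[of "snd z" "fst z"] True hN
      unfolding has_real_derivative_iff_has_vector_derivative has_vector_derivative_within_seq
      by (auto dest!: spec[of _ "\<lambda>n. snd z + h (n + N)"])
    moreover have "d (n + N) z = (g (fst z) (snd z + h (n + N)) - g (fst z) (snd z)) /\<^sub>R (snd z + h (n + N) - snd z)" for n
      using True hN[of n] cl(2) by (simp add: d_def h_def)
    ultimately have "(\<lambda>n. d (n + N) z) \<longlonglongrightarrow> D z" using True by (simp add: D_def)
    then show ?thesis by (rule LIMSEQ_offset)
  qed (auto simp: d_def D_def)
  have "d n \<in> borel_measurable borel" for n
  proof -
    have [measurable]: "(\<lambda>z. g (fst z) (cl (snd z + c))) \<in> borel_measurable borel" for c
      by (rule borel_measurable_continuous_onI[OF gc])
    have [measurable]: "Measurable.pred borel (\<lambda>z::real \<times> real. 0 \<le> snd z \<and> snd z < t)"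
      unfolding borel_prod[symmetric] by measurable
    show ?thesis unfolding d_def[abs_def] by measurable
  qed
  then have "D \<in> borel_measurable borel"
    by (rule borel_measurable_LIMSEQ_real[OF lim])
  then have Dm: "D \<in> borel_measurable (lborel \<Otimes>\<^sub>M lborel)"
    by (simp add: lborel_prod)
  have "AE s in lborel. AE x in lborel. \<bar>D (x, s)\<bar> \<le> B"
  proof (rule AE_I2)
    fix s
    have B: "0 \<le> B"
    proof -
      obtain x where "\<bar>gt x 0\<bar> \<le> B" using AE_lborel_ex[OF bd[of 0]] t by auto
      then show ?thesis by linarith
    qed
    show "AE x in lborel. \<bar>D (x, s)\<bar> \<le> B"
      using bd[of s] B by (cases "0 \<le> s \<and> s < t") (auto simp: D_def elim: eventually_mono)
  qed
  moreover have "{z \<in> space (lborel \<Otimes>\<^sub>M lborel). \<bar>D (fst z, snd z)\<bar> \<le> B} \<in> sets (lborel \<Otimes>\<^sub>M lborel)"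
    using Dm by measurable
  ultimately have AE: "AE x in lborel. AE s in lborel. \<bar>D (x, s)\<bar> \<le> B"
    by (subst lborel_pair.AE_commute) auto
  have main: "\<bar>g x b - g x a\<bar> \<le> B * (b - a)" if x: "AE s in lborel. \<bar>D (x, s)\<bar> \<le> B" and ab: "0 \<le> a" "a \<le> b" "b \<le> t" for x a b
  proof -
    have hi: "((\<lambda>s. gt x s) has_integral g x b - g x a) {a..b}"
    proof (rule fundamental_theorem_of_calculus[OF ab(2)])
      fix s assume "s \<in> {a..b}"
      then have "((\<lambda>r. g x r) has_vector_derivative gt x s) (at s within {0..t})"
        using dt[of s x] ab by (simp add: has_real_derivative_iff_has_vector_derivative)
      then show "((\<lambda>r. g x r) has_vector_derivative gt x s) (at s within {a..b})"
        by (rule has_vector_derivative_within_subset) (use ab in auto)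
    qed
    \<comment> \<open>The integral bound asks for |c| <= B everywhere. Clipping achieves this and,
      inside [a, b], alters the derivative at most on the null set
      \<open>insert t S\<close>.\<close>
    define c where "c s = max (- B) (min B (gt x s))" for s
    obtain S where S: "S \<in> null_sets lborel" "{s. \<not> \<bar>D (x, s)\<bar> \<le> B} \<subseteq> S"
      using x by (auto elim: AE_E simp: null_sets_def)
    have neg: "negligible (insert t S)"
      using S(1) by (simp add: negligible_iff_null_sets null_sets_completionI)
    obtain s0 where "\<bar>D (x, s0)\<bar> \<le> B" using AE_lborel_ex[OF x] by auto
    then have B: "0 \<le> B" by linarith
    have "(c has_integral g x b - g x a) {a..b}"
    proof (rule has_integral_spike[OF neg _ hi])
      fix s assume "s \<in> {a..b} - insert t S"
      then have "\<bar>D (x, s)\<bar> \<le> B" "0 \<le> s" "s < t" using S(2) ab by auto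
      then show "c s = gt x s" by (auto simp: D_def c_def)
    qed
    moreover have "norm (c s) \<le> B" for s using B by (auto simp: c_def)
    ultimately have "norm (g x b - g x a) \<le> B * measure lborel (cbox a b)"
      by (intro has_integral_bound[OF B]) (auto simp: box_real)
    then show ?thesis using ab by simp
  qed
  have AEx: "AE x in lborel. \<bar>g x b - g x a\<bar> \<le> B * (b - a)" if "0 \<le> a" "a \<le> b" "b \<le> t" for a b
    using AE by eventually_elim (rule main[OF _ that])
  have cx: "continuous_on UNIV (\<lambda>x. g x s)" if "s \<in> {0..t}" for s
  proof -
    have 1: "continuous_on UNIV (\<lambda>x::real. (x, s))" by (intro continuous_intros)
    have "continuous_on UNIV (\<lambda>x. (\<lambda>(x, s). g x s) (x, s))"
      by (rule continuous_on_compose2[OF cont 1]) (use that in auto)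
    then show ?thesis by simp
  qed
  have all: "\<bar>g x b - g x a\<bar> \<le> B * (b - a)" if "0 \<le> a" "a \<le> b" "b \<le> t" for a b
    using AE_norm_le_continuous[of "\<lambda>x. g x b - g x a" "B * (b - a)" x] AEx[OF that] that
    by (simp add: cx continuous_on_diff)
  show ?thesis
    using all[of s r] all[of r s] rs by (cases "s \<le> r") (auto simp: abs_minus_commute)
qed

section \<open>Continuity in time with values in Sobolev spaces\<close>

lemma H_nrm_reverse_triangle:
  fixes f g :: "real \<Rightarrow> 'a::euclidean_space"
  assumes f: "in_H m f" and g: "in_H m g"
  shows "in_H m (\<lambda>x. f x - g x)" "\<bar>H_nrm m f - H_nrm m g\<bar> \<le> H_nrm m (\<lambda>x. f x - g x)"
proof -
  have m: "in_H m (\<lambda>x. - h x)" "H_nrm m (\<lambda>x. - h x) \<le> H_nrm m h" if "in_H m h" for h :: "real \<Rightarrow> 'a"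
    using in_H_bounded_linear[OF bounded_linear_minus[OF bounded_linear_ident] that]
      H_nrm_bounded_linear[OF bounded_linear_minus[OF bounded_linear_ident] that, of 1] by auto
  show d: "in_H m (\<lambda>x. f x - g x)" using in_H_add[OF f m(1)[OF g]] by simp
  have "H_nrm m f \<le> H_nrm m (\<lambda>x. f x - g x) + H_nrm m g"
    using H_nrm_triangle[OF d g] by simp
  moreover have "H_nrm m g \<le> H_nrm m (\<lambda>x. f x - g x) + H_nrm m f"
    using H_nrm_triangle[OF m(1)[OF d] f] m(2)[OF d] by simp
  ultimately show "\<bar>H_nrm m f - H_nrm m g\<bar> \<le> H_nrm m (\<lambda>x. f x - g x)" by linarith
qed

lemma H_continuous_onD:
  assumes "H_continuous_on m I u" "s \<in> I"
  shows "in_H m (\<lambda>x. u x s)" "((\<lambda>r. H_nrm m (\<lambda>x. u x r - u x s)) \<longlongrightarrow> 0) (at s within I)"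
  using assms by (auto simp: H_continuous_on_def)

lemma H_continuous_on_norm:
  assumes u: "H_continuous_on m I u"
  shows "continuous_on I (\<lambda>s. H_nrm m (\<lambda>x. u x s))"
  unfolding continuous_on_def
proof
  fix s assume s: "s \<in> I"
  show "((\<lambda>s. H_nrm m (\<lambda>x. u x s)) \<longlongrightarrow> H_nrm m (\<lambda>x. u x s)) (at s within I)"
  proof (rule LIM_zero_cancel, rule Lim_null_comparison[OF _ H_continuous_onD(2)[OF u s]])
    show "\<forall>\<^sub>F r in at s within I. norm (H_nrm m (\<lambda>x. u x r) - H_nrm m (\<lambda>x. u x s)) \<le> H_nrm m (\<lambda>x. u x r - u x s)"
      using H_nrm_reverse_triangle(2)[OF H_continuous_onD(1)[OF u] H_continuous_onD(1)[OF u s]]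
      by (auto simp: eventually_at_filter)
  qed
qed

lemma H_continuous_on_le:
  assumes u: "H_continuous_on m I u" and j: "j \<le> m"
  shows "H_continuous_on j I u"
  unfolding H_continuous_on_def
proof (intro conjI ballI)
  fix s assume s: "s \<in> I"
  show "in_H j (\<lambda>x. u x s)" by (rule in_H_mono[OF H_continuous_onD(1)[OF u s] j])
  show "((\<lambda>r. H_nrm j (\<lambda>x. u x r - u x s)) \<longlongrightarrow> 0) (at s within I)"
    by (rule Lim_null_comparison[OF _ H_continuous_onD(2)[OF u s]]) (auto intro!: always_eventually H_nrm_mono j)
qed

lemma H_continuous_on_L2_norm:
  assumes "H_continuous_on m I u"
  shows "continuous_on I (\<lambda>s. L2_nrm (\<lambda>x. u x s))"
proof -
  have "H_continuous_on 0 I u" by (rule H_continuous_on_le[OF assms]) simp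
  then have "continuous_on I (\<lambda>s. H_nrm 0 (\<lambda>x. u x s))" and L: "\<And>s. s \<in> I \<Longrightarrow> in_H 0 (\<lambda>x. u x s)"
    by (rule H_continuous_on_norm, rule H_continuous_onD(1))
  then show ?thesis
    by (rule_tac continuous_on_eq[of I "\<lambda>s. H_nrm 0 (\<lambda>x. u x s)"]) (use L in_H_L2 H_nrm_0 in blast)+
qed

text \<open>The bound 1/16 gives 1/4 for each Sobolev norm, and the embedding with factor 2 gives
  sup bounds 1/2, which make x + gamma bi-Lipschitz. With \<open>t\<close> positive every time is a
  limit point of the interval, so one-sided derivatives are determined.\<close>

locale phase_function =
  fixes t :: real and k :: nat and \<gamma> \<gamma>x \<gamma>t :: "real \<Rightarrow> real \<Rightarrow> real"
  assumes t: "0 < t"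
    and dx: "\<And>s x. s \<in> {0..t} \<Longrightarrow> ((\<lambda>y. \<gamma> y s) has_real_derivative \<gamma>x x s) (at x)"
    and dt: "\<And>s x. s \<in> {0..t} \<Longrightarrow> ((\<lambda>r. \<gamma> x r) has_real_derivative \<gamma>t x s) (at s within {0..t})"
    and Hx: "H_continuous_on (k + 2) {0..t} \<gamma>x" and Ht: "H_continuous_on (k + 2) {0..t} \<gamma>t"
    and small: "\<And>s. s \<in> {0..t} \<Longrightarrow> (H_nrm (k + 2) (\<lambda>x. \<gamma>x x s))\<^sup>2 + (H_nrm (k + 2) (\<lambda>x. \<gamma>t x s))\<^sup>2 \<le> 1 / 16"
begin

lemma Hx_le: "s \<in> {0..t} \<Longrightarrow> H_nrm (k + 2) (\<lambda>x. \<gamma>x x s) \<le> 1 / 4"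
  and Ht_le: "s \<in> {0..t} \<Longrightarrow> H_nrm (k + 2) (\<lambda>x. \<gamma>t x s) \<le> 1 / 4"
proof -
  assume "s \<in> {0..t}"
  have "a \<le> 1 / 4" "b \<le> 1 / 4" if "a\<^sup>2 + b\<^sup>2 \<le> 1 / 16" for a b :: real
  proof -
    have q: "a\<^sup>2 \<le> (1 / 4)\<^sup>2" "b\<^sup>2 \<le> (1 / 4)\<^sup>2"
    proof -
      have "(1 / 4 :: real)\<^sup>2 = 1 / 16" by (simp add: power_divide)
      then show "a\<^sup>2 \<le> (1 / 4)\<^sup>2" "b\<^sup>2 \<le> (1 / 4)\<^sup>2"
        using that zero_le_power2[of a] zero_le_power2[of b] by linarith+
    qed
    show "a \<le> 1 / 4" "b \<le> 1 / 4"
      by (rule power2_le_imp_le[OF q(1)], simp) (rule power2_le_imp_le[OF q(2)], simp)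
  qed
  from this[OF small[OF \<open>s \<in> {0..t}\<close>]]
  show "H_nrm (k + 2) (\<lambda>x. \<gamma>x x s) \<le> 1 / 4" "H_nrm (k + 2) (\<lambda>x. \<gamma>t x s) \<le> 1 / 4" .
qed

lemma Hx_in: "s \<in> {0..t} \<Longrightarrow> in_H (Suc (Suc k)) (\<lambda>x. \<gamma>x x s)"
  and Ht_in: "s \<in> {0..t} \<Longrightarrow> in_H (Suc (Suc k)) (\<lambda>x. \<gamma>t x s)"
  using H_continuous_onD(1)[OF Hx] H_continuous_onD(1)[OF Ht] by simp_all

lemma \<gamma>x_cont: "s \<in> {0..t} \<Longrightarrow> continuous_on UNIV (\<lambda>x. \<gamma>x x s)"
  by (rule derivative_in_H_continuous[where f = "\<lambda>x. \<gamma> x s", OF dx[unfolded has_real_derivative_iff_has_vector_derivative] Hx_in])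

lemma \<gamma>x_le: "s \<in> {0..t} \<Longrightarrow> \<bar>\<gamma>x x s\<bar> \<le> 1 / 2"
  using H_sup_bound[OF Hx_in \<gamma>x_cont, of s x] Hx_le[of s] by simp

lemma \<gamma>t_AE: "s \<in> {0..t} \<Longrightarrow> AE x in lborel. \<bar>\<gamma>t x s\<bar> \<le> 1 / 2"
  using AE_sup_bound_in_H[OF Ht_in, of s] Ht_le[of s] by (auto elim!: eventually_mono)

lemma \<gamma>_lip_x: "s \<in> {0..t} \<Longrightarrow> \<bar>\<gamma> x s - \<gamma> y s\<bar> \<le> 1 / 2 * \<bar>x - y\<bar>"
  using field_differentiable_bound[of UNIV "\<lambda>x. \<gamma> x s" "\<lambda>x. \<gamma>x x s" "1 / 2" x y] dx[of s] \<gamma>x_le[of s] by simp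

text \<open>Continuity in time at fixed x is combined with a Lipschitz bound in x that is uniform in
  time.\<close>

lemma \<gamma>_joint: "continuous_on (UNIV \<times> {0..t}) (\<lambda>(x, s). \<gamma> x s)"
  unfolding continuous_on_def
proof (clarify)
  fix x s assume s: "s \<in> {0..t}"
  have c: "continuous_on {0..t} (\<lambda>r. \<gamma> x r)" by (rule DERIV_continuous_on[OF dt])
  have "continuous_on (UNIV \<times> {0..t}) (\<lambda>z::real \<times> real. \<gamma> x (snd z))"
    by (rule continuous_on_compose2[OF c]) (auto intro!: continuous_intros)
  then have 1: "((\<lambda>z. \<gamma> x (snd z)) \<longlongrightarrow> \<gamma> x s) (at (x, s) within UNIV \<times> {0..t})"
    using s by (auto simp: continuous_on_def)
  have 2: "((\<lambda>z. \<gamma> (fst z) (snd z) - \<gamma> x (snd z)) \<longlongrightarrow> 0) (at (x, s) within UNIV \<times> {0..t})"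
  proof (rule Lim_null_comparison)
    show "\<forall>\<^sub>F z in at (x, s) within UNIV \<times> {0..t}. norm (\<gamma> (fst z) (snd z) - \<gamma> x (snd z)) \<le> 1 / 2 * \<bar>fst z - x\<bar>"
      unfolding eventually_at_filter by (rule always_eventually) (use \<gamma>_lip_x in auto)
    have "((\<lambda>z. 1 / 2 * \<bar>fst z - x\<bar>) \<longlongrightarrow> 1 / 2 * \<bar>fst (x, s) - x\<bar>) (at (x, s) within UNIV \<times> {0..t})"
      by (intro tendsto_intros)
    then show "((\<lambda>z. 1 / 2 * \<bar>fst z - x\<bar>) \<longlongrightarrow> 0) (at (x, s) within UNIV \<times> {0..t})" by simp
  qed
  have "((\<lambda>z. (\<gamma> (fst z) (snd z) - \<gamma> x (snd z)) + \<gamma> x (snd z)) \<longlongrightarrow> 0 + \<gamma> x s) (at (x, s) within UNIV \<times> {0..t})"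
    by (rule tendsto_add[OF 2 1])
  then show "((\<lambda>(x, s). \<gamma> x s) \<longlongrightarrow> \<gamma> x s) (at (x, s) within UNIV \<times> {0..t})"
    by (simp add: case_prod_beta')
qed

lemma \<gamma>_lip_t: "r \<in> {0..t} \<Longrightarrow> s \<in> {0..t} \<Longrightarrow> \<bar>\<gamma> x r - \<gamma> x s\<bar> \<le> 1 / 2 * \<bar>r - s\<bar>"
  by (rule time_lipschitz_of_AE_bound[OF _ \<gamma>_joint dt \<gamma>t_AE]) (use t in auto)

text \<open>The Sobolev norm controls the time derivative only almost everywhere in x. The Lipschitz
  bound in time holds at every x, and its difference quotients give the bound everywhere.\<close>

lemma \<gamma>t_le: assumes s: "s \<in> {0..t}" shows "\<bar>\<gamma>t x s\<bar> \<le> 1 / 2"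
proof -
  have "((\<lambda>r. (\<gamma> x r - \<gamma> x s) /\<^sub>R (r - s)) \<longlongrightarrow> \<gamma>t x s) (at s within {0..t})"
    using dt[OF s, of x] unfolding has_real_derivative_iff_has_vector_derivative has_vector_derivative_within_quotient .
  moreover have "\<forall>\<^sub>F r in at s within {0..t}. norm ((\<gamma> x r - \<gamma> x s) /\<^sub>R (r - s)) \<le> 1 / 2"
    unfolding eventually_at_filter
  proof (rule always_eventually, intro allI impI)
    fix r assume "r \<noteq> s" "r \<in> {0..t}"
    then show "norm ((\<gamma> x r - \<gamma> x s) /\<^sub>R (r - s)) \<le> 1 / 2"
      using \<gamma>_lip_t[of r s x] s by (simp add: abs_mult divide_simps flip: divide_inverse_commute)
  qed
  moreover have "at s within {0..t} \<noteq> bot"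
    using s t by (simp add: trivial_limit_within)
  ultimately have "norm (\<gamma>t x s) \<le> 1 / 2" by (rule_tac Lim_norm_ubound)
  then show ?thesis by simp
qed

end

section \<open>The inverse of the phase shift\<close>

context phase_function
begin

definition Th :: "real \<Rightarrow> real \<Rightarrow> real" where "Th s x = x + \<gamma> x s"
definition X :: "real \<Rightarrow> real \<Rightarrow> real" where "X s y = (SOME x. Th s x = y)"

lemma Th_bilip: assumes s: "s \<in> {0..t}" shows "bilip (Th s) (\<lambda>x. 1 + \<gamma>x x s)"
  unfolding bilip_def
proof (intro conjI allI)
  show "continuous_on UNIV (\<lambda>x. 1 + \<gamma>x x s)" by (intro continuous_intros \<gamma>x_cont s)
  fix x
  show "(Th s has_real_derivative 1 + \<gamma>x x s) (at x)"
    unfolding Th_def[abs_def] by (intro DERIV_add DERIV_ident dx s)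
  show "1 / 2 \<le> 1 + \<gamma>x x s" "1 + \<gamma>x x s \<le> 2" using \<gamma>x_le[OF s, of x] by (auto simp: abs_le_iff)
qed

lemma Th_X: "s \<in> {0..t} \<Longrightarrow> Th s (X s y) = y"
  unfolding X_def by (rule someI_ex) (rule bilip_surj[OF Th_bilip])

lemma X_Th: assumes s: "s \<in> {0..t}" shows "X s (Th s x) = x"
  using strict_mono_eq[OF bilip_strict_mono[OF Th_bilip[OF s]], of "X s (Th s x)" x] Th_X[OF s] by simp

lemma X_eq: "s \<in> {0..t} \<Longrightarrow> X s y + \<gamma> (X s y) s = y"
  using Th_X by (simp add: Th_def)

lemma X_lip: assumes s: "s \<in> {0..t}" shows "\<bar>X s y - X s z\<bar> \<le> 2 * \<bar>y - z\<bar>"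
proof -
  have "\<bar>X s y - X s z\<bar> \<le> 2 * \<bar>Th s (X s y) - Th s (X s z)\<bar>"
    using bilip_expand[OF Th_bilip[OF s], of "X s y" "X s z"] bilip_expand[OF Th_bilip[OF s], of "X s z" "X s y"]
    by (cases "X s y \<le> X s z") auto
  then show ?thesis by (simp add: Th_X[OF s])
qed

lemma X_continuous: assumes s: "s \<in> {0..t}" shows "isCont (X s) y"
proof -
  have "((\<lambda>z. X s z - X s y) \<longlongrightarrow> 0) (at y)"
  proof (rule Lim_null_comparison)
    show "\<forall>\<^sub>F z in at y. norm (X s z - X s y) \<le> 2 * \<bar>z - y\<bar>" using X_lip[OF s] by simp
    have "((\<lambda>z. 2 * \<bar>z - y\<bar>) \<longlongrightarrow> 2 * \<bar>y - y\<bar>) (at y)" by (intro tendsto_intros)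
    then show "((\<lambda>z. 2 * \<bar>z - y\<bar>) \<longlongrightarrow> 0) (at y)" by simp
  qed
  then show ?thesis unfolding isCont_def by (rule LIM_zero_cancel)
qed

lemma X_bilip: assumes s: "s \<in> {0..t}" shows "bilip (X s) (\<lambda>y. 1 / (1 + \<gamma>x (X s y) s))"
  unfolding bilip_def
proof (intro conjI allI)
  note b = Th_bilip[OF s]
  have pos: "1 + \<gamma>x x s > 0" for x using bilip_ge[OF b, of x] by linarith
  have "continuous_on UNIV (\<lambda>y. \<gamma>x (X s y) s)"
    by (rule continuous_on_compose2[OF \<gamma>x_cont[OF s]]) (auto intro!: continuous_at_imp_continuous_on X_continuous s)
  then show "continuous_on UNIV (\<lambda>y. 1 / (1 + \<gamma>x (X s y) s))"
    using pos by (intro continuous_intros) (auto simp: less_imp_neq[THEN not_sym])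
  fix y
  have "(X s has_real_derivative inverse (1 + \<gamma>x (X s y) s)) (at y)"
  proof (rule DERIV_inverse_function[where f = "Th s" and a = "y - 1" and b = "y + 1"])
    show "(Th s has_real_derivative 1 + \<gamma>x (X s y) s) (at (X s y))" by (rule bilip_deriv[OF b])
    show "1 + \<gamma>x (X s y) s \<noteq> 0" using pos[of "X s y"] by simp
  qed (auto simp: Th_X[OF s] X_continuous[OF s])
  then show "(X s has_real_derivative 1 / (1 + \<gamma>x (X s y) s)) (at y)" by (simp add: inverse_eq_divide)
  have p: "0 < 1 + \<gamma>x (X s y) s" by (rule pos)
  show "1 / 2 \<le> 1 / (1 + \<gamma>x (X s y) s)"
    using bilip_le[OF b, of "X s y"] p by (simp add: le_divide_eq)
  show "1 / (1 + \<gamma>x (X s y) s) \<le> 2"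
    using bilip_ge[OF b, of "X s y"] p by (simp add: divide_le_eq)
qed

text \<open>Subtracting the defining equations leaves an increment of gamma in time and one in
  space. The latter is at most half of the left-hand side; absorbing it doubles the factor
  1/2.\<close>

lemma X_lip_t:
  assumes r: "r \<in> {0..t}" and s: "s \<in> {0..t}"
  shows "\<bar>X r y - X s y\<bar> \<le> \<bar>r - s\<bar>"
proof -
  have "X r y - X s y = (\<gamma> (X s y) s - \<gamma> (X s y) r) + (\<gamma> (X s y) r - \<gamma> (X r y) r)"
    using X_eq[OF r, of y] X_eq[OF s, of y] by linarith
  then show ?thesis
    using \<gamma>_lip_t[OF r s, of "X s y"] \<gamma>_lip_x[OF r, of "X s y" "X r y"]
      abs_triangle_ineq[of "\<gamma> (X s y) s - \<gamma> (X s y) r" "\<gamma> (X s y) r - \<gamma> (X r y) r"]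
    unfolding abs_minus_commute[of "\<gamma> (X s y) s"] abs_minus_commute[of "X s y" "X r y"] by simp
qed

lemma \<gamma>_mvt:
  assumes s: "s \<in> {0..t}"
  shows "\<exists>z. \<bar>z - x\<bar> \<le> \<bar>y - x\<bar> \<and> \<gamma> y s - \<gamma> x s = \<gamma>x z s * (y - x)"
proof (cases x y rule: linorder_cases)
  case less
  obtain z where "x < z" "z < y" "\<gamma> y s - \<gamma> x s = (y - x) * \<gamma>x z s"
    using MVT2[OF less, of "\<lambda>x. \<gamma> x s" "\<lambda>x. \<gamma>x x s"] dx[OF s] by auto
  then show ?thesis by (intro exI[of _ z]) (auto simp: mult.commute)
next
  case greater
  obtain z where "y < z" "z < x" "\<gamma> x s - \<gamma> y s = (x - y) * \<gamma>x z s"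
    using MVT2[OF greater, of "\<lambda>x. \<gamma> x s" "\<lambda>x. \<gamma>x x s"] dx[OF s] by auto
  then show ?thesis by (intro exI[of _ z]) (auto simp: algebra_simps)
qed auto

text \<open>Implicit differentiation of X + gamma(X, s) = y, done by hand because gamma is not
  assumed jointly continuously differentiable. The mean value theorem in space gives an exact
  quotient with an intermediate point \<open>z n\<close>, in which the limit is taken.\<close>

lemma X_deriv_t:
  assumes s: "s \<in> {0..t}"
  shows "((\<lambda>r. X r y) has_vector_derivative - \<gamma>t (X s y) s / (1 + \<gamma>x (X s y) s)) (at s within {0..t})"
  unfolding has_vector_derivative_within_seq
proof (intro allI impI)
  fix R assume R0: "\<forall>n. R n \<in> {0..t} - {s}" and lim: "R \<longlonglongrightarrow> s"
  have R: "R n \<in> {0..t}" "R n \<noteq> s" for n using R0 by auto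
  define x where "x = X s y"
  define xn where "xn n = X (R n) y" for n
  have xn: "xn \<longlonglongrightarrow> x"
  proof -
    have "(\<lambda>n. xn n - x) \<longlonglongrightarrow> 0"
    proof (rule Lim_null_comparison[OF always_eventually])
      show "\<forall>n. norm (xn n - x) \<le> \<bar>R n - s\<bar>" using X_lip_t[OF R(1) s] by (simp add: xn_def x_def)
      have "(\<lambda>n. \<bar>R n - s\<bar>) \<longlonglongrightarrow> \<bar>s - s\<bar>" by (intro tendsto_intros lim)
      then show "(\<lambda>n. \<bar>R n - s\<bar>) \<longlonglongrightarrow> 0" by simp
    qed
    then show ?thesis by (rule LIM_zero_cancel)
  qed
  obtain z where z: "\<And>n. \<bar>z n - x\<bar> \<le> \<bar>xn n - x\<bar>" "\<And>n. \<gamma> (xn n) (R n) - \<gamma> x (R n) = \<gamma>x (z n) (R n) * (xn n - x)"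
  proof -
    have "\<forall>n. \<exists>z. \<bar>z - x\<bar> \<le> \<bar>xn n - x\<bar> \<and> \<gamma> (xn n) (R n) - \<gamma> x (R n) = \<gamma>x z (R n) * (xn n - x)"
      using \<gamma>_mvt[OF R(1)] by blast
    from choice[OF this] show ?thesis using that by blast
  qed
  have zl: "z \<longlonglongrightarrow> x"
  proof -
    have "(\<lambda>n. z n - x) \<longlonglongrightarrow> 0"
    proof (rule Lim_null_comparison[OF always_eventually])
      show "\<forall>n. norm (z n - x) \<le> \<bar>xn n - x\<bar>" using z(1) by simp
      have "(\<lambda>n. \<bar>xn n - x\<bar>) \<longlonglongrightarrow> \<bar>x - x\<bar>" by (intro tendsto_intros xn)
      then show "(\<lambda>n. \<bar>xn n - x\<bar>) \<longlonglongrightarrow> 0" by simp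
    qed
    then show ?thesis by (rule LIM_zero_cancel)
  qed
  \<comment> \<open>Point and time move together. Continuity in time holds in the Sobolev norm,
    hence uniformly in x by the embedding, so the moving point does no harm.\<close>
  have gz: "(\<lambda>n. \<gamma>x (z n) (R n)) \<longlonglongrightarrow> \<gamma>x x s"
  proof -
    have "isCont (\<lambda>x. \<gamma>x x s) x" using \<gamma>x_cont[OF s] continuous_on_eq_continuous_at by blast
    then have 1: "(\<lambda>n. \<gamma>x (z n) s) \<longlonglongrightarrow> \<gamma>x x s" by (rule isCont_tendsto_compose[OF _ zl])
    have "((\<lambda>r. H_nrm (k + 2) (\<lambda>x. \<gamma>x x r - \<gamma>x x s)) \<longlongrightarrow> 0) (at s within {0..t})"
      by (rule H_continuous_onD(2)[OF Hx s])
    then have h: "(\<lambda>n. H_nrm (k + 2) (\<lambda>x. \<gamma>x x (R n) - \<gamma>x x s)) \<longlonglongrightarrow> 0"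
      using R0 lim unfolding tendsto_at_iff_sequentially by (auto simp: o_def)
    have 2: "(\<lambda>n. \<gamma>x (z n) (R n) - \<gamma>x (z n) s) \<longlonglongrightarrow> 0"
    proof (rule Lim_null_comparison[OF always_eventually])
      show "\<forall>n. norm (\<gamma>x (z n) (R n) - \<gamma>x (z n) s) \<le> 2 * H_nrm (k + 2) (\<lambda>x. \<gamma>x x (R n) - \<gamma>x x s)"
      proof
        fix n
        have "in_H (Suc (Suc k)) (\<lambda>x. \<gamma>x x (R n) - \<gamma>x x s)"
          by (rule H_nrm_reverse_triangle(1)[OF Hx_in[OF R(1)] Hx_in[OF s]])
        from H_sup_bound[OF this continuous_on_diff[OF \<gamma>x_cont[OF R(1)] \<gamma>x_cont[OF s]], of "z n"]
        show "norm (\<gamma>x (z n) (R n) - \<gamma>x (z n) s) \<le> 2 * H_nrm (k + 2) (\<lambda>x. \<gamma>x x (R n) - \<gamma>x x s)" by simp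
      qed
      show "(\<lambda>n. 2 * H_nrm (k + 2) (\<lambda>x. \<gamma>x x (R n) - \<gamma>x x s)) \<longlonglongrightarrow> 0"
        using tendsto_mult_left[OF h, of 2] by simp
    qed
    from tendsto_add[OF 2 1] show ?thesis by simp
  qed
  have pos: "1 + \<gamma>x u r > 0" if "r \<in> {0..t}" for u r using bilip_ge[OF Th_bilip[OF that], of u] by linarith
  have eq: "(X (R n) y - X s y) /\<^sub>R (R n - s) = - ((\<gamma> x (R n) - \<gamma> x s) /\<^sub>R (R n - s)) / (1 + \<gamma>x (z n) (R n))" for n
  proof -
    have "xn n + \<gamma> (xn n) (R n) = x + \<gamma> x s" using X_eq[OF R(1), of n y] X_eq[OF s, of y] by (simp add: xn_def x_def)
    then have "(xn n - x) * (1 + \<gamma>x (z n) (R n)) = - (\<gamma> x (R n) - \<gamma> x s)"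
      using z(2)[of n] by (simp add: algebra_simps)
    then have "xn n - x = - (\<gamma> x (R n) - \<gamma> x s) / (1 + \<gamma>x (z n) (R n))"
      using pos[OF R(1), of "z n" n] by (simp add: field_simps)
    then have e: "X (R n) y - X s y = - (\<gamma> x (R n) - \<gamma> x s) / (1 + \<gamma>x (z n) (R n))"
      by (simp only: xn_def x_def)
    have "(- d / c) /\<^sub>R h = - (d /\<^sub>R h) / c" for c d h :: real by (simp add: divide_inverse)
    then show ?thesis unfolding e .
  qed
  have "(\<lambda>n. (\<gamma> x (R n) - \<gamma> x s) /\<^sub>R (R n - s)) \<longlonglongrightarrow> \<gamma>t x s"
    using dt[OF s, of x] R0 lim unfolding has_real_derivative_iff_has_vector_derivative has_vector_derivative_within_seq by blast
  then have "(\<lambda>n. - ((\<gamma> x (R n) - \<gamma> x s) /\<^sub>R (R n - s)) / (1 + \<gamma>x (z n) (R n))) \<longlonglongrightarrow> - \<gamma>t x s / (1 + \<gamma>x x s)"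
    using pos[OF s, of x] by (intro tendsto_intros gz) auto
  then show "(\<lambda>n. (X (R n) y - X s y) /\<^sub>R (R n - s)) \<longlonglongrightarrow> - \<gamma>t (X s y) s / (1 + \<gamma>x (X s y) s)"
    unfolding eq x_def .
qed

end

section \<open>Inverse multipliers and smooth periodic profiles\<close>

lemma W_bdd_uminus: "W_bdd m a A \<Longrightarrow> W_bdd m (\<lambda>x. - a x) A"
proof (induction m arbitrary: a)
  case (Suc m)
  from Suc.prems obtain a' where "\<And>x. (a has_vector_derivative a' x) (at x)" "W_bdd m a' A" by auto
  then show ?case
    using Suc.IH[of a'] W_bdd_bound[OF Suc.prems]
    by (auto intro!: exI[of _ "\<lambda>x. - a' x"] has_vector_derivative_minus)
qed (auto intro!: continuous_intros)

lemma has_vector_derivative_inverse_one_plus: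
  fixes q :: "real \<Rightarrow> complex"
  assumes "(q has_vector_derivative q') (at x)" "1 + q x \<noteq> 0"
  shows "((\<lambda>x. 1 / (1 + q x)) has_vector_derivative - q' * (1 / (1 + q x)) * (1 / (1 + q x))) (at x)"
proof -
  have "((\<lambda>z. 1 / (1 + z)) has_field_derivative - 1 / (1 + q x)\<^sup>2) (at (q x))"
    using assms(2) by (auto intro!: derivative_eq_intros simp: power2_eq_square)
  from field_vector_diff_chain_at[OF assms(1) this] show ?thesis
    by (simp add: o_def power2_eq_square)
qed

text \<open>Reads off the derivative -q' / (1 + q)^2: two Leibniz products with factors bounded by
  1, \<open>inv_const m\<close> and \<open>inv_const m\<close>, plus 2 for the function
  itself.\<close>

primrec inv_const :: "nat \<Rightarrow> real" where
  "inv_const 0 = 2"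
| "inv_const (Suc m) = 2 + 2 ^ m * (2 ^ m * 1 * inv_const m) * inv_const m"

lemma inv_const_ge: "2 \<le> inv_const m"
proof (induction m)
  case (Suc m)
  then have "0 \<le> 2 ^ m * (2 ^ m * 1 * inv_const m) * inv_const m" by simp
  then show ?case by simp
qed simp

lemma W_bdd_inverse:
  assumes "\<And>x. 1 / 2 \<le> cmod (1 + q x)"
  shows "W_bdd m q 1 \<Longrightarrow> W_bdd m (\<lambda>x. 1 / (1 + q x)) (inv_const m)"
proof (induction m)
  case 0
  have nz: "1 + q x \<noteq> 0" for x using assms[of x] by auto
  have "cmod (1 / (1 + q x)) \<le> 2" for x
  proof -
    have "0 < cmod (1 + q x)" using assms[of x] by linarith
    then show ?thesis using assms[of x] by (simp add: norm_divide divide_le_eq)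
  qed
  moreover have "continuous_on UNIV (\<lambda>x. 1 / (1 + q x))"
    using 0 nz by (intro continuous_intros) auto
  ultimately show ?case by simp
next
  case (Suc m)
  have nz: "1 + q x \<noteq> 0" for x using assms[of x] by auto
  obtain q' where q': "\<And>x. (q has_vector_derivative q' x) (at x)" "W_bdd m q' 1"
    using Suc.prems by auto
  note IH = Suc.IH[OF W_bdd_Suc[OF Suc.prems]]
  have "W_bdd m (\<lambda>x. - q' x * (1 / (1 + q x)) * (1 / (1 + q x))) (2 ^ m * (2 ^ m * 1 * inv_const m) * inv_const m)"
    by (intro W_bdd_mult W_bdd_uminus q' IH)
  then have "W_bdd m (\<lambda>x. - q' x * (1 / (1 + q x)) * (1 / (1 + q x))) (inv_const (Suc m))"
    by (rule W_bdd_mono) simp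
  moreover have "cmod (1 / (1 + q x)) \<le> inv_const (Suc m)" for x
  proof -
    have "0 < cmod (1 + q x)" using assms[of x] by linarith
    then have "cmod (1 / (1 + q x)) \<le> 2" using assms[of x] by (simp add: norm_divide divide_le_eq)
    then show ?thesis using inv_const_ge[of "Suc m"] by linarith
  qed
  ultimately show ?case
    unfolding W_bdd.simps
    by (intro conjI allI exI[of _ "\<lambda>x. - q' x * (1 / (1 + q x)) * (1 / (1 + q x))"]
        has_vector_derivative_inverse_one_plus q' nz)
qed

lemma H_bdd_deriv:
  assumes f: "H_bdd (Suc (Suc m)) f B" "continuous_on UNIV f"
  shows "\<exists>f'. (\<forall>x. (f has_vector_derivative f' x) (at x)) \<and> continuous_on UNIV f' \<and> H_bdd (Suc m) f' B"
proof -
  have fH: "in_H (Suc (Suc m)) f" "H_nrm (Suc (Suc m)) f \<le> B" using f(1) by (auto simp: H_bdd_def)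
  obtain g where g: "ac_deriv f g" "in_H (Suc m) g" "H_nrm (Suc m) g \<le> H_nrm (Suc (Suc m)) f"
    by (rule in_H_Suc_continuous[OF fH(1) f(2)])
  obtain g' where g': "continuous_on UNIV g'" "AE x in lborel. g x = g' x"
    "in_H (Suc m) g'" "H_nrm (Suc m) g = H_nrm (Suc m) g'"
    by (rule in_H_Suc_continuous_rep[OF g(2)])
  have "ac_deriv f g'"
    by (rule ac_deriv_cong_AE[OF g(1) g'(2)])
       (use in_L2_borel[OF in_H_L2[OF g(2)]] borel_measurable_continuous_onI[OF g'(1)] in auto)
  from ac_deriv_differentiable[OF this g'(1)] show ?thesis
    using g g' fH(2) by (intro exI[of _ g']) (auto simp: H_bdd_def)
qed

lemma periodic_continuous_bounded:
  fixes f :: "real \<Rightarrow> 'a::real_normed_vector"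
  assumes T: "T > 0" and per: "\<And>x. f (x + T) = f x" and c: "continuous_on UNIV f"
  shows "\<exists>B. \<forall>x. norm (f x) \<le> B"
proof -
  have nat: "f (x + real n * T) = f x" for x and n :: nat
  proof (induction n)
    case (Suc n)
    then show ?case using per[of "x + real n * T"] by (simp add: algebra_simps)
  qed simp
  have int: "f (x - of_int m * T) = f x" for x and m :: int
  proof (cases "0 \<le> m")
    case True
    then show ?thesis using nat[of "x - of_int m * T" "nat m"] by simp
  next
    case False
    then show ?thesis using nat[of x "nat (- m)"] by simp
  qed
  have "compact (f ` {0..T})"
    by (intro compact_continuous_image continuous_on_subset[OF c]) auto
  then obtain B where B: "\<And>y. y \<in> f ` {0..T} \<Longrightarrow> norm y \<le> B"
    using compact_imp_bounded bounded_iff by metis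
  have "norm (f x) \<le> B" for x
  proof -
    define m where "m = \<lfloor>x / T\<rfloor>"
    have "of_int m * T \<le> x" "x < (of_int m + 1) * T"
      using T floor_divide_lower[OF T, of x] floor_divide_upper[OF T, of x] by (auto simp: m_def)
    then have "x - of_int m * T \<in> {0..T}" by (simp add: algebra_simps)
    then have "norm (f (x - of_int m * T)) \<le> B" by (intro B) auto
    then show ?thesis by (simp add: int)
  qed
  then show ?thesis by blast
qed

lemma smooth_periodic_W_bdd:
  fixes \<phi> :: "real \<Rightarrow> complex"
  assumes sm: "smooth \<phi>" and T: "T > 0" and per: "\<And>x. \<phi> (x + T) = \<phi> x"
  shows "\<exists>B. W_bdd m (nth_deriv n \<phi>) B"
proof -
  have "\<exists>B. \<forall>x. norm (nth_deriv n \<phi> x) \<le> B" for n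
  proof (rule periodic_continuous_bounded[OF T])
    show "continuous_on UNIV (nth_deriv n \<phi>)" by (rule smooth_continuous[OF sm])
    have "(\<lambda>x. 1 *\<^sub>R \<phi> (1 * x + T)) = \<phi>" using per by auto
    then show "nth_deriv n \<phi> (x + T) = nth_deriv n \<phi> x" for x
      using smooth_affine(2)[OF sm, of n 1 1 T] by (simp add: fun_eq_iff)
  qed
  then obtain B where B: "\<And>n x. norm (nth_deriv n \<phi> x) \<le> B n" by metis
  show ?thesis
  proof (induction m arbitrary: n)
    case 0
    show ?case using smooth_continuous[OF sm] B by auto
  next
    case (Suc m)
    obtain C where C: "W_bdd m (nth_deriv (Suc n) \<phi>) C" using Suc by blast
    have "W_bdd m (nth_deriv (Suc n) \<phi>) (max C (B n))" by (rule W_bdd_mono[OF C]) simp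
    then have "W_bdd (Suc m) (nth_deriv n \<phi>) (max C (B n))"
      using smooth_deriv[OF sm, of n] B[of n] by (auto simp: le_max_iff_disj)
    then show ?case by blast
  qed
qed

section \<open>The perturbation equation\<close>

lemma vector_lipschitz:
  fixes f :: "real \<Rightarrow> complex"
  assumes "\<And>x. (f has_vector_derivative f' x) (at x)" "\<And>x. cmod (f' x) \<le> B"
  shows "cmod (f a - f b) \<le> B * \<bar>a - b\<bar>"
proof -
  have "norm (f a - f b) \<le> B * norm (a - b)"
  proof (rule differentiable_bound[where S = UNIV and f' = "\<lambda>x h. h *\<^sub>R f' x"])
    show "(f has_derivative (\<lambda>h. h *\<^sub>R f' x)) (at x)" for x
      using assms(1) by (simp add: has_vector_derivative_def)
    show "onorm (\<lambda>h. h *\<^sub>R f' x) \<le> B" for x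
      by (rule onorm_le) (use mult_right_mono[OF assms(2)[of x] abs_ge_zero] in \<open>simp add: mult.commute\<close>)
  qed auto
  then show ?thesis by simp
qed

lemma integrable_csc_bounded:
  fixes b :: "real \<Rightarrow> complex"
  assumes e: "csc \<eta>" and b: "b \<in> borel_measurable borel" "\<And>x. cmod (b x) \<le> B"
  shows "integrable lborel (\<lambda>x. \<eta> x *\<^sub>R b x)"
proof (rule Bochner_Integration.integrable_bound)
  show "integrable lborel (\<lambda>x. \<bar>\<eta> x\<bar> * B)"
    using csc_integrable[OF csc_norm[OF e]] by simp
  show "(\<lambda>x. \<eta> x *\<^sub>R b x) \<in> borel_measurable lborel" using csc_borel[OF e] b(1) by measurable
  show "AE x in lborel. norm (\<eta> x *\<^sub>R b x) \<le> norm (\<bar>\<eta> x\<bar> * B)"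
    using b(2) by (intro AE_I2) (auto simp: abs_mult intro!: mult_left_mono intro: order_trans[OF _ abs_ge_self])
qed

text \<open>As r <= 1 + r^3, the linear terms are dominated by the cubic one and a constant, so
  local cubic integrability makes the reaction locally integrable.\<close>

lemma lle_reaction_le:
  "cmod (lle_reaction \<alpha> F z) \<le> (1 + \<bar>\<alpha>\<bar> + \<bar>F\<bar>) + (2 + \<bar>\<alpha>\<bar>) * cmod z ^ 3"
proof -
  define r where "r = cmod z"
  have r: "0 \<le> r" by (simp add: r_def)
  have "cmod (1 + \<i> * complex_of_real \<alpha>) \<le> 1 + \<bar>\<alpha>\<bar>"
    using norm_triangle_ineq[of 1 "\<i> * complex_of_real \<alpha>"] by (simp add: norm_mult)
  then have 1: "cmod (- (1 + \<i> * complex_of_real \<alpha>) * z) \<le> (1 + \<bar>\<alpha>\<bar>) * r"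
    unfolding r_def norm_mult norm_minus_cancel by (rule mult_right_mono) simp
  have 2: "cmod (\<i> * complex_of_real ((cmod z)\<^sup>2) * z) = r ^ 3"
    by (simp add: norm_mult r_def norm_power power2_eq_square power3_eq_cube)
  have "cmod (lle_reaction \<alpha> F z) \<le> (1 + \<bar>\<alpha>\<bar>) * r + r ^ 3 + \<bar>F\<bar>"
    unfolding lle_reaction_def
    using norm_triangle_ineq[of "- (1 + \<i> * complex_of_real \<alpha>) * z + \<i> * complex_of_real ((cmod z)\<^sup>2) * z" "complex_of_real F"]
      norm_triangle_ineq[of "- (1 + \<i> * complex_of_real \<alpha>) * z" "\<i> * complex_of_real ((cmod z)\<^sup>2) * z"] 1 2
    by simp
  moreover have "r \<le> 1 + r ^ 3"
  proof (cases "r \<le> 1")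
    case False
    then have "r * 1 \<le> r * (r * r)" using r by (intro mult_left_mono) (auto intro: order_trans[OF _ mult_mono[of 1 r 1 r]])
    then show ?thesis by (simp add: power3_eq_cube mult.assoc)
  qed (use r in \<open>simp add: add_increasing2\<close>)
  then have "(1 + \<bar>\<alpha>\<bar>) * r \<le> (1 + \<bar>\<alpha>\<bar>) * (1 + r ^ 3)" by (intro mult_left_mono) auto
  ultimately show ?thesis by (simp add: r_def algebra_simps)
qed

lemma H_bdd_of_real:
  fixes f :: "real \<Rightarrow> real"
  assumes "in_H m f" shows "H_bdd m (\<lambda>x. of_real (f x)) (H_nrm m f)"
proof -
  have "bounded_linear (of_real :: real \<Rightarrow> complex)" by (rule bounded_linear_of_real)
  from in_H_bounded_linear[OF this assms] H_nrm_bounded_linear[OF this assms, of 1] show ?thesis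
    by (simp add: H_bdd_def)
qed

locale modulated_profile = phase_function t k \<gamma> \<gamma>x \<gamma>t
  for t :: real and k :: nat and \<gamma> \<gamma>x \<gamma>t :: "real \<Rightarrow> real \<Rightarrow> real" +
  fixes \<beta> \<Phi> :: real and \<phi> :: "real \<Rightarrow> complex"
  assumes sm: "smooth \<phi>"
    and \<phi>W: "W_bdd k \<phi> \<Phi>" "W_bdd k (nth_deriv 1 \<phi>) \<Phi>" "W_bdd k (nth_deriv 2 \<phi>) \<Phi>"
begin

abbreviation "\<phi>1 \<equiv> nth_deriv 1 \<phi>"
abbreviation "\<phi>2 \<equiv> nth_deriv 2 \<phi>"

definition gx :: "real \<Rightarrow> real \<Rightarrow> complex" where "gx s x = of_real (\<gamma>x x s)"
definition gt :: "real \<Rightarrow> real \<Rightarrow> complex" where "gt s x = of_real (\<gamma>t x s)"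
definition hx :: "real \<Rightarrow> real" where "hx s = H_nrm (k + 2) (\<lambda>x. \<gamma>x x s)"
definition ht :: "real \<Rightarrow> real" where "ht s = H_nrm (k + 2) (\<lambda>x. \<gamma>t x s)"
text \<open>The derivative of the inverse map \<open>X s\<close>, written at the original point
  x.\<close>

definition \<sigma> :: "real \<Rightarrow> real \<Rightarrow> complex" where "\<sigma> s x = 1 / (1 + gx s x)"
definition gxx :: "real \<Rightarrow> real \<Rightarrow> complex" where
  "gxx s = (SOME g'. (\<forall>x. (gx s has_vector_derivative g' x) (at x)) \<and> continuous_on UNIV g' \<and> H_bdd (Suc k) g' (hx s))"
abbreviation "S \<equiv> inv_const k"
text \<open>The profile in the coordinates of psi. The quantities \<open>ps0\<close>,
  \<open>py\<close>, \<open>pyy\<close> and \<open>f0\<close> are written in the original variable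
  x, where the phase is known, and are composed with \<open>X s\<close> afterwards.\<close>

definition p :: "real \<Rightarrow> real \<Rightarrow> complex" where "p s y = \<phi> (X s y)"
definition ps0 :: "real \<Rightarrow> real \<Rightarrow> complex" where "ps0 s x = - (\<phi>1 x * gt s x * \<sigma> s x)"
definition ps :: "real \<Rightarrow> real \<Rightarrow> complex" where "ps s y = ps0 s (X s y)"
definition py :: "real \<Rightarrow> real \<Rightarrow> complex" where "py s x = \<phi>1 x * \<sigma> s x"
definition pyy :: "real \<Rightarrow> real \<Rightarrow> complex" where
  "pyy s x = (\<phi>1 x * (- gxx s x * \<sigma> s x * \<sigma> s x) + \<phi>2 x * \<sigma> s x) * \<sigma> s x"
text \<open>The negative defect of the profile in the equation, rearranged so that each summand is a
  bounded multiplier times \<open>gx\<close>, \<open>gxx\<close> or \<open>gt\<close>. In this form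
  it lies in H^k with a bound linear in the phase.\<close>

definition f0 :: "real \<Rightarrow> real \<Rightarrow> complex" where
  "f0 s x = (((\<i> * of_real \<beta>) * (\<phi>2 x * (\<sigma> s x * (1 + \<sigma> s x)))) * gx s x
     + ((\<i> * of_real \<beta>) * (\<phi>1 x * (\<sigma> s x * (\<sigma> s x * \<sigma> s x)))) * gxx s x) + (\<phi>1 x * \<sigma> s x) * gt s x"
definition f :: "real \<Rightarrow> real \<Rightarrow> complex" where "f s y = f0 s (X s y)"
definition KF :: real where
  "KF = comp_const S k * (3 ^ k * (2 ^ k * \<bar>\<beta>\<bar> * (2 ^ k * \<Phi> * (2 ^ k * S * (1 + S)))
     + 2 ^ k * \<bar>\<beta>\<bar> * (2 ^ k * \<Phi> * (2 ^ k * S * (2 ^ k * S * S))) + 2 ^ k * \<Phi> * S))"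
definition n :: "real \<Rightarrow> real" where "n s = KF * (hx s + ht s)"

lemma \<Phi>_nonneg: "0 \<le> \<Phi>" by (rule W_bdd_nonneg[OF \<phi>W(1)])
lemma S_ge: "2 \<le> S" by (rule inv_const_ge)
lemma hx: "0 \<le> hx s" "s \<in> {0..t} \<Longrightarrow> hx s \<le> 1 / 4" using Hx_le by (auto simp: hx_def)
lemma ht: "0 \<le> ht s" "s \<in> {0..t} \<Longrightarrow> ht s \<le> 1 / 4" using Ht_le by (auto simp: ht_def)

lemma KF_nonneg: "0 \<le> KF"
  unfolding KF_def using \<Phi>_nonneg S_ge comp_const_nonneg[of S k]
  by (intro mult_nonneg_nonneg add_nonneg_nonneg) auto

lemma gx_H: "s \<in> {0..t} \<Longrightarrow> H_bdd (Suc (Suc k)) (gx s) (hx s)"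
  using H_bdd_of_real[OF Hx_in, of s] by (simp add: gx_def[abs_def] hx_def)

lemma gt_H: "s \<in> {0..t} \<Longrightarrow> H_bdd (Suc (Suc k)) (gt s) (ht s)"
  using H_bdd_of_real[OF Ht_in, of s] by (simp add: gt_def[abs_def] ht_def)

lemma gx_cont: "s \<in> {0..t} \<Longrightarrow> continuous_on UNIV (gx s)"
  unfolding gx_def[abs_def] by (intro continuous_intros \<gamma>x_cont)

lemma gx_W: "s \<in> {0..t} \<Longrightarrow> W_bdd (Suc k) (gx s) 1"
  by (rule W_bdd_mono[OF H_bdd_imp_W_bdd[OF gx_H gx_cont]]) (use hx(2)[of s] in auto)

lemma gxx:
  assumes "s \<in> {0..t}"
  shows "(gx s has_vector_derivative gxx s x) (at x)" "continuous_on UNIV (gxx s)" "H_bdd (Suc k) (gxx s) (hx s)"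
  using someI_ex[OF H_bdd_deriv[OF gx_H[OF assms] gx_cont[OF assms]]] unfolding gxx_def[symmetric] by blast+

lemma one_plus_gx: "s \<in> {0..t} \<Longrightarrow> 1 / 2 \<le> cmod (1 + gx s x)"
proof -
  assume s: "s \<in> {0..t}"
  have "1 + gx s x = complex_of_real (1 + \<gamma>x x s)" by (simp add: gx_def)
  then have "cmod (1 + gx s x) = \<bar>1 + \<gamma>x x s\<bar>" by (simp only: norm_of_real)
  then show ?thesis using \<gamma>x_le[OF s, of x] by (auto simp: abs_le_iff)
qed

lemma \<sigma>_W: "s \<in> {0..t} \<Longrightarrow> W_bdd k (\<sigma> s) S"
  unfolding \<sigma>_def[abs_def] by (rule W_bdd_inverse[OF one_plus_gx W_bdd_Suc[OF gx_W]])

lemma \<sigma>_le: "s \<in> {0..t} \<Longrightarrow> cmod (\<sigma> s x) \<le> 2"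
proof -
  assume s: "s \<in> {0..t}"
  have "0 < cmod (1 + gx s x)" using one_plus_gx[OF s, of x] by linarith
  then show ?thesis using one_plus_gx[OF s, of x] by (simp add: \<sigma>_def norm_divide divide_le_eq)
qed

lemma \<sigma>_deriv: "s \<in> {0..t} \<Longrightarrow> (\<sigma> s has_vector_derivative - gxx s x * \<sigma> s x * \<sigma> s x) (at x)"
  unfolding \<sigma>_def[abs_def]
  by (rule has_vector_derivative_inverse_one_plus[OF gxx(1)]) (use one_plus_gx[of s x] in auto)

lemma X_deriv_\<sigma>: "complex_of_real (1 / (1 + \<gamma>x (X s y) s)) = \<sigma> s (X s y)"
  by (simp add: \<sigma>_def gx_def)

lemma comp_X_deriv:
  assumes s: "s \<in> {0..t}" and a: "\<And>x. (a has_vector_derivative a' x) (at x)"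
  shows "((\<lambda>y. a (X s y)) has_vector_derivative a' (X s y) * \<sigma> s (X s y)) (at y)"
  using vector_diff_chain_at[OF bilip_deriv[OF X_bilip[OF s], unfolded has_real_derivative_iff_has_vector_derivative] a, of y]
  by (simp add: o_def X_deriv_\<sigma>[symmetric] scaleR_conv_of_real mult.commute)

lemma X_cont: "s \<in> {0..t} \<Longrightarrow> continuous_on UNIV (X s)"
  by (rule bilip_continuous[OF X_bilip])

lemma comp_X_cont: "s \<in> {0..t} \<Longrightarrow> continuous_on UNIV a \<Longrightarrow> continuous_on UNIV (\<lambda>y. a (X s y))"
  by (rule continuous_on_compose2[OF _ X_cont]) auto

lemma p_W: "s \<in> {0..t} \<Longrightarrow> W_bdd k (p s) (W_comp_const S k * \<Phi>)"
  unfolding p_def[abs_def] by (rule W_bdd_comp_inverse[OF X_bilip X_deriv_\<sigma> \<sigma>_W \<phi>W(1)])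

lemma p_cont: "s \<in> {0..t} \<Longrightarrow> continuous_on UNIV (p s)"
  using W_bdd_continuous[OF p_W] .

lemma p_le: "cmod (p s y) \<le> \<Phi>"
  unfolding p_def by (rule W_bdd_bound[OF \<phi>W(1)])

lemma \<phi>_derivs: "(\<phi> has_vector_derivative \<phi>1 x) (at x)" "(\<phi>1 has_vector_derivative \<phi>2 x) (at x)"
  using smooth_deriv[OF sm, of 0 x] smooth_deriv[OF sm, of 1 x] by (simp_all add: numeral_2_eq_2)

lemma pyy_cont: "s \<in> {0..t} \<Longrightarrow> continuous_on UNIV (pyy s)"
  unfolding pyy_def[abs_def]
  by (intro continuous_intros W_bdd_continuous[OF \<phi>W(2)] W_bdd_continuous[OF \<phi>W(3)] W_bdd_continuous[OF \<sigma>_W] gxx(2))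

lemma p_weak_2: assumes s: "s \<in> {0..t}" shows "has_weak_deriv 2 (p s) (\<lambda>y. pyy s (X s y))"
proof -
  have c1: "continuous_on UNIV (py s)"
    unfolding py_def[abs_def] by (intro continuous_intros W_bdd_continuous[OF \<phi>W(2)] W_bdd_continuous[OF \<sigma>_W[OF s]])
  have "ac_deriv (p s) (\<lambda>y. py s (X s y))"
    using comp_X_deriv[OF s \<phi>_derivs(1)] comp_X_cont[OF s c1]
    by (intro ac_deriv_C1) (simp_all add: p_def[abs_def] py_def)
  moreover have "ac_deriv (\<lambda>y. py s (X s y)) (\<lambda>y. pyy s (X s y))"
  proof (rule ac_deriv_C1[OF _ comp_X_cont[OF s pyy_cont[OF s]]])
    have "(py s has_vector_derivative \<phi>1 x * (- gxx s x * \<sigma> s x * \<sigma> s x) + \<phi>2 x * \<sigma> s x) (at x)" for x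
      unfolding py_def[abs_def] by (rule has_vector_derivative_mult[OF \<phi>_derivs(2) \<sigma>_deriv[OF s]])
    from comp_X_deriv[OF s this] show "((\<lambda>y. py s (X s y)) has_vector_derivative pyy s (X s y)) (at y)" for y
      by (simp add: pyy_def)
  qed
  ultimately show ?thesis
    using has_weak_deriv_trans[OF ac_deriv_imp_weak ac_deriv_imp_weak] by (simp add: numeral_2_eq_2)
qed

text \<open>Stationarity makes i beta phi'' equal to the reaction at phi. The right-hand side is
  therefore the reaction at p minus i beta p_yy minus p_s, the amount by which p fails to solve the
  equation.\<close>

lemma f_eq:
  assumes s: "s \<in> {0..t}"
  shows "f s y = \<i> * of_real \<beta> * \<phi>2 (X s y) - \<i> * of_real \<beta> * pyy s (X s y) - ps s y"
proof -
  define x where "x = X s y"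
  have "1 + gx s x \<noteq> 0" using one_plus_gx[OF s, of x] by auto
  \<comment> \<open>This exhibits the factor \<open>gx\<close> in the difference of the two second
    derivative terms, 1 - sigma^2 = (1 + sigma) \<open>gx\<close> sigma.\<close>
  then have e: "gx s x * \<sigma> s x = 1 - \<sigma> s x" by (simp add: \<sigma>_def field_simps)
  have "f0 s x = (\<i> * of_real \<beta>) * (\<phi>2 x * ((1 + \<sigma> s x) * (gx s x * \<sigma> s x)))
     + (\<i> * of_real \<beta>) * (\<phi>1 x * (\<sigma> s x * (\<sigma> s x * \<sigma> s x))) * gxx s x + (\<phi>1 x * \<sigma> s x) * gt s x"
    by (simp add: f0_def algebra_simps)
  also have "\<dots> = \<i> * of_real \<beta> * \<phi>2 x - \<i> * of_real \<beta> * pyy s x - ps0 s x"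
    unfolding e by (simp add: pyy_def ps0_def algebra_simps)
  finally show ?thesis by (simp add: f_def ps_def x_def)
qed

lemma f_H: assumes s: "s \<in> {0..t}" shows "H_bdd k (f s) (n s)"
proof -
  let ?K1 = "2 ^ k * cmod (\<i> * of_real \<beta>) * (2 ^ k * \<Phi> * (2 ^ k * S * (1 + S)))"
  let ?K2 = "2 ^ k * cmod (\<i> * of_real \<beta>) * (2 ^ k * \<Phi> * (2 ^ k * S * (2 ^ k * S * S)))"
  let ?K3 = "2 ^ k * \<Phi> * S"
  note sW = \<sigma>_W[OF s]
  have "H_bdd k (f0 s) (3 ^ k * ?K1 * hx s + 3 ^ k * ?K2 * hx s + 3 ^ k * ?K3 * ht s)"
    unfolding f0_def[abs_def]
    by (intro H_bdd_add H_bdd_mult W_bdd_cmult W_bdd_mult W_bdd_add W_bdd_const \<phi>W sW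
        H_bdd_le[OF gx_H[OF s]] H_bdd_le[OF gt_H[OF s]] H_bdd_le[OF gxx(3)[OF s]]) auto
  from H_bdd_comp_inverse[OF X_bilip[OF s] X_deriv_\<sigma> sW this]
  have "H_bdd k (f s) (comp_const S k * (3 ^ k * ?K1 * hx s + 3 ^ k * ?K2 * hx s + 3 ^ k * ?K3 * ht s))"
    by (simp add: f_def[abs_def])
  then show ?thesis
  proof (rule H_bdd_mono)
    have K: "0 \<le> ?K1" "0 \<le> ?K2" "0 \<le> ?K3" using \<Phi>_nonneg S_ge by auto
    have "3 ^ k * ?K1 * hx s + 3 ^ k * ?K2 * hx s + 3 ^ k * ?K3 * ht s \<le> 3 ^ k * (?K1 + ?K2 + ?K3) * (hx s + ht s)"
    proof -
      have "0 \<le> 3 ^ k * ?K1 * ht s" "0 \<le> 3 ^ k * ?K2 * ht s" "0 \<le> 3 ^ k * ?K3 * hx s"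
        by (intro mult_nonneg_nonneg K hx ht; simp)+
      moreover have "c * (a1 + a2 + a3) * (x + y) = c * a1 * x + c * a2 * x + c * a3 * y + (c * a1 * y + c * a2 * y + c * a3 * x)"
        for c a1 a2 a3 x y :: real by (simp add: algebra_simps)
      ultimately show ?thesis by simp
    qed
    then have "comp_const S k * (3 ^ k * ?K1 * hx s + 3 ^ k * ?K2 * hx s + 3 ^ k * ?K3 * ht s)
        \<le> comp_const S k * (3 ^ k * (?K1 + ?K2 + ?K3) * (hx s + ht s))"
      using comp_const_nonneg[of S k] S_ge by (intro mult_left_mono) auto
    then show "comp_const S k * (3 ^ k * ?K1 * hx s + 3 ^ k * ?K2 * hx s + 3 ^ k * ?K3 * ht s) \<le> n s"
      by (simp add: n_def KF_def norm_mult mult.assoc)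
  qed
qed

lemma p_lip: "r \<in> {0..t} \<Longrightarrow> s \<in> {0..t} \<Longrightarrow> cmod (p r y - p s y) \<le> \<Phi> * \<bar>r - s\<bar>"
proof -
  assume rs: "r \<in> {0..t}" "s \<in> {0..t}"
  have "cmod (p r y - p s y) \<le> \<Phi> * \<bar>X r y - X s y\<bar>"
    unfolding p_def by (rule vector_lipschitz[OF \<phi>_derivs(1) W_bdd_bound[OF \<phi>W(2)]])
  also have "\<dots> \<le> \<Phi> * \<bar>r - s\<bar>" by (rule mult_left_mono[OF X_lip_t[OF rs] \<Phi>_nonneg])
  finally show ?thesis .
qed

lemma ps_deriv:
  assumes s: "s \<in> {0..t}"
  shows "((\<lambda>r. p r y) has_vector_derivative ps s y) (at s within {0..t})"
proof -
  have "((\<phi> \<circ> (\<lambda>r. X r y)) has_vector_derivative (- \<gamma>t (X s y) s / (1 + \<gamma>x (X s y) s)) *\<^sub>R \<phi>1 (X s y)) (at s within {0..t})"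
    by (rule vector_diff_chain_within[OF X_deriv_t[OF s]]) (rule has_vector_derivative_at_within[OF \<phi>_derivs(1)])
  moreover have "(- \<gamma>t (X s y) s / (1 + \<gamma>x (X s y) s)) *\<^sub>R \<phi>1 (X s y) = ps s y"
    by (simp add: ps_def ps0_def gt_def \<sigma>_def gx_def scaleR_conv_of_real)
  ultimately show ?thesis by (simp add: o_def p_def[abs_def])
qed

lemma ps_le: assumes s: "s \<in> {0..t}" shows "cmod (ps s y) \<le> \<Phi>"
proof -
  have "cmod (ps s y) = cmod (\<phi>1 (X s y)) * (cmod (gt s (X s y)) * cmod (\<sigma> s (X s y)))"
    by (simp add: ps_def ps0_def norm_mult)
  also have "\<dots> \<le> \<Phi> * (1 / 2 * 2)"
    using W_bdd_bound[OF \<phi>W(2)] \<gamma>t_le[OF s] \<sigma>_le[OF s] \<Phi>_nonneg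
    by (intro mult_mono) (auto simp: gt_def)
  finally show ?thesis by simp
qed

lemma ps_borel: assumes s: "s \<in> {0..t}" shows "ps s \<in> borel_measurable borel"
proof -
  have [measurable]: "gt s \<in> borel_measurable borel" "\<phi>1 \<in> borel_measurable borel" "\<sigma> s \<in> borel_measurable borel" "X s \<in> borel_measurable borel"
    using gt_H[OF s] W_bdd_borel[OF \<phi>W(2)] W_bdd_borel[OF \<sigma>_W[OF s]] bilip_borel(1)[OF X_bilip[OF s]]
    by (auto simp: H_bdd_def in_H_def in_L2_def)
  show ?thesis unfolding ps_def[abs_def] ps0_def by measurable
qed

lemma p_time:
  assumes e: "test_function \<eta>" and s: "s \<in> {0..t}"
  shows "((\<lambda>r. \<integral>x. \<eta> x *\<^sub>R p r x \<partial>lborel) has_vector_derivative (\<integral>x. \<eta> x *\<^sub>R ps s x \<partial>lborel)) (at s within {0..t})"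
  unfolding has_vector_derivative_within_seq
proof (intro allI impI)
  fix R assume R0: "\<forall>n. R n \<in> {0..t} - {s}" and lim: "R \<longlonglongrightarrow> s"
  have R: "R n \<in> {0..t}" "R n \<noteq> s" for n using R0 by auto
  note ce = test_function_csc0[OF e]
  note pb = borel_measurable_continuous_onI[OF p_cont]
  note [measurable] = csc_borel[OF ce] pb[OF s] pb[OF R(1)] ps_borel[OF s]
  have eq: "((\<integral>x. \<eta> x *\<^sub>R p (R n) x \<partial>lborel) - (\<integral>x. \<eta> x *\<^sub>R p s x \<partial>lborel)) /\<^sub>R (R n - s)
      = (\<integral>x. \<eta> x *\<^sub>R ((p (R n) x - p s x) /\<^sub>R (R n - s)) \<partial>lborel)" for n
  proof -
    have "(\<integral>x. \<eta> x *\<^sub>R ((p (R n) x - p s x) /\<^sub>R (R n - s)) \<partial>lborel)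
        = (\<integral>x. (\<eta> x *\<^sub>R p (R n) x - \<eta> x *\<^sub>R p s x) /\<^sub>R (R n - s) \<partial>lborel)"
      by (rule Bochner_Integration.integral_cong) (auto simp: scaleR_diff_right mult.commute)
    also have "\<dots> = ((\<integral>x. \<eta> x *\<^sub>R p (R n) x \<partial>lborel) - (\<integral>x. \<eta> x *\<^sub>R p s x \<partial>lborel)) /\<^sub>R (R n - s)"
      using integrable_csc_bounded[OF ce pb[OF R(1)[of n]] p_le] integrable_csc_bounded[OF ce pb[OF s] p_le] by simp
    finally show ?thesis by simp
  qed
  show "(\<lambda>n. ((\<integral>x. \<eta> x *\<^sub>R p (R n) x \<partial>lborel) - (\<integral>x. \<eta> x *\<^sub>R p s x \<partial>lborel)) /\<^sub>R (R n - s))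
      \<longlonglongrightarrow> (\<integral>x. \<eta> x *\<^sub>R ps s x \<partial>lborel)"
    unfolding eq
  proof (rule integral_dominated_convergence)
    show "integrable lborel (\<lambda>x. \<bar>\<eta> x\<bar> * \<Phi>)" using csc_integrable[OF csc_norm[OF ce]] by simp
    show "AE x in lborel. (\<lambda>n. \<eta> x *\<^sub>R ((p (R n) x - p s x) /\<^sub>R (R n - s))) \<longlonglongrightarrow> \<eta> x *\<^sub>R ps s x"
      using ps_deriv[OF s] R0 lim unfolding has_vector_derivative_within_seq by (intro AE_I2 tendsto_intros) blast
    show "AE x in lborel. norm (\<eta> x *\<^sub>R ((p (R n) x - p s x) /\<^sub>R (R n - s))) \<le> \<bar>\<eta> x\<bar> * \<Phi>" for n
    proof (rule AE_I2)
      fix x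
      have "norm ((p (R n) x - p s x) /\<^sub>R (R n - s)) = cmod (p (R n) x - p s x) / \<bar>R n - s\<bar>"
        by (simp add: divide_inverse mult.commute)
      also have "\<dots> \<le> \<Phi>" using p_lip[OF R(1) s, of n x] R(2)[of n] by (simp add: pos_divide_le_eq)
      finally have "norm ((p (R n) x - p s x) /\<^sub>R (R n - s)) \<le> \<Phi>" .
      then show "norm (\<eta> x *\<^sub>R ((p (R n) x - p s x) /\<^sub>R (R n - s))) \<le> \<bar>\<eta> x\<bar> * \<Phi>"
        unfolding norm_scaleR[of "\<eta> x"] by (rule mult_left_mono) simp
    qed
  qed measurable
qed

end

lemma integrable_csc_continuous:
  fixes b :: "real \<Rightarrow> complex"
  assumes e: "csc \<eta>" and b: "continuous_on UNIV b"
  shows "integrable lborel (\<lambda>x. \<eta> x *\<^sub>R b x)"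
  using e b by (intro csc_integrable) (auto simp: compactly_supported_cont_def intro!: continuous_intros)

lemma integrable_csc_lle_reaction:
  assumes e: "csc \<eta>" and m: "\<psi> \<in> borel_measurable borel"
    and i: "\<And>a b. set_integrable lborel {a..b} (\<lambda>x. cmod (\<psi> x) ^ 3)"
  shows "integrable lborel (\<lambda>x. \<eta> x *\<^sub>R lle_reaction \<alpha> F (\<psi> x))"
proof -
  obtain R B where RB: "0 < B" "\<And>x. norm (\<eta> x) \<le> B * indicat_real {- R..R} x"
    using csc_bounds[OF e] by blast
  have R: "\<eta> x = 0" if "\<bar>x\<bar> > R" for x
  proof -
    have "x \<notin> {- R..R}" using that by auto
    then show ?thesis using RB(2)[of x] by simp
  qed
  have B: "\<bar>\<eta> x\<bar> \<le> B" for x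
    using RB(2)[of x] RB(1) by (cases "x \<in> {- R..R}") auto
  define c where "c = 1 + \<bar>\<alpha>\<bar> + \<bar>F\<bar>"
  define d where "d = 2 + \<bar>\<alpha>\<bar>"
  have i3: "integrable lborel (\<lambda>x. indicator {- R..R} x * cmod (\<psi> x) ^ 3)"
    using i[of "- R" R] by (simp add: set_integrable_def)
  show ?thesis
  proof (rule Bochner_Integration.integrable_bound)
    show "integrable lborel (\<lambda>x. \<bar>\<eta> x\<bar> * c + (B * d) * (indicator {- R..R} x * cmod (\<psi> x) ^ 3))"
      using csc_integrable[OF csc_norm[OF e]] by (intro Bochner_Integration.integrable_add integrable_mult_right i3) simp
    show "(\<lambda>x. \<eta> x *\<^sub>R lle_reaction \<alpha> F (\<psi> x)) \<in> borel_measurable lborel"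
      using csc_borel[OF e] m unfolding lle_reaction_def by measurable
    show "AE x in lborel. norm (\<eta> x *\<^sub>R lle_reaction \<alpha> F (\<psi> x))
        \<le> norm (\<bar>\<eta> x\<bar> * c + (B * d) * (indicator {- R..R} x * cmod (\<psi> x) ^ 3))"
    proof (rule AE_I2)
      fix x
      have "norm (\<eta> x *\<^sub>R lle_reaction \<alpha> F (\<psi> x)) \<le> \<bar>\<eta> x\<bar> * (c + d * cmod (\<psi> x) ^ 3)"
        unfolding norm_scaleR real_norm_def c_def d_def by (intro mult_left_mono lle_reaction_le) simp
      also have "\<dots> \<le> \<bar>\<eta> x\<bar> * c + (B * d) * (indicator {- R..R} x * cmod (\<psi> x) ^ 3)"
      proof (cases "\<bar>x\<bar> > R")
        case False
        then have "\<bar>\<eta> x\<bar> * (d * cmod (\<psi> x) ^ 3) \<le> B * (d * cmod (\<psi> x) ^ 3)"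
          by (intro mult_right_mono B) (simp add: d_def)
        moreover have "x \<in> {- R..R}" using False by auto
        ultimately show ?thesis by (simp add: algebra_simps)
      qed (use R in \<open>auto simp: indicator_def\<close>)
      finally show "norm (\<eta> x *\<^sub>R lle_reaction \<alpha> F (\<psi> x))
        \<le> norm (\<bar>\<eta> x\<bar> * c + (B * d) * (indicator {- R..R} x * cmod (\<psi> x) ^ 3))" by simp
    qed
  qed
qed

lemma in_L2_cmult: "in_L2 f \<Longrightarrow> in_L2 (\<lambda>x. c * f x)" for f :: "real \<Rightarrow> complex"
  by (rule in_L2_cmult_bound[of f _ "cmod c"]) (auto dest: in_L2_borel simp: norm_mult)

section \<open>The equation for the perturbation of the moved profile\<close>

context modulated_profile
begin

text \<open>Subtract the time derivative of the integral of eta p from the weak equation of psi. The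
  constant F drops out of the difference of reactions, and \<open>f_eq\<close> accounts for the
  terms in which p is differentiated.\<close>

lemma weak_perturbation_equation:
  assumes sol: "lle_solution \<alpha> \<beta> F t \<psi>"
    and st: "\<And>x. 0 = - \<i> * of_real \<beta> * \<phi>2 x + lle_reaction \<alpha> F (\<phi> x)"
    and wL: "\<And>s. s \<in> {0..t} \<Longrightarrow> in_L2 (\<lambda>y. \<psi> y s - p s y)"
    and e: "test_function \<eta>" and s: "s \<in> {0..t}"
  shows "((\<lambda>r. \<integral>x. \<eta> x *\<^sub>R (\<psi> x r - p r x) \<partial>lborel) has_vector_derivative
        (\<integral>x. nth_deriv 2 \<eta> x *\<^sub>R (- (\<i> * of_real \<beta>) * (\<psi> x s - p s x)) \<partial>lborel)
        + (\<integral>x. \<eta> x *\<^sub>R (lle_reaction \<alpha> 0 (p s x + (\<psi> x s - p s x)) - lle_reaction \<alpha> 0 (p s x) + f s x) \<partial>lborel))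
      (at s within {0..t})"
proof -
  let ?w = "\<lambda>s x. \<psi> x s - p s x"
  let ?b = "\<i> * complex_of_real \<beta>"
  note ce = test_function_csc0[OF e]
  note c2 = test_function_csc[OF e, of 2]
  have \<psi>m: "(\<lambda>x. \<psi> x r) \<in> borel_measurable borel" "set_integrable lborel {a..b} (\<lambda>x. cmod (\<psi> x r) ^ 3)"
    if "r \<in> {0..t}" for r a b using sol that by (auto simp: lle_solution_def)
  have pi: "integrable lborel (\<lambda>x. \<eta> x *\<^sub>R p r x)" if "r \<in> {0..t}" for r
    by (rule integrable_csc_continuous[OF ce p_cont[OF that]])
  have wi: "integrable lborel (\<lambda>x. \<eta> x *\<^sub>R ?w r x)" if "r \<in> {0..t}" for r
    by (rule integrable_test_L2_0[OF e wL[OF that]])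
  have \<psi>i: "integrable lborel (\<lambda>x. \<eta> x *\<^sub>R \<psi> x r)" if "r \<in> {0..t}" for r
  proof -
    have "integrable lborel (\<lambda>x. \<eta> x *\<^sub>R ?w r x + \<eta> x *\<^sub>R p r x)"
      by (rule Bochner_Integration.integrable_add[OF wi[OF that] pi[OF that]])
    then show ?thesis by (simp add: scaleR_diff_right)
  qed
  have split: "(\<integral>x. \<eta> x *\<^sub>R ?w r x \<partial>lborel) = (\<integral>x. \<eta> x *\<^sub>R \<psi> x r \<partial>lborel) - (\<integral>x. \<eta> x *\<^sub>R p r x \<partial>lborel)"
    if "r \<in> {0..t}" for r
    unfolding scaleR_diff_right by (rule Bochner_Integration.integral_diff[OF \<psi>i[OF that] pi[OF that]])
  define P where "P x = pyy s (X s x)" for x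
  define T0 where "T0 x = nth_deriv 2 \<eta> x *\<^sub>R (- \<i> * of_real \<beta> * \<psi> x s) + \<eta> x *\<^sub>R lle_reaction \<alpha> F (\<psi> x s)" for x
  define T1 where "T1 x = nth_deriv 2 \<eta> x *\<^sub>R (- ?b * ?w s x)" for x
  define T2 where "T2 x = \<eta> x *\<^sub>R (lle_reaction \<alpha> 0 (p s x + ?w s x) - lle_reaction \<alpha> 0 (p s x) + f s x)" for x
  define T3 where "T3 x = \<eta> x *\<^sub>R ps s x" for x
  define T4 where "T4 x = nth_deriv 2 \<eta> x *\<^sub>R p s x" for x
  define T5 where "T5 x = \<eta> x *\<^sub>R P x" for x
  have T2: "T2 x = \<eta> x *\<^sub>R lle_reaction \<alpha> F (\<psi> x s) - ?b * T5 x - T3 x" for x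
  proof -
    have z: "lle_reaction \<alpha> 0 z = lle_reaction \<alpha> F z - of_real F" for z by (simp add: lle_reaction_def)
    have "lle_reaction \<alpha> F (p s x) = ?b * \<phi>2 (X s x)"
      using st[of "X s x"] by (simp add: p_def)
    then have eq: "lle_reaction \<alpha> 0 (p s x + ?w s x) - lle_reaction \<alpha> 0 (p s x) + f s x
        = lle_reaction \<alpha> F (\<psi> x s) - ?b * P x - ps s x"
      by (simp add: z P_def f_eq[OF s])
    show ?thesis
      unfolding T2_def eq by (simp add: T3_def T5_def scaleR_conv_of_real algebra_simps)
  qed
  have i1: "integrable lborel T1"
    unfolding T1_def by (rule integrable_test_L2[OF e]) (rule in_L2_cmult[OF wL[OF s]])
  have i3: "integrable lborel T3"
    unfolding T3_def by (rule integrable_csc_bounded[OF ce ps_borel[OF s] ps_le[OF s]])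
  have i4: "integrable lborel T4" unfolding T4_def by (rule integrable_csc_continuous[OF c2 p_cont[OF s]])
  have i5: "integrable lborel T5"
    unfolding T5_def P_def by (rule integrable_csc_continuous[OF ce comp_X_cont[OF s pyy_cont[OF s]]])
  have i2: "integrable lborel T2"
    unfolding T2 using i3 i5 integrable_csc_lle_reaction[OF ce \<psi>m[OF s], of \<alpha> F]
    by (intro Bochner_Integration.integrable_diff integrable_mult_right)
  \<comment> \<open>\<open>T4\<close> and \<open>T5\<close> carry the second derivative on the test
    function and on p respectively, so their integrals agree by \<open>p_weak_2\<close>; inserting
    them turns psi into psi - p in the dispersive term.\<close>
  have "T0 x - T3 x = (T1 x + T2 x) - ?b * (T4 x - T5 x)" for x
    unfolding T2 by (simp add: T0_def T1_def T4_def scaleR_conv_of_real algebra_simps)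
  then have T0: "T0 = (\<lambda>x. ((T1 x + T2 x) - ?b * (T4 x - T5 x)) + T3 x)"
    by (intro ext) (metis diff_add_cancel)
  have "(\<integral>x. T4 x \<partial>lborel) = (\<integral>x. T5 x \<partial>lborel)"
    using has_weak_derivD[OF p_weak_2[OF s] e] by (simp add: T4_def T5_def P_def)
  then have z: "(\<integral>x. ?b * (T4 x - T5 x) \<partial>lborel) = 0" using i4 i5 by simp
  have iz: "integrable lborel (\<lambda>x. ?b * (T4 x - T5 x))" by (intro integrable_mult_right Bochner_Integration.integrable_diff i4 i5)
  have i12: "integrable lborel (\<lambda>x. T1 x + T2 x)" by (intro Bochner_Integration.integrable_add i1 i2)
  have "(\<integral>x. T0 x \<partial>lborel) = ((\<integral>x. T1 x + T2 x \<partial>lborel) - (\<integral>x. ?b * (T4 x - T5 x) \<partial>lborel)) + (\<integral>x. T3 x \<partial>lborel)"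
    unfolding T0 Bochner_Integration.integral_add[OF Bochner_Integration.integrable_diff[OF i12 iz] i3]
      Bochner_Integration.integral_diff[OF i12 iz] ..
  then have val: "(\<integral>x. T0 x \<partial>lborel) - (\<integral>x. T3 x \<partial>lborel) = (\<integral>x. T1 x \<partial>lborel) + (\<integral>x. T2 x \<partial>lborel)"
    unfolding z Bochner_Integration.integral_add[OF i1 i2] by simp
  have "((\<lambda>r. \<integral>x. \<eta> x *\<^sub>R \<psi> x r \<partial>lborel) has_vector_derivative (\<integral>x. T0 x \<partial>lborel)) (at s within {0..t})"
    using sol e s unfolding lle_solution_def T0_def by blast
  from has_vector_derivative_diff[OF this p_time[OF e s]]
  have "((\<lambda>r. (\<integral>x. \<eta> x *\<^sub>R \<psi> x r \<partial>lborel) - (\<integral>x. \<eta> x *\<^sub>R p r x \<partial>lborel)) has_vector_derivative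
      (\<integral>x. T1 x \<partial>lborel) + (\<integral>x. T2 x \<partial>lborel)) (at s within {0..t})"
    unfolding T3_def[symmetric] val .
  then have "((\<lambda>r. \<integral>x. \<eta> x *\<^sub>R ?w r x \<partial>lborel) has_vector_derivative
      (\<integral>x. T1 x \<partial>lborel) + (\<integral>x. T2 x \<partial>lborel)) (at s within {0..t})"
    by (rule has_vector_derivative_transform[OF s, rotated]) (simp add: split)
  then show ?thesis unfolding T1_def T2_def .
qed

text \<open>The constant depends only on k: the phase enters through the bound
  \<open>inv_const k\<close> on the inverse derivative, valid for every phase of the locale.\<close>

lemma perturbation_H:
  assumes s: "s \<in> {0..t}" and v: "H_bdd k v B"
  shows "H_bdd k (\<lambda>y. v (X s y)) (comp_const S k * B)"
  by (rule H_bdd_comp_inverse[OF X_bilip[OF s] X_deriv_\<sigma> \<sigma>_W[OF s] v])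

lemma inverse_perturbation_H:
  assumes s: "s \<in> {0..t}" and w: "H_bdd k w B"
  shows "H_bdd k (\<lambda>x. w (Th s x)) (comp_const 2 k * B)"
proof (rule H_bdd_comp[OF Th_bilip[OF s] _ w])
  have "W_bdd k (\<lambda>x. 1 + gx s x) (1 + 1)"
    by (intro W_bdd_add W_bdd_Suc[OF gx_W[OF s]] W_bdd_const) simp
  then show "W_bdd k (\<lambda>x. of_real (1 + \<gamma>x x s)) 2" by (simp add: gx_def)
qed

lemma modulated_lle_perturbation:
  assumes sol: "lle_solution \<alpha> \<beta> F t \<psi>"
    and st: "\<And>x. 0 = - \<i> * of_real \<beta> * \<phi>2 x + lle_reaction \<alpha> F (\<phi> x)"
    and v: "v = (\<lambda>x s. \<psi> (x + \<gamma> x s) s - \<phi> x)"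
    and vH: "\<And>s. s \<in> {0..t} \<Longrightarrow> H_bdd k (\<lambda>x. v x s) \<delta>"
    and c: "comp_const S k * \<delta> \<le> 1" "\<beta> \<noteq> 0" "1 \<le> k" "\<Phi> \<le> A" "W_comp_const S k * \<Phi> \<le> A"
  shows "modulated_lle \<alpha> \<beta> A k t (comp_const S k * \<delta>) (KF * (1 / 2)) (\<lambda>s y. v (X s y) s) p ps f n"
proof
  have w: "v (X s y) s = \<psi> y s - p s y" if "s \<in> {0..t}" for s y
    using X_eq[OF that] by (simp add: v p_def)
  show "0 \<le> t" using t by simp
  show "\<beta> \<noteq> 0" "1 \<le> k" "comp_const S k * \<delta> \<le> 1" by fact+
  show "W_bdd k (p s) A" if "s \<in> {0..t}" for s by (rule W_bdd_mono[OF p_W[OF that] c(5)])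
  show "cmod (ps s x) \<le> A" if "s \<in> {0..t}" for s x using ps_le[OF that, of x] c(4) by linarith
  show "ps s \<in> borel_measurable borel" if "s \<in> {0..t}" for s by (rule ps_borel[OF that])
  show "((\<lambda>r. p r x) has_vector_derivative ps s x) (at s within {0..t})" if "s \<in> {0..t}" for s x
    by (rule ps_deriv[OF that])
  show "cmod (p r x - p s x) \<le> A * \<bar>r - s\<bar>" if "r \<in> {0..t}" "s \<in> {0..t}" for r s x
    by (rule order_trans[OF p_lip[OF that] mult_right_mono[OF c(4)]]) simp
  show wH: "H_bdd k (\<lambda>y. v (X s y) s) (comp_const S k * \<delta>)" if "s \<in> {0..t}" for s
    by (rule perturbation_H[OF that vH[OF that]])
  show "H_bdd k (f s) (n s)" if "s \<in> {0..t}" for s by (rule f_H[OF that])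
  show "n s \<le> KF * (1 / 2)" if "s \<in> {0..t}" for s
    unfolding n_def using hx(2)[OF that] ht(2)[OF that] by (intro mult_left_mono KF_nonneg) linarith
  fix \<eta> s assume e: "test_function \<eta>" and s: "s \<in> {0..t}"
  have wL: "in_L2 (\<lambda>y. \<psi> y r - p r y)" if "r \<in> {0..t}" for r
    using wH[OF that] in_H_L2 by (auto simp: H_bdd_def w[OF that])
  show "((\<lambda>r. \<integral>x. \<eta> x *\<^sub>R v (X r x) r \<partial>lborel) has_vector_derivative
        (\<integral>x. nth_deriv 2 \<eta> x *\<^sub>R (- (\<i> * of_real \<beta>) * v (X s x) s) \<partial>lborel)
        + (\<integral>x. \<eta> x *\<^sub>R (lle_reaction \<alpha> 0 (p s x + v (X s x) s) - lle_reaction \<alpha> 0 (p s x) + f s x) \<partial>lborel))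
      (at s within {0..t})"
    unfolding w[OF s]
    by (rule has_vector_derivative_transform[OF s _ weak_perturbation_equation[OF sol st wL e s]]) (simp_all add: w)
qed

lemma perturbation_L2:
  assumes s: "s \<in> {0..t}" and v: "in_L2 v"
  shows "L2_nrm (\<lambda>y. v (X s y)) \<le> 2 * L2_nrm v"
  by (rule bilip_L2(2)[OF X_bilip[OF s] v])

text \<open>The 4 is the square of the L2 cost 2 of the change of variables, and the 2 comes from (a
  + b)^2 <= 2 a^2 + 2 b^2 for the two phase norms.\<close>

lemma perturbation_forcing_le:
  assumes s: "s \<in> {0..t}" and v: "in_L2 v"
  shows "(L2_nrm (\<lambda>y. v (X s y)))\<^sup>2 + (n s)\<^sup>2 \<le> (4 + 2 * KF\<^sup>2) * ((L2_nrm v)\<^sup>2 + ((hx s)\<^sup>2 + (ht s)\<^sup>2))"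
proof -
  have "(L2_nrm (\<lambda>y. v (X s y)))\<^sup>2 \<le> (2 * L2_nrm v)\<^sup>2"
    by (rule power_mono[OF perturbation_L2[OF s v]]) (simp add: L2_nrm_nonneg)
  moreover have "(n s)\<^sup>2 \<le> KF\<^sup>2 * (2 * ((hx s)\<^sup>2 + (ht s)\<^sup>2))"
  proof -
    have "(hx s + ht s)\<^sup>2 \<le> 2 * ((hx s)\<^sup>2 + (ht s)\<^sup>2)"
      using sum_squares_ge_zero[of "hx s - ht s" 0] by (simp add: power2_eq_square algebra_simps)
    then show ?thesis unfolding n_def power_mult_distrib by (rule mult_left_mono) simp
  qed
  moreover have "4 * x + K * (2 * y) \<le> (4 + 2 * K) * (x + y)" if "0 \<le> K" "0 \<le> x" "0 \<le> y" for K x y :: real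
  proof -
    have "(4 + 2 * K) * (x + y) = (4 * x + K * (2 * y)) + (2 * (K * x) + 4 * y)" by (simp add: algebra_simps)
    then show ?thesis using mult_nonneg_nonneg[OF that(1,2)] that(3) by linarith
  qed
  from this[of "KF\<^sup>2" "(L2_nrm v)\<^sup>2" "(hx s)\<^sup>2 + (ht s)\<^sup>2"]
  have "4 * (L2_nrm v)\<^sup>2 + KF\<^sup>2 * (2 * ((hx s)\<^sup>2 + (ht s)\<^sup>2)) \<le> (4 + 2 * KF\<^sup>2) * ((L2_nrm v)\<^sup>2 + ((hx s)\<^sup>2 + (ht s)\<^sup>2))"
    by simp
  moreover have "(2 * L2_nrm v)\<^sup>2 = 4 * (L2_nrm v)\<^sup>2" by (simp add: power_mult_distrib)
  ultimately show ?thesis by linarith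
qed

end

text \<open>Integrability is not assumed: the integral of a non-integrable function is 0 by
  convention.\<close>

lemma exp_integral_nonneg:
  fixes r :: "real \<Rightarrow> real"
  assumes "\<And>s. s \<in> {0..t} \<Longrightarrow> 0 \<le> r s"
  shows "0 \<le> integral {0..t} (\<lambda>s. exp (- \<theta> * (t - s)) * r s)"
proof (cases "(\<lambda>s. exp (- \<theta> * (t - s)) * r s) integrable_on {0..t}")
  case True
  then show ?thesis by (rule integral_nonneg) (simp add: assms)
qed (simp add: not_integrable_integral)

theorem theorem6p1:
  fixes \<alpha> \<beta> F K :: real and k :: nat and \<phi> :: "real \<Rightarrow> complex"
  assumes "\<beta> \<noteq> 0" and "F > 0" and "k \<ge> 1" and "K > 0"
    and "lle_smooth_stationary \<alpha> \<beta> F \<phi>"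
    and "\<exists>T>0. \<forall>x. \<phi> (x + T) = \<phi> x"
  shows "\<exists>\<theta>>0. \<exists>C>0. \<exists>\<epsilon>>0.
    \<forall>(t::real) (\<psi> :: real \<Rightarrow> real \<Rightarrow> complex) (\<gamma> :: real \<Rightarrow> real \<Rightarrow> real)
      (\<gamma>x :: real \<Rightarrow> real \<Rightarrow> real) (\<gamma>t :: real \<Rightarrow> real \<Rightarrow> real) (v :: real \<Rightarrow> real \<Rightarrow> complex).
      t \<ge> 0 \<longrightarrow>
      lle_solution \<alpha> \<beta> F t \<psi> \<longrightarrow>
      (\<forall>s\<in>{0..t}. \<forall>x. ((\<lambda>y. \<gamma> y s) has_real_derivative \<gamma>x x s) (at x)) \<longrightarrow>
      (\<forall>s\<in>{0..t}. \<forall>x. ((\<lambda>r. \<gamma> x r) has_real_derivative \<gamma>t x s) (at s within {0..t})) \<longrightarrow>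
      (\<forall>s\<in>{0..t}. esssup lborel (\<lambda>x. ereal \<bar>\<gamma> x s\<bar>) \<le> ereal K) \<longrightarrow>
      v = (\<lambda>x s. \<psi> (x + \<gamma> x s) s - \<phi> x) \<longrightarrow>
      H_continuous_on k {0..t} v \<longrightarrow>
      H_continuous_on (k + 2) {0..t} \<gamma>x \<longrightarrow>
      H_continuous_on (k + 2) {0..t} \<gamma>t \<longrightarrow>
      (\<forall>s\<in>{0..t}. H_nrm k (\<lambda>x. v x s) \<le> \<epsilon>) \<longrightarrow>
      (\<forall>s\<in>{0..t}. (H_nrm (k + 2) (\<lambda>x. \<gamma>x x s))\<^sup>2 + (H_nrm (k + 2) (\<lambda>x. \<gamma>t x s))\<^sup>2 \<le> \<epsilon>) \<longrightarrow>
      (H_nrm k (\<lambda>x. v x t))\<^sup>2 \<le>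
        C * exp (- \<theta> * t) * (H_nrm k (\<lambda>x. v x 0))\<^sup>2
        + C * integral {0..t} (\<lambda>s. exp (- \<theta> * (t - s)) *
            ((L2_nrm (\<lambda>x. v x s))\<^sup>2
             + ((H_nrm (k + 2) (\<lambda>x. \<gamma>x x s))\<^sup>2 + (H_nrm (k + 2) (\<lambda>x. \<gamma>t x s))\<^sup>2)))
        + C * (H_nrm (k + 1) (\<lambda>x. \<gamma>x x t))\<^sup>2"
proof -
  have sm: "smooth \<phi>" and st: "\<And>x. 0 = - \<i> * of_real \<beta> * nth_deriv 2 \<phi> x + lle_reaction \<alpha> F (\<phi> x)"
    using assms(5) by (auto simp: lle_smooth_stationary_def)
  obtain T where T: "T > 0" "\<And>x. \<phi> (x + T) = \<phi> x" using assms(6) by blast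
  \<comment> \<open>Periodicity is what turns smoothness of phi into bounds for all derivatives on
    the whole line.\<close>
  have "\<forall>j. \<exists>B. W_bdd k (nth_deriv j \<phi>) B" using smooth_periodic_W_bdd[OF sm T] by blast
  from choice[OF this] obtain B where B: "\<And>j. W_bdd k (nth_deriv j \<phi>) (B j)" by blast
  define \<Phi> where "\<Phi> = max (B 0) (max (B 1) (B 2))"
  have \<phi>W: "W_bdd k \<phi> \<Phi>" "W_bdd k (nth_deriv 1 \<phi>) \<Phi>" "W_bdd k (nth_deriv 2 \<phi>) \<Phi>"
    using W_bdd_mono[OF B[of 0], of \<Phi>] W_bdd_mono[OF B[of 1], of \<Phi>] W_bdd_mono[OF B[of 2], of \<Phi>]
    by (simp_all add: \<Phi>_def)
  define A where "A = max \<Phi> (W_comp_const (inv_const k) k * \<Phi>)"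
  have A: "0 \<le> A" "\<Phi> \<le> A" "W_comp_const (inv_const k) k * \<Phi> \<le> A"
    using W_bdd_nonneg[OF \<phi>W(1)] by (auto simp: A_def)
  from damping_estimate[OF A(1), of \<alpha> \<beta> k]
  obtain C\<^sub>1 \<theta> \<epsilon>\<^sub>1 where pos: "C\<^sub>1 > 0" "\<theta> > 0" "\<epsilon>\<^sub>1 > 0"
    and damp: "\<forall>t e N w p ps f n R. modulated_lle \<alpha> \<beta> A k t e N w p ps f n \<longrightarrow> e \<le> \<epsilon>\<^sub>1 \<longrightarrow>
    continuous_on {0..t} R \<longrightarrow> (\<forall>s\<in>{0..t}. (L2_nrm (w s))\<^sup>2 + (n s)\<^sup>2 \<le> R s) \<longrightarrow>
    (H_nrm k (w t))\<^sup>2 \<le> C\<^sub>1 * exp (- \<theta> * t) * (H_nrm k (w 0))\<^sup>2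
      + C\<^sub>1 * integral {0..t} (\<lambda>s. exp (- \<theta> * (t - s)) * R s)"
    by (elim exE conjE) (rule that)
  define c where "c = comp_const (inv_const k) k"
  define d where "d = comp_const 2 k"
  define C\<^sub>r where "C\<^sub>r = 4 + 2 * (modulated_profile.KF k \<beta> \<Phi>)\<^sup>2"
  \<comment> \<open>The summands cover, in turn, the case t = 0, the initial value carried from v to
    w and back, and the forcing.\<close>
  define C where "C = 1 + d\<^sup>2 * C\<^sub>1 * c\<^sup>2 + d\<^sup>2 * C\<^sub>1 * C\<^sub>r"
  \<comment> \<open>The 1/16 is the bound asked for by \<open>phase_function\<close>. The second
    entry makes the norm of w at most 1 and at most \<open>\<epsilon>\<^sub>1\<close> after the
    change of variables, which costs c; c + 1 covers c = 0.\<close>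
  define \<epsilon> where "\<epsilon> = min (1 / 16) (min 1 \<epsilon>\<^sub>1 / (c + 1))"
  have c: "0 \<le> c" using comp_const_nonneg[of "inv_const k" k] inv_const_ge[of k] by (simp add: c_def)
  have C: "1 \<le> C" "d\<^sup>2 * C\<^sub>1 * c\<^sup>2 \<le> C" "d\<^sup>2 * C\<^sub>1 * C\<^sub>r \<le> C"
    using pos by (auto simp: C_def C\<^sub>r_def)
  have \<epsilon>: "0 < \<epsilon>" "\<epsilon> \<le> 1 / 16"
  proof -
    show "0 < \<epsilon>" using pos c by (simp add: \<epsilon>_def)
    show "\<epsilon> \<le> 1 / 16" unfolding \<epsilon>_def by (rule min.cobounded1)
  qed
  have c\<epsilon>: "c * \<epsilon> \<le> 1" "c * \<epsilon> \<le> \<epsilon>\<^sub>1"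
  proof -
    have "\<epsilon> \<le> min 1 \<epsilon>\<^sub>1 / (c + 1)" by (simp add: \<epsilon>_def)
    then have "(c + 1) * \<epsilon> \<le> min 1 \<epsilon>\<^sub>1" using c by (simp add: pos_le_divide_eq mult.commute)
    then show "c * \<epsilon> \<le> 1" "c * \<epsilon> \<le> \<epsilon>\<^sub>1" using \<epsilon>(1) by (simp_all add: algebra_simps)
  qed
  show ?thesis
  proof (intro exI conjI allI impI)
    show "\<theta> > 0" "C > 0" "\<epsilon> > 0" using pos C \<epsilon> by auto
    fix t \<psi> \<gamma> \<gamma>x \<gamma>t v
    assume t: "0 \<le> t" and sol: "lle_solution \<alpha> \<beta> F t \<psi>"
      and dx: "\<forall>s\<in>{0..t}. \<forall>x. ((\<lambda>y. \<gamma> y s) has_real_derivative \<gamma>x x s) (at x)"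
      and dt: "\<forall>s\<in>{0..t}. \<forall>x. ((\<lambda>r. \<gamma> x r) has_real_derivative \<gamma>t x s) (at s within {0..t})"
      and v: "v = (\<lambda>x s. \<psi> (x + \<gamma> x s) s - \<phi> x)"
      and vH: "H_continuous_on k {0..t} v"
      and Hx: "H_continuous_on (k + 2) {0..t} \<gamma>x" and Ht: "H_continuous_on (k + 2) {0..t} \<gamma>t"
      and ve: "\<forall>s\<in>{0..t}. H_nrm k (\<lambda>x. v x s) \<le> \<epsilon>"
      and ge: "\<forall>s\<in>{0..t}. (H_nrm (k + 2) (\<lambda>x. \<gamma>x x s))\<^sup>2 + (H_nrm (k + 2) (\<lambda>x. \<gamma>t x s))\<^sup>2 \<le> \<epsilon>"
    define r where "r s = (L2_nrm (\<lambda>x. v x s))\<^sup>2 + ((H_nrm (k + 2) (\<lambda>x. \<gamma>x x s))\<^sup>2 + (H_nrm (k + 2) (\<lambda>x. \<gamma>t x s))\<^sup>2)" for s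
    define I where "I = integral {0..t} (\<lambda>s. exp (- \<theta> * (t - s)) * r s)"
    have I: "0 \<le> I" unfolding I_def by (rule exp_integral_nonneg) (simp add: r_def)
    define V\<^sub>0 where "V\<^sub>0 = (H_nrm k (\<lambda>x. v x 0))\<^sup>2"
    have "(H_nrm k (\<lambda>x. v x t))\<^sup>2 \<le> C * exp (- \<theta> * t) * V\<^sub>0 + C * I"
    proof (cases "t = 0")
      \<comment> \<open>\<open>phase_function\<close> asks for 0 < t; at t = 0 the estimate follows
        from C >= 1 and nonnegativity of the integral.\<close>
      case True
      have "1 * V\<^sub>0 \<le> C * V\<^sub>0" by (rule mult_right_mono[OF C(1)]) (simp add: V\<^sub>0_def)
      moreover have "0 \<le> C * I" using C(1) I by simp
      ultimately show ?thesis using True by (simp add: V\<^sub>0_def)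
    next
      case False
      interpret modulated_profile t k \<gamma> \<gamma>x \<gamma>t \<beta> \<Phi> \<phi>
      proof
        show "0 < t" using t False by simp
        show "(H_nrm (k + 2) (\<lambda>x. \<gamma>x x s))\<^sup>2 + (H_nrm (k + 2) (\<lambda>x. \<gamma>t x s))\<^sup>2 \<le> 1 / 16" if "s \<in> {0..t}" for s
          using ge that \<epsilon>(2) by fastforce
      qed (use dx dt Hx Ht sm \<phi>W in auto)
      define w where "w s y = v (X s y) s" for s y
      have vb: "H_bdd k (\<lambda>x. v x s) (H_nrm k (\<lambda>x. v x s))" if "s \<in> {0..t}" for s
        using H_continuous_onD(1)[OF vH that] by (simp add: H_bdd_def)
      have v2: "in_L2 (\<lambda>x. v x s)" if "s \<in> {0..t}" for s
        using H_continuous_onD(1)[OF vH that] in_H_L2 by blast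
      have ve': "H_bdd k (\<lambda>x. v x s) \<epsilon>" if "s \<in> {0..t}" for s
        using vb[OF that] ve that by (auto simp: H_bdd_def)
      have "modulated_lle \<alpha> \<beta> A k t (comp_const S k * \<epsilon>) (KF * (1 / 2)) (\<lambda>s y. v (X s y) s) p ps f n"
        by (rule modulated_lle_perturbation[OF sol st v ve' c\<epsilon>(1)[unfolded c_def] assms(1,3) A(2,3)])
      then have "(H_nrm k (\<lambda>y. v (X t y) t))\<^sup>2 \<le> C\<^sub>1 * exp (- \<theta> * t) * (H_nrm k (\<lambda>y. v (X 0 y) 0))\<^sup>2
          + C\<^sub>1 * integral {0..t} (\<lambda>s. exp (- \<theta> * (t - s)) * (C\<^sub>r * r s))"
      proof (rule damp[rule_format])
        show "comp_const S k * \<epsilon> \<le> \<epsilon>\<^sub>1" using c\<epsilon>(2) by (simp add: c_def)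
        show "continuous_on {0..t} (\<lambda>s. C\<^sub>r * r s)"
          unfolding r_def by (intro continuous_intros H_continuous_on_L2_norm[OF vH] H_continuous_on_norm Hx Ht)
        show "(L2_nrm (\<lambda>y. v (X s y) s))\<^sup>2 + (n s)\<^sup>2 \<le> C\<^sub>r * r s" if "s \<in> {0..t}" for s
          using perturbation_forcing_le[OF that v2[OF that]] by (simp add: r_def C\<^sub>r_def hx_def ht_def)
      qed
      also have "integral {0..t} (\<lambda>s. exp (- \<theta> * (t - s)) * (C\<^sub>r * r s)) = C\<^sub>r * I"
        unfolding I_def integral_mult_right[symmetric] by (simp add: mult.left_commute)
      finally have W: "(H_nrm k (w t))\<^sup>2 \<le> C\<^sub>1 * exp (- \<theta> * t) * (H_nrm k (w 0))\<^sup>2 + C\<^sub>1 * (C\<^sub>r * I)"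
        by (simp add: w_def[abs_def])
      have t0: "0 \<in> {0..t}" "t \<in> {0..t}" using t by auto
      have wH: "H_bdd k (w s) (c * H_nrm k (\<lambda>x. v x s))" if "s \<in> {0..t}" for s
        unfolding w_def[abs_def] c_def by (rule perturbation_H[OF that vb[OF that]])
      have "(H_nrm k (w 0))\<^sup>2 \<le> (c * H_nrm k (\<lambda>x. v x 0))\<^sup>2"
        using wH[OF t0(1)] by (intro power_mono) (auto simp: H_bdd_def)
      then have W0: "(H_nrm k (w 0))\<^sup>2 \<le> c\<^sup>2 * V\<^sub>0" by (simp add: V\<^sub>0_def power_mult_distrib)
      \<comment> \<open>Since \<open>X\<close> inverts x + gamma, v is w composed with x + gamma, so
        the estimate returns to v at the cost of d.\<close>
      have "H_bdd k (w t) (H_nrm k (w t))" using wH[OF t0(2)] by (simp add: H_bdd_def)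
      from inverse_perturbation_H[OF t0(2) this] have "H_nrm k (\<lambda>x. v x t) \<le> d * H_nrm k (w t)"
        by (simp add: w_def X_Th[OF t0(2)] d_def H_bdd_def)
      then have "(H_nrm k (\<lambda>x. v x t))\<^sup>2 \<le> (d * H_nrm k (w t))\<^sup>2" by (rule power_mono) simp
      also have "\<dots> \<le> d\<^sup>2 * (C\<^sub>1 * exp (- \<theta> * t) * (c\<^sup>2 * V\<^sub>0) + C\<^sub>1 * (C\<^sub>r * I))"
      proof -
        have "C\<^sub>1 * exp (- \<theta> * t) * (H_nrm k (w 0))\<^sup>2 \<le> C\<^sub>1 * exp (- \<theta> * t) * (c\<^sup>2 * V\<^sub>0)"
          by (rule mult_left_mono[OF W0]) (use pos in simp)
        then have "(H_nrm k (w t))\<^sup>2 \<le> C\<^sub>1 * exp (- \<theta> * t) * (c\<^sup>2 * V\<^sub>0) + C\<^sub>1 * (C\<^sub>r * I)" using W by linarith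
        then show ?thesis unfolding power_mult_distrib by (rule mult_left_mono) simp
      qed
      also have "\<dots> = (d\<^sup>2 * C\<^sub>1 * c\<^sup>2) * (exp (- \<theta> * t) * V\<^sub>0) + (d\<^sup>2 * C\<^sub>1 * C\<^sub>r) * I"
        by (simp add: algebra_simps)
      also have "\<dots> \<le> C * (exp (- \<theta> * t) * V\<^sub>0) + C * I"
        by (intro add_mono mult_right_mono C I) (simp add: V\<^sub>0_def)
      finally show ?thesis by (simp add: mult.assoc)
    qed
    moreover have "0 \<le> C * (H_nrm (k + 1) (\<lambda>x. \<gamma>x x t))\<^sup>2" using C(1) by simp
    ultimately show "(H_nrm k (\<lambda>x. v x t))\<^sup>2 \<le>
        C * exp (- \<theta> * t) * (H_nrm k (\<lambda>x. v x 0))\<^sup>2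
        + C * integral {0..t} (\<lambda>s. exp (- \<theta> * (t - s)) *
            ((L2_nrm (\<lambda>x. v x s))\<^sup>2
             + ((H_nrm (k + 2) (\<lambda>x. \<gamma>x x s))\<^sup>2 + (H_nrm (k + 2) (\<lambda>x. \<gamma>t x s))\<^sup>2)))
        + C * (H_nrm (k + 1) (\<lambda>x. \<gamma>x x t))\<^sup>2"
      unfolding I_def r_def V\<^sub>0_def by linarith
  qed
qed

end
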